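(* Consider the control system $$\dot y = f(y) + g(y)\big(u + \varphi'(y,w)\theta + A'(y,w)d\big),\qquad \dot w = h(y,w,\delta),$$ with $y\in\mathbb{R}^n$, $w\in\mathbb{R}^l$, $u\in\mathbb{R}$, $d\in\mathbb{R}^m$, $\theta\in\mathbb{R}^p$, $\delta\in\mathbb{R}^q$, where $f,g:\mathbb{R}^n\to\mathbb{R}^n$, $\varphi:\mathbb{R}^n\times\mathbb{R}^l\to\mathbb{R}^p$, $A:\mathbb{R}^n\times\mathbb{R}^l\to\mathbb{R}^m$, $h:\mathbb{R}^n\times\mathbb{R}^l\times\mathbb{R}^q\to\mathbb{R}^l$ are smooth with $f(0)=0$, $\varphi(0,0)=0$, $h(0,0,0)=0$. Assume: (B1) the subsystem $\dot w=h(y,w,\delta)$ with inputs $(y,\delta)\in\mathbb{R}^n\times\mathbb{R}^q$ is input-to-state stable (ISS); (B2) there exists a smooth $k:\mathbb{R}^n\to\mathbb{R}$ with $k(0)=0$ such that $0\in\mathbb{R}^n$ is globally asymptotically stable for $\dot y=f(y)+g(y)k(y)$. Then there exist smooth mappings $V:\mathbb{R}^n\to\mathbb{R}_+$, $\Phi:\mathbb{R}^l\to\mathbb{R}_+$, $\mu:\mathbb{R}^n\to(0,+\infty)$ with $V,\Phi$ positive definite and radially unbounded, constants $r,\Lambda>0$ and a non-decreasing $\gamma\in C^0(\mathbb{R}_+;\mathbb{R}_+)$ such that for every $\varepsilon,\Gamma>0$, $a,\beta\in(0,1]$, $b,C\ge1$ with $2a\beta<br$ there exist $\omega\in KL$,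 $\zeta\in K_\infty$, a non-decreasing $\tilde\zeta\in C^0(\mathbb{R}_+;\mathbb{R}_+)$ and $B\in C^0(\mathbb{R}^{n+l+1}\times\mathbb{R}_+^3)$ with the following property: for every $(y_0,w_0,z_0)\in\mathbb{R}^{n+l+1}$, $d\in L^\infty(\mathbb{R}_+;\mathbb{R}^m)$, $\theta\in L^\infty(\mathbb{R}_+;\mathbb{R}^p)$, $\delta\in L^\infty(\mathbb{R}_+;\mathbb{R}^q)$, the unique solution of the system in closed loop with $$u = k(y) - C\mu^2(y)\frac{(b+\exp(z))^3}{a^3\beta^2}(\nabla V(y)g(y))^3 - C\big(|A(y,0)|^2+|\varphi(y,0)|^2+\mu(y)+1\big)\frac{(b+\exp(z))^3}{a^3\beta^2}\nabla V(y)g(y),$$ $$\dot z = \Gamma\exp(-z)(V(y)-\varepsilon)^+,\qquad z\in\mathbb{R},$$ and initial condition $(y(0),w(0),z(0))=(y_0,w_0,z_0)$ satisfies for all $t\ge0$: $$\limsup_{t\to+\infty}V(y(t))\le\varepsilon,\qquad \limsup_{t\to+\infty}\Phi(w(t))\le\tilde\zeta\Big(\varepsilon+\limsup_{t\to+\infty}|\delta(t)|\Big),$$ $$U(y(t),w(t))\le \omega(U(y_0,w_0),t)+\zeta\big(\chi(\|d\|_\infty,\|\delta\|_\infty,\|\theta\|_\infty,\exp(z_0))\big),$$ $$z_0\le z(t)\le \lim_{s\to+\infty}z(s)\le B(y_0,w_0,z_0,\|d\|_\infty,\|\delta\|_\infty,\|\theta\|_\infty),$$ where $U(y,w):=V(y)+\frac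 r2\Phi(w)$ and, for $s_1,\dots,s_4\ge0$, $$\chi(s_1,s_2,s_3,s_4):=\frac r2\gamma(s_2)+a\,\frac{s_1^2+s_1^4+\big((s_3-b-s_4)^+\big)^2+\big((s_3-b-s_4)^+\big)^4+2\beta\Lambda}{b+s_4}.$$
   Context: $\mathbb{R}_+=[0,+\infty)$; $|\cdot|$ is the Euclidean norm, $x'$ the transpose, $x^+=\max(x,0)$; $\nabla V(y)$ is the row gradient so $\nabla V(y)g(y)$ is a scalar. $L^\infty$ denotes essentially bounded measurable functions with $\|\cdot\|_\infty$ the essential supremum of the Euclidean norm. $K$: continuous increasing $a:\mathbb{R}_+\to\mathbb{R}_+$ with $a(0)=0$; $K_\infty$: those in $K$ unbounded; $KL$: continuous $\sigma$ with $\sigma(\cdot,t)\in K$ and $\sigma(s,\cdot)$ non-increasing to $0$. Positive definite: $V(0)=0$, $V(x)>0$ for $x\neq0$; radially unbounded: all sublevel sets compact. ISS of $\dot w=h(y,w,\delta)$ with input $(y,\delta)$: there exist $\beta\in KL$, $\sigma\in K_\infty$ such that for every initial state $w_0$ and all locally essentially bounded inputs, the solution exists for all $t\ge0$ and $|w(t)|\le\beta(|w_0|,t)+\sigma(\sup_{0\le s\le t}|(y(s),\delta(s))|)$. *)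

theory Defs
  imports "HOL-Analysis.Analysis"
begin

text \<open>C-infinity smoothness: all iterated partial derivatives (along the
  standard basis directions) exist everywhere and are continuous.\<close>
definition smooth :: "('a::euclidean_space \<Rightarrow> 'b::real_normed_vector) \<Rightarrow> bool" where
  "smooth f \<longleftrightarrow> (\<exists>S. f \<in> S \<and>
     (\<forall>g\<in>S. continuous_on UNIV g \<and>
        (\<forall>i\<in>Basis. \<exists>g'\<in>S. \<forall>x. ((\<lambda>t. g (x + t *\<^sub>R i)) has_vector_derivative g' x) (at 0))))"

definition class_K :: "(real \<Rightarrow> real) \<Rightarrow> bool" where
  "class_K a \<longleftrightarrow> continuous_on {0..} a \<and> strict_mono_on {0..} a \<and> a 0 = 0"

definition class_Kinf :: "(real \<Rightarrow> real) \<Rightarrow> bool" where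
  "class_Kinf a \<longleftrightarrow> class_K a \<and> filterlim a at_top at_top"

definition class_KL :: "(real \<Rightarrow> real \<Rightarrow> real) \<Rightarrow> bool" where
  "class_KL \<sigma> \<longleftrightarrow> continuous_on ({0..} \<times> {0..}) (\<lambda>(s,t). \<sigma> s t) \<and>
     (\<forall>t\<ge>0. class_K (\<lambda>s. \<sigma> s t)) \<and>
     (\<forall>s\<ge>0. antimono_on {0..} (\<lambda>t. \<sigma> s t) \<and> ((\<lambda>t. \<sigma> s t) \<longlongrightarrow> 0) at_top)"

definition loc_ess_bdd :: "(real \<Rightarrow> 'a::euclidean_space) \<Rightarrow> bool" where
  "loc_ess_bdd u \<longleftrightarrow> u \<in> borel_measurable (lebesgue_on {0..}) \<and>
     (\<forall>T. \<exists>M. AE s in lebesgue_on {0..}. s \<le> T \<longrightarrow> norm (u s) \<le> M)"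

definition Linf :: "(real \<Rightarrow> 'a::euclidean_space) \<Rightarrow> bool" where
  "Linf u \<longleftrightarrow> u \<in> borel_measurable (lebesgue_on {0..}) \<and>
     (\<exists>M. AE s in lebesgue_on {0..}. norm (u s) \<le> M)"

definition Linf_norm :: "(real \<Rightarrow> 'a::euclidean_space) \<Rightarrow> real" where
  "Linf_norm u = Inf {M. M \<ge> 0 \<and> (AE s in lebesgue_on {0..}. norm (u s) \<le> M)}"

definition cara_sol :: "(real \<Rightarrow> 'a::euclidean_space \<Rightarrow> 'a) \<Rightarrow> 'a \<Rightarrow> (real \<Rightarrow> 'a) \<Rightarrow> bool" where
  "cara_sol F x0 x \<longleftrightarrow> x 0 = x0 \<and>
     (\<forall>t\<ge>0. (\<lambda>s. F s (x s)) absolutely_integrable_on {0..t} \<and>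
             x t = x0 + integral {0..t} (\<lambda>s. F s (x s)))"

text \<open>Input-to-state stability of w' = h(y,w,\<delta>) with input (y,\<delta>).  The bound with
  \<open>\<sigma>(sup_{0\<le>s\<le>t} |(y(s),\<delta>(s))|)\<close> is stated for every upper bound M of that sup
  (equivalent since \<sigma> is continuous and increasing, and avoids an infinite sup).\<close>
definition ISS :: "('y::euclidean_space \<times> 'w::euclidean_space \<times> 'd::euclidean_space \<Rightarrow> 'w) \<Rightarrow> bool" where
  "ISS h \<longleftrightarrow> (\<exists>\<beta> \<sigma>. class_KL \<beta> \<and> class_Kinf \<sigma> \<and>
     (\<forall>w0 (y::real \<Rightarrow> 'y) (\<delta>::real \<Rightarrow> 'd). loc_ess_bdd y \<and> loc_ess_bdd \<delta> \<longrightarrow>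
        (\<exists>w. cara_sol (\<lambda>s w. h (y s, w, \<delta> s)) w0 w) \<and>
        (\<forall>w. cara_sol (\<lambda>s w. h (y s, w, \<delta> s)) w0 w \<longrightarrow>
           (\<forall>t\<ge>0. \<forall>M. (\<forall>s\<in>{0..t}. norm (y s, \<delta> s) \<le> M) \<longrightarrow>
               norm (w t) \<le> \<beta> (norm w0) t + \<sigma> M))))"

definition ode_sol :: "('a::euclidean_space \<Rightarrow> 'a) \<Rightarrow> (real \<Rightarrow> 'a) \<Rightarrow> bool" where
  "ode_sol F x \<longleftrightarrow> (\<forall>t\<ge>0. (x has_vector_derivative F (x t)) (at t within {0..}))"

definition GAS :: "('a::euclidean_space \<Rightarrow> 'a) \<Rightarrow> bool" where
  "GAS F \<longleftrightarrow> (\<forall>x0. \<exists>x. x 0 = x0 \<and> ode_sol F x) \<and>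
     (\<forall>e>0. \<exists>d>0. \<forall>x. ode_sol F x \<and> norm (x 0) < d \<longrightarrow> (\<forall>t\<ge>0. norm (x t) < e)) \<and>
     (\<forall>x. ode_sol F x \<longrightarrow> (x \<longlongrightarrow> 0) at_top)"

definition pos_def :: "('a::real_normed_vector \<Rightarrow> real) \<Rightarrow> bool" where
  "pos_def V \<longleftrightarrow> V 0 = 0 \<and> (\<forall>x. x \<noteq> 0 \<longrightarrow> V x > 0)"

definition rad_unbdd :: "('a::real_normed_vector \<Rightarrow> real) \<Rightarrow> bool" where
  "rad_unbdd V \<longleftrightarrow> (\<forall>c. compact {x. V x \<le> c})"

definition nondec_C0 :: "(real \<Rightarrow> real) \<Rightarrow> bool" where
  "nondec_C0 \<gamma> \<longleftrightarrow> continuous_on {0..} \<gamma> \<and> mono_on {0..} \<gamma> \<and> (\<forall>s\<ge>0. \<gamma> s \<ge> 0)"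

definition pos_part :: "real \<Rightarrow> real" where
  "pos_part x = max x 0"

end

theory Submission
  imports Defs
begin

text \<open>By a converse Lyapunov theorem, (B2) yields a smooth \<open>V\<close> decreasing along \<open>f + k g\<close>: near each annulus
  one takes Riemann sums of a running cost along Euler polygons, which are smooth in the initial point, and glues
  them by a smooth series.  \<open>V\<close> is rescaled so that its derivative along \<open>f + k g\<close> is at most \<open>c - V\<close>
  and \<open>V\<close> dominates a prescribed function of \<open>|y|\<close>.  The high-gain feedback then turns the disturbances into
  \<open>V' \<le> E + 3 Kf(|w|) - V\<close>, where \<open>Kf\<close> bounds the growth of \<open>\<phi>\<close> and \<open>A\<close> in \<open>w\<close>.  As \<open>V\<close> dominates
  \<open>6 Kf(2 \<sigma>(2 |y|))\<close>, this inequality and the ISS estimate of \<open>w\<close> form a small-gain loop, which is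
  closed on trajectories, without a Lyapunov function for the \<open>w\<close>-subsystem.  Choosing \<open>\<gamma>(0) > 0\<close> makes the
  argument of \<open>\<zeta>\<close> at least 1, so that a uniform bound and a uniform ultimate bound suffice for the estimate of
  \<open>U\<close>.  Finally \<open>z\<close> stays bounded because a large \<open>z\<close> drives \<open>V\<close> below \<open>\<epsilon>\<close>, where \<open>z\<close> is constant.\<close>

section \<open>Smooth functions\<close>

text \<open>(B1) is a bound on whole trajectories, so every statement about w comes from restarting
  the ISS estimate at a later time. Accordingly \<open>\<Phi> w = w \<bullet> w\<close>,
  \<open>r = \<Lambda> = 1\<close> and \<open>\<gamma> s = 2 + 2 * s\<close> are fixed before the
  parameters, which enter only through \<omega>, \<zeta>, the bound on the limsup of \<Phi>, and B.
  The loop gain is 1/2: the high-gain estimate leaves \<open>3 * Kf\<close>, while V dominates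
  \<open>6 * Kf\<close>. Two obstacles shape the rest. One is smoothness of V: an Euler polygon is a
  finite composition of smooth maps, but its step size can be fixed only on a compact region away
  from 0; hence the annuli, and a cut-off extending each piece to the whole space. The other is
  uniformity: the comparison functions must serve all data and disturbances at once. Bounds are
  therefore proved for integer levels of the data, and a smooth function dominating a given sequence
  turns each table of bounds into a function. The same device rescales V and bounds \<phi> and A in
  w.\<close>

definition pder :: "'a \<Rightarrow> ('a::euclidean_space \<Rightarrow> 'b::real_normed_vector) \<Rightarrow> ('a \<Rightarrow> 'b) \<Rightarrow> bool" where
  "pder i f f' \<longleftrightarrow> (\<forall>x. ((\<lambda>t. f (x + t *\<^sub>R i)) has_vector_derivative f' x) (at 0))"

text \<open>Finite orders allow induction: a witness set for \<open>smooth\<close> is hard to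
  exhibit for a composite, while one further derivative of a composite is easy.\<close>

primrec Ck :: "nat \<Rightarrow> ('a::euclidean_space \<Rightarrow> 'b::real_normed_vector) \<Rightarrow> bool" where
  "Ck 0 f \<longleftrightarrow> continuous_on UNIV f"
| "Ck (Suc k) f \<longleftrightarrow> continuous_on UNIV f \<and> (\<forall>i\<in>Basis. \<exists>f'. pder i f f' \<and> Ck k f')"

lemma pder_unique: "pder i f f' \<Longrightarrow> pder i f f'' \<Longrightarrow> f' = f''"
  unfolding pder_def by (intro ext) (meson vector_derivative_unique_at)

lemma Ck_continuous: "Ck k f \<Longrightarrow> continuous_on UNIV f"
  by (cases k) auto

lemma Ck_Suc_D: "Ck (Suc k) f \<Longrightarrow> Ck k f"
proof (induction k arbitrary: f)
  case (Suc k)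
  then show ?case by (metis Ck.simps(2))
qed auto

lemma Ck_SucE:
  assumes "Ck (Suc k) f" "i \<in> Basis"
  obtains f' where "pder i f f'" "Ck k f'"
  using assms unfolding Ck.simps by blast

text \<open>Partial derivatives are unique, so the one found at order 1 is also the one found at
  every higher order. Hence the functions that satisfy \<open>Ck k\<close> for all k are closed
  under partial derivatives and can serve as the witness set.\<close>

lemma smooth_iff_Ck: "smooth f \<longleftrightarrow> (\<forall>k. Ck k f)"
proof
  assume "smooth f"
  then obtain S where S: "f \<in> S" "\<And>g. g \<in> S \<Longrightarrow> continuous_on UNIV g"
    "\<And>g i. g \<in> S \<Longrightarrow> i \<in> Basis \<Longrightarrow> \<exists>g'\<in>S. pder i g g'"
    unfolding smooth_def pder_def by blast
  have "g \<in> S \<Longrightarrow> Ck k g" for k g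
  proof (induction k arbitrary: g)
    case (Suc k)
    then show ?case using S(2,3) by (metis Ck.simps(2))
  qed (use S in auto)
  with S(1) show "\<forall>k. Ck k f" by blast
next
  assume f: "\<forall>k. Ck k f"
  have "\<exists>g'\<in>{f. \<forall>k. Ck k f}. pder i g g'" if "\<forall>k. Ck k g" "i \<in> Basis" for i and g :: "'a \<Rightarrow> 'b"
  proof -
    have "Ck (Suc 0) g" using that by blast
    then obtain g' where g': "pder i g g'" using Ck_SucE \<open>i \<in> Basis\<close> by metis
    have "Ck k g'" for k
      using Ck_SucE[of k g i] that g' pder_unique by metis
    with g' show ?thesis by blast
  qed
  moreover have "continuous_on UNIV g" if "\<forall>k. Ck k g" for g :: "'a \<Rightarrow> 'b"
    using that Ck.simps(1) by blast
  ultimately show "smooth f"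
    unfolding smooth_def pder_def[symmetric] using f
    by (intro exI[of _ "{f. \<forall>k. Ck k f}"]) simp
qed

lemma smooth_imp_Ck: "smooth f \<Longrightarrow> Ck k f"
  by (simp add: smooth_iff_Ck)

lemma smooth_pder:
  assumes "smooth f" "i \<in> Basis"
  obtains f' where "pder i f f'" "smooth f'"
  using assms unfolding smooth_def pder_def by blast

lemma Ck_const: "Ck k (\<lambda>x. c)"
proof (induction k arbitrary: c)
  case (Suc k)
  have "pder i (\<lambda>x. c) (\<lambda>x. 0)" for i :: 'a by (simp add: pder_def)
  then show ?case using Suc by auto
qed auto

lemma Ck_add:
  fixes p q :: "'d::euclidean_space \<Rightarrow> 'e::real_normed_vector"
  shows "Ck k p \<Longrightarrow> Ck k q \<Longrightarrow> Ck k (\<lambda>x. p x + q x)"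
  proof (induction k arbitrary: p q)
    case 0 then show ?case by (auto intro: continuous_intros)
  next
    case (Suc k)
    have "\<exists>r. pder i (\<lambda>x. p x + q x) r \<and> Ck k r" if i: "i \<in> Basis" for i
    proof -
      obtain p' q' where "pder i p p'" "Ck k p'" "pder i q q'" "Ck k q'" using Suc.prems i by (meson Ck_SucE)
      then show ?thesis using Suc.IH
        by (intro exI[of _ "\<lambda>x. p' x + q' x"]) (auto simp: pder_def intro!: derivative_eq_intros)
    qed
    then show ?case using Suc.prems by (auto intro: continuous_intros)
  qed

text \<open>One product rule serves scalar multiples, inner products and real products. In the step
  both f and g are reused at the lower order k beside their derivatives.\<close>

lemma Ck_bilinear:
  assumes "bounded_bilinear B"
  shows "Ck k f \<Longrightarrow> Ck k g \<Longrightarrow> Ck k (\<lambda>x. B (f x) (g x))"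
proof -
  interpret bounded_bilinear B by fact
  show "Ck k f \<Longrightarrow> Ck k g \<Longrightarrow> Ck k (\<lambda>x. B (f x) (g x))"
  proof (induction k arbitrary: f g)
    case 0 then show ?case by (auto intro: continuous_on)
  next
    case (Suc k)
    have "\<exists>r. pder i (\<lambda>x. B (f x) (g x)) r \<and> Ck k r" if i: "i \<in> Basis" for i
    proof -
      obtain p' q' where p: "pder i f p'" "Ck k p'" "pder i g q'" "Ck k q'" using Suc.prems i by (meson Ck_SucE)
      have "pder i (\<lambda>x. B (f x) (g x)) (\<lambda>x. B (f x) (q' x) + B (p' x) (g x))"
        unfolding pder_def
      proof
        fix x
        have "((\<lambda>t. B (f (x + t *\<^sub>R i)) (g (x + t *\<^sub>R i))) has_vector_derivative
           (B (f (x + 0 *\<^sub>R i)) (q' x) + B (p' x) (g (x + 0 *\<^sub>R i)))) (at 0)"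
          using p by (intro has_vector_derivative) (auto simp: pder_def)
        then show "((\<lambda>t. B (f (x + t *\<^sub>R i)) (g (x + t *\<^sub>R i))) has_vector_derivative
           (B (f x) (q' x) + B (p' x) (g x))) (at 0)" by simp
      qed
      moreover have "Ck k (\<lambda>x. B (f x) (q' x) + B (p' x) (g x))"
        using p Suc by (intro Ck_add Suc.IH) (auto dest: Ck_Suc_D simp del: Ck.simps(2))
      ultimately show ?thesis by blast
    qed
    then show ?case using Suc.prems by (auto intro: continuous_on)
  qed
qed

lemma Ck_sum: "(\<And>i. i \<in> I \<Longrightarrow> Ck k (f i)) \<Longrightarrow> Ck k (\<lambda>x. \<Sum>i\<in>I. f i x)"
  by (induction I rule: infinite_finite_induct) (auto intro: Ck_const Ck_add)

lemma Ck_linear: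
  assumes "bounded_linear L" shows "Ck k L"
proof (cases k)
  case (Suc m)
  interpret bounded_linear L by fact
  have "pder i L (\<lambda>x. L i)" for i
    unfolding pder_def
    by (auto simp: add scaleR intro!: derivative_eq_intros)
  then show ?thesis using Suc Ck_const assms by (auto intro: linear_continuous_on)
qed (use assms in \<open>auto intro: linear_continuous_on\<close>)

text \<open>Telescoping along the coordinate directions of a subset of the basis, which makes the
  induction work.\<close>

lemma partials_increment_bound:
  fixes f :: "'a::euclidean_space \<Rightarrow> 'b::real_normed_vector"
  assumes p: "\<And>i. i \<in> Basis \<Longrightarrow> pder i f (f' i)"
    and near: "\<And>i y. i \<in> Basis \<Longrightarrow> dist y x < d \<Longrightarrow> norm (f' i y - f' i x) \<le> e"
    and "B \<subseteq> Basis"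
  shows "dist y x + (\<Sum>i\<in>B. \<bar>c i\<bar>) < d \<Longrightarrow>
    norm (f (y + (\<Sum>i\<in>B. c i *\<^sub>R i)) - f y - (\<Sum>i\<in>B. c i *\<^sub>R f' i x)) \<le> e * (\<Sum>i\<in>B. \<bar>c i\<bar>)"
proof -
  have "finite B" using assms(3) finite_Basis finite_subset by blast
  then show "dist y x + (\<Sum>i\<in>B. \<bar>c i\<bar>) < d \<Longrightarrow>
    norm (f (y + (\<Sum>i\<in>B. c i *\<^sub>R i)) - f y - (\<Sum>i\<in>B. c i *\<^sub>R f' i x)) \<le> e * (\<Sum>i\<in>B. \<bar>c i\<bar>)"
    using \<open>B \<subseteq> Basis\<close>
  proof (induction B)
    case (insert j B)
    define y' where "y' = y + (\<Sum>i\<in>B. c i *\<^sub>R i)"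
    have j: "j \<in> Basis" using insert by auto
    have ny: "dist y' y \<le> (\<Sum>i\<in>B. \<bar>c i\<bar>)"
    proof -
      have "dist y' y \<le> (\<Sum>i\<in>B. norm (c i *\<^sub>R i))"
        unfolding y'_def dist_norm by (metis add_diff_cancel_left' norm_sum)
      also have "\<dots> = (\<Sum>i\<in>B. \<bar>c i\<bar>)" using insert.prems by (intro sum.cong) auto
      finally show ?thesis .
    qed
    have lt: "dist y x + \<bar>c j\<bar> + (\<Sum>i\<in>B. \<bar>c i\<bar>) < d" using insert by simp
    define g where "g t = f (y' + t *\<^sub>R j) - t *\<^sub>R f' j x" for t
    have der: "(g has_vector_derivative (f' j (y' + t *\<^sub>R j) - f' j x)) (at t within S)" for t S
    proof -
      have "((\<lambda>s. f (y' + t *\<^sub>R j + s *\<^sub>R j)) has_vector_derivative f' j (y' + t *\<^sub>R j)) (at 0)"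
        using p[OF j] by (simp add: pder_def)
      then have "((\<lambda>s. f (y' + t *\<^sub>R j + s *\<^sub>R j)) has_vector_derivative f' j (y' + t *\<^sub>R j)) (at (t - t))" by simp
      then have "(((\<lambda>s. f (y' + t *\<^sub>R j + s *\<^sub>R j)) \<circ> (\<lambda>s. s - t)) has_vector_derivative 1 *\<^sub>R f' j (y' + t *\<^sub>R j)) (at t)"
        by (intro vector_diff_chain_at) (auto intro!: derivative_eq_intros)
      then have "((\<lambda>s. f (y' + s *\<^sub>R j)) has_vector_derivative f' j (y' + t *\<^sub>R j)) (at t)"
        by (simp add: o_def algebra_simps)
      moreover have "((\<lambda>s. s *\<^sub>R f' j x) has_vector_derivative f' j x) (at t)"
        unfolding has_vector_derivative_def by (auto intro!: derivative_eq_intros)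
      ultimately show ?thesis unfolding g_def
        using has_vector_derivative_at_within has_vector_derivative_diff by fastforce
    qed
    have "norm (g (c j) - g 0) \<le> e * norm (c j - 0)"
    proof (rule differentiable_bound[where S = "closed_segment 0 (c j)" and f' = "\<lambda>t h. h *\<^sub>R (f' j (y' + t *\<^sub>R j) - f' j x)"])
      fix t assume t: "t \<in> closed_segment 0 (c j)"
      show "(g has_derivative (\<lambda>h. h *\<^sub>R (f' j (y' + t *\<^sub>R j) - f' j x))) (at t within closed_segment 0 (c j))"
        using der by (simp add: has_vector_derivative_def)
      have tc: "\<bar>t\<bar> \<le> \<bar>c j\<bar>" using t by (auto simp: closed_segment_eq_real_ivl split: if_splits)
      have "dist (y' + t *\<^sub>R j) x \<le> dist (y' + t *\<^sub>R j) y' + dist y' y + dist y x"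
        by (meson add_right_mono dist_triangle order_trans)
      also have "dist (y' + t *\<^sub>R j) y' = \<bar>t\<bar>" using j by (simp add: dist_norm)
      finally have "dist (y' + t *\<^sub>R j) x < d" using tc ny lt by linarith
      then have "norm (f' j (y' + t *\<^sub>R j) - f' j x) \<le> e" using near[OF j] by blast
      then show "onorm (\<lambda>h. h *\<^sub>R (f' j (y' + t *\<^sub>R j) - f' j x)) \<le> e"
        by (intro onorm_le) (simp add: mult.commute[of e] mult_left_mono)
    qed auto
    then have 1: "norm (f (y' + c j *\<^sub>R j) - f y' - c j *\<^sub>R f' j x) \<le> e * \<bar>c j\<bar>"
      by (simp add: g_def algebra_simps)
    have 2: "norm (f y' - f y - (\<Sum>i\<in>B. c i *\<^sub>R f' i x)) \<le> e * (\<Sum>i\<in>B. \<bar>c i\<bar>)"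
      unfolding y'_def using insert lt by (intro insert.IH) auto
    have "f (y + (\<Sum>i\<in>insert j B. c i *\<^sub>R i)) - f y - (\<Sum>i\<in>insert j B. c i *\<^sub>R f' i x)
      = (f (y' + c j *\<^sub>R j) - f y' - c j *\<^sub>R f' j x) + (f y' - f y - (\<Sum>i\<in>B. c i *\<^sub>R f' i x))"
      using insert.hyps by (simp add: y'_def algebra_simps)
    then show ?case using norm_triangle_mono[OF 1 2] insert.hyps by (simp add: algebra_simps)
  qed simp
qed

text \<open>The definition of \<open>smooth\<close> speaks only of lines along the basis; continuity
  of the partials upgrades this to a total derivative, on which the chain rules below rest. Each
  partial is kept within e / n of its value at x, and the coordinate increments sum to at most n
  times the norm.\<close>

lemma has_derivative_partials:
  fixes f :: "'a::euclidean_space \<Rightarrow> 'b::real_normed_vector"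
  assumes p: "\<And>i. i \<in> Basis \<Longrightarrow> pder i f (f' i)"
    and c: "\<And>i. i \<in> Basis \<Longrightarrow> continuous_on UNIV (f' i)"
  shows "(f has_derivative (\<lambda>v. \<Sum>i\<in>Basis. (v \<bullet> i) *\<^sub>R f' i x)) (at x)"
proof -
  have "\<exists>d>0. \<forall>y. norm (y - x) < d \<longrightarrow>
      norm (f y - f x - (\<Sum>i\<in>Basis. ((y - x) \<bullet> i) *\<^sub>R f' i x)) \<le> e * norm (y - x)" if "e > 0" for e
  proof -
    define n where "n = real DIM('a)"
    have n: "n > 0" by (simp add: n_def)
    have "\<exists>d>0. \<forall>y. dist y x < d \<longrightarrow> norm (f' i y - f' i x) \<le> e / n" if "i \<in> Basis" for i
      using c[OF that] \<open>e > 0\<close> n unfolding continuous_on_iff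
      by (metis UNIV_I divide_pos_pos dist_norm less_imp_le)
    then obtain d where d: "\<And>i. i \<in> Basis \<Longrightarrow> d i > 0"
       "\<And>i y. i \<in> Basis \<Longrightarrow> dist y x < d i \<Longrightarrow> norm (f' i y - f' i x) \<le> e / n" by metis
    define D where "D = Min (d ` Basis)"
    have D: "D > 0" "\<And>i. i \<in> Basis \<Longrightarrow> D \<le> d i" using d(1) by (auto simp: D_def)
    show ?thesis
    proof (intro exI[of _ "D / n"] conjI allI impI)
      show "D / n > 0" using D n by simp
      fix y assume y: "norm (y - x) < D / n"
      have s: "(\<Sum>i\<in>Basis. \<bar>(y - x) \<bullet> i\<bar>) \<le> n * norm (y - x)"
        using sum_bounded_above[of Basis "\<lambda>i. \<bar>(y - x) \<bullet> i\<bar>" "norm (y - x)"] Basis_le_norm[of _ "y - x"]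
        by (simp add: n_def)
      have "n * norm (y - x) < D" using y n by (simp add: field_simps)
      then have "dist x x + (\<Sum>i\<in>Basis. \<bar>(y - x) \<bullet> i\<bar>) < D" using s by simp
      then have "norm (f (x + (\<Sum>i\<in>Basis. ((y - x) \<bullet> i) *\<^sub>R i)) - f x - (\<Sum>i\<in>Basis. ((y - x) \<bullet> i) *\<^sub>R f' i x))
         \<le> e / n * (\<Sum>i\<in>Basis. \<bar>(y - x) \<bullet> i\<bar>)"
        using d(2) D(2) by (intro partials_increment_bound[OF p]) (auto intro: less_le_trans)
      also have "\<dots> \<le> e / n * (n * norm (y - x))" using s n \<open>e > 0\<close> by (intro mult_left_mono) auto
      finally show "norm (f y - f x - (\<Sum>i\<in>Basis. ((y - x) \<bullet> i) *\<^sub>R f' i x)) \<le> e * norm (y - x)"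
        using n by (simp add: euclidean_representation)
    qed
  qed
  moreover have "bounded_linear (\<lambda>v. \<Sum>i\<in>Basis. (v \<bullet> i) *\<^sub>R f' i x)"
    by (intro bounded_linear_sum bounded_linear_scaleR_const bounded_linear_inner_left)
  ultimately show ?thesis by (auto simp: has_derivative_at_alt)
qed

lemma Ck_Suc_has_derivative:
  fixes f :: "'a::euclidean_space \<Rightarrow> 'b::real_normed_vector"
  assumes "Ck (Suc k) f"
  shows "\<exists>f'. (\<forall>i\<in>Basis. pder i f (f' i) \<and> Ck k (f' i)) \<and>
    (\<forall>x. (f has_derivative (\<lambda>v. \<Sum>i\<in>Basis. (v \<bullet> i) *\<^sub>R f' i x)) (at x))"
proof -
  have "\<forall>i\<in>Basis. \<exists>f'. pder i f f' \<and> Ck k f'"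
    using assms by (meson Ck_SucE)
  from bchoice[OF this] obtain f' where f': "\<forall>i\<in>Basis. pder i f (f' i) \<and> Ck k (f' i)"
    by blast
  have "(f has_derivative (\<lambda>v. \<Sum>i\<in>Basis. (v \<bullet> i) *\<^sub>R f' i x)) (at x)" for x
  proof (rule has_derivative_partials)
    fix i :: 'a assume i: "i \<in> Basis"
    show "pder i f (f' i)" using f' i by blast
    show "continuous_on UNIV (f' i)" using f' i Ck_continuous by blast
  qed
  with f' show ?thesis by blast
qed

lemma has_derivative_pder:
  assumes "\<And>x. (f has_derivative f' x) (at x)"
  shows "pder i f (\<lambda>x. f' x i)"
  unfolding pder_def
proof
  fix x
  interpret bounded_linear "f' x" using assms has_derivative_bounded_linear by blast
  have "(f has_derivative f' x) (at (x + 0 *\<^sub>R i))" using assms by simp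
  then have "((f \<circ> (\<lambda>t. x + t *\<^sub>R i)) has_derivative (f' x \<circ> (\<lambda>t. t *\<^sub>R i))) (at 0)"
    by (intro diff_chain_at) (auto intro!: derivative_eq_intros)
  then show "((\<lambda>t. f (x + t *\<^sub>R i)) has_vector_derivative f' x i) (at 0)"
    by (simp add: has_vector_derivative_def o_def scaleR)
qed

text \<open>The partials of the composite are sums of products of coordinates of partials of g with
  \<open>f' j (g x)\<close>. The induction hypothesis applies to \<open>f' j\<close> with the same
  inner function, so only f is generalised.\<close>

lemma Ck_compose:
  fixes f :: "'b::euclidean_space \<Rightarrow> 'c::real_normed_vector" and g :: "'a::euclidean_space \<Rightarrow> 'b"
  shows "Ck k f \<Longrightarrow> Ck k g \<Longrightarrow> Ck k (\<lambda>x. f (g x))"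
proof (induction k arbitrary: f)
  case 0
  then show ?case by (auto intro: continuous_on_compose2)
next
  case (Suc k)
  obtain f' where f0: "\<forall>i\<in>Basis. pder i f (f' i) \<and> Ck k (f' i)"
    "\<forall>x. (f has_derivative (\<lambda>v. \<Sum>i\<in>Basis. (v \<bullet> i) *\<^sub>R f' i x)) (at x)"
    using Ck_Suc_has_derivative[OF Suc.prems(1)] by blast
  have f': "\<And>i. i \<in> Basis \<Longrightarrow> pder i f (f' i)" "\<And>i. i \<in> Basis \<Longrightarrow> Ck k (f' i)"
    "\<And>x. (f has_derivative (\<lambda>v. \<Sum>i\<in>Basis. (v \<bullet> i) *\<^sub>R f' i x)) (at x)"
    using f0 by auto
  obtain g' where g0: "\<forall>i\<in>Basis. pder i g (g' i) \<and> Ck k (g' i)"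
    "\<forall>x. (g has_derivative (\<lambda>v. \<Sum>i\<in>Basis. (v \<bullet> i) *\<^sub>R g' i x)) (at x)"
    using Ck_Suc_has_derivative[OF Suc.prems(2)] by blast
  have g': "\<And>i. i \<in> Basis \<Longrightarrow> pder i g (g' i)" "\<And>i. i \<in> Basis \<Longrightarrow> Ck k (g' i)"
    "\<And>x. (g has_derivative (\<lambda>v. \<Sum>i\<in>Basis. (v \<bullet> i) *\<^sub>R g' i x)) (at x)"
    using g0 by auto
  have d: "((\<lambda>x. f (g x)) has_derivative (\<lambda>v. \<Sum>j\<in>Basis. ((\<Sum>i\<in>Basis. (v \<bullet> i) *\<^sub>R g' i x) \<bullet> j) *\<^sub>R f' j (g x))) (at x)" for x
    using diff_chain_at[OF g'(3) f'(3)] by (simp add: o_def)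
  have "\<exists>r. pder i (\<lambda>x. f (g x)) r \<and> Ck k r" if i: "i \<in> Basis" for i
  proof -
    have "(\<Sum>l\<in>Basis. (i \<bullet> l) *\<^sub>R g' l x) = g' i x" for x
    proof -
      have "(\<Sum>l\<in>Basis. (i \<bullet> l) *\<^sub>R g' l x) = (\<Sum>l\<in>Basis. if l = i then g' l x else 0)"
        using i by (intro sum.cong) (auto simp: inner_Basis)
      then show ?thesis using i by simp
    qed
    then have "pder i (\<lambda>x. f (g x)) (\<lambda>x. \<Sum>j\<in>Basis. (g' i x \<bullet> j) *\<^sub>R f' j (g x))"
      using has_derivative_pder[OF d, of i] by simp
    moreover have "Ck k (\<lambda>x. \<Sum>j\<in>Basis. (g' i x \<bullet> j) *\<^sub>R f' j (g x))"
      using g'(2)[OF i] f'(2) Suc.IH Ck_Suc_D[OF Suc.prems(2)]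
      by (intro Ck_sum Ck_bilinear[OF bounded_bilinear_scaleR] Ck_bilinear[OF bounded_bilinear_inner] Ck_const) auto
    ultimately show ?thesis by blast
  qed
  then show ?case using Suc.prems by (auto intro: continuous_on_compose2)
qed

text \<open>Lets a function be glued from pieces: the locally finite sums and cut-offs below agree
  near each point with a function already known to be smooth.\<close>

lemma Ck_local:
  fixes f :: "'a::euclidean_space \<Rightarrow> 'b::real_normed_vector"
  shows "\<forall>x. \<exists>U g. open U \<and> x \<in> U \<and> Ck k g \<and> (\<forall>y\<in>U. f y = g y) \<Longrightarrow> Ck k f"
proof (induction k arbitrary: f)
  case 0
  have "isCont f x" for x
  proof -
    obtain U g where U: "open U" "x \<in> U" "continuous_on UNIV g" "\<forall>y\<in>U. f y = g y" using 0[rule_format, of x] by auto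
    then have "isCont g x" by (simp add: continuous_on_eq_continuous_at)
    moreover have "\<forall>\<^sub>F y in nhds x. f y = g y" using U by (auto simp: eventually_nhds)
    ultimately show ?thesis using isCont_cong by blast
  qed
  then show ?case by (simp add: continuous_at_imp_continuous_on)
next
  case (Suc k)
  have c: "continuous_on UNIV f"
  proof -
    have "isCont f x" for x
    proof -
      obtain U g where U: "open U" "x \<in> U" "Ck (Suc k) g" "\<forall>y\<in>U. f y = g y" using Suc.prems[rule_format, of x] by blast
      then have "isCont g x" using Ck_continuous by (metis UNIV_I continuous_on_eq_continuous_at open_UNIV)
      moreover have "\<forall>\<^sub>F y in nhds x. f y = g y" using U by (auto simp: eventually_nhds)
      ultimately show ?thesis using isCont_cong by blast
    qed
    then show ?thesis by (simp add: continuous_at_imp_continuous_on)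
  qed
  have "\<exists>f'. pder i f f' \<and> Ck k f'" if i: "i \<in> Basis" for i
  proof -
    have ex: "\<exists>U g'. open U \<and> x \<in> U \<and> Ck k g' \<and>
        (\<forall>y\<in>U. ((\<lambda>t. f (y + t *\<^sub>R i)) has_vector_derivative g' y) (at 0))" for x
    proof -
      obtain U g where U: "open U" "x \<in> U" "Ck (Suc k) g" "\<forall>y\<in>U. f y = g y" using Suc.prems[rule_format, of x] by blast
      then obtain g' where g': "pder i g g'" "Ck k g'" using i by auto
      have "((\<lambda>t. f (y + t *\<^sub>R i)) has_vector_derivative g' y) (at 0)" if y: "y \<in> U" for y
      proof (rule has_vector_derivative_transform_within_open[where f = "\<lambda>t. g (y + t *\<^sub>R i)" and S = "(\<lambda>t. y + t *\<^sub>R i) -` U"])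
        show "((\<lambda>t. g (y + t *\<^sub>R i)) has_vector_derivative g' y) (at 0)" using g' by (simp add: pder_def)
        show "open ((\<lambda>t. y + t *\<^sub>R i) -` U)"
          using U(1) by (intro open_vimage continuous_intros)
      qed (use U y in auto)
      then show ?thesis using U g' by blast
    qed
    \<comment> \<open>A canonical value for the partial, so that the local representatives agree on
      overlaps without any choice.\<close>
    define f' where "f' x = vector_derivative (\<lambda>t. f (x + t *\<^sub>R i)) (at 0)" for x
    have f': "f' y = g'" if "((\<lambda>t. f (y + t *\<^sub>R i)) has_vector_derivative g') (at 0)" for y g'
      unfolding f'_def using that by (rule vector_derivative_at)
    have "pder i f f'" unfolding pder_def using ex f' by metis
    moreover have "Ck k f'"
    proof (intro Suc.IH allI)
      fix x
      show "\<exists>U g. open U \<and> x \<in> U \<and> Ck k g \<and> (\<forall>y\<in>U. f' y = g y)" using ex[of x] f' by metis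
    qed
    ultimately show ?thesis by blast
  qed
  then have "\<forall>i\<in>Basis. \<exists>f'. pder i f f' \<and> Ck k f'" by (intro ballI)
  with c show ?case by simp
qed

lemma smooth_const : "smooth (\<lambda>x. c)"
  by (simp add: smooth_iff_Ck Ck_const)

lemma smooth_add : "smooth f \<Longrightarrow> smooth g \<Longrightarrow> smooth (\<lambda>x. f x + g x)"
  by (simp add: smooth_iff_Ck Ck_add)

lemma smooth_sum : "(\<And>i. i \<in> I \<Longrightarrow> smooth (f i)) \<Longrightarrow> smooth (\<lambda>x. \<Sum>i\<in>I. f i x)"
  by (simp add: smooth_iff_Ck Ck_sum)

lemma smooth_linear: "bounded_linear L \<Longrightarrow> smooth L"
  by (simp add: smooth_iff_Ck Ck_linear)

lemma smooth_id : "smooth (\<lambda>x. x)"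
  by (rule smooth_linear[OF bounded_linear_ident])

lemma smooth_compose: "smooth f \<Longrightarrow> smooth g \<Longrightarrow> smooth (\<lambda>x. f (g x))"
  by (simp add: smooth_iff_Ck Ck_compose)

lemma smooth_scaleR : "smooth f \<Longrightarrow> smooth g \<Longrightarrow> smooth (\<lambda>x. f x *\<^sub>R g x)"
  by (simp add: smooth_iff_Ck Ck_bilinear[OF bounded_bilinear_scaleR])

lemma smooth_inner : "smooth f \<Longrightarrow> smooth g \<Longrightarrow> smooth (\<lambda>x. f x \<bullet> g x)"
  by (simp add: smooth_iff_Ck Ck_bilinear[OF bounded_bilinear_inner])

lemma smooth_mult :
  fixes f g :: "_ \<Rightarrow> real"
  shows "smooth f \<Longrightarrow> smooth g \<Longrightarrow> smooth (\<lambda>x. f x * g x)"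
  by (simp add: smooth_iff_Ck Ck_bilinear[OF bounded_bilinear_mult])

lemma smooth_diff :
  assumes "smooth f" "smooth g" shows "smooth (\<lambda>x. f x - g x)"
  using smooth_add[OF assms(1) smooth_scaleR[OF smooth_const[of "-1"] assms(2)]] by simp

lemma smooth_power:
  fixes f :: "_ \<Rightarrow> real"
  shows "smooth f \<Longrightarrow> smooth (\<lambda>x. f x ^ n)"
  by (induction n) (auto intro: smooth_mult smooth_const)

lemmas smooth_intros = smooth_const smooth_id smooth_add smooth_diff smooth_sum smooth_scaleR
  smooth_inner smooth_mult smooth_power

lemma smooth_local:
  assumes "\<And>x. \<exists>U g. open U \<and> x \<in> U \<and> smooth g \<and> (\<forall>y\<in>U. f y = g y)"
  shows "smooth f"
  unfolding smooth_iff_Ck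
proof (intro allI Ck_local)
  fix k x show "\<exists>U g. open U \<and> x \<in> U \<and> Ck k g \<and> (\<forall>y\<in>U. f y = g y)"
    using assms[of x] smooth_imp_Ck by blast
qed

lemma smooth_continuous: "smooth f \<Longrightarrow> continuous_on S f"
  using smooth_imp_Ck[of f 0] continuous_on_subset by auto

lemma smooth_has_derivative:
  fixes f :: "'a::euclidean_space \<Rightarrow> 'b::real_normed_vector"
  assumes "smooth f"
  shows "\<exists>f'. (\<forall>i\<in>Basis. pder i f (f' i) \<and> smooth (f' i)) \<and>
    (\<forall>x. (f has_derivative (\<lambda>v. \<Sum>i\<in>Basis. (v \<bullet> i) *\<^sub>R f' i x)) (at x))"
proof -
  have "\<forall>i\<in>Basis. \<exists>f'. pder i f f' \<and> smooth f'"
    using assms by (meson smooth_pder)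
  from bchoice[OF this] obtain f' where f': "\<forall>i\<in>Basis. pder i f (f' i) \<and> smooth (f' i)"
    by blast
  have "(f has_derivative (\<lambda>v. \<Sum>i\<in>Basis. (v \<bullet> i) *\<^sub>R f' i x)) (at x)" for x
  proof (rule has_derivative_partials)
    fix i :: 'a assume i: "i \<in> Basis"
    show "pder i f (f' i)" using f' i by blast
    show "continuous_on UNIV (f' i)" using f' i smooth_continuous by blast
  qed
  with f' show ?thesis by blast
qed

lemma smooth_frechet:
  fixes f :: "'a::euclidean_space \<Rightarrow> 'b::real_normed_vector"
  assumes "smooth f"
  shows "(f has_derivative frechet_derivative f (at x)) (at x)"
  using smooth_has_derivative[OF assms] frechet_derivative_works differentiableI by blast

lemma smooth_Lie:
  fixes f :: "'a::euclidean_space \<Rightarrow> 'b::real_normed_vector"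
  assumes "smooth f" "smooth g"
  shows "smooth (\<lambda>x. frechet_derivative f (at x) (g x))"
proof -
  obtain f' where f0: "\<forall>i\<in>Basis. pder i f (f' i) \<and> smooth (f' i)"
    "\<forall>x. (f has_derivative (\<lambda>v. \<Sum>i\<in>Basis. (v \<bullet> i) *\<^sub>R f' i x)) (at x)"
    using smooth_has_derivative[OF assms(1)] by blast
  have f': "\<And>i. i \<in> Basis \<Longrightarrow> pder i f (f' i)" "\<And>i. i \<in> Basis \<Longrightarrow> smooth (f' i)"
    "\<And>x. (f has_derivative (\<lambda>v. \<Sum>i\<in>Basis. (v \<bullet> i) *\<^sub>R f' i x)) (at x)"
    using f0 by auto
  have "frechet_derivative f (at x) = (\<lambda>v. \<Sum>i\<in>Basis. (v \<bullet> i) *\<^sub>R f' i x)" for x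
    by (rule frechet_derivative_at[OF f'(3), symmetric])
  then have "(\<lambda>x. frechet_derivative f (at x) (g x)) = (\<lambda>x. \<Sum>i\<in>Basis. (g x \<bullet> i) *\<^sub>R f' i x)"
    by simp
  moreover have "smooth (\<lambda>x. (g x \<bullet> i) *\<^sub>R f' i x)" if "i \<in> Basis" for i
    by (rule smooth_scaleR[OF smooth_inner[OF assms(2) smooth_const] f'(2)[OF that]])
  ultimately show ?thesis by (simp only: smooth_sum)
qed

lemma smooth_realI:
  fixes f :: "real \<Rightarrow> real"
  assumes "f \<in> S" "\<And>g. g \<in> S \<Longrightarrow> \<exists>g'\<in>S. \<forall>x. (g has_real_derivative g' x) (at x)"
  shows "smooth f"
  unfolding smooth_def
proof (intro exI conjI ballI)
  fix g i assume g: "g \<in> S"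
  obtain g' where g': "g' \<in> S" "\<And>x. (g has_real_derivative g' x) (at x)" using assms(2)[OF g] by blast
  then show "continuous_on UNIV g" by (meson DERIV_isCont continuous_at_imp_continuous_on)
  assume i: "i \<in> (Basis :: real set)"
  have "((\<lambda>t. g (x + t *\<^sub>R i)) has_vector_derivative g' x) (at 0)" for x
  proof -
    have "(g has_real_derivative g' x) (at (x + 0))" using g' by simp
    then show ?thesis using i DERIV_shift[of g "g' x" 0 x]
      by (simp add: has_real_derivative_iff_has_vector_derivative add.commute)
  qed
  then show "\<exists>g'\<in>S. \<forall>x. ((\<lambda>t. g (x + t *\<^sub>R i)) has_vector_derivative g' x) (at 0)" using g' by blast
qed (fact assms)

lemma smooth_exp: "smooth (exp :: real \<Rightarrow> real)"
  by (rule smooth_realI[of _ "{exp}"]) (auto intro: DERIV_exp)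

section \<open>Flat functions and smooth series\<close>

lemma poly_times_exp_minus_tendsto: "((\<lambda>u::real. poly p u * exp (- u)) \<longlongrightarrow> 0) at_top"
proof -
  have "((\<lambda>u::real. \<Sum>i\<le>degree p. coeff p i * (u ^ i / exp u)) \<longlongrightarrow> (\<Sum>i\<le>degree p. coeff p i * 0)) at_top"
    by (intro tendsto_sum tendsto_mult tendsto_const tendsto_power_div_exp_0)
  moreover have "(\<Sum>i\<le>degree p. coeff p i * (u ^ i / exp u)) = poly p u * exp (- u)" for u :: real
    by (simp add: poly_altdef sum_distrib_right exp_minus divide_inverse mult.assoc)
  ultimately show ?thesis by simp
qed

text \<open>With u = 1 / x, the derivative of p(u) exp(-u) is u^2 (p(u) - p'(u)) exp(-u), again of
  the same shape. Admitting all polynomials p thus gives a family closed under differentiation that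
  contains the classical flat function (p = 1).\<close>

definition flat_poly :: "real poly \<Rightarrow> real \<Rightarrow> real" where
  "flat_poly p x = (if x \<le> 0 then 0 else poly p (1 / x) * exp (- (1 / x)))"

lemma flat_poly_deriv:
  "(flat_poly p has_real_derivative flat_poly ([:0, 0, 1:] * (p - pderiv p)) x) (at x)"
proof -
  consider "x < 0" | "x > 0" | "x = 0" by linarith
  then show ?thesis
  proof cases
    case 1
    have "((\<lambda>x. 0) has_real_derivative 0) (at x)" by simp
    then have "(flat_poly p has_real_derivative 0) (at x)"
      by (rule has_field_derivative_transform_within_open[where S = "{..<0}"]) (use 1 in \<open>auto simp: flat_poly_def\<close>)
    then show ?thesis using 1 by (simp add: flat_poly_def)
  next
    case 2
    have "((\<lambda>x. poly p (1 / x) * exp (- (1 / x))) has_real_derivative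
        poly (pderiv p) (1 / x) * (- (1 / x\<^sup>2)) * exp (- (1 / x)) + poly p (1 / x) * (exp (- (1 / x)) * (1 / x\<^sup>2))) (at x)"
      using 2 by (auto intro!: derivative_eq_intros DERIV_chain2[where f = "poly p"] simp: power2_eq_square field_simps)
    then have "((\<lambda>x. poly p (1 / x) * exp (- (1 / x))) has_real_derivative
        flat_poly ([:0, 0, 1:] * (p - pderiv p)) x) (at x)"
      using 2 by (simp add: flat_poly_def power2_eq_square field_simps)
    then show ?thesis
      by (rule has_field_derivative_transform_within_open[where S = "{0<..}"]) (use 2 in \<open>auto simp: flat_poly_def\<close>)
  next
    case 3
    \<comment> \<open>With u = 1 / h the right difference quotient at 0 is u p(u) exp(-u), which
      tends to 0 as u grows.\<close>
    have "((\<lambda>h. poly ([:0, 1:] * p) (inverse h) * exp (- inverse h)) \<longlongrightarrow> 0) (at_right (0::real))"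
      by (rule filterlim_compose[OF poly_times_exp_minus_tendsto filterlim_inverse_at_top_right])
    moreover have "\<forall>\<^sub>F h in at_right 0. poly ([:0, 1:] * p) (inverse h) * exp (- inverse h) = (flat_poly p (0 + h) - flat_poly p 0) / h"
      unfolding eventually_at_right_field by (intro exI[of _ 1]) (auto simp: flat_poly_def field_simps)
    ultimately have r: "((\<lambda>h. (flat_poly p (0 + h) - flat_poly p 0) / h) \<longlongrightarrow> 0) (at_right 0)"
      by (rule Lim_transform_eventually)
    have "\<forall>\<^sub>F h in at_left 0. 0 = (flat_poly p (0 + h) - flat_poly p 0) / h"
      unfolding eventually_at_left_field by (intro exI[of _ "-1"]) (auto simp: flat_poly_def)
    then have l: "((\<lambda>h. (flat_poly p (0 + h) - flat_poly p 0) / h) \<longlongrightarrow> 0) (at_left 0)"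
      by (rule Lim_transform_eventually[rotated]) simp
    have "((\<lambda>h. (flat_poly p (0 + h) - flat_poly p 0) / h) \<longlongrightarrow> 0) (at 0)"
      using l r by (rule filterlim_split_at)
    then show ?thesis using 3 by (simp add: DERIV_def flat_poly_def)
  qed
qed

lemma smooth_flat_poly: "smooth (flat_poly p)"
  by (rule smooth_realI[of _ "range flat_poly"]) (use flat_poly_deriv in blast)+

definition flat :: "real \<Rightarrow> real" where "flat = flat_poly 1"

lemma flat_simps: "x \<le> 0 \<Longrightarrow> flat x = 0" "x > 0 \<Longrightarrow> flat x = exp (- (1 / x))"
  by (auto simp: flat_def flat_poly_def)

lemma smooth_flat: "smooth flat"
  by (simp add: flat_def smooth_flat_poly)

lemma flat_deriv: "(flat has_real_derivative (if x \<le> 0 then 0 else exp (- (1 / x)) / x\<^sup>2)) (at x)"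
proof -
  have "flat_poly ([:0, 0, 1:] * (1 - pderiv 1)) x = (if x \<le> 0 then 0 else exp (- (1 / x)) / x\<^sup>2)"
    by (simp add: flat_poly_def power2_eq_square)
  with flat_poly_deriv[of 1 x] show ?thesis by (simp add: flat_def)
qed

lemma flat_mono: "x \<le> y \<Longrightarrow> flat x \<le> flat y"
  by (rule DERIV_nonneg_imp_nondecreasing[of x y flat]) (use flat_deriv in fastforce)+

lemma flat_pos: "x > 0 \<Longrightarrow> flat x > 0" and flat_nonneg: "flat x \<ge> 0"
  by (auto simp: flat_def flat_poly_def)

lemma flat_less: "0 < x \<Longrightarrow> x < y \<Longrightarrow> flat x < flat y"
  by (simp add: flat_simps field_simps)

text \<open>The step is \<open>1 - flat (flat 1 - flat x) / flat (flat 1)\<close>: a composition of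
  flat functions divided by a constant, so smoothness follows from the closure rules, and the
  derivative is a product of two factors that are positive exactly where needed.\<close>

lemma smooth_step_exists:
  obtains s s' :: "real \<Rightarrow> real" where "smooth s" "\<And>x. (s has_real_derivative s' x) (at x)"
    "\<And>x. x \<le> 0 \<Longrightarrow> s x = 0" "\<And>x. x \<ge> 1 \<Longrightarrow> s x = 1" "\<And>x. x \<le> 0 \<Longrightarrow> s' x = 0" "\<And>x. s' x \<ge> 0"
    "\<And>x. 0 < x \<Longrightarrow> x < 1 \<Longrightarrow> s' x > 0" "\<And>x. x > 0 \<Longrightarrow> s x > 0" "\<And>x. 0 \<le> s x" "\<And>x. s x \<le> 1"
proof -
  define g where "g x = (if x \<le> 0 then 0 else exp (- (1 / x)) / x\<^sup>2)" for x :: real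
  have g: "(flat has_real_derivative g x) (at x)" for x using flat_deriv by (simp add: g_def)
  have g0: "g x \<ge> 0" for x by (simp add: g_def)
  have gp: "g x > 0" if "x > 0" for x using that by (simp add: g_def)
  define c where "c = flat (flat 1)"
  have c: "c > 0" by (simp add: c_def flat_pos)
  define s where "s x = 1 - flat (flat 1 - flat x) / c" for x
  define s' where "s' x = g (flat 1 - flat x) * g x / c" for x
  show thesis
  proof
    have "smooth (\<lambda>x. 1 - (1 / c) * flat (flat 1 - flat x))"
      by (intro smooth_diff smooth_const smooth_mult smooth_compose[OF smooth_flat] smooth_flat)
    then show "smooth s" by (simp add: s_def[abs_def])
    show "(s has_real_derivative s' x) (at x)" for x
      unfolding s_def[abs_def] s'_def using c
      by (auto intro!: derivative_eq_intros DERIV_chain2[OF g] g)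
    show "s x = 0" if "x \<le> 0" for x using that c by (simp add: s_def flat_simps c_def)
    show "s x = 1" if "x \<ge> 1" for x using flat_mono[OF that] by (simp add: s_def flat_simps)
    show "s' x = 0" if "x \<le> 0" for x using that by (simp add: s'_def g_def)
    show "s' x \<ge> 0" for x using g0 c by (simp add: s'_def)
    show "s' x > 0" if "0 < x" "x < 1" for x
      using gp[OF that(1)] gp[of "flat 1 - flat x"] flat_less[OF that] c by (simp add: s'_def)
    show "0 \<le> s x" for x
      using c flat_mono[of "flat 1 - flat x" "flat 1"] flat_nonneg[of x] by (simp add: s_def c_def)
    show "s x > 0" if x: "x > 0" for x
    proof (cases "x < 1")
      case True
      have "flat (flat 1 - flat x) < c"
        unfolding c_def by (rule flat_less) (use flat_less[OF x True] flat_pos[OF x] in auto)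
      then show ?thesis using c by (simp add: s_def)
    next
      case False
      then have "flat (flat 1 - flat x) = 0" using flat_mono[of 1 x] by (simp add: flat_simps)
      then show ?thesis by (simp add: s_def)
    qed
    show "s x \<le> 1" for x using c flat_nonneg by (simp add: s_def)
  qed
qed

text \<open>A locally finite sum of shifted copies of a function e that vanishes on the negative
  half-line and satisfies e, e' >= 1 from 1 on; the k-th copy is weighted with the size of
  \<open>m k\<close>. Domination by q' as well as by q is what later converts a positive decay rate
  on each slab into a decay rate of exponential type.\<close>

lemma smooth_dominating_exists:
  fixes m :: "nat \<Rightarrow> real"
  obtains q q' :: "real \<Rightarrow> real" where "smooth q" "\<And>x. (q has_real_derivative q' x) (at x)"
    "\<And>x. q' x \<ge> 1" "\<And>k x. real k \<le> x \<Longrightarrow> m k \<le> q x" "\<And>k x. real k \<le> x \<Longrightarrow> m k \<le> q' x"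
proof -
  define g where "g x = (if x \<le> 0 then 0 else exp (- (1 / x)) / x\<^sup>2)" for x :: real
  have g: "(flat has_real_derivative g x) (at x)" for x using flat_deriv by (simp add: g_def)
  \<comment> \<open>The derivative of \<open>flat\<close> itself tends to 0 at infinity; the factor
    x keeps \<open>e'\<close> at least \<open>8 * flat x\<close>. The constant 8 makes this at least
    1 from x = 1 on, since \<open>flat 1 = exp (- 1) \<ge> 1 / 8\<close>.\<close>
  define e where "e x = 8 * x * flat x" for x
  define e' where "e' x = 8 * flat x + 8 * x * g x" for x
  have e: "(e has_real_derivative e' x) (at x)" for x
    unfolding e_def[abs_def] e'_def by (auto intro!: derivative_eq_intros g)
  have e0: "x \<le> 0 \<Longrightarrow> e x = 0" "x \<le> 0 \<Longrightarrow> e' x = 0" "e x \<ge> 0" "e' x \<ge> 0" for x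
    by (auto simp: e_def e'_def g_def flat_def flat_poly_def)
  have f1: "flat x \<ge> 1 / 8" if "x \<ge> 1" for x
  proof -
    have "exp (1::real) \<le> 8" using exp_le by simp
    then have "flat 1 \<ge> 1 / 8" by (simp add: flat_simps exp_minus field_simps)
    then show ?thesis using flat_mono[OF that] by linarith
  qed
  have e1: "e x \<ge> 1" "e' x \<ge> 1" if "x \<ge> 1" for x
  proof -
    have "1 * (1 / 8) \<le> x * flat x" using that f1[OF that] by (intro mult_mono) auto
    then show "e x \<ge> 1" by (simp add: e_def)
    have "8 * x * g x \<ge> 0" using that by (simp add: g_def)
    then show "e' x \<ge> 1" using f1[OF that] by (simp add: e'_def)
  qed
  define qn where "qn N x = x + (\<Sum>k<N. \<bar>m k\<bar> * e (x - real k + 1))" for N x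
  define qn' where "qn' N x = 1 + (\<Sum>k<N. \<bar>m k\<bar> * e' (x - real k + 1))" for N x
  \<comment> \<open>Summands with \<open>real k \<ge> x + 1\<close> vanish at x, so every N beyond x
    + 1 gives the full sum; the strict inequality leaves room for a neighbourhood of x.\<close>
  define N where "N x = Suc (Suc (nat \<lceil>x\<rceil>))" for x :: real
  have N: "x < real (N x)" "x + 1 < real (N x)" for x unfolding N_def by linarith+
  have ext: "qn M x = qn K x" "qn' M x = qn' K x" if "x + 1 \<le> real M" "M \<le> K" for x M K
  proof -
    have "e (x - real k + 1) = 0 \<and> e' (x - real k + 1) = 0" if "k \<in> {..<K} - {..<M}" for k
    proof -
      have "real M \<le> real k" using that by auto
      then show ?thesis using \<open>x + 1 \<le> real M\<close> by (intro conjI e0) linarith+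
    qed
    note z = this
    show "qn M x = qn K x"
      unfolding qn_def using that(2) z by (intro arg_cong2[of _ _ _ _ "(+)"] sum.mono_neutral_left refl) auto
    show "qn' M x = qn' K x"
      unfolding qn'_def using that(2) z by (intro arg_cong2[of _ _ _ _ "(+)"] sum.mono_neutral_left refl) auto
  qed
  define q where "q x = qn (N x) x" for x
  define q' where "q' x = qn' (N x) x" for x
  have q: "q x = qn M x" "q' x = qn' M x" if "x + 1 \<le> real M" for x M
    unfolding q_def q'_def using ext[of x M "max M (N x)"] ext[of x "N x" "max M (N x)"] N[of x] that by auto
  have qn: "(qn M has_real_derivative qn' M x) (at x)" for M x
    unfolding qn_def[abs_def] qn'_def by (auto intro!: derivative_eq_intros DERIV_chain2[OF e] sum.cong)
  have sm: "smooth (qn M)" for M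
    unfolding qn_def[abs_def] e_def
    by (intro smooth_add smooth_sum smooth_mult smooth_const smooth_id smooth_diff smooth_compose[OF smooth_flat])
  show thesis
  proof
    show "smooth q"
    proof (rule smooth_local)
      fix x
      have "\<forall>y\<in>{..<real (N x) - 1}. q y = qn (N x) y" using q by auto
      then show "\<exists>U g. open U \<and> x \<in> U \<and> smooth g \<and> (\<forall>y\<in>U. q y = g y)"
        using N(2)[of x] sm
        by (intro exI[of _ "{..<real (N x) - 1}"] exI[of _ "qn (N x)"]) (simp del: lessThan_iff, simp)
    qed
    show "(q has_real_derivative q' x) (at x)" for x
    proof -
      have "(qn (N x) has_real_derivative q' x) (at x)" using qn q'_def by simp
      then show ?thesis
        by (rule has_field_derivative_transform_within_open[where S = "{..<real (N x) - 1}"])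
           (use N[of x] in \<open>auto intro!: q(1)[symmetric]\<close>)
    qed
    show "q' x \<ge> 1" for x
      unfolding q'_def qn'_def using e0(4) by (simp add: sum_nonneg)
    show "m k \<le> q x" "m k \<le> q' x" if k: "real k \<le> x" for k x
    proof -
      have kN: "k \<in> {..<N x}" using k N[of x] by auto
      have "m k \<le> \<bar>m k\<bar> * e (x - real k + 1)" "m k \<le> \<bar>m k\<bar> * e' (x - real k + 1)"
        using mult_left_mono[OF e1(1)[of "x - real k + 1"], of "\<bar>m k\<bar>"]
          mult_left_mono[OF e1(2)[of "x - real k + 1"], of "\<bar>m k\<bar>"] k by simp_all
      moreover have "\<bar>m k\<bar> * e (x - real k + 1) \<le> (\<Sum>k<N x. \<bar>m k\<bar> * e (x - real k + 1))"
        "\<bar>m k\<bar> * e' (x - real k + 1) \<le> (\<Sum>k<N x. \<bar>m k\<bar> * e' (x - real k + 1))"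
        using e0(3,4) kN by (auto intro!: member_le_sum)
      ultimately show "m k \<le> q x" "m k \<le> q' x"
        using k of_nat_0_le_iff[of k] unfolding q_def q'_def qn_def qn'_def by linarith+
    qed
  qed
qed

section \<open>Weighted series of smooth functions\<close>

definition pd :: "'a \<Rightarrow> ('a::euclidean_space \<Rightarrow> real) \<Rightarrow> 'a \<Rightarrow> real" where
  "pd i f = (\<lambda>x. vector_derivative (\<lambda>t. f (x + t *\<^sub>R i)) (at 0))"

text \<open>Indexing mixed partials by words over the basis leaves only finitely many of each order,
  so they have a common bound.\<close>

primrec pdw :: "'a list \<Rightarrow> ('a::euclidean_space \<Rightarrow> real) \<Rightarrow> 'a \<Rightarrow> real" where
  "pdw [] f = f" | "pdw (i # w) f = pd i (pdw w f)"

lemma pder_pd: "pder i f f' \<Longrightarrow> pd i f = f'"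
  unfolding pder_def pd_def by (intro ext vector_derivative_at) blast

lemma smooth_pd:
  assumes "smooth f" "i \<in> Basis" shows "pder i f (pd i f)" "smooth (pd i f)"
  using smooth_pder[OF assms] pder_pd by metis+

lemma smooth_pdw: "smooth f \<Longrightarrow> w \<in> lists Basis \<Longrightarrow> smooth (pdw w f)"
  by (induction w) (auto intro: smooth_pd)

lemma pd_const_outside:
  fixes f :: "'a::euclidean_space \<Rightarrow> real"
  assumes "\<And>x. norm x > R \<Longrightarrow> f x = c" "norm x > R"
  shows "pd i f x = 0"
proof -
  have "((\<lambda>t. f (x + t *\<^sub>R i)) has_vector_derivative 0) (at 0)"
  proof (rule has_vector_derivative_transform_within_open[where f = "\<lambda>t. c" and S = "{t. norm (x + t *\<^sub>R i) > R}"])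
    show "open {t. R < norm (x + t *\<^sub>R i)}" by (intro open_Collect_less continuous_intros)
  qed (use assms in auto)
  then show ?thesis unfolding pd_def by (rule vector_derivative_at)
qed

lemma pdw_const_outside:
  fixes f :: "'a::euclidean_space \<Rightarrow> real"
  assumes "\<And>x. norm x > R \<Longrightarrow> f x = c"
  shows "\<exists>c. \<forall>x. norm x > R \<longrightarrow> pdw w f x = c"
proof (induction w)
  case (Cons i w)
  then show ?case using pd_const_outside[of R "pdw w f"] by (metis pdw.simps(2))
qed (use assms in auto)

lemma bounded_if_const_outside:
  fixes f :: "'a::euclidean_space \<Rightarrow> real"
  assumes "continuous_on UNIV f" "\<And>x. norm x > R \<Longrightarrow> f x = c"
  shows "\<exists>M. \<forall>x. \<bar>f x\<bar> \<le> M"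
proof -
  have "compact (f ` cball 0 R)"
    using assms(1) by (intro compact_continuous_image) (auto intro: continuous_on_subset)
  then obtain M where M: "\<And>x. x \<in> cball 0 R \<Longrightarrow> \<bar>f x\<bar> \<le> M"
    by (meson bounded_real compact_imp_bounded imageI)
  have "\<bar>f x\<bar> \<le> max M \<bar>c\<bar>" for x
    using M[of x] assms(2)[of x] by (cases "norm x \<le> R") auto
  then show ?thesis by blast
qed

text \<open>The weight \<open>c n\<close> beats the suprema of all partials of \<open>Q n\<close> of
  order at most n; these are finite because each partial is continuous and constant outside a ball.
  For a fixed word the terms with n at least its length are then majorised by a geometric series, so
  every differentiated series converges uniformly and may be differentiated termwise.\<close>

lemma smooth_weighted_series:
  fixes Q :: "nat \<Rightarrow> 'a::euclidean_space \<Rightarrow> real"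
  assumes sm: "\<And>n. smooth (Q n)" and out: "\<And>n. \<exists>R c. \<forall>x. norm x > R \<longrightarrow> Q n x = c"
  obtains c V where "\<And>n. c n > 0" "smooth V" "\<And>x. (\<lambda>n. c n * Q n x) sums V x"
    "\<And>x v. (\<lambda>n. c n * frechet_derivative (Q n) (at x) v) sums frechet_derivative V (at x) v"
proof -
  have "\<exists>M. \<forall>w\<in>{w. set w \<subseteq> Basis \<and> length w \<le> n}. \<forall>x. \<bar>pdw w (Q n) x\<bar> \<le> M" for n
  proof -
    obtain R c where R: "\<And>x. norm x > R \<Longrightarrow> Q n x = c" using out by metis
    have "\<exists>M. \<forall>x. \<bar>pdw w (Q n) x\<bar> \<le> M" if "set w \<subseteq> Basis" for w
    proof -
      obtain c' where "\<And>x. norm x > R \<Longrightarrow> pdw w (Q n) x = c'"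
        using pdw_const_outside[of R "Q n" c w] R by blast
      moreover have "continuous_on UNIV (pdw w (Q n))"
        using smooth_pdw[OF sm[of n], of w] that by (intro smooth_continuous) auto
      ultimately show ?thesis by (rule bounded_if_const_outside[rotated])
    qed
    then obtain M where M: "\<And>w x. set w \<subseteq> Basis \<Longrightarrow> \<bar>pdw w (Q n) x\<bar> \<le> M w" by metis
    have fin: "finite {w. set w \<subseteq> (Basis::'a set) \<and> length w \<le> n}"
      by (rule finite_lists_length_le[OF finite_Basis])
    have "\<bar>pdw w (Q n) x\<bar> \<le> Max (M ` {w. set w \<subseteq> Basis \<and> length w \<le> n})"
      if "w \<in> {w. set w \<subseteq> Basis \<and> length w \<le> n}" for w x
      using M[of w x] that fin by (intro order_trans[OF _ Max_ge[of _ "M w"]]) auto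
    then show ?thesis by blast
  qed
  then obtain M where M: "\<And>n w x. set w \<subseteq> Basis \<Longrightarrow> length w \<le> n \<Longrightarrow> \<bar>pdw w (Q n) x\<bar> \<le> M n"
    by (simp add: Ball_def) metis
  \<comment> \<open>The summand 1 keeps the denominator positive.\<close>
  define c where "c n = (1 / 2) ^ n / (1 + \<bar>M n\<bar>)" for n
  have c: "c n > 0" for n by (simp add: c_def)
  have bd: "norm (c n * pdw w (Q n) x) \<le> (1 / 2) ^ n" if "set w \<subseteq> Basis" "length w \<le> n" for w n x
  proof -
    have "\<bar>c n * pdw w (Q n) x\<bar> = c n * \<bar>pdw w (Q n) x\<bar>" using c by (simp add: abs_mult less_imp_le)
    also have "\<dots> \<le> c n * (1 + \<bar>M n\<bar>)" using M[OF that, of x] c[of n] by (intro mult_left_mono) auto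
    also have "\<dots> = (1 / 2) ^ n" by (simp add: c_def)
    finally show ?thesis by simp
  qed
  have half: "summable (\<lambda>n. (1 / 2 :: real) ^ n)" by (rule summable_geometric) simp
  define W where "W w x = (\<Sum>n. c n * pdw w (Q n) x)" for w x
  have sum: "summable (\<lambda>n. c n * pdw w (Q n) x)" if "set w \<subseteq> Basis" for w x
    by (rule summable_comparison_test[OF _ half]) (use bd[OF that] in blast)
  have cont: "continuous_on UNIV (W w)" if w: "set w \<subseteq> Basis" for w
  proof -
    have "uniform_limit UNIV (\<lambda>n x. \<Sum>i<n. c i * pdw w (Q i) x) (W w) sequentially"
      unfolding W_def[abs_def]
      by (rule Weierstrass_m_test_ev[OF _ half]) (use bd[OF w] in \<open>auto simp: eventually_sequentially\<close>)
    moreover have "continuous_on UNIV (pdw w (Q i))" for i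
      using smooth_pdw[OF sm[of i], of w] w by (intro smooth_continuous) auto
    ultimately show ?thesis
      by (intro uniform_limit_theorem[OF _ _ trivial_limit_sequentially])
         (auto intro!: continuous_intros always_eventually)
  qed
  have der: "pder i (W w) (W (i # w))" if w: "set w \<subseteq> Basis" and i: "i \<in> Basis" for i w
    unfolding pder_def
  proof
    fix x
    have d: "((\<lambda>t. c n * pdw w (Q n) (x + t *\<^sub>R i)) has_real_derivative c n * pdw (i # w) (Q n) (x + t *\<^sub>R i)) (at t within UNIV)" for n t
    proof -
      have "((\<lambda>s. pdw w (Q n) ((x + t *\<^sub>R i) + s *\<^sub>R i)) has_vector_derivative pdw (i # w) (Q n) (x + t *\<^sub>R i)) (at 0)"
        using smooth_pd(1)[OF smooth_pdw[OF sm[of n], of w] i] w by (auto simp: pder_def)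
      then have "((\<lambda>s. pdw w (Q n) (x + (t + s) *\<^sub>R i)) has_real_derivative pdw (i # w) (Q n) (x + t *\<^sub>R i)) (at 0)"
        by (simp add: has_real_derivative_iff_has_vector_derivative scaleR_add_left add.assoc)
      then have "((\<lambda>t. pdw w (Q n) (x + t *\<^sub>R i)) has_real_derivative pdw (i # w) (Q n) (x + t *\<^sub>R i)) (at (0 + t))"
        by (subst DERIV_shift) (simp add: add.commute)
      then show ?thesis by (simp add: DERIV_cmult)
    qed
    have "((\<lambda>t. \<Sum>n. c n * pdw w (Q n) (x + t *\<^sub>R i)) has_real_derivative (\<Sum>n. c n * pdw (i # w) (Q n) (x + 0 *\<^sub>R i))) (at 0)"
    proof (rule has_field_derivative_series'(2)[where S = UNIV and x0 = 0])
      show "uniformly_convergent_on UNIV (\<lambda>n t. \<Sum>j<n. c j * pdw (i # w) (Q j) (x + t *\<^sub>R i))"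
      proof (rule Weierstrass_m_test'_ev[OF _ half])
        have "norm (c n * pdw (i # w) (Q n) (x + t *\<^sub>R i)) \<le> (1 / 2) ^ n" if "n \<ge> Suc (length w)" for n t
          using bd[of "i # w" n] that w i by simp
        then show "\<forall>\<^sub>F n in sequentially. \<forall>t\<in>UNIV. norm (c n * pdw (i # w) (Q n) (x + t *\<^sub>R i)) \<le> (1 / 2) ^ n"
          unfolding eventually_sequentially by blast
      qed
    qed (use d sum[OF w] in auto)
    then show "((\<lambda>t. W w (x + t *\<^sub>R i)) has_vector_derivative W (i # w) x) (at 0)"
      by (simp add: W_def has_real_derivative_iff_has_vector_derivative)
  qed
  have smW: "smooth (W [])"
    unfolding smooth_def
  proof (intro exI conjI ballI)
    show "W [] \<in> W ` {w. set w \<subseteq> Basis}" by simp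
    fix g i assume g: "g \<in> W ` {w. set w \<subseteq> (Basis :: 'a set)}"
    then show "continuous_on UNIV g" using cont by auto
    assume i: "i \<in> (Basis :: 'a set)"
    obtain w where w: "g = W w" "set w \<subseteq> Basis" using g by auto
    then have "pder i g (W (i # w))" "W (i # w) \<in> W ` {w. set w \<subseteq> Basis}" using der i by auto
    then show "\<exists>g'\<in>W ` {w. set w \<subseteq> Basis}. \<forall>x. ((\<lambda>t. g (x + t *\<^sub>R i)) has_vector_derivative g' x) (at 0)"
      unfolding pder_def by blast
  qed
  show thesis
  proof (rule that[OF c smW])
    show "(\<lambda>n. c n * Q n x) sums W [] x" for x
      using sum[of "[]" x] by (simp add: W_def summable_sums)
    fix x v :: 'a
    have eq: "frechet_derivative f (at x) v = (\<Sum>i\<in>Basis. (v \<bullet> i) * pd i f x)" if f: "smooth f" for f :: "'a \<Rightarrow> real"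
    proof -
      have "(f has_derivative (\<lambda>v. \<Sum>i\<in>Basis. (v \<bullet> i) *\<^sub>R pd i f x)) (at x)"
        by (rule has_derivative_partials) (use smooth_pd[OF f] smooth_continuous in auto)
      from frechet_derivative_at[OF this] show ?thesis by (metis (no_types, lifting) real_scaleR_def sum.cong)
    qed
    have "pd i (W []) x = W [i] x" if "i \<in> Basis" for i using pder_pd[OF der[of "[]" i]] that by simp
    then have "frechet_derivative (W []) (at x) v = (\<Sum>i\<in>Basis. (v \<bullet> i) * W [i] x)"
      using eq[OF smW] by simp
    moreover have "(\<lambda>n. c n * frechet_derivative (Q n) (at x) v) = (\<lambda>n. \<Sum>i\<in>Basis. (v \<bullet> i) * (c n * pdw [i] (Q n) x))"
      by (intro ext) (simp add: eq[OF sm] sum_distrib_left mult.left_commute)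
    moreover have "(\<lambda>n. \<Sum>i\<in>Basis. (v \<bullet> i) * (c n * pdw [i] (Q n) x)) sums (\<Sum>i\<in>Basis. (v \<bullet> i) * W [i] x)"
      unfolding W_def by (intro sums_sum sums_mult summable_sums sum) auto
    ultimately show "(\<lambda>n. c n * frechet_derivative (Q n) (at x) v) sums frechet_derivative (W []) (at x) v" by simp
  qed
qed

section \<open>Flows and Euler polygons\<close>

lemma continuous_bounded_cball:
  fixes f :: "'a::euclidean_space \<Rightarrow> 'b::real_normed_vector"
  assumes "continuous_on UNIV f"
  shows "\<exists>B>0. \<forall>x. norm x \<le> R \<longrightarrow> norm (f x) \<le> B"
proof -
  have "compact (f ` cball 0 R)"
    using assms by (intro compact_continuous_image) (auto intro: continuous_on_subset)
  then obtain B where B: "B > 0" "\<forall>y\<in>f ` cball 0 R. norm y \<le> B"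
    using bounded_pos compact_imp_bounded by blast
  then show ?thesis by (intro exI[of _ B]) auto
qed

lemma smooth_bounds_cball:
  fixes f :: "'a::euclidean_space \<Rightarrow> 'b::real_normed_vector"
  assumes "smooth f"
  shows "\<exists>L>0. (\<forall>x v. norm x \<le> R \<longrightarrow> norm (frechet_derivative f (at x) v) \<le> L * norm v) \<and>
    (\<forall>x y. norm x \<le> R \<longrightarrow> norm y \<le> R \<longrightarrow> norm (f x - f y) \<le> L * norm (x - y))"
proof -
  obtain f' where f': "\<forall>i\<in>Basis. pder i f (f' i) \<and> smooth (f' i)"
    "\<forall>x. (f has_derivative (\<lambda>v. \<Sum>i\<in>Basis. (v \<bullet> i) *\<^sub>R f' i x)) (at x)"
    using smooth_has_derivative[OF assms] by blast
  have fd: "frechet_derivative f (at x) = (\<lambda>v. \<Sum>i\<in>Basis. (v \<bullet> i) *\<^sub>R f' i x)" for x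
    by (rule frechet_derivative_at[OF f'(2)[rule_format], symmetric])
  have "\<forall>i\<in>Basis. \<exists>B>0. \<forall>x. norm x \<le> R \<longrightarrow> norm (f' i x) \<le> B"
    using f'(1) by (intro ballI continuous_bounded_cball smooth_continuous) blast
  from bchoice[OF this] obtain B where B: "\<forall>i\<in>Basis. B i > 0 \<and> (\<forall>x. norm x \<le> R \<longrightarrow> norm (f' i x) \<le> B i)"
    by blast
  define L where "L = (\<Sum>i\<in>Basis. B i)"
  have L: "L > 0" unfolding L_def using B by (intro sum_pos) auto
  have der: "norm (frechet_derivative f (at x) v) \<le> L * norm v" if "norm x \<le> R" for x v
  proof -
    have "norm (frechet_derivative f (at x) v) \<le> (\<Sum>i\<in>Basis. norm ((v \<bullet> i) *\<^sub>R f' i x))"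
      unfolding fd by (rule norm_sum)
    also have "\<dots> \<le> (\<Sum>i\<in>Basis. norm v * B i)"
      using B that Basis_le_norm by (intro sum_mono) (auto intro!: mult_mono)
    also have "\<dots> = L * norm v" by (simp add: L_def sum_distrib_left mult.commute)
    finally show ?thesis .
  qed
  have "norm (f x - f y) \<le> L * norm (x - y)" if "norm x \<le> R" "norm y \<le> R" for x y
  proof (rule differentiable_bound[where S = "cball 0 R" and f' = "\<lambda>x. frechet_derivative f (at x)"])
    show "(f has_derivative frechet_derivative f (at z)) (at z within cball 0 R)" for z
      using smooth_frechet[OF assms] has_derivative_at_withinI by blast
    show "onorm (frechet_derivative f (at z)) \<le> L" if "z \<in> cball 0 R" for z
      using der that by (intro onorm_le) auto
  qed (use that in auto)
  with der L show ?thesis by blast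
qed

text \<open>The remainder is at most |v| times the oscillation of the derivative along the segment.
  The partials are Lipschitz on the ball of radius R + 1, in which the segment stays since |v| is at
  most 1.\<close>

lemma smooth_taylor:
  fixes f :: "'a::euclidean_space \<Rightarrow> 'b::real_normed_vector"
  assumes "smooth f"
  shows "\<exists>K>0. \<forall>x v. norm x \<le> R \<longrightarrow> norm v \<le> 1 \<longrightarrow>
    norm (f (x + v) - f x - frechet_derivative f (at x) v) \<le> K * (norm v)\<^sup>2"
proof -
  obtain f' where f': "\<forall>i\<in>Basis. pder i f (f' i) \<and> smooth (f' i)"
    "\<forall>x. (f has_derivative (\<lambda>v. \<Sum>i\<in>Basis. (v \<bullet> i) *\<^sub>R f' i x)) (at x)"
    using smooth_has_derivative[OF assms] by blast
  have fd: "frechet_derivative f (at x) = (\<lambda>v. \<Sum>i\<in>Basis. (v \<bullet> i) *\<^sub>R f' i x)" for x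
    by (rule frechet_derivative_at[OF f'(2)[rule_format], symmetric])
  have "\<forall>i\<in>Basis. \<exists>B>0. \<forall>x y. norm x \<le> R + 1 \<longrightarrow> norm y \<le> R + 1 \<longrightarrow> norm (f' i x - f' i y) \<le> B * norm (x - y)"
    using f'(1) smooth_bounds_cball by blast
  from bchoice[OF this] obtain B where B: "\<forall>i\<in>Basis. B i > 0 \<and>
     (\<forall>x y. norm x \<le> R + 1 \<longrightarrow> norm y \<le> R + 1 \<longrightarrow> norm (f' i x - f' i y) \<le> B i * norm (x - y))"
    by blast
  define K where "K = (\<Sum>i\<in>Basis. B i)"
  have K: "K > 0" unfolding K_def using B by (intro sum_pos) auto
  have "norm (f (x + v) - f x - frechet_derivative f (at x) v) \<le> K * (norm v)\<^sup>2"
    if x: "norm x \<le> R" and v: "norm v \<le> 1" for x v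
  proof -
    have "norm (f (x + v) - f x - frechet_derivative f (at x) (x + v - x)) \<le> norm (x + v - x) * (K * norm v)"
    proof (rule differentiable_bound_linearization[where S = "cball x (norm v)"])
      show "x + t *\<^sub>R (x + v - x) \<in> cball x (norm v)" if "t \<in> {0..1}" for t
        using that by (simp add: dist_norm mult_left_le_one_le)
      show "(f has_derivative frechet_derivative f (at z)) (at z within cball x (norm v))" for z
        using smooth_frechet[OF assms] has_derivative_at_withinI by blast
      show "onorm (frechet_derivative f (at z) - frechet_derivative f (at x)) \<le> K * norm v"
        if z: "z \<in> cball x (norm v)" for z
        unfolding fun_diff_def
      proof (rule onorm_le)
        fix u
        have zx: "norm (z - x) \<le> norm v" using z by (simp add: dist_norm norm_minus_commute)
        then have zn: "norm z \<le> R + 1" using norm_triangle_sub[of z x] x v by linarith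
        have "norm (frechet_derivative f (at z) u - frechet_derivative f (at x) u)
          = norm (\<Sum>i\<in>Basis. (u \<bullet> i) *\<^sub>R (f' i z - f' i x))"
          by (simp add: fd sum_subtractf scaleR_diff_right)
        also have "\<dots> \<le> (\<Sum>i\<in>Basis. norm ((u \<bullet> i) *\<^sub>R (f' i z - f' i x)))" by (rule norm_sum)
        also have "\<dots> \<le> (\<Sum>i\<in>Basis. norm u * (B i * norm v))"
        proof (rule sum_mono)
          fix i :: 'a assume i: "i \<in> Basis"
          have "norm (f' i z - f' i x) \<le> B i * norm (z - x)" using B i zn x by simp
          also have "\<dots> \<le> B i * norm v" using B i zx by (intro mult_left_mono) (auto intro: less_imp_le)
          finally show "norm ((u \<bullet> i) *\<^sub>R (f' i z - f' i x)) \<le> norm u * (B i * norm v)"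
            using Basis_le_norm[OF i, of u] by (simp add: mult_mono)
        qed
        also have "\<dots> = K * norm v * norm u" by (simp add: K_def sum_distrib_left sum_distrib_right mult_ac)
        finally show "norm (frechet_derivative f (at z) u - frechet_derivative f (at x) u) \<le> K * norm v * norm u" .
      qed
    qed auto
    then show ?thesis by (simp add: power2_eq_square mult_ac)
  qed
  with K show ?thesis by blast
qed

text \<open>The recurrence has to be supplied only while the claimed bound holds at all earlier
  indices. This lets a caller first deduce that the polygon is still in the region where its
  constants are valid.\<close>

lemma discrete_gronwall:
  fixes a :: "nat \<Rightarrow> real"
  assumes "a 0 \<le> d" "d \<ge> 0" "h \<ge> 0" "L \<ge> 0" "K \<ge> 0"
    and "\<And>j. j < n \<Longrightarrow> (\<And>i. i \<le> j \<Longrightarrow> a i \<le> exp (L * (real i * h)) * (d + real i * h * (K * h))) \<Longrightarrow>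
      a (Suc j) \<le> (1 + h * L) * a j + h\<^sup>2 * K"
  shows "j \<le> n \<Longrightarrow> a j \<le> exp (L * (real j * h)) * (d + real j * h * (K * h))"
proof (induction j rule: less_induct)
  case (less j)
  show ?case
  proof (cases j)
    case 0 then show ?thesis using assms by simp
  next
    case (Suc m)
    let ?E = "\<lambda>i. exp (L * (real i * h)) * (d + real i * h * (K * h))"
    have "a j \<le> (1 + h * L) * a m + h\<^sup>2 * K"
      unfolding Suc by (rule assms(6)) (use less Suc in auto)
    also have "a m \<le> ?E m" using less Suc by simp
    then have "(1 + h * L) * a m + h\<^sup>2 * K \<le> (1 + h * L) * ?E m + h\<^sup>2 * K"
      using assms by (simp add: mult_left_mono)
    also have "(1 + h * L) * ?E m \<le> exp (L * h) * ?E m"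
    proof (rule mult_right_mono)
      show "1 + h * L \<le> exp (L * h)" using exp_ge_add_one_self[of "L * h"] by (simp add: mult.commute)
      show "0 \<le> ?E m" using assms by simp
    qed
    also have "exp (L * h) * ?E m = exp (L * (real j * h)) * (d + real m * h * (K * h))"
      unfolding Suc by (simp add: exp_add[symmetric] algebra_simps)
    also have "h\<^sup>2 * K \<le> exp (L * (real j * h)) * (h * (K * h))"
      using mult_right_mono[of 1 "exp (L * (real j * h))" "h * (K * h)"] assms by (simp add: power2_eq_square mult_ac)
    finally have "a j \<le> exp (L * (real j * h)) * (d + real m * h * (K * h)) + exp (L * (real j * h)) * (h * (K * h))"
      by simp
    also have "\<dots> = ?E j" unfolding Suc by (simp add: algebra_simps)
    finally show ?thesis .
  qed
qed

primrec euler :: "('a::real_normed_vector \<Rightarrow> 'a) \<Rightarrow> real \<Rightarrow> nat \<Rightarrow> 'a \<Rightarrow> 'a" where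
  "euler F h 0 x = x"
| "euler F h (Suc j) x = euler F h j x + h *\<^sub>R F (euler F h j x)"

lemma smooth_euler:
  assumes "smooth F" shows "smooth (euler F h j)"
proof (induction j)
  case 0
  have "euler F h 0 = (\<lambda>x. x)" by auto
  then show ?case by (simp add: smooth_id)
next
  case (Suc j)
  have "euler F h (Suc j) = (\<lambda>x. euler F h j x + h *\<^sub>R F (euler F h j x))" by auto
  then show ?case using Suc assms
    by (simp add: smooth_add smooth_scaleR smooth_const smooth_compose)
qed

lemma ode_sol_continuous:
  assumes "ode_sol F x" shows "continuous_on {0..} x"
  using assms unfolding ode_sol_def continuous_on_eq_continuous_within
  by (auto intro: has_vector_derivative_continuous)

lemma ode_sol_increment:
  assumes "ode_sol F x" "0 \<le> s" "s \<le> t" "\<And>u. s \<le> u \<Longrightarrow> u \<le> t \<Longrightarrow> norm (F (x u) - c) \<le> B"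
  shows "norm (x t - x s - (t - s) *\<^sub>R c) \<le> B * (t - s)"
proof -
  have "norm ((x t - t *\<^sub>R c) - (x s - s *\<^sub>R c)) \<le> B * norm (t - s)"
  proof (rule differentiable_bound[where S = "{s..t}" and f' = "\<lambda>u v. v *\<^sub>R (F (x u) - c)"])
    fix u assume u: "u \<in> {s..t}"
    have "(x has_vector_derivative F (x u)) (at u within {0..})"
      using assms(1,2) u unfolding ode_sol_def by simp
    then have "(x has_vector_derivative F (x u)) (at u within {s..t})"
      by (rule has_vector_derivative_within_subset) (use assms(2) in auto)
    moreover have "((\<lambda>u. u *\<^sub>R c) has_vector_derivative c) (at u within {s..t})"
      unfolding has_vector_derivative_def by (auto intro!: derivative_eq_intros)
    ultimately have "((\<lambda>u. x u - u *\<^sub>R c) has_vector_derivative (F (x u) - c)) (at u within {s..t})"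
      by (rule has_vector_derivative_diff)
    then show "((\<lambda>u. x u - u *\<^sub>R c) has_derivative (\<lambda>v. v *\<^sub>R (F (x u) - c))) (at u within {s..t})"
      by (simp add: has_vector_derivative_def)
    show "onorm (\<lambda>v. v *\<^sub>R (F (x u) - c)) \<le> B"
      using assms(4)[of u] u by (intro onorm_le) (simp add: mult.commute[of B] mult_left_mono)
  qed (use assms in auto)
  then show ?thesis using assms(3) by (simp add: algebra_simps)
qed

text \<open>The bound \<open>small\<close> keeps the polygon within distance 1 of the solution,
  hence in the ball of radius M + 1 on which B and L are valid; the local error of a step is of
  order h^2. The start p may differ from \<open>x 0\<close> by d, which is what yields dependence on
  the initial point.\<close>

lemma euler_close:
  assumes sol: "ode_sol F x" and M: "\<And>t. 0 \<le> t \<Longrightarrow> t \<le> T \<Longrightarrow> norm (x t) \<le> M"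
    and B: "\<And>y. norm y \<le> M + 1 \<Longrightarrow> norm (F y) \<le> B" "B > 0"
    and L: "\<And>y z. norm y \<le> M + 1 \<Longrightarrow> norm z \<le> M + 1 \<Longrightarrow> norm (F y - F z) \<le> L * norm (y - z)" "L > 0"
    and h: "h > 0" and d: "norm (x 0 - p) \<le> d"
    and small: "exp (L * T) * (d + T * (L * B * h)) \<le> 1" and jT: "real j * h \<le> T"
  shows "norm (euler F h j p - x (real j * h)) \<le> exp (L * T) * (d + T * (L * B * h))"
proof -
  have d0: "d \<ge> 0" using d norm_ge_zero order_trans by blast
  let ?E = "\<lambda>i. exp (L * (real i * h)) * (d + real i * h * (L * B * h))"
  have E: "?E i \<le> exp (L * T) * (d + T * (L * B * h))" if "real i * h \<le> T" for i
    using that h d0 B L by (intro mult_mono add_left_mono mult_right_mono) auto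
  have "norm (euler F h j p - x (real j * h)) \<le> ?E j"
  proof (rule discrete_gronwall[where n = j])
    show "norm (euler F h 0 p - x (real 0 * h)) \<le> d" using d by (simp add: norm_minus_commute)
    fix i assume i: "i < j" and IH: "\<And>k. k \<le> i \<Longrightarrow> norm (euler F h k p - x (real k * h)) \<le> ?E k"
    define t where "t = real i * h"
    have "real (Suc i) * h \<le> real j * h" using i h by (intro mult_right_mono) auto
    then have t: "0 \<le> t" "t + h \<le> T" "real (Suc i) * h = t + h" using jT h by (auto simp: t_def algebra_simps)
    let ?e = "euler F h i p"
    have e1: "norm (?e - x t) \<le> 1"
      using IH[of i] E[of i] small t h by (simp add: t_def)
    have xt: "norm (x t) \<le> M" using M t h by simp
    then have en: "norm ?e \<le> M + 1" using norm_triangle_sub[of ?e "x t"] e1 by linarith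
    have inc: "norm (x u - x t) \<le> B * h" if "t \<le> u" "u \<le> t + h" for u
    proof -
      have "norm (x u - x t - (u - t) *\<^sub>R 0) \<le> B * (u - t)"
      proof (rule ode_sol_increment[OF sol])
        fix v assume "t \<le> v" "v \<le> u"
        then have "norm (x v) \<le> M + 1" using M[of v] t that by simp
        then show "norm (F (x v) - 0) \<le> B" using B by simp
      qed (use t that in auto)
      also have "\<dots> \<le> B * h" using that B by simp
      finally show ?thesis by simp
    qed
    have "norm (x (t + h) - x t - (t + h - t) *\<^sub>R F (x t)) \<le> (L * (B * h)) * (t + h - t)"
    proof (rule ode_sol_increment[OF sol])
      fix u assume u: "t \<le> u" "u \<le> t + h"
      have "norm (F (x u) - F (x t)) \<le> L * norm (x u - x t)"
        using M[of u] xt u t by (intro L(1)) auto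
      also have "\<dots> \<le> L * (B * h)" using inc[OF u] L(2) by simp
      finally show "norm (F (x u) - F (x t)) \<le> L * (B * h)" .
    qed (use t h in auto)
    then have tr: "norm (x (t + h) - x t - h *\<^sub>R F (x t)) \<le> h\<^sup>2 * (L * B)" by (simp add: power2_eq_square mult_ac)
    have "euler F h (Suc i) p - x (real (Suc i) * h)
      = (?e - x t) + h *\<^sub>R (F ?e - F (x t)) - (x (t + h) - x t - h *\<^sub>R F (x t))"
      unfolding t(3) by (simp add: algebra_simps)
    also have "norm \<dots> \<le> norm (?e - x t) + norm (h *\<^sub>R (F ?e - F (x t))) + norm (x (t + h) - x t - h *\<^sub>R F (x t))"
      by (meson add_mono_thms_linordered_semiring(3) norm_triangle_ineq norm_triangle_ineq4 order_trans)
    also have "norm (h *\<^sub>R (F ?e - F (x t))) \<le> h * (L * norm (?e - x t))"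
      using L(1)[of ?e "x t"] en xt h by simp
    finally show "norm (euler F h (Suc i) p - x (real (Suc i) * h))
      \<le> (1 + h * L) * norm (euler F h i p - x (real i * h)) + h\<^sup>2 * (L * B)"
      using tr by (simp add: t_def algebra_simps)
  qed (use d0 h L B in auto)
  also have "\<dots> \<le> exp (L * T) * (d + T * (L * B * h))" using E jT by simp
  finally show ?thesis .
qed

lemma smooth_field_bounds:
  fixes F :: "'a::euclidean_space \<Rightarrow> 'a"
  assumes "smooth F"
  obtains B L where "B > 0" "L > 0" "\<And>y. norm y \<le> M \<Longrightarrow> norm (F y) \<le> B"
    "\<And>y z. norm y \<le> M \<Longrightarrow> norm z \<le> M \<Longrightarrow> norm (F y - F z) \<le> L * norm (y - z)"
proof -
  obtain B where "B > 0 \<and> (\<forall>y. norm y \<le> M \<longrightarrow> norm (F y) \<le> B)"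
    using continuous_bounded_cball[OF smooth_continuous[OF assms], of M] by blast
  moreover obtain L where "L > 0 \<and> (\<forall>y z. norm y \<le> M \<longrightarrow> norm z \<le> M \<longrightarrow> norm (F y - F z) \<le> L * norm (y - z))"
    using smooth_bounds_cball[OF assms, of M] by blast
  ultimately show ?thesis using that by blast
qed

text \<open>The same polygon, started at \<open>z 0\<close>, approximates both x and z. Its distance
  to x is controlled by \<eta> uniformly in z, and its distance to z tends to 0 with the step size,
  so the constants belonging to z drop out in the limit.\<close>

lemma ode_sol_dependence:
  fixes F :: "'a::euclidean_space \<Rightarrow> 'a"
  assumes F: "smooth F" and x: "ode_sol F x" and T: "T \<ge> 0" and e: "e > 0"
  shows "\<exists>\<eta>>0. \<forall>z. ode_sol F z \<and> norm (z 0 - x 0) < \<eta> \<longrightarrow> (\<forall>t. 0 \<le> t \<and> t \<le> T \<longrightarrow> norm (z t - x t) \<le> e)"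
proof -
  have bd: "\<exists>M. \<forall>t. 0 \<le> t \<and> t \<le> T \<longrightarrow> norm (z t) \<le> M" if "ode_sol F z" for z :: "real \<Rightarrow> 'a"
  proof -
    have "compact (z ` {0..T})"
      using ode_sol_continuous[OF that] by (intro compact_continuous_image) (auto intro: continuous_on_subset)
    then show ?thesis by (metis atLeastAtMost_iff bounded_iff compact_imp_bounded imageI)
  qed
  obtain M where M: "\<And>t. 0 \<le> t \<Longrightarrow> t \<le> T \<Longrightarrow> norm (x t) \<le> M" using bd[OF x] by blast
  obtain B L where BL: "B > 0" "L > 0" "\<And>y. norm y \<le> M + 1 \<Longrightarrow> norm (F y) \<le> B"
    "\<And>y z. norm y \<le> M + 1 \<Longrightarrow> norm z \<le> M + 1 \<Longrightarrow> norm (F y - F z) \<le> L * norm (y - z)"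
    by (rule smooth_field_bounds[OF F, of "M + 1"]) blast
  \<comment> \<open>Chosen so that \<open>exp (L * T) * \<eta>\<close> is half of
    \<open>min 1 e\<close>: the remaining half absorbs the discretisation error, both for the
    smallness condition of \<open>euler_close\<close> and for the final distance.\<close>
  define \<eta> where "\<eta> = min 1 e / (2 * exp (L * T))"
  have "norm (z t - x t) \<le> e" if z: "ode_sol F z" "norm (z 0 - x 0) < \<eta>" and t: "0 \<le> t" "t \<le> T" for z t
  proof (cases "t = 0")
    case True
    have "exp (L * T) \<ge> 1" using BL T by simp
    then have "e * 1 \<le> e * (2 * exp (L * T))" using e by (intro mult_left_mono) linarith+
    then have "min 1 e \<le> e * (2 * exp (L * T))" using min.cobounded2[of 1 e] by linarith
    then have "\<eta> \<le> e" unfolding \<eta>_def by (simp add: pos_divide_le_eq)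
    then show ?thesis using True z(2) by simp
  next
    case False
    \<comment> \<open>These constants depend on z, which is harmless because they only enter an
      error that vanishes as n grows.\<close>
    obtain M' where M': "\<And>t. 0 \<le> t \<Longrightarrow> t \<le> T \<Longrightarrow> norm (z t) \<le> M'" using bd[OF z(1)] by blast
    obtain B' L' where BL': "B' > 0" "L' > 0" "\<And>y. norm y \<le> M' + 1 \<Longrightarrow> norm (F y) \<le> B'"
      "\<And>y z. norm y \<le> M' + 1 \<Longrightarrow> norm z \<le> M' + 1 \<Longrightarrow> norm (F y - F z) \<le> L' * norm (y - z)"
      by (rule smooth_field_bounds[OF F, of "M' + 1"]) blast
    define a where "a n = exp (L * T) * (\<eta> + T * (L * B * (t / real n)))" for n
    define a' where "a' n = exp (L' * T) * (0 + T * (L' * B' * (t / real n)))" for n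
    have lim: "(\<lambda>n. t / real n) \<longlonglongrightarrow> 0" by (rule lim_const_over_n)
    have "a \<longlonglongrightarrow> exp (L * T) * (\<eta> + T * (L * B * 0))" "a' \<longlonglongrightarrow> exp (L' * T) * (0 + T * (L' * B' * 0))"
      unfolding a_def a'_def by (intro tendsto_mult tendsto_add tendsto_const lim)+
    then have a: "a \<longlonglongrightarrow> min 1 e / 2" "a' \<longlonglongrightarrow> 0" by (simp_all add: \<eta>_def)
    have "\<forall>\<^sub>F n in sequentially. a n < 1 \<and> a' n < 1 \<and> n > 0"
      using order_tendstoD(2)[OF a(1), of 1] order_tendstoD(2)[OF a(2), of 1] eventually_gt_at_top[of 0] e
      by (simp add: eventually_conj min_def)
    then have "\<forall>\<^sub>F n in sequentially. norm (z t - x t) \<le> a n + a' n"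
    proof (rule eventually_mono)
      fix n assume n: "a n < 1 \<and> a' n < 1 \<and> n > 0"
      have tn: "real n * (t / real n) = t" "t / real n > 0" using n t False by auto
      have 1: "norm (euler F (t / real n) n (z 0) - x (real n * (t / real n))) \<le> a n"
        unfolding a_def using n t BL M z(2) tn
        by (intro euler_close[OF x]) (auto simp: a_def norm_minus_commute)
      have 2: "norm (euler F (t / real n) n (z 0) - z (real n * (t / real n))) \<le> a' n"
        unfolding a'_def using n t BL' M' tn
        by (intro euler_close[OF z(1)]) (auto simp: a'_def)
      have "norm (z t - x t) \<le> norm (euler F (t / real n) n (z 0) - x t) + norm (euler F (t / real n) n (z 0) - z t)"
        using norm_triangle_ineq4[of "euler F (t / real n) n (z 0) - x t" "euler F (t / real n) n (z 0) - z t"] by simp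
      then show "norm (z t - x t) \<le> a n + a' n" using 1 2 unfolding tn by linarith
    qed
    moreover have "(\<lambda>n. a n + a' n) \<longlonglongrightarrow> min 1 e / 2 + 0" using a by (intro tendsto_add)
    ultimately have "norm (z t - x t) \<le> min 1 e / 2 + 0"
      by (intro tendsto_lowerbound[OF _ _ trivial_limit_sequentially])
    then show ?thesis using e by (auto simp: min_def split: if_splits)
  qed
  moreover have "\<eta> > 0" using e by (simp add: \<eta>_def)
  ultimately show ?thesis by blast
qed

lemma ode_sol_shift:
  assumes "ode_sol F x" "a \<ge> 0" shows "ode_sol F (\<lambda>t. x (a + t))"
  unfolding ode_sol_def
proof (intro allI impI)
  fix t :: real assume t: "t \<ge> 0"
  have "(x has_vector_derivative F (x (a + t))) (at (a + t) within {0..})"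
    using assms t unfolding ode_sol_def by simp
  then have "(x has_vector_derivative F (x (a + t))) (at (a + t) within (\<lambda>t. a + t) ` {0..})"
    by (rule has_vector_derivative_within_subset) (use assms in auto)
  moreover have "((\<lambda>t. a + t) has_vector_derivative 1) (at t within {0..})"
    by (auto intro!: derivative_eq_intros)
  ultimately have "((x \<circ> (\<lambda>t. a + t)) has_vector_derivative 1 *\<^sub>R F (x (a + t))) (at t within {0..})"
    by (intro vector_diff_chain_within) auto
  then show "((\<lambda>t. x (a + t)) has_vector_derivative F (x (a + t))) (at t within {0..})"
    by (simp add: o_def)
qed

text \<open>Each solution enters the stability ball of radius \<delta> at some time, neighbouring
  solutions follow it up to that time, and stability keeps them inside the ball of radius r
  afterwards. A finite subcover of the ball of initial points makes the time and the bound
  uniform.\<close>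

lemma flow_uniform:
  fixes F :: "'a::euclidean_space \<Rightarrow> 'a"
  assumes F: "smooth F" and G: "GAS F" and r: "r > 0"
  shows "\<exists>T S. T > 0 \<and> S > 0 \<and> (\<forall>x. ode_sol F x \<and> norm (x 0) \<le> R \<longrightarrow>
    (\<forall>t\<ge>0. norm (x t) \<le> S) \<and> (\<forall>t\<ge>T. norm (x t) < r))"
proof -
  obtain \<delta> where \<delta>: "\<delta> > 0" "\<And>x t. ode_sol F x \<Longrightarrow> norm (x 0) < \<delta> \<Longrightarrow> t \<ge> 0 \<Longrightarrow> norm (x t) < r"
    using G r unfolding GAS_def by meson
  have "\<exists>\<eta> T M. \<eta> > 0 \<and> T \<ge> 0 \<and> M \<ge> 0 \<and> (\<forall>z. ode_sol F z \<and> norm (z 0 - p) < \<eta> \<longrightarrow>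
      (\<forall>t\<ge>0. norm (z t) \<le> M) \<and> (\<forall>t\<ge>T. norm (z t) < r))" for p
  proof -
    obtain x where x: "x 0 = p" "ode_sol F x" using G unfolding GAS_def by blast
    have "(x \<longlongrightarrow> 0) at_top" using G x unfolding GAS_def by blast
    then have "\<forall>\<^sub>F t in at_top. dist (x t) 0 < \<delta> / 2"
      using \<delta>(1) by (intro tendstoD) auto
    then have "\<forall>\<^sub>F t in at_top. norm (x t) < \<delta> / 2" by simp
    then obtain N where N: "\<And>t. t \<ge> N \<Longrightarrow> norm (x t) < \<delta> / 2" unfolding eventually_at_top_linorder by blast
    define T where "T = max N 0"
    have T: "T \<ge> 0" "norm (x T) < \<delta> / 2" using N by (auto simp: T_def)
    have "compact (x ` {0..T})"
      using ode_sol_continuous[OF x(2)] by (intro compact_continuous_image) (auto intro: continuous_on_subset)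
    then obtain M where M: "\<And>t. 0 \<le> t \<Longrightarrow> t \<le> T \<Longrightarrow> norm (x t) \<le> M"
      by (metis atLeastAtMost_iff bounded_iff compact_imp_bounded imageI)
    define e where "e = min 1 (\<delta> / 2)"
    have e: "e > 0" "e \<le> 1" "e \<le> \<delta> / 2" using \<delta> by (auto simp: e_def)
    obtain \<eta> where \<eta>: "\<eta> > 0" "\<And>z t. ode_sol F z \<Longrightarrow> norm (z 0 - x 0) < \<eta> \<Longrightarrow> 0 \<le> t \<Longrightarrow> t \<le> T \<Longrightarrow> norm (z t - x t) \<le> e"
      using ode_sol_dependence[OF F x(2) T(1) e(1)] by blast
    have "(\<forall>t\<ge>0. norm (z t) \<le> max (M + 1) r) \<and> (\<forall>t\<ge>T. norm (z t) < r)" if z: "ode_sol F z" "norm (z 0 - p) < \<eta>" for z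
    proof -
      have zx: "norm (z t) \<le> norm (x t) + e" if "0 \<le> t" "t \<le> T" for t
        using \<eta>(2)[OF z(1), of t] z(2) x(1) that norm_triangle_sub[of "z t" "x t"] by simp
      have "norm (z (T + 0)) < \<delta>" using zx[of T] T e by simp
      then have later: "norm (z (T + s)) < r" if "s \<ge> 0" for s
        using \<delta>(2)[OF ode_sol_shift[OF z(1) T(1)], of s] that by simp
      then have after: "norm (z t) < r" if "t \<ge> T" for t
        using later[of "t - T"] that by simp
      have "norm (z t) \<le> max (M + 1) r" if "t \<ge> 0" for t
        using after[of t] zx[of t] M[of t] that e by (cases "t \<le> T") auto
      with after show ?thesis by blast
    qed
    then show ?thesis using \<eta>(1) T(1) r
      by (intro exI[of _ \<eta>] exI[of _ T] exI[of _ "max (M + 1) r"]) auto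
  qed
  then obtain \<eta> T M where P: "\<And>p. \<eta> p > 0" "\<And>p. T p \<ge> 0" "\<And>p. M p \<ge> 0"
    "\<And>p z. ode_sol F z \<Longrightarrow> norm (z 0 - p) < \<eta> p \<Longrightarrow> (\<forall>t\<ge>0. norm (z t) \<le> M p) \<and> (\<forall>t\<ge>T p. norm (z t) < r)"
    by metis
  have cov: "cball (0::'a) R \<subseteq> (\<Union>p\<in>cball 0 R. ball p (\<eta> p))" using P(1) by auto
  obtain C where C: "C \<subseteq> cball 0 R" "finite C" "cball 0 R \<subseteq> (\<Union>p\<in>C. ball p (\<eta> p))"
    by (rule compactE_image[OF compact_cball _ cov]) auto
  \<comment> \<open>Sums stand in for maxima over the subcover; the 1 keeps them positive even when
    the subcover is empty.\<close>
  define T' where "T' = 1 + sum T C"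
  define S' where "S' = 1 + sum M C"
  have le: "T p \<le> T'" "M p \<le> S'" if "p \<in> C" for p
    using member_le_sum[OF that, of T] member_le_sum[OF that, of M] P C(2) by (auto simp: T'_def S'_def)
  have "(\<forall>t\<ge>0. norm (x t) \<le> S') \<and> (\<forall>t\<ge>T'. norm (x t) < r)" if "ode_sol F x" "norm (x 0) \<le> R" for x
  proof -
    have "x 0 \<in> cball 0 R" using that(2) by simp
    then obtain p where p: "p \<in> C" "x 0 \<in> ball p (\<eta> p)" using C(3) by blast
    then have "norm (x 0 - p) < \<eta> p" by (simp add: dist_norm norm_minus_commute)
    from P(4)[OF that(1) this] le[OF p(1)] show ?thesis by fastforce
  qed
  moreover have "T' > 0" "S' > 0" using P(2,3) by (auto simp: T'_def S'_def intro!: add_pos_nonneg sum_nonneg)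
  ultimately show ?thesis by blast
qed

lemma euler_uniform:
  fixes F :: "'a::euclidean_space \<Rightarrow> 'a"
  assumes F: "smooth F" and S: "\<And>x t. ode_sol F x \<Longrightarrow> norm (x 0) \<le> R \<Longrightarrow> t \<ge> 0 \<Longrightarrow> norm (x t) \<le> S"
    and e: "e > 0" and T: "T > 0"
  shows "\<exists>h0>0. \<forall>h x j. 0 < h \<and> h < h0 \<and> ode_sol F x \<and> norm (x 0) \<le> R \<and> real j * h \<le> T \<longrightarrow>
    norm (euler F h j (x 0) - x (real j * h)) \<le> e"
proof -
  obtain B L where BL: "B > 0" "L > 0" "\<And>y. norm y \<le> S + 1 \<Longrightarrow> norm (F y) \<le> B"
    "\<And>y z. norm y \<le> S + 1 \<Longrightarrow> norm z \<le> S + 1 \<Longrightarrow> norm (F y - F z) \<le> L * norm (y - z)"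
    by (rule smooth_field_bounds[OF F, of "S + 1"]) blast
  define c where "c = exp (L * T) * (T * (L * B))"
  have c: "c > 0" using BL T by (simp add: c_def)
  have "norm (euler F h j (x 0) - x (real j * h)) \<le> e"
    if h: "0 < h" "h < min 1 e / c" and x: "ode_sol F x" "norm (x 0) \<le> R" and j: "real j * h \<le> T" for h x j
  proof -
    have "c * h < min 1 e" using h c by (simp add: field_simps)
    then have ch: "exp (L * T) * (0 + T * (L * B * h)) < min 1 e" by (simp add: c_def mult_ac)
    have "norm (euler F h j (x 0) - x (real j * h)) \<le> exp (L * T) * (0 + T * (L * B * h))"
      using ch S[OF x] BL h j by (intro euler_close[OF x(1), where M = S]) auto
    then show ?thesis using ch by simp
  qed
  moreover have "min 1 e / c > 0" using c e by simp
  ultimately show ?thesis by blast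
qed

lemma frechet_euler_Suc:
  fixes F :: "'a::euclidean_space \<Rightarrow> 'a"
  assumes F: "smooth F"
  shows "frechet_derivative (euler F h (Suc j)) (at x) v = frechet_derivative (euler F h j) (at x) v
    + h *\<^sub>R frechet_derivative F (at (euler F h j x)) (frechet_derivative (euler F h j) (at x) v)"
proof -
  let ?E = "euler F h j"
  have dE: "(?E has_derivative frechet_derivative ?E (at x)) (at x)" by (rule smooth_frechet[OF smooth_euler[OF F]])
  have "((F \<circ> ?E) has_derivative (frechet_derivative F (at (?E x)) \<circ> frechet_derivative ?E (at x))) (at x)"
    by (rule diff_chain_at[OF dE smooth_frechet[OF F]])
  then have "((\<lambda>x. ?E x + h *\<^sub>R (F \<circ> ?E) x) has_derivative
      (\<lambda>v. frechet_derivative ?E (at x) v + h *\<^sub>R (frechet_derivative F (at (?E x)) \<circ> frechet_derivative ?E (at x)) v)) (at x)"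
    by (intro has_derivative_add dE has_derivative_scaleR_right)
  moreover have "(\<lambda>x. ?E x + h *\<^sub>R (F \<circ> ?E) x) = euler F h (Suc j)" by auto
  ultimately have "(euler F h (Suc j) has_derivative
      (\<lambda>v. frechet_derivative ?E (at x) v + h *\<^sub>R (frechet_derivative F (at (?E x)) \<circ> frechet_derivative ?E (at x)) v)) (at x)"
    by simp
  from frechet_derivative_at[OF this] show ?thesis by (simp add: fun_eq_iff)
qed

text \<open>The differential of an Euler step carries \<open>F\<close> at \<open>x\<close> to \<open>F\<close> at the next point up to
  an error of order \<open>h\<^sup>2\<close>, so along the polygon the derivative of the Riemann sum in the
  direction \<open>F\<close> telescopes up to an error of order \<open>h\<close>.\<close>

lemma euler_sum_derivative:
  fixes F :: "'a::euclidean_space \<Rightarrow> 'a" and G :: "'a \<Rightarrow> real"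
  assumes F: "smooth F" and G: "smooth G" and T: "T > 0"
  shows "\<exists>C>0. \<exists>h0>0. \<forall>h N x. 0 < h \<and> h < h0 \<and> real N * h = T \<and> (\<forall>j\<le>N. norm (euler F h j x) \<le> M) \<longrightarrow>
    frechet_derivative (\<lambda>x. \<Sum>j<N. h * G (euler F h j x)) (at x) (F x) \<le> G (euler F h N x) - G x + C * h"
proof -
  obtain B where B: "B > 0" "\<And>y. norm y \<le> M \<Longrightarrow> norm (F y) \<le> B"
    using continuous_bounded_cball[OF smooth_continuous[OF F], of M] by blast
  obtain L where L: "L > 0" "\<And>y v. norm y \<le> M \<Longrightarrow> norm (frechet_derivative F (at y) v) \<le> L * norm v"
    using smooth_bounds_cball[OF F, of M] by blast
  obtain K where K: "K > 0" "\<And>y v. norm y \<le> M \<Longrightarrow> norm v \<le> 1 \<Longrightarrow>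
      norm (F (y + v) - F y - frechet_derivative F (at y) v) \<le> K * (norm v)\<^sup>2"
    using smooth_taylor[OF F, of M] by blast
  obtain LG where LG: "LG > 0" "\<And>y v. norm y \<le> M \<Longrightarrow> norm (frechet_derivative G (at y) v) \<le> LG * norm v"
    using smooth_bounds_cball[OF G, of M] by blast
  obtain KG where KG: "KG > 0" "\<And>y v. norm y \<le> M \<Longrightarrow> norm v \<le> 1 \<Longrightarrow>
      norm (G (y + v) - G y - frechet_derivative G (at y) v) \<le> KG * (norm v)\<^sup>2"
    using smooth_taylor[OF G, of M] by blast
  define C1 where "C1 = exp (L * T) * (T * (K * B\<^sup>2))"
  define C where "C = T * (KG * B\<^sup>2 + LG * C1) + 1"
  have C1: "C1 \<ge> 0" using T K by (simp add: C1_def)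
  have C: "C > 0" using T KG LG C1 by (auto simp: C_def intro!: add_nonneg_pos mult_nonneg_nonneg add_nonneg_nonneg)
  have main: "frechet_derivative (\<lambda>x. \<Sum>j<N. h * G (euler F h j x)) (at x) (F x) \<le> G (euler F h N x) - G x + C * h"
    if h: "0 < h" "h < 1 / B" and N: "real N * h = T" and bd: "\<And>j. j \<le> N \<Longrightarrow> norm (euler F h j x) \<le> M" for h N x
  proof -
    define X where "X j = euler F h j x" for j
    define D where "D j = frechet_derivative (euler F h j) (at x) (F x)" for j
    have X: "norm (X j) \<le> M" "norm (F (X j)) \<le> B" "norm (h *\<^sub>R F (X j)) \<le> h * B" "h * B \<le> 1" if "j \<le> N" for j
    proof -
      show "norm (X j) \<le> M" using bd[OF that] by (simp add: X_def)
      then show "norm (F (X j)) \<le> B" by (rule B(2))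
      then show "norm (h *\<^sub>R F (X j)) \<le> h * B" using h by simp
      show "h * B \<le> 1" using h B by (simp add: field_simps)
    qed
    have XS: "X (Suc j) = X j + h *\<^sub>R F (X j)" for j by (simp add: X_def)
    have sq: "(norm (h *\<^sub>R F (X j)))\<^sup>2 \<le> h\<^sup>2 * B\<^sup>2" if "j \<le> N" for j
      using X(3)[OF that] by (metis norm_ge_zero power_mono power_mult_distrib)
    have DS: "D (Suc j) = D j + h *\<^sub>R frechet_derivative F (at (X j)) (D j)" for j
      unfolding D_def X_def by (rule frechet_euler_Suc[OF F])
    have linF: "linear (frechet_derivative F (at y))" for y
      using smooth_frechet[OF F] has_derivative_linear by blast
    have linG: "linear (frechet_derivative G (at y))" for y
      using smooth_frechet[OF G] has_derivative_linear by blast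
    have err: "norm (D j - F (X j)) \<le> C1 * h" if j: "j \<le> N" for j
    proof -
      have "norm (D j - F (X j)) \<le> exp (L * (real j * h)) * (0 + real j * h * (K * B\<^sup>2 * h))"
      proof (rule discrete_gronwall[where n = N and a = "\<lambda>j. norm (D j - F (X j))"])
        have "euler F h 0 = (\<lambda>x. x)" by auto
        then show "norm (D 0 - F (X 0)) \<le> 0"
          by (simp add: D_def X_def frechet_derivative_at[OF has_derivative_ident, symmetric])
        fix i assume i: "i < N"
        have "D (Suc i) - F (X (Suc i)) = (D i - F (X i)) + h *\<^sub>R frechet_derivative F (at (X i)) (D i - F (X i))
            - (F (X i + h *\<^sub>R F (X i)) - F (X i) - frechet_derivative F (at (X i)) (h *\<^sub>R F (X i)))"
          using linF[of "X i"] by (simp add: DS XS linear_diff linear_scale algebra_simps)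
        also have "norm \<dots> \<le> norm (D i - F (X i)) + norm (h *\<^sub>R frechet_derivative F (at (X i)) (D i - F (X i)))
            + norm (F (X i + h *\<^sub>R F (X i)) - F (X i) - frechet_derivative F (at (X i)) (h *\<^sub>R F (X i)))"
          by (intro order_trans[OF norm_triangle_ineq4] add_mono norm_triangle_ineq order_refl)
        also have "norm (h *\<^sub>R frechet_derivative F (at (X i)) (D i - F (X i))) \<le> h * (L * norm (D i - F (X i)))"
          using L(2)[OF X(1)[of i], of "D i - F (X i)"] h i by simp
        also have "norm (F (X i + h *\<^sub>R F (X i)) - F (X i) - frechet_derivative F (at (X i)) (h *\<^sub>R F (X i))) \<le> K * (h\<^sup>2 * B\<^sup>2)"
        proof -
          have "norm (F (X i + h *\<^sub>R F (X i)) - F (X i) - frechet_derivative F (at (X i)) (h *\<^sub>R F (X i)))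
            \<le> K * (norm (h *\<^sub>R F (X i)))\<^sup>2"
            using X[of i] i by (intro K(2)) auto
          also have "\<dots> \<le> K * (h\<^sup>2 * B\<^sup>2)" using sq[of i] i K(1) by (intro mult_left_mono) auto
          finally show ?thesis .
        qed
        finally show "norm (D (Suc i) - F (X (Suc i))) \<le> (1 + h * L) * norm (D i - F (X i)) + h\<^sup>2 * (K * B\<^sup>2)"
          by (simp add: algebra_simps)
      qed (use h L K j in auto)
      also have "\<dots> \<le> exp (L * T) * (T * (K * B\<^sup>2 * h))"
      proof -
        have jT: "real j * h \<le> T" using j h N by (metis mult_right_mono of_nat_le_iff less_imp_le)
        have "exp (L * (real j * h)) \<le> exp (L * T)" using jT L by simp
        moreover have "real j * h * (K * B\<^sup>2 * h) \<le> T * (K * B\<^sup>2 * h)"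
          using jT K h by (intro mult_right_mono) auto
        ultimately show ?thesis using h K by (simp add: mult_mono)
      qed
      also have "\<dots> = C1 * h" by (simp add: C1_def mult_ac)
      finally show ?thesis .
    qed
    have summand: "frechet_derivative (\<lambda>x. h * G (euler F h j x)) (at x) (F x) = h * frechet_derivative G (at (X j)) (D j)" for j
    proof -
      have "((G \<circ> euler F h j) has_derivative (frechet_derivative G (at (X j)) \<circ> frechet_derivative (euler F h j) (at x))) (at x)"
        unfolding X_def by (rule diff_chain_at[OF smooth_frechet[OF smooth_euler[OF F]] smooth_frechet[OF G]])
      then have "((\<lambda>x. h * (G \<circ> euler F h j) x) has_derivative (\<lambda>v. h * (frechet_derivative G (at (X j)) \<circ> frechet_derivative (euler F h j) (at x)) v)) (at x)"
        by (rule has_derivative_mult_right)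
      from frechet_derivative_at[OF this] show ?thesis by (simp add: fun_eq_iff D_def o_def)
    qed
    have smt: "smooth (\<lambda>x. h * G (euler F h j x))" for j
      by (intro smooth_mult smooth_const smooth_compose[OF G] smooth_euler[OF F])
    have "((\<lambda>x. \<Sum>j<N. h * G (euler F h j x)) has_derivative
        (\<lambda>v. \<Sum>j<N. frechet_derivative (\<lambda>x. h * G (euler F h j x)) (at x) v)) (at x)"
      by (intro has_derivative_sum smooth_frechet[OF smt])
    from fun_cong[OF frechet_derivative_at[OF this, symmetric], of "F x"]
    have "frechet_derivative (\<lambda>x. \<Sum>j<N. h * G (euler F h j x)) (at x) (F x) = (\<Sum>j<N. h * frechet_derivative G (at (X j)) (D j))"
      unfolding summand .
    also have "\<dots> \<le> (\<Sum>j<N. (G (X (Suc j)) - G (X j)) + h * (h * (KG * B\<^sup>2 + LG * C1)))"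
    proof (rule sum_mono)
      fix j assume "j \<in> {..<N}"
      then have j: "j \<le> N" by simp
      have "\<bar>G (X (Suc j)) - G (X j) - frechet_derivative G (at (X j)) (h *\<^sub>R F (X j))\<bar> \<le> KG * (norm (h *\<^sub>R F (X j)))\<^sup>2"
        using KG(2)[OF X(1)[OF j], of "h *\<^sub>R F (X j)"] X[OF j] by (simp add: XS)
      also have "\<dots> \<le> KG * (h\<^sup>2 * B\<^sup>2)" using sq[OF j] KG(1) by (intro mult_left_mono) auto
      finally have 1: "h * frechet_derivative G (at (X j)) (F (X j)) \<le> G (X (Suc j)) - G (X j) + KG * (h\<^sup>2 * B\<^sup>2)"
        using linear_scale[OF linG[of "X j"], of h "F (X j)"] by (simp add: abs_le_iff)
      have "\<bar>frechet_derivative G (at (X j)) (D j - F (X j))\<bar> \<le> LG * norm (D j - F (X j))"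
        using LG(2)[OF X(1)[OF j], of "D j - F (X j)"] by simp
      also have "\<dots> \<le> LG * (C1 * h)" using err[OF j] LG(1) by simp
      finally have "h * frechet_derivative G (at (X j)) (D j - F (X j)) \<le> h * (LG * (C1 * h))"
        using h by (intro mult_left_mono) auto
      then have 2: "h * frechet_derivative G (at (X j)) (D j) \<le> h * frechet_derivative G (at (X j)) (F (X j)) + h * (LG * (C1 * h))"
        using linear_diff[OF linG[of "X j"], of "D j" "F (X j)"] by (simp add: algebra_simps)
      show "h * frechet_derivative G (at (X j)) (D j) \<le> (G (X (Suc j)) - G (X j)) + h * (h * (KG * B\<^sup>2 + LG * C1))"
        using 1 2 by (simp add: power2_eq_square algebra_simps)
    qed
    also have "\<dots> = (\<Sum>j<N. G (X (Suc j)) - G (X j)) + real N * (h * (h * (KG * B\<^sup>2 + LG * C1)))"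
      by (simp add: sum.distrib)
    also have "(\<Sum>j<N. G (X (Suc j)) - G (X j)) = G (X N) - G (X 0)" by (rule sum_lessThan_telescope)
    also have "real N * (h * (h * (KG * B\<^sup>2 + LG * C1))) = T * (KG * B\<^sup>2 + LG * C1) * h"
      using N by (metis mult.assoc mult.commute)
    also have "G (X N) - G (X 0) + T * (KG * B\<^sup>2 + LG * C1) * h \<le> G (X N) - G (X 0) + C * h"
      using h by (simp add: C_def algebra_simps)
    finally show ?thesis by (simp add: X_def)
  qed
  have "1 / B > 0" using B by simp
  then show ?thesis using C main by blast
qed

section \<open>The converse Lyapunov theorem\<close>

lemma smooth_transition_exists:
  fixes a b :: real
  assumes "a < b"
  obtains s s' :: "real \<Rightarrow> real" where "smooth s" "\<And>x. (s has_real_derivative s' x) (at x)"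
    "\<And>x. x \<le> a \<Longrightarrow> s x = 0" "\<And>x. x \<ge> b \<Longrightarrow> s x = 1" "\<And>x. x \<le> a \<Longrightarrow> s' x = 0" "\<And>x. s' x \<ge> 0"
    "\<And>x. a < x \<Longrightarrow> x < b \<Longrightarrow> s' x > 0" "\<And>x. x > a \<Longrightarrow> s x > 0" "\<And>x. 0 \<le> s x" "\<And>x. s x \<le> 1"
proof -
  obtain s s' :: "real \<Rightarrow> real" where s: "smooth s" "\<And>x. (s has_real_derivative s' x) (at x)"
    "\<And>x. x \<le> 0 \<Longrightarrow> s x = 0" "\<And>x. x \<ge> 1 \<Longrightarrow> s x = 1" "\<And>x. x \<le> 0 \<Longrightarrow> s' x = 0" "\<And>x. s' x \<ge> 0"
    "\<And>x. 0 < x \<Longrightarrow> x < 1 \<Longrightarrow> s' x > 0" "\<And>x. x > 0 \<Longrightarrow> s x > 0" "\<And>x. 0 \<le> s x" "\<And>x. s x \<le> 1"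
    using smooth_step_exists by blast
  define c where "c = 1 / (b - a)"
  have c: "c > 0" "c * (b - a) = 1" using assms by (auto simp: c_def)
  show thesis
  proof (rule that[of "\<lambda>x. s (c * (x - a))" "\<lambda>x. s' (c * (x - a)) * c"])
    show "smooth (\<lambda>x. s (c * (x - a)))"
      by (rule smooth_compose[OF s(1)]) (intro smooth_mult smooth_diff smooth_const smooth_id)
    show "((\<lambda>x. s (c * (x - a))) has_real_derivative s' (c * (x - a)) * c) (at x)" for x
      by (rule DERIV_chain2[OF s(2)]) (auto intro!: derivative_eq_intros)
    show "s (c * (x - a)) = 0" "s' (c * (x - a)) * c = 0" if "x \<le> a" for x
      using that c s(3,5) by (simp_all add: mult_nonneg_nonpos)
    show "s (c * (x - a)) = 1" if "x \<ge> b" for x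
    proof -
      have "c * (b - a) \<le> c * (x - a)" using c that by (intro mult_left_mono) auto
      then show ?thesis using c s(4) by simp
    qed
    show "s' (c * (x - a)) * c \<ge> 0" for x using s(6) c by simp
    show "s' (c * (x - a)) * c > 0" if "a < x" "x < b" for x
    proof -
      have "c * (x - a) < c * (b - a)" using c that by (intro mult_strict_left_mono) auto
      then show ?thesis using c s(7) that by simp
    qed
    show "s (c * (x - a)) > 0" if "x > a" for x using s(8) c that by simp
  qed (use s in auto)
qed

text \<open>A Riemann sum with left end points counts the node at time 0, so there are
  \<open>\<lceil>t / h\<rceil>\<close> nodes at which the integrand is at least c, and nothing is
  lost to rounding.\<close>

lemma sum_time_lower_bound:
  fixes g :: "nat \<Rightarrow> real"
  assumes "h > 0" "real N * h = T" "0 < t" "t \<le> T" "\<And>j. j < N \<Longrightarrow> g j \<ge> 0"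
    and "\<And>j. j < N \<Longrightarrow> real j * h \<le> t \<Longrightarrow> g j \<ge> c" and "c \<ge> 0"
  shows "(\<Sum>j<N. h * g j) \<ge> c * t"
proof -
  define m where "m = nat \<lceil>t / h\<rceil>"
  have m: "t / h \<le> real m" "real m < t / h + 1" using assms by (auto simp: m_def) linarith+
  have "real m < real N + 1" using m assms by (smt (verit) divide_right_mono nonzero_mult_div_cancel_right)
  then have mN: "m \<le> N" by linarith
  have "c * t \<le> c * (real m * h)" using m assms by (intro mult_left_mono) (auto simp: field_simps)
  also have "\<dots> = (\<Sum>j<m. h * c)" by simp
  also have "\<dots> \<le> (\<Sum>j<m. h * g j)"
  proof (rule sum_mono)
    fix j assume "j \<in> {..<m}"
    then have "real j + 1 \<le> real m" "j < N" using mN by auto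
    then have "real j \<le> t / h" using m by linarith
    then show "h * c \<le> h * g j" using assms \<open>j < N\<close> by (intro mult_left_mono assms(6)) (auto simp: field_simps)
  qed
  also have "\<dots> \<le> (\<Sum>j<N. h * g j)" using mN assms by (intro sum_mono2) auto
  finally show ?thesis .
qed

lemma euler_speed:
  assumes "\<And>i. i < j \<Longrightarrow> norm (F (euler F h i x)) \<le> B" "h \<ge> 0"
  shows "norm (euler F h j x - x) \<le> real j * h * B"
  using assms(1)
proof (induction j)
  case (Suc j)
  have "norm (euler F h (Suc j) x - x) \<le> norm (euler F h j x - x) + norm (h *\<^sub>R F (euler F h j x))"
    using norm_triangle_ineq[of "euler F h j x - x" "h *\<^sub>R F (euler F h j x)"] by (simp add: diff_add_eq)
  also have "\<dots> \<le> real j * h * B + h * B"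
    using Suc assms(2) by (intro add_mono) (auto intro!: mult_left_mono)
  finally show ?case by (simp add: algebra_simps)
qed simp

text \<open>The Riemann sum \<open>W\<close> of \<open>G = \<kappa>|x|\<^sup>2 + g1(|x|\<^sup>2) + lam g2(|x|\<^sup>2)\<close> along Euler polygons decreases
  strictly along \<open>F\<close> on an annulus, as all trajectories have become small at the final time.  The weight \<open>g1\<close>
  counts the time spent outside a small ball, \<open>lam\<close> makes \<open>W\<close> large at the outer boundary, and \<open>\<kappa>\<close> is so
  small that \<open>W\<close> is small on the inner ball; hence a cut-off of \<open>W\<close> extends to the whole space.\<close>

lemma Lyapunov_stage:
  fixes F :: "'a::euclidean_space \<Rightarrow> 'a"
  assumes F: "smooth F" and gas: "GAS F"
    and r: "0 < r" "r \<le> s" "s < \<rho>" and s0: "\<forall>x t. ode_sol F x \<and> norm (x 0) \<le> r \<and> t \<ge> 0 \<longrightarrow> norm (x t) \<le> s"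
  shows "\<exists>(Q :: 'a \<Rightarrow> real) R. smooth Q \<and> (\<forall>x. 0 \<le> Q x) \<and> (\<forall>x. norm x \<le> r \<longrightarrow> Q x = 0) \<and> (\<forall>x. norm x > R \<longrightarrow> Q x = 1) \<and>
    (\<forall>x. frechet_derivative Q (at x) (F x) \<le> 0) \<and>
    (\<forall>x. \<rho> \<le> norm x \<and> norm x \<le> R1 \<longrightarrow> 0 < Q x \<and> frechet_derivative Q (at x) (F x) < 0)"
proof -
  have s: "norm (x t) \<le> s" if "ode_sol F x" "norm (x 0) \<le> r" "t \<ge> 0" for x t using s0 that by blast
  have ex: "\<exists>x. x 0 = p \<and> ode_sol F x" for p using gas unfolding GAS_def by blast
  obtain T1 S0 where S0: "S0 > 0" "\<And>x t. ode_sol F x \<Longrightarrow> norm (x 0) \<le> R1 \<Longrightarrow> t \<ge> 0 \<Longrightarrow> norm (x t) \<le> S0"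
    using flow_uniform[OF F gas r(1), of R1] by blast
  define S1 where "S1 = max S0 (max R1 \<rho>)"
  have S1: "S1 \<ge> R1" "S1 \<ge> \<rho>" "S1 > 0" "\<And>x t. ode_sol F x \<Longrightarrow> norm (x 0) \<le> R1 \<Longrightarrow> t \<ge> 0 \<Longrightarrow> norm (x t) \<le> S1"
    using S0 by (fastforce simp: S1_def)+
  define R2 where "R2 = S1 + 3"
  obtain T0 S2 where S2: "T0 > 0" "S2 > 0" "\<And>x t. ode_sol F x \<Longrightarrow> norm (x 0) \<le> R2 + 1 \<Longrightarrow> t \<ge> 0 \<Longrightarrow> norm (x t) \<le> S2"
     "\<And>x t. ode_sol F x \<Longrightarrow> norm (x 0) \<le> R2 + 1 \<Longrightarrow> t \<ge> T0 \<Longrightarrow> norm (x t) < r / 4"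
    using flow_uniform[OF F gas, of "r / 4" "R2 + 1"] r by auto
  define M where "M = S2 + 1"
  obtain B0 where B0: "B0 > 0" "\<And>y. norm y \<le> M \<Longrightarrow> norm (F y) \<le> B0"
    using continuous_bounded_cball[OF smooth_continuous[OF F], of M] by blast
  define B where "B = max B0 1"
  have B: "B \<ge> 1" "\<And>y. norm y \<le> M \<Longrightarrow> norm (F y) \<le> B" using B0 by (fastforce simp: B_def)+
  \<comment> \<open>The gap between s and \<rho> is cut into thirds: \<sigma> - s is the margin for
    polygons that follow solutions from the inner ball, and \<rho> - \<tau> is the distance a
    polygon from outside radius \<rho> must cover before \<open>g1\<close> may fall below 1.\<close>
  define \<sigma> where "\<sigma> = s + (\<rho> - s) / 3"
  define \<tau> where "\<tau> = s + 2 * (\<rho> - s) / 3"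
  have st: "s < \<sigma>" "\<sigma> < \<tau>" "\<tau> < \<rho>" "0 < \<sigma>" using r by (auto simp: \<sigma>_def \<tau>_def field_simps)
  \<comment> \<open>With speed at most B, a polygon starting outside radius \<rho> stays outside
    radius \<tau> at least up to this time.\<close>
  define t1 where "t1 = (\<rho> - \<tau>) / B"
  have t1: "t1 > 0" using st B by (simp add: t1_def)
  define T where "T = max T0 (max 1 t1)"
  have T: "T \<ge> T0" "T \<ge> 1" "T \<ge> t1" "T > 0" using S2 by (auto simp: T_def)
  \<comment> \<open>A polygon starting beyond \<open>R2 = S1 + 3\<close> stays beyond
    \<open>S1 + 2\<close> for time 1 / B, which contributes \<open>lam / B = T + 3\<close> to W and
    lifts it above every value on the annulus.\<close>
  define lam where "lam = (T + 3) * B"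
  \<comment> \<open>The first bound gives W <= t1 / 4 on the inner ball, the second W <= T + 1 on
    the annulus.\<close>
  define \<kappa> where "\<kappa> = min (t1 / (4 * T * \<sigma>\<^sup>2)) (1 / (T * (S1 + 1)\<^sup>2))"
  have \<kappa>: "\<kappa> > 0" using t1 T st S1 by (auto simp: \<kappa>_def)
  have \<kappa>1: "T * (\<kappa> * \<sigma>\<^sup>2) \<le> t1 / 4"
  proof -
    have "\<kappa> \<le> t1 / (4 * T * \<sigma>\<^sup>2)" by (simp add: \<kappa>_def)
    then have "\<kappa> * (4 * T * \<sigma>\<^sup>2) \<le> t1" using T st by (subst (asm) pos_le_divide_eq) auto
    then show ?thesis by (simp add: mult_ac)
  qed
  have \<kappa>2: "T * (\<kappa> * (S1 + 1)\<^sup>2) \<le> 1"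
  proof -
    have "\<kappa> \<le> 1 / (T * (S1 + 1)\<^sup>2)" by (simp add: \<kappa>_def)
    then have "\<kappa> * (T * (S1 + 1)\<^sup>2) \<le> 1" using T S1 by (subst (asm) pos_le_divide_eq) auto
    then show ?thesis by (simp add: mult_ac)
  qed
  have "\<sigma>\<^sup>2 < \<tau>\<^sup>2" using st by (intro power_strict_mono) auto
  then obtain g1 :: "real \<Rightarrow> real" where g1: "smooth g1" "\<And>x. x \<le> \<sigma>\<^sup>2 \<Longrightarrow> g1 x = 0" "\<And>x. x \<ge> \<tau>\<^sup>2 \<Longrightarrow> g1 x = 1"
     "\<And>x. 0 \<le> g1 x" "\<And>x. g1 x \<le> 1"
    by (rule smooth_transition_exists) blast
  have "(S1 + 1)\<^sup>2 < (S1 + 2)\<^sup>2" using S1 by (intro power_strict_mono) auto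
  then obtain g2 :: "real \<Rightarrow> real" where g2: "smooth g2" "\<And>x. x \<le> (S1 + 1)\<^sup>2 \<Longrightarrow> g2 x = 0" "\<And>x. x \<ge> (S1 + 2)\<^sup>2 \<Longrightarrow> g2 x = 1"
     "\<And>x. 0 \<le> g2 x" "\<And>x. g2 x \<le> 1"
    by (rule smooth_transition_exists) blast
  define G where "G x = \<kappa> * (x \<bullet> x) + g1 (x \<bullet> x) + lam * g2 (x \<bullet> x)" for x :: 'a
  have smG: "smooth G"
    unfolding G_def[abs_def]
    by (intro smooth_add smooth_mult smooth_const smooth_inner smooth_id smooth_compose[OF g1(1)] smooth_compose[OF g2(1)])
  have lam: "lam \<ge> 0" using T B by (simp add: lam_def)
  have Gn: "G x \<ge> \<kappa> * (norm x)\<^sup>2" "G x \<ge> 0" "\<tau> \<le> norm x \<Longrightarrow> G x \<ge> 1" "S1 + 2 \<le> norm x \<Longrightarrow> G x \<ge> lam"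
    "norm x \<le> \<sigma> \<Longrightarrow> G x = \<kappa> * (norm x)\<^sup>2" "norm x \<le> S1 + 1 \<Longrightarrow> G x \<le> \<kappa> * (S1 + 1)\<^sup>2 + 1" for x
  proof -
    have xx: "x \<bullet> x = (norm x)\<^sup>2" by (simp add: power2_norm_eq_inner)
    have 1: "\<kappa> * (norm x)\<^sup>2 \<ge> 0" "g1 (x \<bullet> x) \<ge> 0" "lam * g2 (x \<bullet> x) \<ge> 0" using \<kappa> g1 g2 lam by auto
    then show "G x \<ge> \<kappa> * (norm x)\<^sup>2" "G x \<ge> 0" unfolding G_def xx by linarith+
    show "G x \<ge> 1" if "\<tau> \<le> norm x"
    proof -
      have "\<tau>\<^sup>2 \<le> (norm x)\<^sup>2" using that st by (intro power_mono) auto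
      then show ?thesis using 1 g1(3)[of "(norm x)\<^sup>2"] unfolding G_def xx by linarith
    qed
    show "G x \<ge> lam" if "S1 + 2 \<le> norm x"
    proof -
      have "(S1 + 2)\<^sup>2 \<le> (norm x)\<^sup>2" using that S1 by (intro power_mono) auto
      then show ?thesis using 1 g2(3)[of "(norm x)\<^sup>2"] unfolding G_def xx by simp
    qed
    show "G x = \<kappa> * (norm x)\<^sup>2" if "norm x \<le> \<sigma>"
    proof -
      have "(norm x)\<^sup>2 \<le> \<sigma>\<^sup>2" using that by (intro power_mono) auto
      moreover have "(norm x)\<^sup>2 \<le> (S1 + 1)\<^sup>2" using that st S1 by (intro power_mono) auto
      ultimately show ?thesis using g1(2) g2(2) unfolding G_def xx by simp
    qed
    show "G x \<le> \<kappa> * (S1 + 1)\<^sup>2 + 1" if "norm x \<le> S1 + 1"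
    proof -
      have "(norm x)\<^sup>2 \<le> (S1 + 1)\<^sup>2" using that by (intro power_mono) auto
      then show ?thesis using g1(5)[of "(norm x)\<^sup>2"] g2(2) \<kappa> unfolding G_def xx by (simp add: add_mono)
    qed
  qed
  \<comment> \<open>The polygon error: at most \<sigma> - s, so that polygons from the inner ball
    avoid the support of \<open>g1\<close>; at most r / 4, so that they end within r / 2; at most 1,
    so that they stay within \<open>S1 + 1\<close> and M.\<close>
  define \<epsilon> where "\<epsilon> = min 1 (min (r / 4) ((\<rho> - s) / 3))"
  have "\<epsilon> \<le> (\<rho> - s) / 3" unfolding \<epsilon>_def by (intro min.coboundedI2 order_refl)
  then have \<epsilon>: "\<epsilon> > 0" "\<epsilon> \<le> 1" "\<epsilon> \<le> r / 4" "\<epsilon> \<le> \<sigma> - s" using r by (auto simp: \<epsilon>_def \<sigma>_def)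
  obtain h1 where h1: "h1 > 0" "\<And>h x j. 0 < h \<Longrightarrow> h < h1 \<Longrightarrow> ode_sol F x \<Longrightarrow> norm (x 0) \<le> R2 + 1 \<Longrightarrow> real j * h \<le> T \<Longrightarrow>
     norm (euler F h j (x 0) - x (real j * h)) \<le> \<epsilon>"
    using euler_uniform[OF F, of "R2 + 1" S2 \<epsilon> T] S2(3) \<epsilon> T by blast
  obtain C h2 where h2: "C > 0" "h2 > 0" "\<And>h N x. 0 < h \<Longrightarrow> h < h2 \<Longrightarrow> real N * h = T \<Longrightarrow> (\<And>j. j \<le> N \<Longrightarrow> norm (euler F h j x) \<le> M) \<Longrightarrow>
    frechet_derivative (\<lambda>x. \<Sum>j<N. h * G (euler F h j x)) (at x) (F x) \<le> G (euler F h N x) - G x + C * h"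
    using euler_sum_derivative[OF F smG T(4), of M] by blast
  \<comment> \<open>The derivative of W along F is at most G(end) - G(start) + C h. Here G(start) >=
    \<kappa> r^2 and G(end) <= \<kappa> r^2 / 4, so an error of at most \<kappa> r^2 / 2 leaves it
    negative.\<close>
  define h3 where "h3 = min h1 (min h2 (\<kappa> * r\<^sup>2 / (2 * C)))"
  have h3: "h3 > 0" using h1 h2 \<kappa> r by (simp add: h3_def)
  obtain N :: nat where N: "real N > T / h3" using reals_Archimedean2 by blast
  define h where "h = T / real N"
  have N0: "real N > 0" using N T h3 by (meson divide_pos_pos less_trans)
  have h: "h > 0" "h < h3" "real N * h = T" using N N0 T h3 by (auto simp: h_def field_simps)
  then have hh: "h < h1" "h < h2" "C * h \<le> \<kappa> * r\<^sup>2 / 2" using h2 by (auto simp: h3_def field_simps)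
  define W where "W x = (\<Sum>j<N. h * G (euler F h j x))" for x
  have smW: "smooth W"
    unfolding W_def[abs_def] by (intro smooth_sum smooth_mult smooth_const smooth_compose[OF smG] smooth_euler[OF F])
  have jT: "real j * h \<le> T" if "j \<le> N" for j using that h by (metis mult_right_mono of_nat_le_iff less_imp_le)
  have near: "\<exists>x. ode_sol F x \<and> x 0 = p \<and> (\<forall>j\<le>N. norm (euler F h j p - x (real j * h)) \<le> \<epsilon>)"
    if "norm p \<le> R2 + 1" for p
    using ex[of p] h1(2)[OF h(1) hh(1)] jT that by metis
  have inM: "norm (euler F h j p) \<le> M" if pj: "norm p \<le> R2 + 1" "j \<le> N" for p j
  proof -
    obtain x where x: "ode_sol F x" "x 0 = p" "\<forall>j\<le>N. norm (euler F h j p - x (real j * h)) \<le> \<epsilon>" using near pj by blast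
    have "norm (x (real j * h)) \<le> S2" using S2(3)[OF x(1)] x(2) that h by simp
    then show ?thesis using x(3) that(2) norm_triangle_sub[of "euler F h j p" "x (real j * h)"] \<epsilon> by (fastforce simp: M_def)
  qed
  have speed: "norm p - real j * h * B \<le> norm (euler F h j p)" if "norm p \<le> R2 + 1" "j \<le> N" for p j
  proof -
    have "norm (euler F h j p - p) \<le> real j * h * B"
      using inM that h B by (intro euler_speed) auto
    then show ?thesis using norm_triangle_sub[of p "euler F h j p"] by (simp add: norm_minus_commute)
  qed
  have R: "R1 \<le> R2 + 1" "\<rho> \<le> R2 + 1" "r \<le> R2 + 1" using S1 r by (auto simp: R2_def)
  have W1: "W p \<le> t1 / 4" if p: "norm p \<le> r" for p
  proof -
    obtain x where x: "ode_sol F x" "x 0 = p" "\<forall>j\<le>N. norm (euler F h j p - x (real j * h)) \<le> \<epsilon>" using near[OF order_trans[OF p R(3)]] by blast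
    have "G (euler F h j p) \<le> \<kappa> * \<sigma>\<^sup>2" if "j \<in> {..<N}" for j
    proof -
      have "norm (x (real j * h)) \<le> s" using s[OF x(1)] x(2) p h by simp
      moreover have "norm (euler F h j p - x (real j * h)) \<le> \<epsilon>" using x(3) that by simp
      ultimately have n: "norm (euler F h j p) \<le> \<sigma>"
        using norm_triangle_sub[of "euler F h j p" "x (real j * h)"] \<epsilon>(4) by linarith
      then have "(norm (euler F h j p))\<^sup>2 \<le> \<sigma>\<^sup>2" by (intro power_mono) auto
      then show ?thesis using Gn(5)[OF n] \<kappa> by simp
    qed
    then have "W p \<le> (\<Sum>j<N. h * (\<kappa> * \<sigma>\<^sup>2))" unfolding W_def using h by (intro sum_mono mult_left_mono) auto
    also have "\<dots> = T * (\<kappa> * \<sigma>\<^sup>2)" using h(3) by simp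
    finally show ?thesis using \<kappa>1 by linarith
  qed
  have W2: "t1 \<le> W p \<and> W p \<le> T + 1" if p: "\<rho> \<le> norm p" "norm p \<le> R1" for p
  proof
    have "1 * t1 \<le> W p"
      unfolding W_def
    proof (rule sum_time_lower_bound[OF h(1) h(3) t1 T(3)])
      fix j assume j: "j < N" "real j * h \<le> t1"
      have "real j * h * B \<le> t1 * B" using j B by (intro mult_right_mono) auto
      then have "real j * h * B \<le> \<rho> - \<tau>" using B by (simp add: t1_def)
      then have "\<tau> \<le> norm (euler F h j p)" using speed[of p j] j p R by linarith
      then show "1 \<le> G (euler F h j p)" by (rule Gn(3))
    qed (use Gn in auto)
    then show "t1 \<le> W p" by simp
    obtain x where x: "ode_sol F x" "x 0 = p" "\<forall>j\<le>N. norm (euler F h j p - x (real j * h)) \<le> \<epsilon>" using near[OF order_trans[OF p(2) R(1)]] by blast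
    have "G (euler F h j p) \<le> \<kappa> * (S1 + 1)\<^sup>2 + 1" if "j \<in> {..<N}" for j
    proof (rule Gn(6))
      have "norm (x (real j * h)) \<le> S1" using S1(4)[OF x(1)] x(2) p h by simp
      moreover have "norm (euler F h j p - x (real j * h)) \<le> \<epsilon>" using x(3) that by simp
      ultimately show "norm (euler F h j p) \<le> S1 + 1"
        using norm_triangle_sub[of "euler F h j p" "x (real j * h)"] \<epsilon>(2) by linarith
    qed
    then have "W p \<le> (\<Sum>j<N. h * (\<kappa> * (S1 + 1)\<^sup>2 + 1))" unfolding W_def using h by (intro sum_mono mult_left_mono) auto
    also have "\<dots> = T * (\<kappa> * (S1 + 1)\<^sup>2 + 1)" using h(3) by simp
    also have "\<dots> \<le> T + 1" using \<kappa>2 by (simp add: algebra_simps)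
    finally show "W p \<le> T + 1" .
  qed
  have W3: "T + 2 \<le> W p" if p: "R2 \<le> norm p" "norm p \<le> R2 + 1" for p
  proof -
    have "lam * (1 / B) \<le> W p"
      unfolding W_def
    proof (rule sum_time_lower_bound[OF h(1) h(3)])
      have "1 / B \<le> 1" using B by simp
      then show "1 / B \<le> T" using T by linarith
      fix j assume j: "j < N" "real j * h \<le> 1 / B"
      have "real j * h * B \<le> 1 / B * B" using j B by (intro mult_right_mono) auto
      then have "real j * h * B \<le> 1" using B by simp
      then have "S1 + 2 \<le> norm (euler F h j p)" using speed[of p j] j p by (simp add: R2_def)
      then show "lam \<le> G (euler F h j p)" by (rule Gn(4))
    qed (use Gn B lam in auto)
    then show ?thesis using B by (simp add: lam_def)
  qed
  have W4: "frechet_derivative W (at p) (F p) < 0" if p: "r \<le> norm p" "norm p \<le> R2 + 1" for p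
  proof -
    obtain x where x: "ode_sol F x" "x 0 = p" "\<forall>j\<le>N. norm (euler F h j p - x (real j * h)) \<le> \<epsilon>" using near[OF p(2)] by blast
    have "norm (x T) < r / 4" using S2(4)[OF x(1)] x(2) p T by simp
    moreover have "norm (euler F h N p - x T) \<le> \<epsilon>" using x(3) h(3) by auto
    ultimately have n: "norm (euler F h N p) \<le> r / 2"
      using norm_triangle_sub[of "euler F h N p" "x T"] \<epsilon>(3) by linarith
    have "norm (euler F h N p) \<le> \<sigma>" using n r st by linarith
    then have "G (euler F h N p) = \<kappa> * (norm (euler F h N p))\<^sup>2" by (rule Gn(5))
    also have "\<dots> \<le> \<kappa> * (r / 2)\<^sup>2" using n \<kappa> by (intro mult_left_mono power_mono) auto
    finally have 1: "G (euler F h N p) \<le> \<kappa> * r\<^sup>2 / 4" by (simp add: power_divide)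
    have "\<kappa> * r\<^sup>2 \<le> \<kappa> * (norm p)\<^sup>2" using p r \<kappa> by (intro mult_left_mono power_mono) auto
    then have 2: "\<kappa> * r\<^sup>2 \<le> G p" using Gn(1)[of p] by linarith
    have "frechet_derivative W (at p) (F p) \<le> G (euler F h N p) - G p + C * h"
      unfolding W_def[abs_def] using h hh inM p by (intro h2(3)) auto
    moreover have "\<kappa> * r\<^sup>2 > 0" using \<kappa> r by simp
    ultimately show ?thesis using 1 2 hh(3) by linarith
  qed
  \<comment> \<open>The thresholds separate the regions: W <= t1 / 4 on the inner ball, t1 <= W <= T
    + 1 on the annulus, and W >= T + 2 on the shell between R2 and R2 + 1.\<close>
  have "t1 / 2 < T + 2" using T t1 by linarith
  then obtain q q' :: "real \<Rightarrow> real" where q: "smooth q" "\<And>x. (q has_real_derivative q' x) (at x)"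
    "\<And>x. x \<le> t1 / 2 \<Longrightarrow> q x = 0" "\<And>x. x \<ge> T + 2 \<Longrightarrow> q x = 1" "\<And>x. x \<le> t1 / 2 \<Longrightarrow> q' x = 0" "\<And>x. q' x \<ge> 0"
    "\<And>x. t1 / 2 < x \<Longrightarrow> x < T + 2 \<Longrightarrow> q' x > 0" "\<And>x. x > t1 / 2 \<Longrightarrow> q x > 0" "\<And>x. 0 \<le> q x"
    by (rule smooth_transition_exists) blast
  \<comment> \<open>On the shell between R2 and R2 + 1 both branches equal 1. This overlap makes Q
    smooth and constant outside radius R2, although W is controlled only up to R2 + 1.\<close>
  define Q where "Q x = (if norm x < R2 + 1 then q (W x) else 1)" for x
  have smqW: "smooth (\<lambda>x. q (W x))" by (rule smooth_compose[OF q(1) smW])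
  have Qin: "Q x = q (W x)" if "norm x < R2 + 1" for x using that by (simp add: Q_def)
  have Qout: "Q x = 1" if "norm x > R2" for x using that W3[of x] q(4) by (simp add: Q_def)
  have smQ: "smooth Q"
  proof (rule smooth_local)
    fix x
    show "\<exists>U g. open U \<and> x \<in> U \<and> smooth g \<and> (\<forall>y\<in>U. Q y = g y)"
    proof (cases "norm x < R2 + 1")
      case True
      then show ?thesis using Qin smqW
        by (intro exI[of _ "{x. norm x < R2 + 1}"] exI[of _ "\<lambda>x. q (W x)"])
           (auto intro!: open_Collect_less continuous_intros)
    next
      case False
      then show ?thesis using Qout
        by (intro exI[of _ "{x. R2 < norm x}"] exI[of _ "\<lambda>x. 1"])
           (auto intro!: open_Collect_less continuous_intros smooth_const)
    qed
  qed
  have dQ_in: "frechet_derivative Q (at x) v = q' (W x) * frechet_derivative W (at x) v" if x: "norm x < R2 + 1" for x v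
  proof -
    have "((q \<circ> W) has_derivative ((*) (q' (W x)) \<circ> frechet_derivative W (at x))) (at x)"
      using q(2)[of "W x"] by (intro diff_chain_at[OF smooth_frechet[OF smW]]) (simp add: has_field_derivative_def)
    then have "(Q has_derivative ((*) (q' (W x)) \<circ> frechet_derivative W (at x))) (at x)"
      by (rule has_derivative_transform_within_open[where s = "{x. norm x < R2 + 1}"])
         (use x Qin in \<open>auto intro!: open_Collect_less continuous_intros\<close>)
    from fun_cong[OF frechet_derivative_at[OF this, symmetric], of v] show ?thesis by simp
  qed
  have dQ_out: "frechet_derivative Q (at x) v = 0" if x: "norm x > R2" for x v
  proof -
    have "((\<lambda>x. 1) has_derivative (\<lambda>v. 0)) (at x)" by simp
    then have "(Q has_derivative (\<lambda>v. 0)) (at x)"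
      by (rule has_derivative_transform_within_open[where s = "{x. R2 < norm x}"])
         (use x Qout in \<open>auto intro!: open_Collect_less continuous_intros\<close>)
    from fun_cong[OF frechet_derivative_at[OF this, symmetric], of v] show ?thesis by simp
  qed
  show ?thesis
  proof (rule exI[of _ Q], rule exI[of _ R2], intro conjI allI impI smQ)
    show "0 \<le> Q x" for x using q(9) by (simp add: Q_def)
    show "Q x = 0" if "norm x \<le> r" for x
      using W1[OF that] q(3) t1 Qin[of x] that R(3) S1 r by (simp add: R2_def)
    show "Q x = 1" if "norm x > R2" for x using Qout that by blast
    show "frechet_derivative Q (at x) (F x) \<le> 0" for x
    proof (cases "norm x < R2 + 1")
      case True
      show ?thesis
      proof (cases "norm x \<le> r")
        case False
        then show ?thesis using dQ_in[OF True] W4[of x] True q(6) by (simp add: mult_nonneg_nonpos)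
      next
        case small: True
        show ?thesis using dQ_in[OF True] W1[OF small] q(5) t1 by simp
      qed
    qed (use dQ_out in auto)
    fix x :: 'a assume x: "\<rho> \<le> norm x \<and> norm x \<le> R1"
    have xR: "norm x < R2 + 1" using x S1 by (simp add: R2_def)
    have w: "t1 / 2 < W x" "W x < T + 2" using W2[of x] x t1 by auto
    show "0 < Q x" using Qin[OF xR] q(8) w by simp
    show "frechet_derivative Q (at x) (F x) < 0"
      using dQ_in[OF xR] W4[of x] q(7)[OF w] x xR r by (simp add: mult_pos_neg)
  qed
qed

text \<open>The weighted series of the \<open>Q n\<close> decreases strictly at every nonzero point,
  because the annuli exhaust the punctured space, but its weights may keep it bounded. Radial
  unboundedness comes from a second family \<open>P n\<close> that vanishes on growing balls and
  equals 1 far out: its unweighted sum is locally finite and does not increase along F.\<close>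

theorem converse_Lyapunov:
  fixes F :: "'a::euclidean_space \<Rightarrow> 'a"
  assumes F: "smooth F" and gas: "GAS F"
  shows "\<exists>V :: 'a \<Rightarrow> real. smooth V \<and> V 0 = 0 \<and> (\<forall>x. x \<noteq> 0 \<longrightarrow> V x > 0) \<and> (\<forall>c::real. \<exists>R. \<forall>x. V x \<le> c \<longrightarrow> norm x \<le> R) \<and>
    (\<forall>x. x \<noteq> 0 \<longrightarrow> frechet_derivative V (at x) (F x) < 0)"
proof -
  have "\<exists>(Q :: 'a \<Rightarrow> real) R. smooth Q \<and> (\<forall>x. 0 \<le> Q x) \<and> Q 0 = (0::real) \<and> (\<forall>x. norm x > R \<longrightarrow> Q x = 1) \<and>
    (\<forall>x. frechet_derivative Q (at x) (F x) \<le> 0) \<and>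
    (\<forall>x. 1 / (real n + 1) \<le> norm x \<and> norm x \<le> real n + 1 \<longrightarrow> 0 < Q x \<and> frechet_derivative Q (at x) (F x) < 0)" for n :: nat
  proof -
    define \<rho> where "\<rho> = 1 / (real n + 1)"
    have \<rho>: "\<rho> > 0" by (simp add: \<rho>_def)
    then obtain d where d: "d > 0" "\<And>x t. ode_sol F x \<Longrightarrow> norm (x 0) < d \<Longrightarrow> t \<ge> 0 \<Longrightarrow> norm (x t) < \<rho> / 2"
      using gas unfolding GAS_def by (meson half_gt_zero)
    define r where "r = min (d / 2) (\<rho> / 2)"
    have r: "0 < r" "r \<le> \<rho> / 2" "\<rho> / 2 < \<rho>" "r < d" using d \<rho> by (auto simp: r_def)
    have s: "\<forall>x t. ode_sol F x \<and> norm (x 0) \<le> r \<and> t \<ge> 0 \<longrightarrow> norm (x t) \<le> \<rho> / 2"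
      using d(2) r by (meson le_less_trans less_imp_le)
    obtain Q :: "'a \<Rightarrow> real" and R where Q: "smooth Q" "\<forall>x. 0 \<le> Q x" "\<forall>x. norm x \<le> r \<longrightarrow> Q x = 0" "\<forall>x. norm x > R \<longrightarrow> Q x = 1"
      "\<forall>x. frechet_derivative Q (at x) (F x) \<le> 0"
      "\<forall>x. \<rho> \<le> norm x \<and> norm x \<le> real n + 1 \<longrightarrow> 0 < Q x \<and> frechet_derivative Q (at x) (F x) < 0"
      using Lyapunov_stage[OF F gas r(1,2,3) s, of "real n + 1"] by blast
    have "Q 0 = 0" using Q(3) r by simp
    with Q show ?thesis unfolding \<rho>_def by blast
  qed
  then obtain Q R where Q: "\<And>n. smooth (Q n)" "\<And>n x. 0 \<le> Q n x" "\<And>n. Q n 0 = (0::real)" "\<And>n x. norm x > R n \<Longrightarrow> Q n x = 1"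
    "\<And>n x. frechet_derivative (Q n) (at x) (F x) \<le> 0"
    "\<And>n x. 1 / (real n + 1) \<le> norm x \<Longrightarrow> norm x \<le> real n + 1 \<Longrightarrow> 0 < Q n x \<and> frechet_derivative (Q n) (at x) (F x) < 0"
    by metis
  have "\<exists>(P :: 'a \<Rightarrow> real) R. smooth P \<and> (\<forall>x. 0 \<le> P x) \<and> (\<forall>x. norm x \<le> real n + 1 \<longrightarrow> P x = (0::real)) \<and> (\<forall>x. norm x > R \<longrightarrow> P x = 1) \<and>
    (\<forall>x. frechet_derivative P (at x) (F x) \<le> 0)" for n :: nat
  proof -
    obtain T S where S: "\<And>x t. ode_sol F x \<Longrightarrow> norm (x 0) \<le> real n + 1 \<Longrightarrow> t \<ge> 0 \<Longrightarrow> norm (x t) \<le> S"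
      using flow_uniform[OF F gas zero_less_one, of "real n + 1"] by blast
    define s where "s = max S (real n + 1)"
    have s: "\<forall>x t. ode_sol F x \<and> norm (x 0) \<le> real n + 1 \<and> t \<ge> 0 \<longrightarrow> norm (x t) \<le> s"
      using S by (auto simp: s_def le_max_iff_disj)
    have "0 < real n + 1" "real n + 1 \<le> s" "s < s + 1" by (auto simp: s_def)
    \<comment> \<open>For \<open>P n\<close> only the sign, the zero set and the value 1 at infinity
      are wanted, so the annulus is left empty by taking 0 as its outer radius.\<close>
    from Lyapunov_stage[OF F gas this s, of 0] show ?thesis by blast
  qed
  then obtain P R' where P: "\<And>n. smooth (P n)" "\<And>n x. 0 \<le> P n x" "\<And>n x. norm x \<le> real n + 1 \<Longrightarrow> P n x = (0::real)"
    "\<And>n x. norm x > R' n \<Longrightarrow> P n x = 1" "\<And>n x. frechet_derivative (P n) (at x) (F x) \<le> 0"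
    by metis
  obtain c Vin where Vin: "\<And>n. c n > 0" "smooth Vin" "\<And>x. (\<lambda>n. c n * Q n x) sums Vin x"
    "\<And>x v. (\<lambda>n. c n * frechet_derivative (Q n) (at x) v) sums frechet_derivative Vin (at x) v"
    by (rule smooth_weighted_series[of Q]) (use Q(1,4) in blast)+
  define Vout where "Vout x = (\<Sum>n<nat \<lceil>norm x\<rceil>. P n x)" for x
  have Vout: "Vout x = (\<Sum>n<N. P n x)" if "norm x < real N" for x N
  proof -
    have "P n x = 0" if "n \<ge> nat \<lceil>norm x\<rceil>" for n
    proof (rule P(3))
      have "norm x \<le> real n" using that by linarith
      then show "norm x \<le> real n + 1" by simp
    qed
    note zero = this
    have "nat \<lceil>norm x\<rceil> \<le> N" using that by linarith
    then show ?thesis unfolding Vout_def by (intro sum.mono_neutral_left) (use zero in auto)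
  qed
  have smN: "smooth (\<lambda>x. \<Sum>n<N. P n x)" for N by (rule smooth_sum) (rule P(1))
  have opn: "open {x::'a. norm x < real N}" for N by (intro open_Collect_less continuous_intros)
  have smVout: "smooth Vout"
  proof (rule smooth_local)
    fix x :: 'a
    obtain N where "norm x < real N" using reals_Archimedean2 by blast
    then show "\<exists>U g. open U \<and> x \<in> U \<and> smooth g \<and> (\<forall>y\<in>U. Vout y = g y)"
      using Vout smN[of N] opn[of N]
      by (intro exI[of _ "{x. norm x < real N}"] exI[of _ "\<lambda>x. \<Sum>n<N. P n x"]) auto
  qed
  have dVout: "frechet_derivative Vout (at x) (F x) \<le> 0" for x
  proof -
    obtain N where N: "norm x < real N" using reals_Archimedean2 by blast
    have "((\<lambda>x. \<Sum>n<N. P n x) has_derivative (\<lambda>v. \<Sum>n<N. frechet_derivative (P n) (at x) v)) (at x)"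
      by (intro has_derivative_sum smooth_frechet[OF P(1)])
    then have "(Vout has_derivative (\<lambda>v. \<Sum>n<N. frechet_derivative (P n) (at x) v)) (at x)"
      by (rule has_derivative_transform_within_open[where s = "{x. norm x < real N}"]) (use N Vout opn in auto)
    from fun_cong[OF frechet_derivative_at[OF this, symmetric], of "F x"]
    show ?thesis using P(5) by (simp add: sum_nonpos)
  qed
  define V where "V x = Vin x + Vout x" for x
  have smV: "smooth V" unfolding V_def[abs_def] by (rule smooth_add[OF Vin(2) smVout])
  have Vin_nonneg: "Vin x \<ge> 0" for x
    using sums_unique[OF Vin(3)[of x]] suminf_nonneg[OF sums_summable[OF Vin(3)[of x]]] Vin(1) Q(2)
    by (simp add: less_imp_le)
  have Vout_nonneg: "Vout x \<ge> 0" for x unfolding Vout_def by (intro sum_nonneg P(2))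
  have hit: "\<exists>n. 1 / (real n + 1) \<le> norm x \<and> norm x \<le> real n + 1" if "x \<noteq> 0" for x :: 'a
  proof -
    obtain n where n: "real n > max (norm x) (1 / norm x)" using reals_Archimedean2 by blast
    have "1 / norm x \<le> real n + 1" using n by simp
    then have "1 / (real n + 1) \<le> norm x" using that by (simp add: field_simps)
    with n show ?thesis by (intro exI[of _ n]) auto
  qed
  have "V 0 = 0"
    using sums_unique[OF Vin(3)[of 0]] Q(3) by (simp add: V_def Vout_def)
  moreover have "V x > 0" if x: "x \<noteq> 0" for x
  proof -
    obtain n where n: "1 / (real n + 1) \<le> norm x \<and> norm x \<le> real n + 1" using hit[OF x] by blast
    have "0 < suminf (\<lambda>n. c n * Q n x)"
      using sums_summable[OF Vin(3)[of x]] Vin(1) Q(2) Q(6)[of n x] n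
      by (subst suminf_pos_iff) (auto intro!: exI[of _ n] simp: less_imp_le)
    then have "Vin x > 0" using sums_unique[OF Vin(3)[of x]] by simp
    then show ?thesis using Vout_nonneg[of x] by (simp add: V_def)
  qed
  moreover have "\<exists>R. \<forall>x. V x \<le> c \<longrightarrow> norm x \<le> R" for c
  proof -
    obtain N :: nat where N: "real N > c" using reals_Archimedean2 by blast
    define R0 where "R0 = real N + (\<Sum>n<N. \<bar>R' n\<bar>)"
    have "V x > c" if x: "norm x > R0" for x
    proof -
      obtain M where M: "norm x < real M" using reals_Archimedean2 by blast
      have "(\<Sum>n<N. \<bar>R' n\<bar>) \<ge> 0" by (intro sum_nonneg) auto
      then have "real N < real M" using M x unfolding R0_def by linarith
      then have NM: "N \<le> M" by linarith
      have "P n x = 1" if "n \<in> {..<N}" for n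
      proof (rule P(4))
        have "\<bar>R' n\<bar> \<le> (\<Sum>n<N. \<bar>R' n\<bar>)" using that by (intro member_le_sum) auto
        then show "R' n < norm x" using x of_nat_0_le_iff[of N] unfolding R0_def by linarith
      qed
      then have "real N = (\<Sum>n<N. P n x)" by simp
      also have "\<dots> \<le> (\<Sum>n<M. P n x)" using NM P(2) by (intro sum_mono2) auto
      finally have "real N \<le> Vout x" using Vout[OF M] by simp
      then show ?thesis using N Vin_nonneg[of x] by (simp add: V_def)
    qed
    then show ?thesis by (meson not_less)
  qed
  moreover have "frechet_derivative V (at x) (F x) < 0" if x: "x \<noteq> 0" for x
  proof -
    obtain n where n: "1 / (real n + 1) \<le> norm x \<and> norm x \<le> real n + 1" using hit[OF x] by blast
    have sm: "(\<lambda>n. - (c n * frechet_derivative (Q n) (at x) (F x))) sums - frechet_derivative Vin (at x) (F x)"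
      by (rule sums_minus[OF Vin(4)])
    have nn: "0 \<le> - (c n * frechet_derivative (Q n) (at x) (F x))" for n
      using Q(5)[of n x] Vin(1)[of n] by (simp add: mult_nonneg_nonpos)
    have "0 < - (c n * frechet_derivative (Q n) (at x) (F x))"
      using Q(6)[of n x] n Vin(1)[of n] by (simp add: mult_pos_neg)
    then have "0 < suminf (\<lambda>n. - (c n * frechet_derivative (Q n) (at x) (F x)))"
      using suminf_pos_iff[OF sums_summable[OF sm] nn] by blast
    then have "frechet_derivative Vin (at x) (F x) < 0" using sums_unique[OF sm] by simp
    moreover have "(V has_derivative (\<lambda>v. frechet_derivative Vin (at x) v + frechet_derivative Vout (at x) v)) (at x)"
      unfolding V_def[abs_def] by (intro has_derivative_add smooth_frechet Vin(2) smVout)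
    ultimately show ?thesis
      using fun_cong[OF frechet_derivative_at, of V "\<lambda>v. frechet_derivative Vin (at x) v + frechet_derivative Vout (at x) v" x "F x"] dVout[of x]
      by simp
  qed
  ultimately show ?thesis using smV by blast
qed

lemma compact_positive_lower_bound:
  fixes w :: "'a::euclidean_space \<Rightarrow> real"
  assumes "compact S" "continuous_on S w" "\<And>x. x \<in> S \<Longrightarrow> w x > 0"
  shows "\<exists>\<alpha>>0. \<forall>x\<in>S. \<alpha> \<le> w x"
proof (cases "S = {}")
  case True
  then show ?thesis by (intro exI[of _ 1]) auto
next
  case False
  then show ?thesis using continuous_attains_inf[OF assms(1) False assms(2)] assms(3) by blast
qed

lemma compact_sublevel:
  fixes V :: "'a::euclidean_space \<Rightarrow> real"
  assumes "continuous_on UNIV V" "\<forall>c. \<exists>R. \<forall>x. V x \<le> c \<longrightarrow> norm x \<le> R"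
  shows "compact {x. V x \<le> c}" "compact {x. a \<le> V x \<and> V x \<le> c}"
proof -
  obtain R where "\<forall>x. V x \<le> c \<longrightarrow> norm x \<le> R" using assms(2) by blast
  then have b: "bounded {x. V x \<le> c}" by (auto simp: bounded_iff)
  have "closed {x. V x \<le> c}" by (intro closed_Collect_le assms continuous_on_const)
  with b show "compact {x. V x \<le> c}" by (simp add: compact_eq_bounded_closed)
  have "closed {x. a \<le> V x \<and> V x \<le> c}"
    by (intro closed_Collect_conj closed_Collect_le assms continuous_on_const)
  moreover have "bounded {x. a \<le> V x \<and> V x \<le> c}" by (rule bounded_subset[OF b]) auto
  ultimately show "compact {x. a \<le> V x \<and> V x \<le> c}" by (simp add: compact_eq_bounded_closed)
qed

text \<open>V is \<open>exp (q (V0 x)) - exp (q 0)\<close>. Where V0 >= 1, q' exceeds the reciprocal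
  of the decay rate of V0, so V decreases at least at the rate
  \<open>exp (q (V0 x)) = V x + exp (q 0)\<close>. Where V0 < 1, V is below the constant c and the
  derivative is at most 0. Growth follows from K <= q <= exp q on each slab.\<close>

lemma Lyapunov_dominating:
  fixes F :: "'a::euclidean_space \<Rightarrow> 'a" and K :: "real \<Rightarrow> real"
  assumes F: "smooth F" and gas: "GAS F" and K: "mono_on {0..} K"
  shows "\<exists>(V :: 'a \<Rightarrow> real) c. smooth V \<and> (\<forall>x. V x \<ge> 0) \<and> pos_def V \<and> rad_unbdd V \<and>
    (\<forall>x. x \<noteq> 0 \<longrightarrow> frechet_derivative V (at x) (F x) < 0) \<and>
    (\<forall>x. frechet_derivative V (at x) (F x) \<le> c - V x) \<and> (\<forall>x. K (norm x) \<le> V x + c)"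
proof -
  obtain V0 :: "'a \<Rightarrow> real" where V0: "smooth V0" "V0 0 = 0" "\<And>x. x \<noteq> 0 \<Longrightarrow> V0 x > 0"
    "\<forall>c::real. \<exists>R. \<forall>x. V0 x \<le> c \<longrightarrow> norm x \<le> R" "\<And>x. x \<noteq> 0 \<Longrightarrow> frechet_derivative V0 (at x) (F x) < 0"
    using converse_Lyapunov[OF F gas] by blast
  have cV0: "continuous_on UNIV V0" by (rule smooth_continuous[OF V0(1)])
  define w where "w x = - frechet_derivative V0 (at x) (F x)" for x
  have w: "continuous_on UNIV w"
    unfolding w_def[abs_def] by (intro continuous_intros smooth_continuous smooth_Lie V0 F)
  have V0n: "V0 x \<ge> 0" for x using V0(2,3) by (cases "x = 0") (auto intro: less_imp_le)
  \<comment> \<open>The slab k = 0 is exempt: it contains the origin, where the decay rate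
    vanishes.\<close>
  have "\<exists>\<alpha>>0. \<forall>x. real k \<le> V0 x \<and> V0 x \<le> real k + 1 \<and> k > 0 \<longrightarrow> \<alpha> \<le> w x" for k
  proof (cases "k = 0")
    case False
    have "x \<noteq> 0" if "real k \<le> V0 x" for x using that V0(2) False by auto
    then have "\<exists>\<alpha>>0. \<forall>x\<in>{x. real k \<le> V0 x \<and> V0 x \<le> real k + 1}. \<alpha> \<le> w x"
      using V0(5) by (intro compact_positive_lower_bound compact_sublevel(2)[OF cV0 V0(4)] continuous_on_subset[OF w]) (auto simp: w_def)
    then show ?thesis by auto
  qed (auto intro: exI[of _ 1])
  then obtain \<alpha> where \<alpha>: "\<And>k. \<alpha> k > 0" "\<And>k x. real k \<le> V0 x \<Longrightarrow> V0 x \<le> real k + 1 \<Longrightarrow> k > 0 \<Longrightarrow> \<alpha> k \<le> w x" by metis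
  obtain R where R: "\<And>c x. V0 x \<le> c \<Longrightarrow> norm x \<le> R c" using V0(4) by metis
  \<comment> \<open>The first entry is used through q', to normalise the decay on the slab; the
    second through q, to dominate K on the ball that contains the slab.\<close>
  define m where "m k = max (1 / \<alpha> k) (K (\<bar>R (real k + 1)\<bar>))" for k
  obtain q q' where q: "smooth q" "\<And>x. (q has_real_derivative q' x) (at x)"
    "\<And>x. q' x \<ge> 1" "\<And>k x. real k \<le> x \<Longrightarrow> m k \<le> q x" "\<And>k x. real k \<le> x \<Longrightarrow> m k \<le> q' x"
    by (rule smooth_dominating_exists[of m]) blast
  have q_strict: "q x < q y" if "x < y" for x y
    by (rule DERIV_pos_imp_increasing[OF that]) (meson q(2,3) less_le_trans zero_less_one)
  have q_mono: "q x \<le> q y" if "x \<le> y" for x y using q_strict[of x y] that by (cases "x = y") auto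
  define V where "V x = exp (q (V0 x)) - exp (q 0)" for x
  have smV: "smooth V"
    unfolding V_def[abs_def] by (intro smooth_diff smooth_const smooth_compose[OF smooth_exp] smooth_compose[OF q(1)] V0(1))
  have dV: "frechet_derivative V (at x) (F x) = - (exp (q (V0 x)) * q' (V0 x) * w x)" for x
  proof -
    have "((\<lambda>s. exp (q s) - exp (q 0)) has_real_derivative exp (q (V0 x)) * q' (V0 x)) (at (V0 x))"
      by (auto intro!: derivative_eq_intros q(2))
    then have "(((\<lambda>s. exp (q s) - exp (q 0)) \<circ> V0) has_derivative ((*) (exp (q (V0 x)) * q' (V0 x)) \<circ> frechet_derivative V0 (at x))) (at x)"
      by (intro diff_chain_at[OF smooth_frechet[OF V0(1)]]) (simp add: has_field_derivative_def)
    then have "(V has_derivative ((*) (exp (q (V0 x)) * q' (V0 x)) \<circ> frechet_derivative V0 (at x))) (at x)"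
      by (simp add: V_def[abs_def] o_def)
    from fun_cong[OF frechet_derivative_at[OF this, symmetric], of "F x"] show ?thesis by (simp add: w_def)
  qed
  have wn: "w x \<ge> 0" for x
  proof (cases "x = 0")
    case True
    then show ?thesis
    proof -
      \<comment> \<open>\<open>GAS\<close> does not state that 0 is an equilibrium. Stability forces
        a solution that starts at 0 to remain there, so its derivative vanishes.\<close>
      have "F 0 = 0"
      proof -
        obtain x where x: "x 0 = 0" "ode_sol F x" using gas unfolding GAS_def by blast
        have z: "x t = 0" if t: "t \<ge> 0" for t
        proof (rule ccontr)
          assume "x t \<noteq> 0"
          then obtain d where "d > 0" "\<forall>z. ode_sol F z \<and> norm (z 0) < d \<longrightarrow> (\<forall>s\<ge>0. norm (z s) < norm (x t))"
            using gas unfolding GAS_def by (metis zero_less_norm_iff)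
          then show False using x t by fastforce
        qed
        have "at (1::real) within {0..} = at 1" by (rule at_within_interior) simp
        then have "(x has_vector_derivative F (x 1)) (at 1)" using x(2) unfolding ode_sol_def by (metis zero_le_one)
        then have "((\<lambda>t. 0) has_vector_derivative F (x 1)) (at 1)"
          by (rule has_vector_derivative_transform_within_open[where S = "{0<..}"]) (use z in auto)
        then have "F (x 1) = 0" using has_vector_derivative_const vector_derivative_unique_at by blast
        moreover have "x 1 = 0" using z by simp
        ultimately show ?thesis by simp
      qed
      then show ?thesis using True linear_0[OF has_derivative_linear[OF smooth_frechet[OF V0(1)]]] by (simp add: w_def)
    qed
  qed (use V0(5) in \<open>auto simp: w_def intro: less_imp_le\<close>)
  define c where "c = exp (q 1) + exp (q 0)"
  have Vn: "V x \<ge> 0" for x using q_mono[OF V0n] by (simp add: V_def)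
  have pd: "pos_def V" unfolding pos_def_def V_def using V0(2,3) q_strict by auto
  have ru: "rad_unbdd V"
    unfolding rad_unbdd_def
  proof
    fix e
    have "\<exists>R. \<forall>x. V x \<le> e \<longrightarrow> norm x \<le> R" for e
    proof -
      have lin: "q 0 + s \<le> q s" if "s \<ge> 0" for s
      proof -
        have "q 0 - 0 \<le> q s - s"
          using that by (rule DERIV_nonneg_imp_nondecreasing[of 0 s "\<lambda>s. q s - s"])
            (metis DERIV_diff DERIV_ident diff_ge_0_iff_ge q(2) q(3))
        then show ?thesis by simp
      qed
      have "norm x \<le> R (e + exp (q 0) - q 0)" if "V x \<le> e" for x
      proof (rule R)
        have "q 0 + V0 x \<le> exp (q (V0 x))" using lin[OF V0n, of x] exp_ge_add_one_self[of "q (V0 x)"] by linarith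
        then show "V0 x \<le> e + exp (q 0) - q 0" using that by (simp add: V_def)
      qed
      then show ?thesis by blast
    qed
    then show "compact {x. V x \<le> e}" by (intro compact_sublevel(1) smooth_continuous[OF smV]) blast
  qed
  have dec: "frechet_derivative V (at x) (F x) \<le> c - V x" for x
  proof (cases "V0 x \<ge> 1")
    case True
    define k where "k = nat \<lfloor>V0 x\<rfloor>"
    have k: "real k \<le> V0 x" "V0 x \<le> real k + 1" "k > 0" using True unfolding k_def by linarith+
    have "1 / \<alpha> k \<le> q' (V0 x)" using q(5)[OF k(1)] by (simp add: m_def)
    then have "1 / \<alpha> k * \<alpha> k \<le> q' (V0 x) * w x"
      using \<alpha>(1)[of k] \<alpha>(2)[OF k] q(3)[of "V0 x"] by (intro mult_mono) auto
    then have "exp (q (V0 x)) * 1 \<le> exp (q (V0 x)) * (q' (V0 x) * w x)" using \<alpha>(1)[of k] by (intro mult_left_mono) auto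
    moreover have "exp (q 1) > 0" "exp (q 0) > 0" by auto
    ultimately show ?thesis unfolding dV V_def c_def mult.assoc by linarith
  next
    case False
    then have "exp (q (V0 x)) \<le> exp (q 1)" using q_mono by simp
    moreover have "exp (q (V0 x)) * q' (V0 x) * w x \<ge> 0" using wn[of x] q(3)[of "V0 x"] by simp
    moreover have "exp (q 0) > 0" by simp
    ultimately show ?thesis unfolding dV V_def c_def by linarith
  qed
  have dom: "K (norm x) \<le> V x + c" for x
  proof -
    define k where "k = nat \<lfloor>V0 x\<rfloor>"
    have k: "real k \<le> V0 x" "V0 x \<le> real k + 1" using V0n[of x] unfolding k_def by linarith+
    have "norm x \<le> \<bar>R (real k + 1)\<bar>" using R[OF k(2)] by linarith
    then have "K (norm x) \<le> K \<bar>R (real k + 1)\<bar>" using K by (intro mono_onD[OF K]) auto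
    also have "\<dots> \<le> q (V0 x)" using q(4)[OF k(1)] by (simp add: m_def)
    also have "\<dots> \<le> exp (q (V0 x))" using exp_ge_add_one_self[of "q (V0 x)"] by linarith
    also have "\<dots> = V x + exp (q 0)" by (simp add: V_def)
    also have "\<dots> \<le> V x + c" by (simp add: c_def)
    finally show ?thesis .
  qed
  have neg: "frechet_derivative V (at x) (F x) < 0" if "x \<noteq> 0" for x
  proof -
    have "w x > 0" using V0(5)[OF that] by (simp add: w_def)
    moreover have "q' (V0 x) > 0" using q(3)[of "V0 x"] by linarith
    ultimately show ?thesis unfolding dV by simp
  qed
  show ?thesis using smV Vn pd ru neg dec dom by blast
qed

section \<open>Caratheodory solutions\<close>

text \<open>The finite-horizon form of \<open>cara_sol\<close>: a priori bounds must be stated for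
  solutions that are not yet known to be global.\<close>

definition sol_on :: "real \<Rightarrow> (real \<Rightarrow> 'a::euclidean_space \<Rightarrow> 'a) \<Rightarrow> 'a \<Rightarrow> (real \<Rightarrow> 'a) \<Rightarrow> bool" where
  "sol_on T F x0 X \<longleftrightarrow> X 0 = x0 \<and> (\<forall>t\<in>{0..T}. (\<lambda>s. F s (X s)) absolutely_integrable_on {0..t} \<and>
     X t = x0 + integral {0..t} (\<lambda>s. F s (X s)))"

lemma cara_sol_iff: "cara_sol F x0 X \<longleftrightarrow> (\<forall>T\<ge>0. sol_on T F x0 X)"
proof
  assume "cara_sol F x0 X"
  then show "\<forall>T\<ge>0. sol_on T F x0 X" unfolding cara_sol_def sol_on_def by simp
next
  assume sol: "\<forall>T\<ge>0. sol_on T F x0 X"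
  show "cara_sol F x0 X"
    unfolding cara_sol_def
  proof (intro conjI allI impI)
    have "sol_on 0 F x0 X" using sol by simp
    then show "X 0 = x0" by (simp add: sol_on_def)
    fix t :: real assume "t \<ge> 0"
    then have "sol_on t F x0 X" "t \<in> {0..t}" using sol by simp_all
    then show "(\<lambda>s. F s (X s)) absolutely_integrable_on {0..t}" "X t = x0 + integral {0..t} (\<lambda>s. F s (X s))"
      unfolding sol_on_def by blast+
  qed
qed

lemma sol_on_mono: "sol_on T F x0 X \<Longrightarrow> S \<le> T \<Longrightarrow> sol_on S F x0 X"
  unfolding sol_on_def by auto

lemma sol_on_integrable:
  assumes "sol_on T F x0 X" "0 \<le> s" "s \<le> t" "t \<le> T"
  shows "(\<lambda>s. F s (X s)) absolutely_integrable_on {s..t}" "(\<lambda>s. F s (X s)) integrable_on {s..t}"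
    "X t - X s = integral {s..t} (\<lambda>s. F s (X s))"
proof -
  have a: "(\<lambda>s. F s (X s)) absolutely_integrable_on {0..t}" using assms unfolding sol_on_def by auto
  then show "(\<lambda>s. F s (X s)) absolutely_integrable_on {s..t}"
    by (rule absolutely_integrable_on_subinterval) (use assms in auto)
  then show "(\<lambda>s. F s (X s)) integrable_on {s..t}" using absolutely_integrable_on_def by blast
  have "(\<lambda>s. F s (X s)) integrable_on {0..t}" using a absolutely_integrable_on_def by blast
  from Henstock_Kurzweil_Integration.integral_combine[OF assms(2,3) this]
  have c: "integral {0..s} (\<lambda>s. F s (X s)) + integral {s..t} (\<lambda>s. F s (X s)) = integral {0..t} (\<lambda>s. F s (X s))" .
  have "X t = x0 + integral {0..t} (\<lambda>s. F s (X s))" "X s = x0 + integral {0..s} (\<lambda>s. F s (X s))"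
    using assms unfolding sol_on_def by auto
  then show "X t - X s = integral {s..t} (\<lambda>s. F s (X s))" using c by (simp add: algebra_simps)
qed

lemma sol_on_continuous:
  assumes "sol_on T F x0 X" shows "continuous_on {0..T} X"
proof (cases "T \<ge> 0")
  case True
  have "continuous_on {0..T} (\<lambda>t. x0 + integral {0..t} (\<lambda>s. F s (X s)))"
    using sol_on_integrable(2)[OF assms order_refl True order_refl]
    by (intro continuous_intros indefinite_integral_continuous_1)
  then show ?thesis
    by (rule continuous_on_cong[THEN iffD1, rotated -1, OF _ refl]) (use assms in \<open>auto simp: sol_on_def\<close>)
qed auto

text \<open>The negligible set serves a change of the input on a null set; with the empty set, the
  lemma serves a change of the field away from the solution.\<close>

lemma sol_on_cong:
  assumes sol: "sol_on T F x0 X" and "negligible N"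
    and F: "\<And>s. s \<in> {0..T} - N \<Longrightarrow> F' s (X' s) = F s (X s)" and X: "\<And>s. s \<in> {0..T} \<Longrightarrow> X' s = X s"
    and "X' 0 = x0"
  shows "sol_on T F' x0 X'"
  unfolding sol_on_def
proof (intro conjI ballI)
  fix t assume t: "t \<in> {0..T}"
  have eq: "\<And>s. s \<in> {0..t} - N \<Longrightarrow> F' s (X' s) = F s (X s)" using F t by auto
  show "(\<lambda>s. F' s (X' s)) absolutely_integrable_on {0..t}"
    by (rule absolutely_integrable_spike[OF _ assms(2) eq]) (use sol t in \<open>auto simp: sol_on_def\<close>)
  have "integral {0..t} (\<lambda>s. F s (X s)) = integral {0..t} (\<lambda>s. F' s (X' s))"
    by (rule integral_spike[OF assms(2) eq])
  then show "X' t = x0 + integral {0..t} (\<lambda>s. F' s (X' s))" using sol t X by (auto simp: sol_on_def)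
qed (fact assms)

text \<open>Joint continuity makes \<open>H (X s) (u s)\<close> measurable for measurable u, and the
  Lipschitz constant in the state is uniform over bounded inputs since u has no continuity in
  time.\<close>

definition field_ok :: "('s::euclidean_space \<Rightarrow> 'u::euclidean_space \<Rightarrow> 's) \<Rightarrow> bool" where
  "field_ok H \<longleftrightarrow> continuous_on UNIV (\<lambda>(x, u). H x u) \<and>
    (\<forall>R. \<exists>L>0. \<forall>x x' u. norm x \<le> R \<and> norm x' \<le> R \<and> norm u \<le> R \<longrightarrow> norm (H x u - H x' u) \<le> L * norm (x - x'))"

definition input_ok :: "real \<Rightarrow> (real \<Rightarrow> 'u::euclidean_space) \<Rightarrow> bool" where
  "input_ok N u \<longleftrightarrow> u \<in> borel_measurable lebesgue \<and> (\<forall>s. norm (u s) \<le> N)"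

lemma field_integrable:
  fixes H :: "'s::euclidean_space \<Rightarrow> 'u::euclidean_space \<Rightarrow> 's"
  assumes H: "continuous_on UNIV (\<lambda>(x, u). H x u)" and u: "input_ok N u" and X: "continuous_on {0..T} X"
  shows "(\<lambda>s. H (X s) (u s)) absolutely_integrable_on {0..T}"
proof -
  have "X \<in> borel_measurable (lebesgue_on {0..T})"
    by (rule continuous_imp_measurable_on_sets_lebesgue[OF X]) simp
  moreover have "u \<in> borel_measurable (lebesgue_on {0..T})"
    using u unfolding input_ok_def by (intro measurable_restrict_space1) auto
  ultimately have "(\<lambda>s. (X s, u s)) \<in> borel_measurable (lebesgue_on {0..T})" by (rule borel_measurable_Pair)
  then have "(\<lambda>s. (\<lambda>(x, u). H x u) (X s, u s)) \<in> borel_measurable (lebesgue_on {0..T})"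
    by (rule measurable_compose[OF _ borel_measurable_continuous_onI[OF H]])
  then have meas: "(\<lambda>s. H (X s) (u s)) \<in> borel_measurable (lebesgue_on {0..T})" by simp
  have "compact (X ` {0..T})" using X by (intro compact_continuous_image) auto
  then obtain R where R: "\<And>s. s \<in> {0..T} \<Longrightarrow> norm (X s) \<le> R"
    by (metis bounded_iff compact_imp_bounded imageI)
  obtain B where B: "\<forall>p. norm p \<le> R + N \<longrightarrow> norm ((\<lambda>(x, u). H x u) p) \<le> B"
    using continuous_bounded_cball[OF H, of "R + N"] by blast
  show ?thesis
  proof (rule measurable_bounded_by_integrable_imp_absolutely_integrable[OF meas])
    show "(\<lambda>s. B) integrable_on {0..T}" by (rule integrable_on_const) simp
    fix s assume s: "s \<in> {0..T}"
    have "norm (X s, u s) \<le> norm (X s) + norm (u s)" by (rule norm_Pair_le)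
    also have "\<dots> \<le> R + N" using R[OF s] u unfolding input_ok_def by (intro add_mono) auto
    finally show "norm (H (X s) (u s)) \<le> B" using B by auto
  qed simp
qed

lemma integral_exp_weight:
  fixes L :: real
  assumes "L > 0" "t \<ge> 0"
  shows "(\<lambda>s. L * exp (2 * L * s)) integrable_on {0..t}"
    "integral {0..t} (\<lambda>s. L * exp (2 * L * s)) = (exp (2 * L * t) - 1) / 2"
proof -
  have "((\<lambda>s. L * exp (2 * L * s)) has_integral (exp (2 * L * t) / 2 - exp (2 * L * 0) / 2)) {0..t}"
  proof (rule fundamental_theorem_of_calculus[OF assms(2)])
    fix s
    have "((\<lambda>s. exp (2 * L * s) / 2) has_real_derivative L * exp (2 * L * s)) (at s within {0..t})"
      by (auto intro!: derivative_eq_intros)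
    then show "((\<lambda>s. exp (2 * L * s) / 2) has_vector_derivative L * exp (2 * L * s)) (at s within {0..t})"
      by (simp add: has_real_derivative_iff_has_vector_derivative)
  qed
  then show "(\<lambda>s. L * exp (2 * L * s)) integrable_on {0..t}"
    "integral {0..t} (\<lambda>s. L * exp (2 * L * s)) = (exp (2 * L * t) - 1) / 2"
    by (auto simp: has_integral_integrable_integral diff_divide_distrib)
qed

text \<open>Gronwall by a weighted maximum: if \<mu> is the maximum of exp(-2 L t) m(t), attained at
  t0, the integral inequality gives m(t0) <= \<mu> exp(2 L t0) / 2 for positive \<mu>, while m(t0) =
  \<mu> exp(2 L t0).\<close>

lemma integral_gronwall_zero:
  fixes m :: "real \<Rightarrow> real"
  assumes m: "continuous_on {0..T} m" and L: "L > 0"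
    and le: "\<And>t. t \<in> {0..T} \<Longrightarrow> m t \<le> integral {0..t} (\<lambda>s. L * m s)" and t: "t \<in> {0..T}"
  shows "m t \<le> 0"
proof -
  let ?p = "\<lambda>t. exp (- (2 * L * t)) * m t"
  have "continuous_on {0..T} ?p" by (intro continuous_intros m)
  moreover have "{0..T} \<noteq> {}" using t by auto
  ultimately have "\<exists>t0\<in>{0..T}. \<forall>s\<in>{0..T}. ?p s \<le> ?p t0"
    by (intro continuous_attains_sup compact_Icc)
  then obtain t0 where t0: "t0 \<in> {0..T}" "\<And>s. s \<in> {0..T} \<Longrightarrow> ?p s \<le> ?p t0" by blast
  define \<mu> where "\<mu> = ?p t0"
  have ms: "m s \<le> \<mu> * exp (2 * L * s)" if "s \<in> {0..T}" for s
    using t0(2)[OF that] by (simp add: \<mu>_def exp_minus field_simps)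
  have "\<mu> \<le> 0"
  proof (rule ccontr)
    assume pos: "\<not> \<mu> \<le> 0"
    have "m t0 \<le> integral {0..t0} (\<lambda>s. L * m s)" by (rule le[OF t0(1)])
    also have "\<dots> \<le> integral {0..t0} (\<lambda>s. \<mu> * (L * exp (2 * L * s)))"
    proof (rule integral_le)
      show "(\<lambda>s. L * m s) integrable_on {0..t0}"
        using t0(1) by (intro integrable_continuous_interval continuous_intros continuous_on_subset[OF m]) auto
      show "(\<lambda>s. \<mu> * (L * exp (2 * L * s))) integrable_on {0..t0}"
        by (intro integrable_continuous_interval continuous_intros)
      show "L * m s \<le> \<mu> * (L * exp (2 * L * s))" if "s \<in> {0..t0}" for s
        using ms[of s] that t0(1) L by (simp add: mult.left_commute)
    qed
    also have "\<dots> = \<mu> * ((exp (2 * L * t0) - 1) / 2)"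
      using integral_exp_weight(2)[OF L, of t0] t0(1) by simp
    also have "\<dots> \<le> \<mu> * (exp (2 * L * t0) / 2)" using pos by (intro mult_left_mono) auto
    finally have "m t0 \<le> \<mu> * (exp (2 * L * t0) / 2)" .
    moreover have "m t0 = \<mu> * exp (2 * L * t0)"
    proof -
      have "exp (- (2 * L * t0)) * exp (2 * L * t0) = 1" by (simp add: exp_minus)
      then have "m t0 * (exp (- (2 * L * t0)) * exp (2 * L * t0)) = m t0" by (simp only: mult_1_right)
      then show ?thesis unfolding \<mu>_def by (simp only: mult_ac)
    qed
    moreover have "\<mu> * exp (2 * L * t0) > 0" using pos by simp
    ultimately show False by linarith
  qed
  then have "\<mu> * exp (2 * L * t) \<le> 0" by (simp add: mult_nonpos_nonneg)
  with ms[OF t] show ?thesis by linarith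
qed

lemma sol_on_bounded:
  assumes "sol_on T F x0 X" obtains R where "\<And>s. s \<in> {0..T} \<Longrightarrow> norm (X s) \<le> R"
proof -
  have "compact (X ` {0..T})" using sol_on_continuous[OF assms] by (intro compact_continuous_image) auto
  then have "\<exists>R. \<forall>s\<in>{0..T}. norm (X s) \<le> R" unfolding bounded_iff[symmetric]
    by (metis bounded_iff compact_imp_bounded imageI)
  then show ?thesis using that by blast
qed

lemma sol_on_unique:
  fixes H :: "'s::euclidean_space \<Rightarrow> 'u::euclidean_space \<Rightarrow> 's"
  assumes H: "field_ok H" and u: "input_ok N u"
    and X: "sol_on T (\<lambda>s x. H x (u s)) x0 X" and Y: "sol_on T (\<lambda>s x. H x (u s)) x0 Y" and t: "t \<in> {0..T}"
  shows "X t = Y t"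
proof -
  obtain R1 where R1: "\<And>s. s \<in> {0..T} \<Longrightarrow> norm (X s) \<le> R1" using sol_on_bounded[OF X] by blast
  obtain R2 where R2: "\<And>s. s \<in> {0..T} \<Longrightarrow> norm (Y s) \<le> R2" using sol_on_bounded[OF Y] by blast
  define R where "R = max N (max R1 R2)"
  obtain L where L: "L > 0" "\<And>x x' u. norm x \<le> R \<Longrightarrow> norm x' \<le> R \<Longrightarrow> norm u \<le> R \<Longrightarrow> norm (H x u - H x' u) \<le> L * norm (x - x')"
    using H unfolding field_ok_def by blast
  have cont: "continuous_on {0..T} (\<lambda>s. norm (X s - Y s))"
    by (intro continuous_intros sol_on_continuous[OF X] sol_on_continuous[OF Y])
  have "norm (X t - Y t) \<le> 0"
  proof (rule integral_gronwall_zero[OF cont L(1) _ t])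
    fix t assume t: "t \<in> {0..T}"
    then have t0: "0 \<le> t" "t \<le> T" by auto
    note iX = sol_on_integrable[OF X order_refl t0] and iY = sol_on_integrable[OF Y order_refl t0]
    have "X t - Y t = (X t - X 0) - (Y t - Y 0)" using X Y by (simp add: sol_on_def)
    also have "\<dots> = integral {0..t} (\<lambda>s. H (X s) (u s) - H (Y s) (u s))"
      unfolding iX(3) iY(3) by (rule integral_diff[symmetric, OF iX(2) iY(2)])
    finally have e: "X t - Y t = integral {0..t} (\<lambda>s. H (X s) (u s) - H (Y s) (u s))" .
    show "norm (X t - Y t) \<le> integral {0..t} (\<lambda>s. L * norm (X s - Y s))"
      unfolding e
    proof (rule Henstock_Kurzweil_Integration.integral_norm_bound_integral)
      show "(\<lambda>s. H (X s) (u s) - H (Y s) (u s)) integrable_on {0..t}"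
        by (rule integrable_diff[OF iX(2) iY(2)])
      show "(\<lambda>s. L * norm (X s - Y s)) integrable_on {0..t}"
        using t0 by (intro integrable_continuous_interval continuous_intros continuous_on_subset[OF cont]) auto
      fix s assume s: "s \<in> {0..t}"
      have "norm (X s) \<le> R" "norm (Y s) \<le> R" "norm (u s) \<le> R"
        using R1[of s] R2[of s] u s t0 by (auto simp: R_def input_ok_def le_max_iff_disj)
      then show "norm (H (X s) (u s) - H (Y s) (u s)) \<le> L * norm (X s - Y s)" by (rule L(2))
    qed
  qed
  then show ?thesis by simp
qed

text \<open>Picard iteration as a contraction for the norm weighted by \<open>exp (- 2 L t)\<close>, on the whole half-line.\<close>

lemma Picard_global:
  fixes H :: "'s::euclidean_space \<Rightarrow> 'u::euclidean_space \<Rightarrow> 's"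
  assumes H: "continuous_on UNIV (\<lambda>(x, u). H x u)" and u: "input_ok N u" and L: "L > 0"
    and lip: "\<And>x y v. norm v \<le> N \<Longrightarrow> norm (H x v - H y v) \<le> L * norm (x - y)"
  shows "\<exists>X. cara_sol (\<lambda>s x. H x (u s)) x0 X"
proof -
  have uN: "norm (u s) \<le> N" for s using u by (simp add: input_ok_def)
  obtain B where B: "B > 0" "\<forall>p. norm p \<le> N \<longrightarrow> norm ((\<lambda>(x, u). H x u) p) \<le> B"
    using continuous_bounded_cball[OF H, of N] by blast
  have H0: "norm (H 0 v) \<le> B" if "norm v \<le> N" for v using B(2)[rule_format, of "(0, v)"] that by (simp add: norm_Pair)
  define lift where "lift \<phi> s = exp (2 * L * s) *\<^sub>R (apply_bcontfun \<phi> s :: 's)" for \<phi> s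
  have cl: "continuous_on S (lift \<phi>)" for S \<phi>
    unfolding lift_def by (intro continuous_intros continuous_on_apply_bcontfun)
  define I where "I \<phi> t = x0 + integral {0..t} (\<lambda>s. H (lift \<phi> s) (u s))" for \<phi> t
  have int: "(\<lambda>s. H (lift \<phi> s) (u s)) absolutely_integrable_on {0..t}" for \<phi> t
    by (rule field_integrable[OF H u cl])
  then have int': "(\<lambda>s. H (lift \<phi> s) (u s)) integrable_on {0..t}" for \<phi> t
    using absolutely_integrable_on_def by blast
  \<comment> \<open>The type of bounded continuous functions lives on the whole line; clamping the
    time at 0 makes W constant on the negative half-line.\<close>
  define W where "W \<phi> t = exp (- (2 * L * max 0 t)) *\<^sub>R I \<phi> (max 0 t)" for \<phi> t
  have contI: "continuous_on {0..} (I \<phi>)" for \<phi>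
  proof -
    have "isCont (\<lambda>t. I \<phi> (max 0 t)) t" for t
    proof -
      define b where "b = max 0 t + 1"
      have "continuous_on {0..b} (I \<phi>)"
        unfolding I_def by (intro continuous_intros indefinite_integral_continuous_1 int')
      then have "continuous_on {..<b} (\<lambda>t. I \<phi> (max 0 t))"
        by (rule continuous_on_compose2) (auto intro!: continuous_intros simp: b_def)
      then show ?thesis
        by (rule continuous_on_interior) (simp add: b_def interior_open)
    qed
    then have "continuous_on {0..} (\<lambda>t. I \<phi> (max 0 t))" by (simp add: continuous_at_imp_continuous_on)
    then show ?thesis by (rule continuous_on_cong[THEN iffD1, rotated -1, OF _ refl]) auto
  qed
  have contW: "continuous_on UNIV (W \<phi>)" for \<phi>
    unfolding W_def by (intro continuous_intros continuous_on_compose2[OF contI]) auto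
  have diff: "norm (W \<phi> t - W \<psi> t) \<le> dist \<phi> \<psi> / 2" for \<phi> \<psi> t
  proof -
    define r where "r = max 0 t"
    have r: "r \<ge> 0" by (simp add: r_def)
    have "norm (I \<phi> r - I \<psi> r) = norm (integral {0..r} (\<lambda>s. H (lift \<phi> s) (u s) - H (lift \<psi> s) (u s)))"
      unfolding I_def by (simp add: integral_diff[OF int' int'])
    also have "\<dots> \<le> integral {0..r} (\<lambda>s. dist \<phi> \<psi> * (L * exp (2 * L * s)))"
    proof (rule Henstock_Kurzweil_Integration.integral_norm_bound_integral)
      show "(\<lambda>s. H (lift \<phi> s) (u s) - H (lift \<psi> s) (u s)) integrable_on {0..r}" by (intro integrable_diff int')
      show "(\<lambda>s. dist \<phi> \<psi> * (L * exp (2 * L * s))) integrable_on {0..r}"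
        by (intro integrable_continuous_interval continuous_intros)
      fix s
      have "norm (H (lift \<phi> s) (u s) - H (lift \<psi> s) (u s)) \<le> L * norm (lift \<phi> s - lift \<psi> s)" by (rule lip[OF uN])
      also have "norm (lift \<phi> s - lift \<psi> s) = exp (2 * L * s) * dist (apply_bcontfun \<phi> s) (apply_bcontfun \<psi> s)"
        unfolding lift_def by (simp add: scaleR_diff_right[symmetric] dist_norm)
      also have "L * \<dots> \<le> L * (exp (2 * L * s) * dist \<phi> \<psi>)"
        using L dist_bounded[of \<phi> s \<psi>] by (intro mult_left_mono) auto
      finally show "norm (H (lift \<phi> s) (u s) - H (lift \<psi> s) (u s)) \<le> dist \<phi> \<psi> * (L * exp (2 * L * s))"
        by (simp add: mult_ac)
    qed
    also have "\<dots> = dist \<phi> \<psi> * ((exp (2 * L * r) - 1) / 2)"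
      using integral_exp_weight(2)[OF L r] by simp
    also have "\<dots> \<le> dist \<phi> \<psi> * (exp (2 * L * r) / 2)" by (intro mult_left_mono) auto
    finally have "exp (- (2 * L * r)) * norm (I \<phi> r - I \<psi> r) \<le> exp (- (2 * L * r)) * (dist \<phi> \<psi> * (exp (2 * L * r) / 2))"
      by (intro mult_left_mono) auto
    also have "\<dots> = dist \<phi> \<psi> / 2" by (simp add: exp_minus)
    finally show ?thesis unfolding W_def r_def[symmetric] scaleR_diff_right[symmetric] by simp
  qed
  \<comment> \<open>Only the image of the zero function is bounded directly; the contraction
    estimate then bounds every other image.\<close>
  have W0: "norm (W 0 t) \<le> norm x0 + B / (2 * L)" for t
  proof -
    define r where "r = max 0 t"
    have r: "r \<ge> 0" by (simp add: r_def)
    have "norm (integral {0..r} (\<lambda>s. H (lift 0 s) (u s))) \<le> integral {0..r} (\<lambda>s. B)"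
      by (rule Henstock_Kurzweil_Integration.integral_norm_bound_integral[OF int'])
         (auto simp: lift_def H0[OF uN] intro: integrable_on_const)
    also have "\<dots> = B * r" using r by simp
    finally have "norm (I 0 r) \<le> norm x0 + B * r"
      unfolding I_def by (intro order_trans[OF norm_triangle_ineq] add_left_mono)
    then have "exp (- (2 * L * r)) * norm (I 0 r) \<le> exp (- (2 * L * r)) * (norm x0 + B * r)" by (intro mult_left_mono) auto
    also have "\<dots> \<le> norm x0 + B / (2 * L)"
    proof -
      have "2 * L * r \<le> exp (2 * L * r)" using exp_ge_add_one_self[of "2 * L * r"] by linarith
      then have "exp (- (2 * L * r)) * (2 * L * r) \<le> 1" by (simp add: exp_minus field_simps)
      then have "B / (2 * L) * (exp (- (2 * L * r)) * (2 * L * r)) \<le> B / (2 * L) * 1" using B L by (intro mult_left_mono) auto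
      then have 1: "exp (- (2 * L * r)) * (B * r) \<le> B / (2 * L)" using L by (simp add: field_simps)
      have "exp (- (2 * L * r)) \<le> 1" using L r by simp
      then have "exp (- (2 * L * r)) * norm x0 \<le> norm x0" by (intro mult_left_le_one_le) auto
      with 1 show ?thesis by (simp add: algebra_simps)
    qed
    finally show ?thesis unfolding W_def r_def[symmetric] by simp
  qed
  have W_bc: "W \<phi> \<in> bcontfun" for \<phi>
  proof (rule bcontfun_normI[OF contW])
    fix t
    have "norm (W \<phi> t) \<le> norm (W \<phi> t - W 0 t) + norm (W 0 t)" by (metis diff_add_cancel norm_triangle_ineq)
    also have "\<dots> \<le> dist \<phi> 0 / 2 + (norm x0 + B / (2 * L))" by (intro add_mono diff W0)
    finally show "norm (W \<phi> t) \<le> dist \<phi> 0 / 2 + (norm x0 + B / (2 * L))" .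
  qed
  define P where "P \<phi> = Bcontfun (W \<phi>)" for \<phi>
  have P: "apply_bcontfun (P \<phi>) = W \<phi>" for \<phi> unfolding P_def by (rule Bcontfun_inverse[OF W_bc])
  have "dist (P \<phi>) (P \<psi>) \<le> 1 / 2 * dist \<phi> \<psi>" for \<phi> \<psi>
    using diff[of \<phi> _ \<psi>] by (intro dist_bound) (simp add: P dist_norm)
  then obtain \<phi> where \<phi>: "P \<phi> = \<phi>" using banach_fix_type[of "1/2" P] by auto
  have fixp: "lift \<phi> t = I \<phi> t" if "t \<ge> 0" for t
  proof -
    have "apply_bcontfun \<phi> t = W \<phi> t" using P[of \<phi>] \<phi> by simp
    then show ?thesis using that unfolding lift_def W_def by (simp add: exp_minus)
  qed
  have "cara_sol (\<lambda>s x. H x (u s)) x0 (lift \<phi>)"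
    unfolding cara_sol_def
  proof (intro conjI allI impI)
    show "lift \<phi> 0 = x0" using fixp[of 0] by (simp add: I_def)
    show "(\<lambda>s. H (lift \<phi> s) (u s)) absolutely_integrable_on {0..t}" for t by (rule int)
    show "lift \<phi> t = x0 + integral {0..t} (\<lambda>s. H (lift \<phi> s) (u s))" if "t \<ge> 0" for t
      using fixp[OF that] by (simp add: I_def)
  qed
  then show ?thesis by blast
qed

text \<open>Composing the field with the nearest-point projection onto a large ball makes it
  globally Lipschitz, so Picard iteration applies. The a priori bound is below the radius of the
  ball, hence solutions of the truncated equation never leave it and solve the original one.\<close>

lemma sol_exists_of_apriori:
  fixes H :: "'s::euclidean_space \<Rightarrow> 'u::euclidean_space \<Rightarrow> 's"
  assumes H: "field_ok H" and u: "input_ok N u"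
    and apriori: "\<And>T. T \<ge> 0 \<Longrightarrow> \<exists>R. \<forall>\<tau> X. 0 \<le> \<tau> \<and> \<tau> \<le> T \<and> sol_on \<tau> (\<lambda>s x. H x (u s)) x0 X \<longrightarrow> norm (X \<tau>) < R"
  shows "\<exists>X. cara_sol (\<lambda>s x. H x (u s)) x0 X"
proof -
  have ex: "\<exists>X. sol_on T (\<lambda>s x. H x (u s)) x0 X" if T: "T \<ge> 0" for T
  proof -
    obtain R0 where R0: "\<And>\<tau> X. 0 \<le> \<tau> \<Longrightarrow> \<tau> \<le> T \<Longrightarrow> sol_on \<tau> (\<lambda>s x. H x (u s)) x0 X \<Longrightarrow> norm (X \<tau>) < R0"
      using apriori[OF T] by blast
    define R where "R = max R0 (max N (norm x0 + 1))"
    have R: "R0 \<le> R" "N \<le> R" "norm x0 < R" by (auto simp: R_def less_max_iff_disj)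
    have R0': "0 < R" using R(3) by (rule le_less_trans[OF norm_ge_zero])
    define p where "p = closest_point (cball (0::'s) R)"
    have p: "norm (p x) \<le> R" "norm x \<le> R \<Longrightarrow> p x = x" "dist (p x) (p y) \<le> dist x y" for x y
    proof -
      have "p x \<in> cball 0 R" unfolding p_def using R0' by (intro closest_point_in_set) auto
      then show "norm (p x) \<le> R" by simp
      show "norm x \<le> R \<Longrightarrow> p x = x" unfolding p_def by (intro closest_point_self) simp
      show "dist (p x) (p y) \<le> dist x y" unfolding p_def using R0' by (intro closest_point_lipschitz) auto
    qed
    have cp: "continuous_on UNIV p" unfolding p_def using R0' by (intro continuous_on_closest_point) auto
    obtain L where L: "L > 0" "\<And>x x' u. norm x \<le> R \<Longrightarrow> norm x' \<le> R \<Longrightarrow> norm u \<le> R \<Longrightarrow> norm (H x u - H x' u) \<le> L * norm (x - x')"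
      using H unfolding field_ok_def by blast
    have cH: "continuous_on UNIV (\<lambda>(x, u). H x u)" using H by (simp add: field_ok_def)
    have "continuous_on UNIV (\<lambda>q. (\<lambda>(x, u). H x u) (p (fst q), snd q))"
      by (intro continuous_on_compose2[OF cH] continuous_intros continuous_on_compose2[OF cp]) auto
    then have cG: "continuous_on UNIV (\<lambda>(x, u). H (p x) u)" by (simp add: case_prod_beta)
    have "\<exists>X. cara_sol (\<lambda>s x. H (p x) (u s)) x0 X"
    proof (rule Picard_global[OF cG u L(1)])
      fix x y and v :: 'u assume "norm v \<le> N"
      then have "norm (H (p x) v - H (p y) v) \<le> L * norm (p x - p y)" using L(2) p(1) R by auto
      also have "\<dots> \<le> L * norm (x - y)" using p(3)[of x y] L(1) by (simp add: dist_norm)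
      finally show "norm (H (p x) v - H (p y) v) \<le> L * norm (x - y)" .
    qed
    then obtain X where X: "cara_sol (\<lambda>s x. H (p x) (u s)) x0 X" by blast
    then have XT: "sol_on T (\<lambda>s x. H (p x) (u s)) x0 X" using T by (simp add: cara_sol_iff)
    have same: "sol_on \<tau> (\<lambda>s x. H x (u s)) x0 X" if "\<tau> \<le> T" "\<And>s. s \<in> {0..\<tau>} \<Longrightarrow> norm (X s) \<le> R" for \<tau>
      by (rule sol_on_cong[OF sol_on_mono[OF XT that(1)], of "{}"]) (use p(2) that X in \<open>auto simp: cara_sol_def\<close>)
    have "norm (X s) \<le> R" if s: "s \<in> {0..T}" for s
    proof (rule ccontr)
      assume bad: "\<not> norm (X s) \<le> R"
      have cX: "continuous_on {0..s} (\<lambda>t. norm (X t))"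
        using sol_on_continuous[OF XT] s by (intro continuous_intros) (auto intro: continuous_on_subset)
      have "\<exists>t\<ge>0. t \<le> s \<and> norm (X t) = R"
        using bad s R X by (intro IVT'[OF _ _ _ cX]) (auto simp: cara_sol_def)
      then have ne: "{t \<in> {0..s}. norm (X t) = R} \<noteq> {}" by auto
      have "closed {t \<in> {0..s}. norm (X t) = R}"
        using continuous_closed_preimage_constant[OF cX, of R] by simp
      then have "compact {t \<in> {0..s}. norm (X t) = R}"
        by (rule compact_eq_bounded_closed[THEN iffD2, OF conjI, rotated]) (rule bounded_subset[of "{0..s}"], auto)
      \<comment> \<open>The first time at which the norm reaches R. Up to it the truncation is
        invisible, so X is a genuine solution there and contradicts the a priori bound.\<close>
      then obtain t where t: "t \<in> {t \<in> {0..s}. norm (X t) = R}" "\<And>t'. t' \<in> {t \<in> {0..s}. norm (X t) = R} \<Longrightarrow> t \<le> t'"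
        using compact_attains_inf[OF _ ne] by blast
      have "norm (X t') \<le> R" if "t' \<in> {0..t}" for t'
      proof (rule ccontr)
        assume "\<not> norm (X t') \<le> R"
        then have "\<exists>t''\<ge>0. t'' \<le> t' \<and> norm (X t'') = R"
          using that t(1) R X by (intro IVT'[of "\<lambda>t. norm (X t)"] continuous_on_subset[OF cX]) (auto simp: cara_sol_def)
        then obtain t'' where t'': "t'' \<ge> 0" "t'' \<le> t'" "norm (X t'') = R" by blast
        then have "t \<le> t''" using t that by (intro t(2)) auto
        then have "t' = t" using t'' that by simp
        then show False using t(1) \<open>\<not> norm (X t') \<le> R\<close> by simp
      qed
      then have "sol_on t (\<lambda>s x. H x (u s)) x0 X" using same t(1) s by auto
      then have "norm (X t) < R0" using R0[of t X] t(1) s by auto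
      then show False using t(1) R by simp
    qed
    then show ?thesis using same[of T] by blast
  qed
  then have "\<forall>T. \<exists>X. T \<ge> 0 \<longrightarrow> sol_on T (\<lambda>s x. H x (u s)) x0 X" by blast
  from choice[OF this] obtain Y where Y: "\<And>T. T \<ge> 0 \<Longrightarrow> sol_on T (\<lambda>s x. H x (u s)) x0 (Y T)" by blast
  \<comment> \<open>By uniqueness the solutions on different horizons agree where both live, so the
    diagonal is one global solution.\<close>
  define X where "X t = Y t t" for t
  have XY: "X s = Y T s" if "0 \<le> s" "s \<le> T" for s T
    unfolding X_def using that by (intro sol_on_unique[OF H u Y sol_on_mono[OF Y]]) auto
  have "sol_on T (\<lambda>s x. H x (u s)) x0 X" if T: "T \<ge> 0" for T
    by (rule sol_on_cong[OF Y[OF T], of "{}"]) (use XY[of _ T] Y[of T] T in \<open>auto simp: sol_on_def\<close>)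
  then show ?thesis by (auto simp: cara_sol_iff)
qed

lemma lebesgue_measurable_shift:
  fixes u :: "real \<Rightarrow> 'a::euclidean_space"
  assumes "u \<in> borel_measurable lebesgue" shows "(\<lambda>s. u (a + s)) \<in> borel_measurable lebesgue"
proof -
  have "(\<lambda>s::real. a + s) \<in> lebesgue \<rightarrow>\<^sub>M lebesgue"
    using lebesgue_affine_measurable[of "\<lambda>_::real. 1" a] by simp
  then show ?thesis using assms by (rule measurable_compose)
qed

lemma input_ok_shift: "input_ok N u \<Longrightarrow> input_ok N (\<lambda>s. u (a + s))"
  unfolding input_ok_def using lebesgue_measurable_shift by auto

lemma sol_on_shift:
  fixes H :: "'s::euclidean_space \<Rightarrow> 'u::euclidean_space \<Rightarrow> 's"
  assumes H: "continuous_on UNIV (\<lambda>(x, u). H x u)" and u: "input_ok N u"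
    and X: "sol_on T (\<lambda>s x. H x (u s)) x0 X" and a: "0 \<le> a" "a \<le> T"
  shows "sol_on (T - a) (\<lambda>s x. H x (u (a + s))) (X a) (\<lambda>s. X (a + s))"
  unfolding sol_on_def
proof (intro conjI ballI)
  fix t assume t: "t \<in> {0..T - a}"
  have "continuous_on {0..t} (\<lambda>s. X (a + s))"
    by (rule continuous_on_compose2[OF sol_on_continuous[OF X]]) (use t a in \<open>auto intro!: continuous_intros\<close>)
  then show "(\<lambda>s. H (X (a + s)) (u (a + s))) absolutely_integrable_on {0..t}"
    by (rule field_integrable[OF H input_ok_shift[OF u]])
  have "integral {0..t} ((\<lambda>s. H (X s) (u s)) \<circ> (+) a) = integral {0 + a..t + a} (\<lambda>s. H (X s) (u s))"
    by (rule integral_shift_Icc_real)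
  also have "\<dots> = X (t + a) - X a"
    using sol_on_integrable(3)[OF X a(1), of "t + a"] t by simp
  finally show "X (a + t) = X a + integral {0..t} (\<lambda>s. H (X (a + s)) (u (a + s)))"
    by (simp add: o_def add.commute)
qed simp

section \<open>Upper Dini derivatives and input-to-state stability\<close>

text \<open>Says that the upper right Dini derivative of v at s is at most g. With merely measurable
  inputs, V along a solution need not be differentiable at every time, but this one-sided bound
  holds everywhere. The test points stop at b, the end of the known solution.\<close>

definition dini_le :: "(real \<Rightarrow> real) \<Rightarrow> real \<Rightarrow> real \<Rightarrow> real \<Rightarrow> bool" where
  "dini_le v b s g \<longleftrightarrow> (\<forall>\<eta>>0. \<exists>h>0. \<forall>t. s < t \<and> t < s + h \<and> t \<le> b \<longrightarrow> v t \<le> v s + (g + \<eta>) * (t - s))"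

lemma dini_le_mono: "dini_le v b s g \<Longrightarrow> g \<le> g' \<Longrightarrow> dini_le v b s g'"
  unfolding dini_le_def
proof (intro allI impI)
  fix \<eta> :: real
  assume d: "\<forall>\<eta>>0. \<exists>h>0. \<forall>t. s < t \<and> t < s + h \<and> t \<le> b \<longrightarrow> v t \<le> v s + (g + \<eta>) * (t - s)" and g: "g \<le> g'" and "\<eta> > 0"
  then obtain h where h: "h > 0" "\<And>t. s < t \<and> t < s + h \<and> t \<le> b \<Longrightarrow> v t \<le> v s + (g + \<eta>) * (t - s)" by blast
  have "v t \<le> v s + (g' + \<eta>) * (t - s)" if "s < t \<and> t < s + h \<and> t \<le> b" for t
  proof -
    have "(g + \<eta>) * (t - s) \<le> (g' + \<eta>) * (t - s)" using g that by (intro mult_right_mono) auto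
    with h(2)[OF that] show ?thesis by linarith
  qed
  with h(1) show "\<exists>h>0. \<forall>t. s < t \<and> t < s + h \<and> t \<le> b \<longrightarrow> v t \<le> v s + (g' + \<eta>) * (t - s)" by blast
qed

lemma dini_le_restrict: "dini_le v b s g \<Longrightarrow> b' \<le> b \<Longrightarrow> dini_le v b' s g"
  unfolding dini_le_def by (meson order_trans)

text \<open>At the last time at which v lies on or below the line of slope g + \<eta>, the Dini
  bound would carry the inequality further, unless that time is b. Then \<eta> tends to 0.\<close>

lemma dini_bound:
  fixes v :: "real \<Rightarrow> real"
  assumes cont: "continuous_on {a..b} v" and ab: "a \<le> b"
    and d: "\<And>s. a \<le> s \<Longrightarrow> s < b \<Longrightarrow> dini_le v b s g"
  shows "v b \<le> v a + g * (b - a)"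
proof -
  have "v b \<le> v a + (g + \<eta>) * (b - a)" if \<eta>: "\<eta> > 0" for \<eta>
  proof -
    let ?f = "\<lambda>t. v t - (g + \<eta>) * (t - a)"
    define S where "S = {t \<in> {a..b}. ?f t \<in> {..v a}}"
    have "continuous_on {a..b} ?f" by (intro continuous_intros cont)
    then have "closed S" unfolding S_def by (intro continuous_closed_preimage[unfolded vimage_def Int_def mem_Collect_eq, simplified]) auto
    moreover have "bounded S" by (rule bounded_subset[of "{a..b}"]) (auto simp: S_def)
    ultimately have "compact S" by (simp add: compact_eq_bounded_closed)
    moreover have "a \<in> S" using ab by (simp add: S_def)
    ultimately obtain m where m: "m \<in> S" "\<And>t. t \<in> S \<Longrightarrow> t \<le> m"
      using compact_attains_sup[of S] by blast
    have "m = b"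
    proof (rule ccontr)
      assume "m \<noteq> b"
      then have mb: "a \<le> m" "m < b" using m(1) by (auto simp: S_def)
      then obtain h where h: "h > 0" "\<And>t. m < t \<and> t < m + h \<and> t \<le> b \<Longrightarrow> v t \<le> v m + (g + \<eta>) * (t - m)"
        using d[of m] \<eta> unfolding dini_le_def by blast
      define t where "t = min b (m + h / 2)"
      have t: "m < t" "t < m + h" "t \<le> b" using mb h(1) by (auto simp: t_def min_def)
      have "v t \<le> v m + (g + \<eta>) * (t - m)" using h(2) t by blast
      moreover have "v m \<le> v a + (g + \<eta>) * (m - a)" using m(1) by (simp add: S_def)
      ultimately have "v t \<le> v a + (g + \<eta>) * (t - a)" by (simp add: algebra_simps)
      then have "t \<in> S" using t mb by (simp add: S_def)
      then show False using m(2)[of t] t by simp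
    qed
    then show ?thesis using m(1) by (simp add: S_def)
  qed
  then have "v b \<le> v a + g * (b - a) + e" if "e > 0" for e
  proof -
    have "v b \<le> v a + (g + e / (b - a + 1)) * (b - a)" using that ab \<open>\<And>\<eta>. \<eta> > 0 \<Longrightarrow> v b \<le> v a + (g + \<eta>) * (b - a)\<close> by simp
    also have "\<dots> = v a + g * (b - a) + e * ((b - a) / (b - a + 1))" by (simp add: algebra_simps)
    also have "e * ((b - a) / (b - a + 1)) \<le> e * 1" using that ab by (intro mult_left_mono) auto
    finally show ?thesis by simp
  qed
  then show ?thesis by (rule field_le_epsilon)
qed

text \<open>If v ends above m, consider the last time it was at or below m: it equals m there and v
  cannot rise afterwards, a contradiction. If there is no such time, v descends at rate k
  throughout.\<close>

lemma dini_barrier: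
  fixes v :: "real \<Rightarrow> real"
  assumes cont: "continuous_on {a..b} v" and ab: "a \<le> b" and k: "k \<ge> 0"
    and d: "\<And>s. a \<le> s \<Longrightarrow> s < b \<Longrightarrow> v s \<ge> m \<Longrightarrow> dini_le v b s (- k)"
  shows "v b \<le> max m (v a - k * (b - a))"
proof (rule ccontr)
  assume neg: "\<not> ?thesis"
  then have vb: "v b > m" "v b > v a - k * (b - a)" by auto
  have low: "v b \<le> v t - k * (b - t)" if t: "a \<le> t" "t \<le> b" "\<And>s. t < s \<Longrightarrow> s \<le> b \<Longrightarrow> v s > m" "v t \<ge> m" for t
  proof -
    have "v b \<le> v t + (- k) * (b - t)"
    proof (rule dini_bound)
      show "continuous_on {t..b} v" by (rule continuous_on_subset[OF cont]) (use t in auto)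
      fix s assume s: "t \<le> s" "s < b"
      have "v s \<ge> m" using t(3)[of s] t(4) s by (cases "s = t") auto
      then show "dini_le v b s (- k)" using d s t by auto
    qed (use t in auto)
    then show ?thesis by simp
  qed
  define S where "S = {t \<in> {a..b}. v t \<in> {..m}}"
  show False
  proof (cases "S = {}")
    case True
    have "v s > m" if "a \<le> s" "s \<le> b" for s
    proof -
      have "s \<notin> S" using True by simp
      then show ?thesis using that by (simp add: S_def)
    qed
    then have "v b \<le> v a - k * (b - a)" using ab by (intro low) (auto intro: less_imp_le)
    then show False using vb by simp
  next
    case False
    have "closed S" unfolding S_def using cont by (intro continuous_closed_preimage[unfolded vimage_def Int_def mem_Collect_eq, simplified]) auto
    moreover have "bounded S" by (rule bounded_subset[of "{a..b}"]) (auto simp: S_def)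
    ultimately have "compact S" by (simp add: compact_eq_bounded_closed)
    then obtain t where t: "t \<in> S" "\<And>s. s \<in> S \<Longrightarrow> s \<le> t" using compact_attains_sup[of S] False by blast
    have tab: "a \<le> t" "t \<le> b" "v t \<le> m" using t(1) by (auto simp: S_def)
    have after: "v s > m" if "t < s" "s \<le> b" for s using t(2)[of s] that tab by (force simp: S_def not_le)
    have "t < b" using tab vb(1) by (cases "t = b") auto
    have "v t = m"
    proof (rule ccontr)
      assume "v t \<noteq> m"
      then have "v t < m" using tab by simp
      then have "\<exists>s\<ge>t. s \<le> b \<and> v s = m"
        using vb(1) tab by (intro IVT' continuous_on_subset[OF cont]) auto
      then obtain s where s: "s \<ge> t" "s \<le> b" "v s = m" by blast
      then show False using after[of s] \<open>v t < m\<close> by (cases "s = t") auto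
    qed
    then have "v b \<le> v t - k * (b - t)" using tab after by (intro low) auto
    moreover have "k * (b - t) \<ge> 0" using k tab by simp
    ultimately show False using \<open>v t = m\<close> vb(1) by linarith
  qed
qed

text \<open>The hypothesis freezes the state at time s and lets the input range over its later
  values. The increment of X is an integral of the field, and over a short interval the field
  differs from its frozen version by a Lipschitz error that \<eta> absorbs.\<close>

lemma sol_dini:
  fixes H :: "'s::euclidean_space \<Rightarrow> 'u::euclidean_space \<Rightarrow> 's" and \<Psi> :: "'s \<Rightarrow> real"
  assumes H: "field_ok H" and u: "input_ok N u" and X: "sol_on T (\<lambda>s x. H x (u s)) x0 X" and s: "0 \<le> s" "s < T"
    and \<Psi>: "(\<Psi> has_derivative \<Psi>') (at (X s))" and g: "\<And>\<tau>. s \<le> \<tau> \<Longrightarrow> \<tau> \<le> T \<Longrightarrow> \<Psi>' (H (X s) (u \<tau>)) \<le> g"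
  shows "dini_le (\<lambda>t. \<Psi> (X t)) T s g"
  unfolding dini_le_def
proof (intro allI impI)
  fix \<eta> :: real assume \<eta>: "\<eta> > 0"
  obtain R1 where R1: "\<And>s. s \<in> {0..T} \<Longrightarrow> norm (X s) \<le> R1" using sol_on_bounded[OF X] by blast
  define R where "R = max N R1"
  have XR: "norm (X \<tau>) \<le> R" if "\<tau> \<in> {0..T}" for \<tau> using R1[OF that] by (simp add: R_def)
  have uR: "norm (u \<tau>) \<le> R" for \<tau> using u by (simp add: R_def input_ok_def le_max_iff_disj)
  obtain L where L: "L > 0" "\<And>x x' u. norm x \<le> R \<Longrightarrow> norm x' \<le> R \<Longrightarrow> norm u \<le> R \<Longrightarrow> norm (H x u - H x' u) \<le> L * norm (x - x')"
    using H unfolding field_ok_def by blast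
  have cH: "continuous_on UNIV (\<lambda>(x, u). H x u)" using H by (simp add: field_ok_def)
  obtain B where B: "B > 0" "\<forall>p. norm p \<le> R + R \<longrightarrow> norm ((\<lambda>(x, u). H x u) p) \<le> B"
    using continuous_bounded_cball[OF cH, of "R + R"] by blast
  have HB: "norm (H (X \<tau>) (u \<tau>)) \<le> B" if "\<tau> \<in> {0..T}" for \<tau>
  proof -
    have "norm (X \<tau>, u \<tau>) \<le> norm (X \<tau>) + norm (u \<tau>)" by (rule norm_Pair_le)
    then show ?thesis using B(2)[rule_format, of "(X \<tau>, u \<tau>)"] XR[OF that] uR[of \<tau>] by simp
  qed
  have inc: "norm (X t - X s) \<le> B * (t - s)" if "s \<le> t" "t \<le> T" for t
  proof -
    have "norm (integral {s..t} (\<lambda>\<tau>. H (X \<tau>) (u \<tau>))) \<le> integral {s..t} (\<lambda>\<tau>. B)"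
      using that s by (intro Henstock_Kurzweil_Integration.integral_norm_bound_integral sol_on_integrable(2)[OF X] integrable_on_const HB) auto
    then show ?thesis using sol_on_integrable(3)[OF X s(1) that] that by (simp add: mult.commute)
  qed
  have bl: "bounded_linear \<Psi>'" by (rule has_derivative_bounded_linear[OF \<Psi>])
  obtain K where K: "K > 0" "\<And>x. norm (\<Psi>' x) \<le> norm x * K" using bounded_linear.pos_bounded[OF bl] by blast
  define e where "e = \<eta> / (2 * B)"
  have e: "e > 0" using \<eta> B by (simp add: e_def)
  obtain d where d: "d > 0" "\<And>y. norm (y - X s) < d \<Longrightarrow> norm (\<Psi> y - \<Psi> (X s) - \<Psi>' (y - X s)) \<le> e * norm (y - X s)"
    using \<Psi> e unfolding has_derivative_at_alt by blast
  \<comment> \<open>The first bound keeps X in the range of the first-order expansion of \<Psi>, the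
    second keeps the Lipschitz drift of the field below \<eta> / 2 after applying
    \<open>\<Psi>'\<close>.\<close>
  define h where "h = min (d / B) (\<eta> / (2 * K * L * B))"
  have h: "h > 0" using d \<eta> K L B by (simp add: h_def)
  have "\<Psi> (X t) \<le> \<Psi> (X s) + (g + \<eta>) * (t - s)" if t: "s < t \<and> t < s + h \<and> t \<le> T" for t
  proof -
    have ts: "s \<le> t" "t \<le> T" "t - s < h" "0 < t - s" using t by auto
    have "B * (t - s) < B * (d / B)" using ts B by (intro mult_strict_left_mono) (auto simp: h_def)
    then have "norm (X t - X s) < d" using inc[OF ts(1,2)] B by simp
    then have "\<Psi> (X t) - \<Psi> (X s) - \<Psi>' (X t - X s) \<le> e * norm (X t - X s)" using d(2) by fastforce
    also have "\<dots> \<le> e * (B * (t - s))" using inc[OF ts(1,2)] e by (intro mult_left_mono) auto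
    also have "\<dots> = \<eta> / 2 * (t - s)" using B by (simp add: e_def)
    finally have 1: "\<Psi> (X t) - \<Psi> (X s) - \<Psi>' (X t - X s) \<le> \<eta> / 2 * (t - s)" .
    note int = sol_on_integrable(2)[OF X s(1) ts(1,2)]
    have "\<Psi>' (X t - X s) = integral {s..t} (\<Psi>' \<circ> (\<lambda>\<tau>. H (X \<tau>) (u \<tau>)))"
      unfolding sol_on_integrable(3)[OF X s(1) ts(1,2)] by (rule integral_linear[OF int bl, symmetric])
    also have "\<dots> \<le> integral {s..t} (\<lambda>\<tau>. g + \<eta> / 2)"
    proof (rule integral_le)
      show "(\<Psi>' \<circ> (\<lambda>\<tau>. H (X \<tau>) (u \<tau>))) integrable_on {s..t}" by (rule integrable_linear[OF int bl])
      show "(\<lambda>\<tau>. g + \<eta> / 2) integrable_on {s..t}" by (rule integrable_on_const) simp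
      fix \<tau> assume \<tau>: "\<tau> \<in> {s..t}"
      have "norm (H (X \<tau>) (u \<tau>) - H (X s) (u \<tau>)) \<le> L * norm (X \<tau> - X s)"
        using \<tau> ts s by (intro L(2) XR uR) auto
      also have "\<dots> \<le> L * (B * h)"
      proof (intro mult_left_mono)
        have "norm (X \<tau> - X s) \<le> B * (\<tau> - s)" using \<tau> ts by (intro inc) auto
        also have "\<dots> \<le> B * h" using \<tau> ts B by (intro mult_left_mono) auto
        finally show "norm (X \<tau> - X s) \<le> B * h" .
      qed (use L in auto)
      finally have "norm (\<Psi>' (H (X \<tau>) (u \<tau>) - H (X s) (u \<tau>))) \<le> L * (B * h) * K"
        using K order_trans[OF K(2)] by (meson mult_right_mono less_imp_le)
      also have "\<dots> \<le> \<eta> / 2"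
      proof -
        have "h \<le> \<eta> / (2 * K * L * B)" by (simp add: h_def)
        then have "h * (2 * K * L * B) \<le> \<eta>" using K L B by (subst (asm) pos_le_divide_eq) auto
        then show ?thesis by (simp add: mult_ac)
      qed
      finally have "\<Psi>' (H (X \<tau>) (u \<tau>)) - \<Psi>' (H (X s) (u \<tau>)) \<le> \<eta> / 2"
        using linear_diff[OF bounded_linear.linear[OF bl]] by (metis abs_le_iff real_norm_def)
      then show "(\<Psi>' \<circ> (\<lambda>\<tau>. H (X \<tau>) (u \<tau>))) \<tau> \<le> g + \<eta> / 2" using g[of \<tau>] \<tau> ts by simp
    qed
    also have "\<dots> = (g + \<eta> / 2) * (t - s)" using ts by simp
    finally have 2: "\<Psi>' (X t - X s) \<le> (g + \<eta> / 2) * (t - s)" .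
    have "(g + \<eta> / 2) * (t - s) + \<eta> / 2 * (t - s) = (g + \<eta>) * (t - s)" by (simp add: field_simps)
    with 1 2 show ?thesis by linarith
  qed
  with h show "\<exists>h>0. \<forall>t. s < t \<and> t < s + h \<and> t \<le> T \<longrightarrow> \<Psi> (X t) \<le> \<Psi> (X s) + (g + \<eta>) * (t - s)" by blast
qed

section \<open>The ISS estimate on finite and restarted intervals\<close>

definition ISS_bound :: "('y::euclidean_space \<times> 'w::euclidean_space \<times> 'd::euclidean_space \<Rightarrow> 'w) \<Rightarrow>
    (real \<Rightarrow> real \<Rightarrow> real) \<Rightarrow> (real \<Rightarrow> real) \<Rightarrow> bool" where
  "ISS_bound h \<beta> \<sigma> \<longleftrightarrow> (\<forall>w0 (y::real \<Rightarrow> 'y) (\<delta>::real \<Rightarrow> 'd). loc_ess_bdd y \<and> loc_ess_bdd \<delta> \<longrightarrow>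
        (\<exists>w. cara_sol (\<lambda>s w. h (y s, w, \<delta> s)) w0 w) \<and>
        (\<forall>w. cara_sol (\<lambda>s w. h (y s, w, \<delta> s)) w0 w \<longrightarrow>
           (\<forall>t\<ge>0. \<forall>M. (\<forall>s\<in>{0..t}. norm (y s, \<delta> s) \<le> M) \<longrightarrow>
               norm (w t) \<le> \<beta> (norm w0) t + \<sigma> M)))"

lemma input_ok_loc_ess_bdd: "input_ok N u \<Longrightarrow> loc_ess_bdd u"
  unfolding input_ok_def loc_ess_bdd_def
  by (auto intro: measurable_restrict_space1 exI[of _ N])

lemma field_ok_h:
  fixes h :: "'y::euclidean_space \<times> 'w::euclidean_space \<times> 'd::euclidean_space \<Rightarrow> 'w"
  assumes "smooth h"
  shows "field_ok (\<lambda>w (y, \<delta>). h (y, w, \<delta>))"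
  unfolding field_ok_def
proof (intro conjI allI)
  have "continuous_on UNIV (\<lambda>p. h (fst (snd p), fst p, snd (snd p)))"
    by (intro continuous_on_compose2[OF smooth_continuous[OF assms, of UNIV]] continuous_intros) auto
  then show "continuous_on UNIV (\<lambda>(w, u). case u of (y, \<delta>) \<Rightarrow> h (y, w, \<delta>))"
    by (simp add: case_prod_beta)
  fix R :: real
  obtain L where L: "L > 0" "\<forall>x y. norm x \<le> R + (R + R) \<longrightarrow> norm y \<le> R + (R + R) \<longrightarrow> norm (h x - h y) \<le> L * norm (x - y)"
    using smooth_bounds_cball[OF assms, of "R + (R + R)"] by blast
  have "norm (h (y, x, \<delta>) - h (y, x', \<delta>)) \<le> L * norm (x - x')"
    if "norm x \<le> R" "norm x' \<le> R" "norm (y, \<delta>) \<le> R" for x x' y \<delta>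
  proof -
    have yd: "norm y \<le> R" "norm \<delta> \<le> R" using that(3) norm_fst_le[of y \<delta>] norm_snd_le[of \<delta> y] by linarith+
    have "norm (y, x'', \<delta>) \<le> R + (R + R)" if "norm x'' \<le> R" for x'' :: 'w
      using norm_Pair_le[of y "(x'', \<delta>)"] norm_Pair_le[of x'' \<delta>] yd that by linarith
    then have "norm (h (y, x, \<delta>) - h (y, x', \<delta>)) \<le> L * norm ((y, x, \<delta>) - (y, x', \<delta>))" using L(2) that by blast
    then show ?thesis by (simp add: norm_Pair)
  qed
  with L(1) show "\<exists>L>0. \<forall>x x' u. norm x \<le> R \<and> norm x' \<le> R \<and> norm u \<le> R \<longrightarrow>
      norm ((case u of (y, \<delta>) \<Rightarrow> h (y, x, \<delta>)) - (case u of (y, \<delta>) \<Rightarrow> h (y, x', \<delta>))) \<le> L * norm (x - x')"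
    by (intro exI[of _ L]) auto
qed

text \<open>(B1) concerns inputs on the half-line and the initial time 0. Here the input is extended
  beyond the interval and shifted by a; uniqueness identifies the solution supplied by (B1) with the
  given w on the interval. Only the inputs on [a, b] then enter M.\<close>

lemma ISS_sol_on:
  fixes h :: "'y::euclidean_space \<times> 'w::euclidean_space \<times> 'd::euclidean_space \<Rightarrow> 'w"
  assumes h: "smooth h" and iss: "ISS_bound h \<beta> \<sigma>" and \<delta>: "input_ok N \<delta>" and y: "continuous_on {0..T} y"
    and w: "sol_on T (\<lambda>s w. h (y s, w, \<delta> s)) w0 w" and ab: "0 \<le> a" "a \<le> b" "b \<le> T"
    and M: "\<And>s. s \<in> {a..b} \<Longrightarrow> norm (y s, \<delta> s) \<le> M"
  shows "norm (w b) \<le> \<beta> (norm (w a)) (b - a) + \<sigma> M"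
proof -
  let ?H = "\<lambda>w (y, \<delta>). h (y, w, \<delta>)"
  \<comment> \<open>Clamping the time freezes y outside [0, b], which gives a bounded measurable
    input on the half-line.\<close>
  define c where "c s = max 0 (min b s)" for s
  have c: "c s \<in> {0..b}" "s \<in> {0..b} \<Longrightarrow> c s = s" for s using ab by (auto simp: c_def)
  have rc: "c s \<in> {0..T}" for s using c(1)[of s] ab by auto
  have "continuous_on UNIV c" unfolding c_def by (intro continuous_intros)
  then have yc: "continuous_on UNIV (\<lambda>s. y (c s))"
    by (rule continuous_on_compose2[OF y]) (use rc in auto)
  obtain R where R: "\<And>s. s \<in> {0..b} \<Longrightarrow> norm (y s) \<le> R"
  proof -
    have "compact (y ` {0..b})" using y ab by (intro compact_continuous_image continuous_on_subset[OF y]) auto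
    then have "\<exists>R. \<forall>s\<in>{0..b}. norm (y s) \<le> R" by (metis bounded_iff compact_imp_bounded imageI)
    then show ?thesis using that by blast
  qed
  have ym: "input_ok R (\<lambda>s. y (c s))"
    unfolding input_ok_def using R c(1) continuous_imp_measurable_on_sets_lebesgue[OF yc] by (auto simp: lebesgue_on_UNIV_eq)
  let ?u = "\<lambda>s. (y (c s), \<delta> s)"
  have u: "input_ok (R + N) ?u"
    unfolding input_ok_def
  proof (intro conjI allI)
    show "?u \<in> borel_measurable lebesgue"
      using ym \<delta> unfolding input_ok_def by (intro borel_measurable_Pair) auto
    show "norm (?u s) \<le> R + N" for s
      using ym \<delta> norm_Pair_le[of "y (c s)" "\<delta> s"] unfolding input_ok_def by (meson add_mono order_trans)
  qed
  have wb: "sol_on b (\<lambda>s w. h (y s, w, \<delta> s)) w0 w" by (rule sol_on_mono[OF w ab(3)])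
  have "sol_on b (\<lambda>s w. ?H w (?u s)) w0 w"
    by (rule sol_on_cong[OF wb, of "{}"]) (use c(2) w in \<open>auto simp: sol_on_def\<close>)
  then have sh: "sol_on (b - a) (\<lambda>s w. ?H w (?u (a + s))) (w a) (\<lambda>s. w (a + s))"
    using field_ok_h[OF h] u ab by (intro sol_on_shift) (auto simp: field_ok_def)
  have le: "loc_ess_bdd (\<lambda>s. y (c (a + s)))" "loc_ess_bdd (\<lambda>s. \<delta> (a + s))"
    using input_ok_loc_ess_bdd[OF input_ok_shift[OF ym, of a]] input_ok_loc_ess_bdd[OF input_ok_shift[OF \<delta>, of a]] by auto
  obtain W where W: "cara_sol (\<lambda>s w. h (y (c (a + s)), w, \<delta> (a + s))) (w a) W"
    using iss le unfolding ISS_bound_def by blast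
  then have "sol_on (b - a) (\<lambda>s w. ?H w (?u (a + s))) (w a) W" using ab by (simp add: cara_sol_iff)
  then have eq: "w (a + (b - a)) = W (b - a)"
    using ab by (intro sol_on_unique[OF field_ok_h[OF h] input_ok_shift[OF u] sh]) auto
  have "\<forall>s\<in>{0..b - a}. norm (y (c (a + s)), \<delta> (a + s)) \<le> M"
    using M c(2) ab by auto
  then have "norm (W (b - a)) \<le> \<beta> (norm (w a)) (b - a) + \<sigma> M"
    using iss le W ab unfolding ISS_bound_def by (meson diff_ge_0_iff_ge)
  with eq show ?thesis by simp
qed

section \<open>The small-gain argument\<close>

text \<open>The factor 6 in \<open>V_dom\<close> is twice the factor 3 with which \<open>Kf\<close>
  enters the inequality for V, so the loop closes with gain 1/2.\<close>

locale small_gain =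
  fixes \<beta> :: "real \<Rightarrow> real \<Rightarrow> real" and \<sigma> Kf :: "real \<Rightarrow> real" and V :: "'y::euclidean_space \<Rightarrow> real" and c :: real
  assumes KL: "class_KL \<beta>" and Kinf: "class_Kinf \<sigma>" and Kf_mono: "mono_on {0..} Kf" and Kf_nonneg: "\<And>s. s \<ge> 0 \<Longrightarrow> Kf s \<ge> 0"
    and V_nonneg: "\<And>y. V y \<ge> 0" and V_rad: "rad_unbdd V" and V_cont: "continuous_on UNIV V" and c_nonneg: "c \<ge> 0"
    and V_dom: "\<And>y. 6 * Kf (2 * \<sigma> (2 * norm y)) \<le> V y + c"
begin

lemma beta_nonneg: "s \<ge> 0 \<Longrightarrow> t \<ge> 0 \<Longrightarrow> \<beta> s t \<ge> 0"
  and beta_mono: "0 \<le> s \<Longrightarrow> s \<le> s' \<Longrightarrow> t \<ge> 0 \<Longrightarrow> \<beta> s t \<le> \<beta> s' t"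
  and beta_antimono: "s \<ge> 0 \<Longrightarrow> 0 \<le> t \<Longrightarrow> t \<le> t' \<Longrightarrow> \<beta> s t' \<le> \<beta> s t"
  and beta_tendsto: "s \<ge> 0 \<Longrightarrow> (\<beta> s \<longlongrightarrow> 0) at_top"
proof -
  have m: "strict_mono_on {0..} (\<lambda>s. \<beta> s t)" "\<beta> 0 t = 0" if "t \<ge> 0" for t
    using KL that unfolding class_KL_def class_K_def by auto
  show mono: "\<beta> s t \<le> \<beta> s' t" if "0 \<le> s" "s \<le> s'" "t \<ge> 0" for s s' t
    using strict_mono_on_leD[OF m(1)[OF that(3)], of s s'] that by simp
  show "s \<ge> 0 \<Longrightarrow> t \<ge> 0 \<Longrightarrow> \<beta> s t \<ge> 0" for s t using mono[of 0 s t] m(2)[of t] by simp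
  show "s \<ge> 0 \<Longrightarrow> 0 \<le> t \<Longrightarrow> t \<le> t' \<Longrightarrow> \<beta> s t' \<le> \<beta> s t" for s t t'
    using KL unfolding class_KL_def monotone_on_def by auto
  show "s \<ge> 0 \<Longrightarrow> (\<beta> s \<longlongrightarrow> 0) at_top" for s
    using KL unfolding class_KL_def by (metis (no_types, lifting))
qed

lemma sigma_mono: "0 \<le> s \<Longrightarrow> s \<le> s' \<Longrightarrow> \<sigma> s \<le> \<sigma> s'" and sigma_nonneg: "s \<ge> 0 \<Longrightarrow> \<sigma> s \<ge> 0"
proof -
  have m: "strict_mono_on {0..} \<sigma>" "\<sigma> 0 = 0" using Kinf unfolding class_Kinf_def class_K_def by auto
  show mono: "0 \<le> s \<Longrightarrow> s \<le> s' \<Longrightarrow> \<sigma> s \<le> \<sigma> s'" for s s' using strict_mono_on_leD[OF m(1), of s s'] by simp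
  show "s \<ge> 0 \<Longrightarrow> \<sigma> s \<ge> 0" for s using mono[of 0 s] m(2) by simp
qed

lemma Kf_le: "0 \<le> s \<Longrightarrow> s \<le> t \<Longrightarrow> Kf s \<le> Kf t"
  using monotone_onD[OF Kf_mono, of s t] by simp

text \<open>Weak triangle inequality for a nondecreasing function: p + q is at most twice the larger
  summand.\<close>

lemma Kf_split: "0 \<le> p \<Longrightarrow> 0 \<le> q \<Longrightarrow> Kf (p + q) \<le> Kf (2 * p) + Kf (2 * q)"
  using Kf_le[of "p + q" "2 * p"] Kf_le[of "p + q" "2 * q"] Kf_nonneg[of "2 * p"] Kf_nonneg[of "2 * q"]
  by (cases "p \<le> q") auto

lemma Kf_gain:
  assumes "0 \<le> p" "0 \<le> Y" "0 \<le> D"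
  shows "Kf (p + \<sigma> (Y + D)) \<le> Kf (2 * p) + Kf (2 * \<sigma> (2 * Y)) + Kf (2 * \<sigma> (2 * D))"
proof -
  have "Kf (2 * \<sigma> (Y + D)) \<le> Kf (2 * \<sigma> (2 * Y)) + Kf (2 * \<sigma> (2 * D))"
  proof (cases "Y \<le> D")
    case True
    then have "Kf (2 * \<sigma> (Y + D)) \<le> Kf (2 * \<sigma> (2 * D))"
      using assms by (intro Kf_le mult_left_mono sigma_mono mult_nonneg_nonneg sigma_nonneg) auto
    then show ?thesis using Kf_nonneg[of "2 * \<sigma> (2 * Y)"] sigma_nonneg[of "2 * Y"] assms by simp
  next
    case False
    then have "Kf (2 * \<sigma> (Y + D)) \<le> Kf (2 * \<sigma> (2 * Y))"
      using assms by (intro Kf_le mult_left_mono sigma_mono mult_nonneg_nonneg sigma_nonneg) auto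
    then show ?thesis using Kf_nonneg[of "2 * \<sigma> (2 * D)"] sigma_nonneg[of "2 * D"] assms by simp
  qed
  moreover have "Kf (p + \<sigma> (Y + D)) \<le> Kf (2 * p) + Kf (2 * \<sigma> (Y + D))"
    using assms by (intro Kf_split sigma_nonneg) auto
  ultimately show ?thesis by linarith
qed

lemma V_sublevel: "\<exists>\<rho>\<ge>0. \<forall>y. V y \<le> M \<longrightarrow> norm y \<le> \<rho>"
proof -
  have "bounded {y. V y \<le> M}" using V_rad unfolding rad_unbdd_def by (blast intro: compact_imp_bounded)
  then obtain \<rho> where "\<rho> > 0" "\<forall>y\<in>{y. V y \<le> M}. norm y \<le> \<rho>" using bounded_pos by blast
  then show ?thesis by (intro exI[of _ \<rho>]) auto
qed

text \<open>The only facts about the closed loop that the small-gain argument sees: the scalar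
  inequality for V with constant disturbance term E, and the ISS estimate restarted at an arbitrary
  time a, with D bounding the external input.\<close>

definition traj :: "real \<Rightarrow> real \<Rightarrow> real \<Rightarrow> (real \<Rightarrow> 'y) \<Rightarrow> (real \<Rightarrow> 'w::real_normed_vector) \<Rightarrow> bool" where
  "traj T E D y w \<longleftrightarrow> 0 \<le> E \<and> 0 \<le> D \<and> continuous_on {0..T} y \<and>
    (\<forall>s. 0 \<le> s \<and> s < T \<longrightarrow> dini_le (\<lambda>t. V (y t)) T s (E + 3 * Kf (norm (w s)) - V (y s))) \<and>
    (\<forall>a b Y. 0 \<le> a \<and> a \<le> b \<and> b \<le> T \<and> (\<forall>s\<in>{a..b}. norm (y s) \<le> Y) \<longrightarrow>
       norm (w b) \<le> \<beta> (norm (w a)) (b - a) + \<sigma> (Y + D))"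

lemma traj_restrict: "traj T E D y w \<Longrightarrow> S \<le> T \<Longrightarrow> traj S E D y w"
  unfolding traj_def by (auto intro: continuous_on_subset dini_le_restrict)

text \<open>The maximum of |y| over [a, s] is attained, and \<open>V_dom\<close> at that point turns
  the gain term into (V + c) / 2. The number p stands for whatever is left of the transient since
  the restart at a.\<close>

lemma traj_w:
  assumes t: "traj T E D y w" and s: "0 \<le> a" "a \<le> s" "s \<le> T" and S: "\<And>r. r \<in> {a..s} \<Longrightarrow> V (y r) \<le> S"
    and p: "\<beta> (norm (w a)) (s - a) \<le> p"
  shows "3 * Kf (norm (w s)) \<le> 3 * Kf (2 * p) + 3 * Kf (2 * \<sigma> (2 * D)) + (S + c) / 2"
proof -
  have "continuous_on {a..s} (\<lambda>r. norm (y r))"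
    using t s unfolding traj_def by (intro continuous_intros) (auto intro: continuous_on_subset)
  then obtain s1 where s1: "s1 \<in> {a..s}" "\<forall>r\<in>{a..s}. norm (y r) \<le> norm (y s1)"
    using continuous_attains_sup[of "{a..s}"] s by fastforce
  have D: "D \<ge> 0" using t by (simp add: traj_def)
  have "norm (w s) \<le> \<beta> (norm (w a)) (s - a) + \<sigma> (norm (y s1) + D)"
    using t s s1(2) unfolding traj_def by blast
  also have "\<dots> \<le> p + \<sigma> (norm (y s1) + D)" using p by simp
  finally have "Kf (norm (w s)) \<le> Kf (p + \<sigma> (norm (y s1) + D))" by (intro Kf_le) auto
  also have "\<dots> \<le> Kf (2 * p) + Kf (2 * \<sigma> (2 * norm (y s1))) + Kf (2 * \<sigma> (2 * D))"
    using p beta_nonneg[of "norm (w a)" "s - a"] s D by (intro Kf_gain) auto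
  finally have 1: "Kf (norm (w s)) \<le> Kf (2 * p) + Kf (2 * \<sigma> (2 * norm (y s1))) + Kf (2 * \<sigma> (2 * D))" .
  have "6 * Kf (2 * \<sigma> (2 * norm (y s1))) \<le> S + c" using V_dom[of "y s1"] S[OF s1(1)] by linarith
  then have "3 * Kf (2 * \<sigma> (2 * norm (y s1))) \<le> (S + c) / 2" by simp
  moreover have "3 * Kf (norm (w s)) \<le> 3 * Kf (2 * p) + 3 * Kf (2 * \<sigma> (2 * norm (y s1))) + 3 * Kf (2 * \<sigma> (2 * D))"
    using mult_left_mono[OF 1, of 3] by (simp only: distrib_left)
  ultimately show ?thesis by linarith
qed

text \<open>Above the level E + m + 1 the inequality forces V to fall at unit rate; the extra 1 is
  what makes the time of descent explicit.\<close>

lemma traj_V: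
  assumes t: "traj T E D y w" and ab: "0 \<le> a" "a \<le> b" "b \<le> T" and m: "\<And>s. s \<in> {a..b} \<Longrightarrow> 3 * Kf (norm (w s)) \<le> m"
  shows "V (y b) \<le> max (E + m + 1) (V (y a) - (b - a))"
proof -
  have "V (y b) \<le> max (E + m + 1) (V (y a) - 1 * (b - a))"
  proof (rule dini_barrier)
    have "continuous_on {a..b} y" using t ab unfolding traj_def by (auto intro: continuous_on_subset)
    then show "continuous_on {a..b} (\<lambda>t. V (y t))" by (rule continuous_on_compose2[OF V_cont]) auto
    fix s assume s: "a \<le> s" "s < b" "E + m + 1 \<le> V (y s)"
    have "dini_le (\<lambda>t. V (y t)) T s (E + 3 * Kf (norm (w s)) - V (y s))"
      using t s ab unfolding traj_def by simp
    moreover have "E + 3 * Kf (norm (w s)) - V (y s) \<le> - 1" using m[of s] s by simp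
    ultimately show "dini_le (\<lambda>t. V (y t)) b s (- 1)" using dini_le_mono dini_le_restrict ab(3) by blast
  qed (use ab in auto)
  then show ?thesis by simp
qed

text \<open>Let S be the maximum of V up to T. Either S <= R, or S <= E + q + (S + c) / 2 + 1 with q
  collecting the transient and the input; absorbing S / 2 on the left bounds S independently of
  T.\<close>

lemma traj_bounded:
  assumes "R \<ge> 0" "E \<ge> 0" "D \<ge> 0"
  shows "\<exists>M\<ge>0. \<forall>T y (w::real \<Rightarrow> 'w::real_normed_vector). T \<ge> 0 \<and> traj T E D y w \<and> V (y 0) \<le> R \<and> norm (w 0) \<le> R \<longrightarrow>
    V (y T) \<le> M \<and> norm (w T) \<le> M"
proof -
  define q where "q = 3 * Kf (2 * \<beta> R 0) + 3 * Kf (2 * \<sigma> (2 * D))"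
  define M1 where "M1 = 2 * (E + 1 + q + R) + c"
  obtain \<rho> where \<rho>: "\<rho> \<ge> 0" "\<And>y. V y \<le> M1 \<Longrightarrow> norm y \<le> \<rho>" using V_sublevel by blast
  define M where "M = max M1 (\<beta> R 0 + \<sigma> (\<rho> + D))"
  have "V (y T) \<le> M \<and> norm (w T) \<le> M"
    if T: "T \<ge> 0" and t: "traj T E D y w" and i: "V (y 0) \<le> R" "norm (w 0) \<le> R" for T y and w :: "real \<Rightarrow> 'w"
  proof -
    have "continuous_on {0..T} y" using t unfolding traj_def by auto
    then have "continuous_on {0..T} (\<lambda>t. V (y t))" by (rule continuous_on_compose2[OF V_cont]) auto
    then obtain s0 where s0: "s0 \<in> {0..T}" "\<forall>s\<in>{0..T}. V (y s) \<le> V (y s0)"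
      using continuous_attains_sup[of "{0..T}"] T by fastforce
    define S where "S = V (y s0)"
    have b: "\<beta> (norm (w 0)) s \<le> \<beta> R 0" if "s \<ge> 0" for s
    proof -
      have "\<beta> (norm (w 0)) s \<le> \<beta> R s" using i that by (intro beta_mono) auto
      also have "\<dots> \<le> \<beta> R 0" using assms that by (intro beta_antimono) auto
      finally show ?thesis .
    qed
    have "3 * Kf (norm (w s)) \<le> q + (S + c) / 2" if "s \<in> {0..s0}" for s
      unfolding q_def S_def using that s0 b by (intro traj_w[OF t, of 0]) auto
    then have "V (y s0) \<le> max (E + (q + (S + c) / 2) + 1) (V (y 0) - (s0 - 0))"
      using s0(1) by (intro traj_V[OF t]) auto
    moreover have "q \<ge> 0" unfolding q_def using assms
      by (intro add_nonneg_nonneg mult_nonneg_nonneg Kf_nonneg beta_nonneg sigma_nonneg) auto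
    moreover have "S \<ge> 0" unfolding S_def by (rule V_nonneg)
    moreover have "0 \<le> s0" using s0(1) by simp
    ultimately have "S \<le> M1"
    proof (cases "S \<le> E + (q + (S + c) / 2) + 1")
      case True
      then have "S \<le> 2 * E + 2 * q + c + 2" by (simp add: field_simps)
      then show ?thesis unfolding M1_def using assms by simp
    next
      case False
      assume *: "V (y s0) \<le> max (E + (q + (S + c) / 2) + 1) (V (y 0) - (s0 - 0))" "0 \<le> q" "0 \<le> s0"
      then have "S \<le> R" using False i unfolding S_def by (auto simp: le_max_iff_disj)
      then show ?thesis unfolding M1_def using assms c_nonneg * by (simp add: algebra_simps)
    qed
    then have VM: "V (y s) \<le> M1" if "s \<in> {0..T}" for s using s0(2) that unfolding S_def by force
    have "norm (w T) \<le> \<beta> (norm (w 0)) (T - 0) + \<sigma> (\<rho> + D)"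
      using t T \<rho>(2)[OF VM] unfolding traj_def by blast
    also have "\<dots> \<le> \<beta> R 0 + \<sigma> (\<rho> + D)" using b[of T] T by simp
    finally show ?thesis using VM[of T] T by (auto simp: M_def le_max_iff_disj)
  qed
  moreover have "M \<ge> 0"
    unfolding M_def using assms \<rho>(1) by (intro max.coboundedI2 add_nonneg_nonneg beta_nonneg sigma_nonneg) auto
  ultimately show ?thesis by blast
qed

text \<open>Restarting after a fixed time replaces a bound L on V by L / 2 + q, a contraction with
  fixed point 2 q. Finitely many restarts bring V below 2 q + 1. The initial level R influences only
  the number and length of the restarts, not Z.\<close>

lemma traj_converge:
  assumes "E \<ge> 0" "D \<ge> 0"
  shows "\<exists>Z\<ge>0. \<forall>R\<ge>0. \<exists>\<tau>\<ge>0. \<forall>T y (w::real \<Rightarrow> 'w::real_normed_vector). T \<ge> \<tau> \<and> traj T E D y w \<and> V (y 0) \<le> R \<and> norm (w 0) \<le> R \<longrightarrow>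
    V (y T) \<le> Z \<and> norm (w T) \<le> Z"
proof -
  define q where "q = E + 1 + 3 * Kf 2 + 3 * Kf (2 * \<sigma> (2 * D)) + c / 2"
  have q: "q \<ge> 0" unfolding q_def using assms c_nonneg
    by (intro add_nonneg_nonneg mult_nonneg_nonneg Kf_nonneg sigma_nonneg) auto
  obtain \<rho> where \<rho>: "\<rho> \<ge> 0" "\<And>y. V y \<le> 2 * q + 1 \<Longrightarrow> norm y \<le> \<rho>" using V_sublevel by blast
  define Z where "Z = max (2 * q + 1) (1 + \<sigma> (\<rho> + D))"
  have "\<exists>\<tau>\<ge>0. \<forall>T y (w::real \<Rightarrow> 'w). T \<ge> \<tau> \<and> traj T E D y w \<and> V (y 0) \<le> R \<and> norm (w 0) \<le> R \<longrightarrow>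
    V (y T) \<le> Z \<and> norm (w T) \<le> Z" if R: "R \<ge> 0" for R
  proof -
    obtain M where M: "M \<ge> 0" "\<And>T y (w::real \<Rightarrow> 'w). T \<ge> 0 \<Longrightarrow> traj T E D y w \<Longrightarrow> V (y 0) \<le> R \<Longrightarrow> norm (w 0) \<le> R \<Longrightarrow>
        V (y T) \<le> M \<and> norm (w T) \<le> M"
      using traj_bounded[OF R assms, where 'w = 'w] by blast
    have "\<forall>\<^sub>F t in at_top. \<beta> M t < 1"
      using beta_tendsto[OF M(1)] by (rule order_tendstoD) simp
    then obtain N where N: "\<And>t. t \<ge> N \<Longrightarrow> \<beta> M t < 1" unfolding eventually_at_top_linorder by blast
    define T1 where "T1 = max N 0"
    have T1: "T1 \<ge> 0" "\<And>t. t \<ge> T1 \<Longrightarrow> \<beta> M t \<le> 1" using N by (auto simp: T1_def less_imp_le)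
    \<comment> \<open>The time T1 lets the ISS transient fall to 1; the further time M lets V, which
      is at most M, descend at unit rate to the barrier level.\<close>
    define \<tau>1 where "\<tau>1 = T1 + M"
    have \<tau>1: "\<tau>1 \<ge> 0" using T1 M by (simp add: \<tau>1_def)
    obtain n :: nat where n: "M / 2 ^ n \<le> 1"
    proof -
      obtain n :: nat where n: "M < real n" using reals_Archimedean2 by blast
      have "real n < 2 ^ n" by (rule of_nat_less_two_power)
      then have "M \<le> 2 ^ n" using n by linarith
      then have "M / 2 ^ n \<le> 1" by simp
      then show ?thesis using that by blast
    qed
    have main: "V (y T) \<le> Z \<and> norm (w T) \<le> Z"
      if T: "T \<ge> real n * \<tau>1 + T1" and t: "traj T E D y w" and i: "V (y 0) \<le> R" "norm (w 0) \<le> R" for T y and w :: "real \<Rightarrow> 'w"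
    proof -
      have bM: "V (y s) \<le> M" "norm (w s) \<le> M" if "0 \<le> s" "s \<le> T" for s
        using M(2)[OF _ traj_restrict[OF t] i, of s] that by auto
      have bw: "\<beta> (norm (w a)) (s - a) \<le> 1" if "0 \<le> a" "a + T1 \<le> s" "s \<le> T" for a s
      proof -
        have "\<beta> (norm (w a)) (s - a) \<le> \<beta> M (s - a)" using bM[of a] that T1 by (intro beta_mono) auto
        also have "\<dots> \<le> 1" using that by (intro T1) auto
        finally show ?thesis .
      qed
      have step: "V (y s) \<le> L / 2 + q" if L: "\<And>r. a \<le> r \<Longrightarrow> r \<le> T \<Longrightarrow> V (y r) \<le> L" and as: "0 \<le> a" "a + \<tau>1 \<le> s" "s \<le> T" for a s L
      proof -
        define a' where "a' = a + T1"
        have a': "0 \<le> a'" "a' + M \<le> s" using as T1 by (auto simp: a'_def \<tau>1_def)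
        define m where "m = 3 * Kf (2 * 1) + 3 * Kf (2 * \<sigma> (2 * D)) + (L + c) / 2"
        have "3 * Kf (norm (w r)) \<le> m" if "r \<in> {a'..s}" for r
          unfolding m_def using that as T1 L bw[of a r] by (intro traj_w[OF t, of a]) (auto simp: a'_def)
        then have "V (y s) \<le> max (E + m + 1) (V (y a') - (s - a'))"
          using a' as M by (intro traj_V[OF t]) auto
        moreover have "V (y a') - (s - a') \<le> 0" using bM[of a'] a' as M by simp
        moreover have "E + m + 1 = L / 2 + q" by (simp add: m_def q_def add_divide_distrib)
        moreover have "V (y s) \<ge> 0" by (rule V_nonneg)
        moreover have "L / 2 + q \<ge> 0"
        proof -
          have "L \<ge> 0" using L[of s] as \<tau>1 V_nonneg[of "y s"] by simp
          then show ?thesis using q by simp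
        qed
        ultimately show ?thesis by (simp add: max_def split: if_splits)
      qed
      have iter: "\<forall>s. real j * \<tau>1 \<le> s \<and> s \<le> T \<longrightarrow> V (y s) \<le> M / 2 ^ j + 2 * q" for j
      proof (induction j)
        case 0
        have "V (y s) \<le> M + 2 * q" if "0 \<le> s" "s \<le> T" for s using bM(1)[OF that] q by simp
        then show ?case by simp
      next
        case (Suc j)
        have "V (y s) \<le> M / 2 ^ Suc j + 2 * q" if s: "real (Suc j) * \<tau>1 \<le> s" "s \<le> T" for s
        proof -
          have "V (y s) \<le> (M / 2 ^ j + 2 * q) / 2 + q"
            using Suc s \<tau>1 by (intro step[of "real j * \<tau>1"]) (auto simp: algebra_simps)
          then show ?thesis by (simp add: add_divide_distrib)
        qed
        then show ?case by blast
      qed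
      define a where "a = real n * \<tau>1"
      have a: "0 \<le> a" "a + T1 \<le> T" using \<tau>1 T by (auto simp: a_def)
      have VT: "V (y s) \<le> 2 * q + 1" if "a \<le> s" "s \<le> T" for s
      proof -
        have "V (y s) \<le> M / 2 ^ n + 2 * q" using iter[of n] that unfolding a_def by blast
        then show ?thesis using n by linarith
      qed
      have "norm (w T) \<le> \<beta> (norm (w a)) (T - a) + \<sigma> (\<rho> + D)"
      proof -
        have "\<forall>s\<in>{a..T}. norm (y s) \<le> \<rho>" using VT \<rho>(2) by auto
        then show ?thesis using t a T1 unfolding traj_def by (smt (verit))
      qed
      also have "\<dots> \<le> 1 + \<sigma> (\<rho> + D)" using bw[of a T] a by simp
      finally show ?thesis using VT[of T] a T1 by (auto simp: Z_def le_max_iff_disj)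
    qed
    have "real n * \<tau>1 + T1 \<ge> 0" using \<tau>1 T1 by simp
    then show ?thesis using main by blast
  qed
  moreover have "Z \<ge> 0" using q by (simp add: Z_def le_max_iff_disj)
  ultimately show ?thesis by blast
qed

end

section \<open>The high-gain feedback estimate\<close>

lemma young:
  fixes p q E :: real
  assumes "E > 0" shows "p * q \<le> E * p\<^sup>2 / 4 + q\<^sup>2 / E"
proof -
  have "0 \<le> (E * p / 2 - q)\<^sup>2 / E" using assms by simp
  also have "\<dots> = E * p\<^sup>2 / 4 + q\<^sup>2 / E - p * q" using assms by (simp add: power2_eq_square field_simps)
  finally show ?thesis by simp
qed

text \<open>With \<open>e = a / P\<close>, the high gain \<open>E = P\<^sup>3 / (a\<^sup>3 \<beta>\<^sup>2)\<close> satisfies \<open>1 / E \<le> e\<^sup>3\<close>, which absorbs all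
  products of \<open>x\<close> with the disturbances into \<open>e\<close> times powers of the disturbances.\<close>

lemma high_gain_estimate:
  fixes x :: real
  assumes a: "0 < a" "a \<le> 1" and bt: "0 < bt" "bt \<le> 1" and P: "P \<ge> 1" and C: "C \<ge> 1" and mu: "\<mu> \<ge> 0"
    and n: "A0 \<ge> 0" "F0 \<ge> 0" "\<kappa> \<ge> 0" "dn \<ge> 0" "S \<ge> 0"
    and F: "\<bar>pF\<bar> \<le> (F0 + sqrt \<mu> * \<kappa>) * (P + S)" and A: "\<bar>pA\<bar> \<le> (A0 + sqrt \<mu> * \<kappa>) * dn"
  shows "(- (C * \<mu>\<^sup>2 * P ^ 3 / (a ^ 3 * bt\<^sup>2) * x ^ 3) - C * (A0\<^sup>2 + F0\<^sup>2 + \<mu> + 1) * P ^ 3 / (a ^ 3 * bt\<^sup>2) * x + pF + pA) * x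
    \<le> a / P * (1 + S\<^sup>2 + S ^ 4 + dn\<^sup>2 + dn ^ 4 + 3 * \<kappa>\<^sup>2)"
proof -
  define E where "E = P ^ 3 / (a ^ 3 * bt\<^sup>2)"
  define e where "e = a / P"
  define m where "m = sqrt \<mu> * \<bar>x\<bar>"
  have e: "0 < e" "e \<le> 1" using a P by (auto simp: e_def divide_le_eq_1)
  have E: "E > 0" using a bt P by (simp add: E_def)
  have "1 / E = e ^ 3 * bt\<^sup>2" using a P bt by (simp add: E_def e_def power_divide)
  also have "\<dots> \<le> e ^ 3 * 1" using e bt by (intro mult_left_mono) (auto simp: power_le_one)
  finally have E3: "1 / E \<le> e ^ 3" by simp
  have "e ^ 3 \<le> e" using e power_decreasing[of 1 3 e] by simp
  then have E1: "1 / E \<le> e" using E3 by linarith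
  have div: "t / E \<le> e * t" if "t \<ge> 0" for t using mult_right_mono[OF E1 that] by simp
  \<comment> \<open>Here the cube of P in the gain matters: P^2 / E <= P^2 e^3 = a^2 e, so a full
    factor e survives although P enters squared.\<close>
  have EP: "(P * t)\<^sup>2 / E \<le> e * t\<^sup>2" for t
  proof -
    have "P\<^sup>2 * (1 / E) \<le> P\<^sup>2 * e ^ 3" using E3 by (intro mult_left_mono) auto
    also have "\<dots> = a\<^sup>2 * e" using P by (simp add: e_def power2_eq_square power3_eq_cube)
    also have "\<dots> \<le> 1 * e" using a e by (intro mult_right_mono) (auto simp: power_le_one)
    finally have "t\<^sup>2 * (P\<^sup>2 * (1 / E)) \<le> t\<^sup>2 * e" by (intro mult_left_mono) auto
    then show ?thesis by (simp add: power_mult_distrib mult_ac)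
  qed
  have m2: "m\<^sup>2 = \<mu> * x\<^sup>2" using mu by (simp add: m_def power_mult_distrib)
  have E4: "1 / e ^ 3 \<le> E"
  proof -
    have "1 \<le> e ^ 3 * E" using E3 E by (simp add: pos_divide_le_eq)
    then show ?thesis using e by (simp add: pos_divide_le_eq mult.commute)
  qed
  \<comment> \<open>Young's inequality twice: first \<kappa> against m t, then m^2 against t^2. The
    second use leaves m^4 / (64 e^3), and 1 / e^3 <= E lets the cubic part of the feedback absorb
    it.\<close>
  have quartic: "m * \<kappa> * t \<le> e * \<kappa>\<^sup>2 + e * t ^ 4 + E * (\<mu>\<^sup>2 * x ^ 4) / 64" if "t \<ge> 0" for t
  proof -
    have 1: "m * t * \<kappa> \<le> (1 / e) * (m * t)\<^sup>2 / 4 + \<kappa>\<^sup>2 / (1 / e)" by (rule young) (use e in auto)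
    have 2: "(m\<^sup>2 / (4 * e)) * t\<^sup>2 \<le> (1 / e) * (m\<^sup>2 / (4 * e))\<^sup>2 / 4 + (t\<^sup>2)\<^sup>2 / (1 / e)" by (rule young) (use e in auto)
    have "(1 / e) * (m\<^sup>2 / (4 * e))\<^sup>2 / 4 = (1 / e ^ 3) * (\<mu>\<^sup>2 * x ^ 4) / 64"
      unfolding m2 by (simp add: power2_eq_square power3_eq_cube power4_eq_xxxx mult_ac)
    also have "\<dots> \<le> E * (\<mu>\<^sup>2 * x ^ 4) / 64" using E4 by (intro divide_right_mono mult_right_mono) auto
    finally have 3: "(1 / e) * (m\<^sup>2 / (4 * e))\<^sup>2 / 4 \<le> E * (\<mu>\<^sup>2 * x ^ 4) / 64" .
    have 4: "(1 / e) * (m * t)\<^sup>2 / 4 = (m\<^sup>2 / (4 * e)) * t\<^sup>2" by (simp add: power_mult_distrib)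
    have 5: "(t\<^sup>2)\<^sup>2 / (1 / e) = e * t ^ 4" "\<kappa>\<^sup>2 / (1 / e) = e * \<kappa>\<^sup>2" by (simp_all add: power_mult[symmetric])
    have "m * \<kappa> * t = m * t * \<kappa>" by simp
    then show ?thesis using 1 2 3 unfolding 4 5 by linarith
  qed
  let ?y = "\<bar>x\<bar>"
  have t1: "F0 * ?y * P \<le> E * (F0\<^sup>2 * x\<^sup>2) / 4 + e"
    using young[OF E, of "F0 * ?y" P] EP[of 1] by (simp add: power_mult_distrib)
  have t2: "F0 * ?y * S \<le> E * (F0\<^sup>2 * x\<^sup>2) / 4 + e * S\<^sup>2"
    using young[OF E, of "F0 * ?y" S] div[of "S\<^sup>2"] by (simp add: power_mult_distrib)
  have t3: "m * (P * \<kappa>) \<le> E * (\<mu> * x\<^sup>2) / 4 + e * \<kappa>\<^sup>2"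
    using young[OF E, of m "P * \<kappa>"] EP[of \<kappa>] m2 by simp
  have t4: "m * \<kappa> * S \<le> e * \<kappa>\<^sup>2 + e * S ^ 4 + E * (\<mu>\<^sup>2 * x ^ 4) / 64" by (rule quartic[OF n(5)])
  have t5: "A0 * ?y * dn \<le> E * (A0\<^sup>2 * x\<^sup>2) / 4 + e * dn\<^sup>2"
    using young[OF E, of "A0 * ?y" dn] div[of "dn\<^sup>2"] by (simp add: power_mult_distrib)
  have t6: "m * \<kappa> * dn \<le> e * \<kappa>\<^sup>2 + e * dn ^ 4 + E * (\<mu>\<^sup>2 * x ^ 4) / 64" by (rule quartic[OF n(4)])
  have "pF * x \<le> \<bar>pF\<bar> * ?y" by (metis abs_ge_self abs_mult)
  also have "\<dots> \<le> (F0 + sqrt \<mu> * \<kappa>) * (P + S) * ?y" by (rule mult_right_mono[OF F]) simp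
  also have "\<dots> = F0 * ?y * P + F0 * ?y * S + m * (P * \<kappa>) + m * \<kappa> * S" by (simp add: m_def algebra_simps)
  finally have pF: "pF * x \<le> F0 * ?y * P + F0 * ?y * S + m * (P * \<kappa>) + m * \<kappa> * S" .
  have "pA * x \<le> \<bar>pA\<bar> * ?y" by (metis abs_ge_self abs_mult)
  also have "\<dots> \<le> (A0 + sqrt \<mu> * \<kappa>) * dn * ?y" by (rule mult_right_mono[OF A]) simp
  also have "\<dots> = A0 * ?y * dn + m * \<kappa> * dn" by (simp add: m_def algebra_simps)
  finally have pA: "pA * x \<le> A0 * ?y * dn + m * \<kappa> * dn" .
  define Q2 where "Q2 = E * ((A0\<^sup>2 + F0\<^sup>2 + \<mu> + 1) * x\<^sup>2)"
  define Q4 where "Q4 = E * (\<mu>\<^sup>2 * x ^ 4)"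
  have Q: "Q2 \<ge> 0" "Q4 \<ge> 0" using E mu by (auto simp: Q2_def Q4_def)
  have "E * (F0\<^sup>2 * x\<^sup>2) / 4 + E * (F0\<^sup>2 * x\<^sup>2) / 4 + E * (\<mu> * x\<^sup>2) / 4 + E * (A0\<^sup>2 * x\<^sup>2) / 4 \<le> Q2"
  proof -
    have "0 \<le> E * (F0\<^sup>2 * x\<^sup>2)" "0 \<le> E * (\<mu> * x\<^sup>2)" "0 \<le> E * (A0\<^sup>2 * x\<^sup>2)" "0 \<le> E * x\<^sup>2" using E mu by auto
    moreover have "Q2 = E * (A0\<^sup>2 * x\<^sup>2) + E * (F0\<^sup>2 * x\<^sup>2) + E * (\<mu> * x\<^sup>2) + E * x\<^sup>2" by (simp add: Q2_def algebra_simps)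
    ultimately show ?thesis by linarith
  qed
  then have "pF * x + pA * x \<le> Q2 + Q4 + e * (1 + S\<^sup>2 + S ^ 4 + dn\<^sup>2 + dn ^ 4 + 3 * \<kappa>\<^sup>2)"
    using pF pA t1 t2 t3 t4 t5 t6 Q(2) unfolding Q4_def by (simp add: distrib_left)
  moreover have "Q2 + Q4 \<le> C * (Q2 + Q4)" using C Q mult_right_mono[of 1 C "Q2 + Q4"] by simp
  moreover have "(- (C * \<mu>\<^sup>2 * P ^ 3 / (a ^ 3 * bt\<^sup>2) * x ^ 3) - C * (A0\<^sup>2 + F0\<^sup>2 + \<mu> + 1) * P ^ 3 / (a ^ 3 * bt\<^sup>2) * x + pF + pA) * x
    = - (C * (Q2 + Q4)) + (pF * x + pA * x)"
  proof -
    have "C * \<mu>\<^sup>2 * P ^ 3 / (a ^ 3 * bt\<^sup>2) = C * \<mu>\<^sup>2 * E"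
      "C * (A0\<^sup>2 + F0\<^sup>2 + \<mu> + 1) * P ^ 3 / (a ^ 3 * bt\<^sup>2) = C * (A0\<^sup>2 + F0\<^sup>2 + \<mu> + 1) * E"
      by (simp_all add: E_def)
    then show ?thesis unfolding Q2_def Q4_def
      by (simp only:) (simp add: algebra_simps power2_eq_square power3_eq_cube power4_eq_xxxx)
  qed
  ultimately show ?thesis unfolding e_def by linarith
qed

section \<open>The closed loop\<close>

lemma smooth_Pair:
  fixes f :: "'a::euclidean_space \<Rightarrow> 'b::euclidean_space" and g :: "'a \<Rightarrow> 'c::euclidean_space"
  assumes "smooth f" "smooth g" shows "smooth (\<lambda>x. (f x, g x))"
proof -
  have "bounded_linear (\<lambda>a::'b. (a, 0::'c))" "bounded_linear (\<lambda>b::'c. (0::'b, b))"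
    by (intro bounded_linear_Pair bounded_linear_ident bounded_linear_zero)+
  then have "smooth (\<lambda>x. (f x, 0::'c))" "smooth (\<lambda>x. (0::'b, g x))"
    using smooth_compose[OF smooth_linear assms(1)] smooth_compose[OF smooth_linear assms(2)] by blast+
  from smooth_add[OF this] show ?thesis by simp
qed

lemma smooth_fst:
  fixes f :: "'a::euclidean_space \<Rightarrow> 'b::euclidean_space \<times> 'c::euclidean_space"
  shows "smooth f \<Longrightarrow> smooth (\<lambda>x. fst (f x))"
  by (rule smooth_compose[OF smooth_linear[OF bounded_linear_fst]])

lemma smooth_snd:
  fixes f :: "'a::euclidean_space \<Rightarrow> 'b::euclidean_space \<times> 'c::euclidean_space"
  shows "smooth f \<Longrightarrow> smooth (\<lambda>x. snd (f x))"
  by (rule smooth_compose[OF smooth_linear[OF bounded_linear_snd]])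

text \<open>The positive part in the equation of z is Lipschitz but not smooth, so the closed loop
  is split into a smooth field plus a positive part times a smooth field.\<close>

lemma field_ok_pos_part:
  fixes S1 :: "'s::euclidean_space \<times> 'u::euclidean_space \<Rightarrow> 's" and S2 :: "'s \<Rightarrow> real" and S3 :: "'s \<Rightarrow> 's"
  assumes S1: "smooth S1" and S2: "smooth S2" and S3: "smooth S3"
  shows "field_ok (\<lambda>x u. S1 (x, u) + pos_part (S2 x) *\<^sub>R S3 x)"
  unfolding field_ok_def
proof (intro conjI allI)
  have "continuous_on UNIV (\<lambda>p. S1 p + pos_part (S2 (fst p)) *\<^sub>R S3 (fst p))"
    unfolding pos_part_def
    by (intro continuous_intros smooth_continuous[OF S1] continuous_on_compose2[OF smooth_continuous[OF S2, of UNIV]]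
        continuous_on_compose2[OF smooth_continuous[OF S3, of UNIV]]) auto
  then show "continuous_on UNIV (\<lambda>(x, u). S1 (x, u) + pos_part (S2 x) *\<^sub>R S3 x)" by (simp add: case_prod_beta)
  fix R :: real
  obtain L1 where L1: "L1 > 0" "\<forall>x y. norm x \<le> R + R \<longrightarrow> norm y \<le> R + R \<longrightarrow> norm (S1 x - S1 y) \<le> L1 * norm (x - y)"
    using smooth_bounds_cball[OF S1, of "R + R"] by blast
  obtain L2 where L2: "L2 > 0" "\<forall>x y. norm x \<le> R \<longrightarrow> norm y \<le> R \<longrightarrow> norm (S2 x - S2 y) \<le> L2 * norm (x - y)"
    using smooth_bounds_cball[OF S2, of R] by blast
  obtain L3 where L3: "L3 > 0" "\<forall>x y. norm x \<le> R \<longrightarrow> norm y \<le> R \<longrightarrow> norm (S3 x - S3 y) \<le> L3 * norm (x - y)"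
    using smooth_bounds_cball[OF S3, of R] by blast
  obtain B2 where B2: "B2 > 0" "\<forall>x. norm x \<le> R \<longrightarrow> norm (S2 x) \<le> B2"
    using continuous_bounded_cball[OF smooth_continuous[OF S2], of R] by blast
  obtain B3 where B3: "B3 > 0" "\<forall>x. norm x \<le> R \<longrightarrow> norm (S3 x) \<le> B3"
    using continuous_bounded_cball[OF smooth_continuous[OF S3], of R] by blast
  have "norm ((S1 (x, u) + pos_part (S2 x) *\<^sub>R S3 x) - (S1 (x', u) + pos_part (S2 x') *\<^sub>R S3 x'))
      \<le> (L1 + L2 * B3 + B2 * L3) * norm (x - x')"
    if "norm x \<le> R" "norm x' \<le> R" "norm u \<le> R" for x x' u
  proof -
    have n: "norm (x'', u) \<le> R + R" if "norm x'' \<le> R" for x''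
      using norm_Pair_le[of x'' u] that \<open>norm u \<le> R\<close> by linarith
    have "norm (S1 (x, u) - S1 (x', u)) \<le> L1 * norm ((x, u) - (x', u))" using L1(2) n that by blast
    then have 1: "norm (S1 (x, u) - S1 (x', u)) \<le> L1 * norm (x - x')" by (simp add: norm_Pair)
    have "\<bar>pos_part (S2 x) - pos_part (S2 x')\<bar> \<le> \<bar>S2 x - S2 x'\<bar>" by (auto simp: pos_part_def)
    also have "\<dots> \<le> L2 * norm (x - x')" using L2(2) that by auto
    finally have 2: "norm ((pos_part (S2 x) - pos_part (S2 x')) *\<^sub>R S3 x) \<le> L2 * norm (x - x') * B3"
      using B3 that L2(1) by (auto intro!: mult_mono)
    have "\<bar>pos_part (S2 x')\<bar> \<le> \<bar>S2 x'\<bar>" by (auto simp: pos_part_def)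
    also have "\<dots> \<le> B2" using B2 that by auto
    finally have 3: "norm (pos_part (S2 x') *\<^sub>R (S3 x - S3 x')) \<le> B2 * (L3 * norm (x - x'))"
      using L3 B2(1) that by (auto intro!: mult_mono)
    have "(S1 (x, u) + pos_part (S2 x) *\<^sub>R S3 x) - (S1 (x', u) + pos_part (S2 x') *\<^sub>R S3 x')
      = (S1 (x, u) - S1 (x', u)) + (pos_part (S2 x) - pos_part (S2 x')) *\<^sub>R S3 x + pos_part (S2 x') *\<^sub>R (S3 x - S3 x')"
      by (simp add: algebra_simps)
    also have "norm \<dots> \<le> L1 * norm (x - x') + L2 * norm (x - x') * B3 + B2 * (L3 * norm (x - x'))"
      by (intro norm_triangle_le add_mono 1 2 3 order_refl)
    finally show ?thesis by (simp add: algebra_simps)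
  qed
  moreover have "L1 + L2 * B3 + B2 * L3 > 0" using L1 L2 L3 B2 B3 by (auto intro!: add_pos_pos)
  ultimately show "\<exists>L>0. \<forall>x x' u. norm x \<le> R \<and> norm x' \<le> R \<and> norm u \<le> R \<longrightarrow>
      norm ((S1 (x, u) + pos_part (S2 x) *\<^sub>R S3 x) - (S1 (x', u) + pos_part (S2 x') *\<^sub>R S3 x')) \<le> L * norm (x - x')"
    by blast
qed

text \<open>\<open>V_dec\<close> drives the small-gain loop, while \<open>V_neg\<close> provides the
  positive decay rate on the compact sets \<epsilon> <= V <= M from which the bound on z comes. In
  \<open>phi_w\<close> and \<open>A_w\<close> the dependence on y and on |w| is separated, so that
  \<mu> can enter the gain while \<open>Kf\<close> is left to the loop.\<close>

locale closed_loop = small_gain \<beta> \<sigma> Kf V c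
  for \<beta> :: "real \<Rightarrow> real \<Rightarrow> real" and \<sigma> Kf :: "real \<Rightarrow> real" and V :: "'y::euclidean_space \<Rightarrow> real" and c :: real +
  fixes f g :: "'y \<Rightarrow> 'y" and k \<mu> :: "'y \<Rightarrow> real"
    and \<phi> :: "'y \<times> 'w::euclidean_space \<Rightarrow> 'p::euclidean_space" and A :: "'y \<times> 'w \<Rightarrow> 'm::euclidean_space"
    and h :: "'y \<times> 'w \<times> 'q::euclidean_space \<Rightarrow> 'w"
    and \<epsilon> \<Gamma> a bt b C :: real
  assumes sm: "smooth f" "smooth g" "smooth k" "smooth \<mu>" "smooth \<phi>" "smooth A" "smooth h" "smooth V"
    and iss: "ISS_bound h \<beta> \<sigma>" and V_pos: "pos_def V"
    and V_neg: "\<And>y. y \<noteq> 0 \<Longrightarrow> frechet_derivative V (at y) (f y + k y *\<^sub>R g y) < 0"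
    and V_dec: "\<And>y. frechet_derivative V (at y) (f y + k y *\<^sub>R g y) \<le> c - V y"
    and mu: "\<And>y. \<mu> y > 0"
    and phi_w: "\<And>y w. (norm (\<phi> (y, w) - \<phi> (y, 0)))\<^sup>2 \<le> \<mu> y * Kf (norm w)"
    and A_w: "\<And>y w. (norm (A (y, w) - A (y, 0)))\<^sup>2 \<le> \<mu> y * Kf (norm w)"
    and par: "\<epsilon> > 0" "\<Gamma> > 0" "0 < a" "a \<le> 1" "0 < bt" "bt \<le> 1" "b \<ge> 1" "C \<ge> 1"
begin

definition LgV :: "'y \<Rightarrow> real" where "LgV y = frechet_derivative V (at y) (g y)"

definition fb :: "'y \<Rightarrow> real \<Rightarrow> real" where
  "fb y z = k y - C * (\<mu> y)^2 * (b + exp z)^3 / (a^3 * bt^2) * (LgV y)^3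
     - C * ((norm (A (y, 0)))^2 + (norm (\<phi> (y, 0)))^2 + \<mu> y + 1) * (b + exp z)^3 / (a^3 * bt^2) * LgV y"

definition cl :: "'y \<times> 'w \<times> real \<Rightarrow> 'm \<times> 'p \<times> 'q \<Rightarrow> 'y \<times> 'w \<times> real" where
  "cl = (\<lambda>(y, w, z) (d, \<theta>, \<delta>). (f y + (fb y z + \<phi> (y, w) \<bullet> \<theta> + A (y, w) \<bullet> d) *\<^sub>R g y, h (y, w, \<delta>),
     \<Gamma> * exp (- z) * pos_part (V y - \<epsilon>)))"

lemma field_ok_cl: "field_ok cl"
proof -
  let ?y = "\<lambda>p :: ('y \<times> 'w \<times> real) \<times> ('m \<times> 'p \<times> 'q). fst (fst p)"
  let ?w = "\<lambda>p :: ('y \<times> 'w \<times> real) \<times> ('m \<times> 'p \<times> 'q). fst (snd (fst p))"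
  let ?z = "\<lambda>p :: ('y \<times> 'w \<times> real) \<times> ('m \<times> 'p \<times> 'q). snd (snd (fst p))"
  have s: "smooth ?y" "smooth ?w" "smooth ?z" "smooth (\<lambda>p :: ('y \<times> 'w \<times> real) \<times> ('m \<times> 'p \<times> 'q). fst (snd p))"
    "smooth (\<lambda>p :: ('y \<times> 'w \<times> real) \<times> ('m \<times> 'p \<times> 'q). fst (snd (snd p)))"
    "smooth (\<lambda>p :: ('y \<times> 'w \<times> real) \<times> ('m \<times> 'p \<times> 'q). snd (snd (snd p)))"
    by (intro smooth_fst smooth_snd smooth_id)+
  have LgV: "smooth LgV" unfolding LgV_def[abs_def] by (rule smooth_Lie[OF sm(8) sm(2)])
  have fb: "smooth (\<lambda>p. fb (?y p) (?z p))"
    unfolding fb_def power2_norm_eq_inner divide_inverse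
    by (intro smooth_diff smooth_mult smooth_add smooth_power smooth_const smooth_inner s smooth_Pair
        smooth_compose[OF sm(3)] smooth_compose[OF sm(4)] smooth_compose[OF sm(5)] smooth_compose[OF sm(6)]
        smooth_compose[OF LgV] smooth_compose[OF smooth_exp])
  have 1: "smooth (\<lambda>p. (f (?y p) + (fb (?y p) (?z p) + \<phi> (?y p, ?w p) \<bullet> fst (snd (snd p)) + A (?y p, ?w p) \<bullet> fst (snd p)) *\<^sub>R g (?y p),
      h (?y p, ?w p, snd (snd (snd p))), 0::real))"
    by (intro smooth_Pair smooth_add smooth_scaleR smooth_inner smooth_const s fb
        smooth_compose[OF sm(1)] smooth_compose[OF sm(2)] smooth_compose[OF sm(5)] smooth_compose[OF sm(6)] smooth_compose[OF sm(7)])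
  have 2: "smooth (\<lambda>x :: 'y \<times> 'w \<times> real. V (fst x) - \<epsilon>)"
    by (intro smooth_diff smooth_const smooth_compose[OF sm(8)] smooth_fst smooth_id)
  have "smooth (\<lambda>x :: 'y \<times> 'w \<times> real. (0::'y, 0::'w, \<Gamma> * exp ((- 1) * snd (snd x))))"
    by (intro smooth_Pair smooth_const smooth_mult smooth_compose[OF smooth_exp] smooth_snd smooth_id)
  then have 3: "smooth (\<lambda>x :: 'y \<times> 'w \<times> real. (0::'y, 0::'w, \<Gamma> * exp (- snd (snd x))))" by simp
  have "cl = (\<lambda>x u. (\<lambda>p. (f (?y p) + (fb (?y p) (?z p) + \<phi> (?y p, ?w p) \<bullet> fst (snd (snd p)) + A (?y p, ?w p) \<bullet> fst (snd p)) *\<^sub>R g (?y p),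
      h (?y p, ?w p, snd (snd (snd p))), 0::real)) (x, u) + pos_part (V (fst x) - \<epsilon>) *\<^sub>R (0, 0, \<Gamma> * exp (- snd (snd x))))"
    unfolding cl_def by (intro ext) (simp add: case_prod_beta mult_ac)
  with field_ok_pos_part[OF 1 2 3] show ?thesis by simp
qed

text \<open>The quantity b + exp z acts as an estimate of the size of \<theta>: the gain dominates
  that much of \<theta>, and only the excess appears. The factor a / (b + exp z) shows why a growing
  z suppresses the disturbances.\<close>

definition rate :: "real \<Rightarrow> real \<Rightarrow> 'y \<times> 'w \<times> real \<Rightarrow> real" where
  "rate s1 s3 x = frechet_derivative V (at (fst x)) (f (fst x) + k (fst x) *\<^sub>R g (fst x)) +
    a / (b + exp (snd (snd x))) * (1 + (pos_part (s3 - b - exp (snd (snd x))))^2 + (pos_part (s3 - b - exp (snd (snd x))))^4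
      + s1^2 + s1^4 + 3 * Kf (norm (fst (snd x))))"

lemma V_rate:
  assumes d: "norm d \<le> s1" and th: "norm \<theta> \<le> s3"
  shows "frechet_derivative V (at (fst x)) (fst (cl x (d, \<theta>, \<delta>))) \<le> rate s1 s3 x"
proof -
  obtain y w z where x: "x = (y, w, z)" by (cases x) auto
  have lin: "linear (frechet_derivative V (at y))"
    using smooth_frechet[OF sm(8)] has_derivative_linear by blast
  define P where "P = b + exp z"
  have P: "P \<ge> 1" using par by (simp add: P_def add_increasing2)
  define S where "S = pos_part (s3 - P)"
  have S: "S \<ge> 0" "s3 \<le> P + S" by (auto simp: S_def pos_part_def)
  define \<kappa> where "\<kappa> = sqrt (Kf (norm w))"
  have \<kappa>: "\<kappa> \<ge> 0" "\<kappa>\<^sup>2 = Kf (norm w)" using Kf_nonneg[of "norm w"] by (auto simp: \<kappa>_def)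
  have root: "t \<le> sqrt (\<mu> y) * \<kappa>" if "t\<^sup>2 \<le> \<mu> y * Kf (norm w)" for t
    unfolding \<kappa>_def real_sqrt_mult[symmetric] by (rule real_le_rsqrt[OF that])
  have "norm (\<phi> (y, w)) \<le> norm (\<phi> (y, 0)) + sqrt (\<mu> y) * \<kappa>"
    using norm_triangle_sub[of "\<phi> (y, w)" "\<phi> (y, 0)"] root[OF phi_w] by linarith
  moreover have "norm \<theta> \<le> P + S" using th S by linarith
  ultimately have F: "\<bar>\<phi> (y, w) \<bullet> \<theta>\<bar> \<le> (norm (\<phi> (y, 0)) + sqrt (\<mu> y) * \<kappa>) * (P + S)"
    using mu[of y] \<kappa> by (intro order_trans[OF Cauchy_Schwarz_ineq2] mult_mono) (auto intro!: add_nonneg_nonneg mult_nonneg_nonneg less_imp_le)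
  have "norm (A (y, w)) \<le> norm (A (y, 0)) + sqrt (\<mu> y) * \<kappa>"
    using norm_triangle_sub[of "A (y, w)" "A (y, 0)"] root[OF A_w] by linarith
  then have A': "\<bar>A (y, w) \<bullet> d\<bar> \<le> (norm (A (y, 0)) + sqrt (\<mu> y) * \<kappa>) * s1"
    using mu[of y] \<kappa> d by (intro order_trans[OF Cauchy_Schwarz_ineq2] mult_mono) (auto intro!: add_nonneg_nonneg mult_nonneg_nonneg less_imp_le)
  have s1: "s1 \<ge> 0" using d norm_ge_zero order_trans by blast
  let ?G = "- (C * (\<mu> y)\<^sup>2 * P ^ 3 / (a ^ 3 * bt\<^sup>2) * LgV y ^ 3)
    - C * ((norm (A (y, 0)))\<^sup>2 + (norm (\<phi> (y, 0)))\<^sup>2 + \<mu> y + 1) * P ^ 3 / (a ^ 3 * bt\<^sup>2) * LgV y + \<phi> (y, w) \<bullet> \<theta> + A (y, w) \<bullet> d"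
  have est: "?G * LgV y \<le> a / P * (1 + S\<^sup>2 + S ^ 4 + s1\<^sup>2 + s1 ^ 4 + 3 * \<kappa>\<^sup>2)"
    using par P mu[of y] \<kappa>(1) S(1) s1 F A' by (intro high_gain_estimate) auto
  \<comment> \<open>The nominal feedback \<open>k y\<close> is split off, so that the remaining
    scalar \<open>?G\<close> meets g and pairs with \<open>LgV\<close>.\<close>
  have "fst (cl x (d, \<theta>, \<delta>)) = (f y + k y *\<^sub>R g y) + ?G *\<^sub>R g y"
  proof -
    have e: "fb y z + \<phi> (y, w) \<bullet> \<theta> + A (y, w) \<bullet> d = k y + ?G" unfolding fb_def P_def by linarith
    show ?thesis unfolding x cl_def prod.case fst_conv e by (simp only: scaleR_add_left add.assoc)
  qed
  then have "frechet_derivative V (at y) (fst (cl x (d, \<theta>, \<delta>))) = frechet_derivative V (at y) (f y + k y *\<^sub>R g y) + ?G * LgV y"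
    using linear_add[OF lin] linear_scale[OF lin] by (simp add: LgV_def)
  then show ?thesis
    using est unfolding x rate_def S_def P_def \<kappa>(2) by (simp add: diff_diff_eq)
qed

definition inputs :: "real \<Rightarrow> real \<Rightarrow> real \<Rightarrow> (real \<Rightarrow> 'm) \<Rightarrow> (real \<Rightarrow> 'p) \<Rightarrow> (real \<Rightarrow> 'q) \<Rightarrow> bool" where
  "inputs s1 s2 s3 d \<theta> \<delta> \<longleftrightarrow> input_ok s1 d \<and> input_ok s2 \<delta> \<and> input_ok s3 \<theta>"

definition cl_sol :: "real \<Rightarrow> 'y \<times> 'w \<times> real \<Rightarrow> (real \<Rightarrow> 'm) \<Rightarrow> (real \<Rightarrow> 'p) \<Rightarrow> (real \<Rightarrow> 'q) \<Rightarrow> (real \<Rightarrow> 'y \<times> 'w \<times> real) \<Rightarrow> bool" where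
  "cl_sol T x0 d \<theta> \<delta> X \<longleftrightarrow> sol_on T (\<lambda>s x. cl x (d s, \<theta> s, \<delta> s)) x0 X"

lemma inputs_ok:
  assumes "inputs s1 s2 s3 d \<theta> \<delta>"
  shows "input_ok (s1 + (s3 + s2)) (\<lambda>s. (d s, \<theta> s, \<delta> s))" "s1 \<ge> 0" "s2 \<ge> 0" "s3 \<ge> 0"
    "norm (d s) \<le> s1" "norm (\<theta> s) \<le> s3" "norm (\<delta> s) \<le> s2"
proof -
  have n: "norm (d s) \<le> s1" "norm (\<theta> s) \<le> s3" "norm (\<delta> s) \<le> s2" for s using assms by (auto simp: inputs_def input_ok_def)
  then show "norm (d s) \<le> s1" "norm (\<theta> s) \<le> s3" "norm (\<delta> s) \<le> s2" by auto
  show "s1 \<ge> 0" "s2 \<ge> 0" "s3 \<ge> 0" using n[of 0] norm_ge_zero order_trans by blast+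
  have "norm (d s, \<theta> s, \<delta> s) \<le> s1 + (s3 + s2)" for s
    using norm_Pair_le[of "d s" "(\<theta> s, \<delta> s)"] norm_Pair_le[of "\<theta> s" "\<delta> s"] n[of s] by linarith
  moreover have "(\<lambda>s. (d s, \<theta> s, \<delta> s)) \<in> borel_measurable lebesgue"
    using assms unfolding inputs_def input_ok_def by (intro borel_measurable_Pair) auto
  ultimately show "input_ok (s1 + (s3 + s2)) (\<lambda>s. (d s, \<theta> s, \<delta> s))" by (simp add: input_ok_def)
qed

lemma cl_dini:
  fixes \<Psi> :: "'y \<times> 'w \<times> real \<Rightarrow> real"
  assumes i: "inputs s1 s2 s3 d \<theta> \<delta>" and X: "cl_sol T x0 d \<theta> \<delta> X" and s: "0 \<le> s" "s < T"
    and \<Psi>: "(\<Psi> has_derivative \<Psi>') (at (X s))"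
    and g: "\<And>\<tau>. \<Psi>' (cl (X s) (d \<tau>, \<theta> \<tau>, \<delta> \<tau>)) \<le> r"
  shows "dini_le (\<lambda>t. \<Psi> (X t)) T s r"
proof (rule sol_dini[where H = cl and u = "\<lambda>s. (d s, \<theta> s, \<delta> s)" and X = X and \<Psi>' = \<Psi>'])
  show "field_ok cl" by (rule field_ok_cl)
  show "input_ok (s1 + (s3 + s2)) (\<lambda>s. (d s, \<theta> s, \<delta> s))" by (rule inputs_ok(1)[OF i])
  show "sol_on T (\<lambda>s x. cl x (d s, \<theta> s, \<delta> s)) x0 X" using X by (simp add: cl_sol_def)
qed (use s \<Psi> g in auto)

lemma cl_dini_V:
  assumes i: "inputs s1 s2 s3 d \<theta> \<delta>" and X: "cl_sol T x0 d \<theta> \<delta> X" and s: "0 \<le> s" "s < T"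
  shows "dini_le (\<lambda>t. V (fst (X t))) T s (rate s1 s3 (X s))"
proof (rule cl_dini[OF i X s])
  have "((V \<circ> fst) has_derivative (frechet_derivative V (at (fst (X s))) \<circ> fst)) (at (X s))"
    by (rule diff_chain_at[OF has_derivative_fst[OF has_derivative_ident] smooth_frechet[OF sm(8)]])
  then show "((\<lambda>x. V (fst x)) has_derivative (\<lambda>v. frechet_derivative V (at (fst (X s))) (fst v))) (at (X s))"
    by (simp add: o_def)
  show "frechet_derivative V (at (fst (X s))) (fst (cl (X s) (d \<tau>, \<theta> \<tau>, \<delta> \<tau>))) \<le> rate s1 s3 (X s)" for \<tau>
    by (rule V_rate[OF inputs_ok(5)[OF i] inputs_ok(6)[OF i]])
qed

definition zrate :: "'y \<times> 'w \<times> real \<Rightarrow> real" where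
  "zrate x = \<Gamma> * exp (- snd (snd x)) * pos_part (V (fst x) - \<epsilon>)"

lemma cl_dini_z:
  assumes i: "inputs s1 s2 s3 d \<theta> \<delta>" and X: "cl_sol T x0 d \<theta> \<delta> X" and s: "0 \<le> s" "s < T"
  shows "dini_le (\<lambda>t. snd (snd (X t))) T s (zrate (X s))" "dini_le (\<lambda>t. - snd (snd (X t))) T s (- zrate (X s))"
proof -
  have z: "snd (snd (cl x (d \<tau>, \<theta> \<tau>, \<delta> \<tau>))) = zrate x" for x \<tau>
    unfolding cl_def zrate_def by (simp add: case_prod_beta)
  have dz: "((\<lambda>x. snd (snd x)) has_derivative (\<lambda>v. snd (snd v))) (at (X s))"
    by (intro has_derivative_snd has_derivative_ident)
  show "dini_le (\<lambda>t. snd (snd (X t))) T s (zrate (X s))"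
    by (rule cl_dini[OF i X s dz]) (simp add: z)
  show "dini_le (\<lambda>t. - snd (snd (X t))) T s (- zrate (X s))"
    by (rule cl_dini[OF i X s has_derivative_minus[OF dz]]) (simp add: z)
qed

lemma zrate_nonneg: "zrate x \<ge> 0"
  using par by (simp add: zrate_def pos_part_def)

lemma cl_continuous:
  assumes "cl_sol T x0 d \<theta> \<delta> X"
  shows "continuous_on {0..T} (\<lambda>t. fst (X t))" "continuous_on {0..T} (\<lambda>t. V (fst (X t)))"
    "continuous_on {0..T} (\<lambda>t. snd (snd (X t)))"
proof -
  have X: "continuous_on {0..T} X" using assms sol_on_continuous unfolding cl_sol_def by blast
  show y: "continuous_on {0..T} (\<lambda>t. fst (X t))" by (intro continuous_intros X)
  show "continuous_on {0..T} (\<lambda>t. V (fst (X t)))" by (rule continuous_on_compose2[OF V_cont y]) auto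
  show "continuous_on {0..T} (\<lambda>t. snd (snd (X t)))" by (intro continuous_intros X)
qed

lemma cl_z_mono:
  assumes i: "inputs s1 s2 s3 d \<theta> \<delta>" and X: "cl_sol T x0 d \<theta> \<delta> X" and st: "0 \<le> s" "s \<le> t" "t \<le> T"
  shows "snd (snd (X s)) \<le> snd (snd (X t))"
proof -
  have "- snd (snd (X t)) \<le> - snd (snd (X s)) + 0 * (t - s)"
  proof (rule dini_bound)
    show "continuous_on {s..t} (\<lambda>t. - snd (snd (X t)))"
      using st by (intro continuous_on_minus continuous_on_subset[OF cl_continuous(3)[OF X]]) auto
    fix r assume r: "s \<le> r" "r < t"
    have "dini_le (\<lambda>t. - snd (snd (X t))) T r (- zrate (X r))" using cl_dini_z(2)[OF i X, of r] r st by simp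
    then have "dini_le (\<lambda>t. - snd (snd (X t))) T r 0" by (rule dini_le_mono) (simp add: zrate_nonneg)
    then show "dini_le (\<lambda>t. - snd (snd (X t))) t r 0" by (rule dini_le_restrict) (rule st)
  qed (rule st)
  then show ?thesis by simp
qed

lemma pos_part_le: "x \<le> y \<Longrightarrow> pos_part x \<le> pos_part y" "pos_part x \<ge> 0"
  by (auto simp: pos_part_def)

text \<open>The coefficient a / (b + exp z) and the excess of the \<theta> bound both decrease in z,
  so a lower bound z0 on z may replace z in the disturbance term. In front of 1 and
  \<open>3 * Kf\<close> the coefficient is estimated by 1, which yields the summand 1 next to
  c.\<close>

lemma rate_le:
  assumes "snd (snd x) \<ge> z0"
  shows "rate s1 s3 x \<le> (c + 1 + a * (s1^2 + s1^4 + (pos_part (s3 - b - exp z0))^2 + (pos_part (s3 - b - exp z0))^4) / (b + exp z0))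
    + 3 * Kf (norm (fst (snd x))) - V (fst x)"
proof -
  let ?P = "b + exp (snd (snd x))"
  let ?S = "pos_part (s3 - b - exp (snd (snd x)))" and ?Sz = "pos_part (s3 - b - exp z0)"
  have P: "b + exp z0 \<le> ?P" "1 \<le> b + exp z0" using assms par by (auto simp: add_increasing2)
  have S: "?S \<le> ?Sz" "0 \<le> ?S" using assms by (auto intro!: pos_part_le)
  have q: "a / ?P \<le> a / (b + exp z0)" using P par by (intro frac_le) linarith+
  have "a \<le> ?P" "0 < ?P" using P par by linarith+
  then have q1: "a / ?P \<le> 1" "0 \<le> a / ?P" using par by (auto simp: divide_le_eq)
  let ?D = "s1^2 + s1^4 + ?S^2 + ?S^4" and ?Dz = "s1^2 + s1^4 + ?Sz^2 + ?Sz^4"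
  have "?D \<le> ?Dz" using S by (intro add_mono power_mono order_refl) auto
  moreover have "0 \<le> ?D" by simp
  ultimately have 1: "a / ?P * ?D \<le> a / (b + exp z0) * ?Dz" using q q1 by (intro mult_mono) auto
  have 2: "a / ?P * (1 + 3 * Kf (norm (fst (snd x)))) \<le> 1 * (1 + 3 * Kf (norm (fst (snd x))))"
    using q1 Kf_nonneg by (intro mult_right_mono) auto
  have "rate s1 s3 x = frechet_derivative V (at (fst x)) (f (fst x) + k (fst x) *\<^sub>R g (fst x))
      + (a / ?P * ?D + a / ?P * (1 + 3 * Kf (norm (fst (snd x)))))"
    unfolding rate_def distrib_left[symmetric] by (simp add: ac_simps)
  also have "\<dots> \<le> (c - V (fst x)) + (a / (b + exp z0) * ?Dz + 1 * (1 + 3 * Kf (norm (fst (snd x)))))"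
    by (intro add_mono V_dec 1 2)
  also have "\<dots> = (c + 1 + a * ?Dz / (b + exp z0)) + 3 * Kf (norm (fst (snd x))) - V (fst x)" by simp
  finally show ?thesis .
qed

lemma cl_w:
  assumes i: "inputs s1 s2 s3 d \<theta> \<delta>" and X: "cl_sol T (y0, w0, z0) d \<theta> \<delta> X" and ab: "0 \<le> r" "r \<le> t" "t \<le> T"
    and M: "\<And>s. s \<in> {r..t} \<Longrightarrow> norm (fst (X s), \<delta> s) \<le> M"
  shows "norm (fst (snd (X t))) \<le> \<beta> (norm (fst (snd (X r)))) (t - r) + \<sigma> M"
proof (rule ISS_sol_on[OF sm(7) iss _ cl_continuous(1)[OF X] _ ab M])
  show "input_ok s2 \<delta>" using i by (simp add: inputs_def)
  have bl: "bounded_linear (\<lambda>x :: 'y \<times> 'w \<times> real. fst (snd x))"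
    using bounded_linear_compose[OF bounded_linear_fst bounded_linear_snd] by simp
  have w: "fst (snd (cl x (d s, \<theta> s, \<delta> s))) = h (fst x, fst (snd x), \<delta> s)" for x s
    unfolding cl_def by (simp add: case_prod_beta)
  show "sol_on T (\<lambda>s w. h (fst (X s), w, \<delta> s)) w0 (\<lambda>t. fst (snd (X t)))"
    unfolding sol_on_def
  proof (intro conjI ballI)
    show "fst (snd (X 0)) = w0" using X by (simp add: cl_sol_def sol_on_def)
    fix t assume "t \<in> {0..T}"
    then have 1: "(\<lambda>s. cl (X s) (d s, \<theta> s, \<delta> s)) absolutely_integrable_on {0..t}"
      "X t = (y0, w0, z0) + integral {0..t} (\<lambda>s. cl (X s) (d s, \<theta> s, \<delta> s))"
      using X unfolding cl_sol_def sol_on_def by auto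
    have "((\<lambda>x. fst (snd x)) \<circ> (\<lambda>s. cl (X s) (d s, \<theta> s, \<delta> s))) absolutely_integrable_on {0..t}"
      by (rule absolutely_integrable_linear[OF 1(1) bl])
    then show "(\<lambda>s. h (fst (X s), fst (snd (X s)), \<delta> s)) absolutely_integrable_on {0..t}" by (simp add: o_def w)
    have "(\<lambda>s. cl (X s) (d s, \<theta> s, \<delta> s)) integrable_on {0..t}" using 1(1) absolutely_integrable_on_def by blast
    from integral_linear[OF this bl]
    have "integral {0..t} (\<lambda>s. h (fst (X s), fst (snd (X s)), \<delta> s)) = fst (snd (integral {0..t} (\<lambda>s. cl (X s) (d s, \<theta> s, \<delta> s))))"
      by (simp add: o_def w)
    then show "fst (snd (X t)) = w0 + integral {0..t} (\<lambda>s. h (fst (X s), fst (snd (X s)), \<delta> s))" using 1(2) by simp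
  qed
qed

definition E0 :: "real \<Rightarrow> real \<Rightarrow> real \<Rightarrow> real" where
  "E0 s1 s3 z0 = c + 1 + a * (s1^2 + s1^4 + (pos_part (s3 - b - exp z0))^2 + (pos_part (s3 - b - exp z0))^4) / (b + exp z0)"

lemma cl_traj:
  assumes i: "inputs s1 s2 s3 d \<theta> \<delta>" and X: "cl_sol T (y0, w0, z0) d \<theta> \<delta> X"
    and E: "E0 s1 s3 z0 \<le> E" and D: "s2 \<le> D"
  shows "traj T E D (\<lambda>t. fst (X t)) (\<lambda>t. fst (snd (X t)))"
  unfolding traj_def
proof (intro conjI allI impI)
  have "b + exp z0 > 0" using par by (simp add: add_pos_pos)
  then have "E0 s1 s3 z0 \<ge> 0" using par c_nonneg unfolding E0_def by (intro add_nonneg_nonneg divide_nonneg_pos mult_nonneg_nonneg) auto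
  then show "0 \<le> E" using E by simp
  show "0 \<le> D" using D inputs_ok(3)[OF i] by simp
  show "continuous_on {0..T} (\<lambda>t. fst (X t))" by (rule cl_continuous(1)[OF X])
next
  fix s assume s: "0 \<le> s \<and> s < T"
  have X0: "X 0 = (y0, w0, z0)" using X by (simp add: cl_sol_def sol_on_def)
  have "z0 \<le> snd (snd (X s))" using cl_z_mono[OF i X, of 0 s] s X0 by simp
  then have "rate s1 s3 (X s) \<le> E + 3 * Kf (norm (fst (snd (X s)))) - V (fst (X s))"
    using rate_le[of z0 "X s" s1 s3] E unfolding E0_def by linarith
  then show "dini_le (\<lambda>t. V (fst (X t))) T s (E + 3 * Kf (norm (fst (snd (X s)))) - V (fst (X s)))"
    using dini_le_mono[OF cl_dini_V[OF i X]] s by blast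
next
  fix r t Y assume r: "0 \<le> r \<and> r \<le> t \<and> t \<le> T \<and> (\<forall>s\<in>{r..t}. norm (fst (X s)) \<le> Y)"
  have "norm (fst (X s), \<delta> s) \<le> Y + D" if "s \<in> {r..t}" for s
    using norm_Pair_le[of "fst (X s)" "\<delta> s"] r that inputs_ok(7)[OF i, of s] D by fastforce
  then show "norm (fst (snd (X t))) \<le> \<beta> (norm (fst (snd (X r)))) (t - r) + \<sigma> (Y + D)"
    using r by (intro cl_w[OF i X]) auto
qed

section \<open>Uniform bounds and existence for the closed loop\<close>

lemma cl_init: "cl_sol T x0 d \<theta> \<delta> X \<Longrightarrow> X 0 = x0"
  by (simp add: cl_sol_def sol_on_def)

lemma cl_sol_mono: "cl_sol T x0 d \<theta> \<delta> X \<Longrightarrow> S \<le> T \<Longrightarrow> cl_sol S x0 d \<theta> \<delta> X"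
  unfolding cl_sol_def by (rule sol_on_mono)

text \<open>Uniform over times, inputs, initial data and solutions at the given levels; a comparison
  function cannot be assembled from bounds tied to a single solution.\<close>

definition bound_after :: "real \<Rightarrow> real \<Rightarrow> real \<Rightarrow> real \<Rightarrow> real \<Rightarrow> bool" where
  "bound_after \<tau> M R E D \<longleftrightarrow> (\<forall>T s1 s2 s3 d \<theta> \<delta> y0 w0 z0 X. T \<ge> \<tau> \<and> inputs s1 s2 s3 d \<theta> \<delta> \<and> cl_sol T (y0, w0, z0) d \<theta> \<delta> X \<and>
    E0 s1 s3 z0 \<le> E \<and> s2 \<le> D \<and> V y0 \<le> R \<and> norm w0 \<le> R \<longrightarrow> V (fst (X T)) \<le> M \<and> norm (fst (snd (X T))) \<le> M)"

lemma bound_afterD: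
  assumes "bound_after \<tau> M R E D" "T \<ge> \<tau>" "inputs s1 s2 s3 d \<theta> \<delta>" "cl_sol T (y0, w0, z0) d \<theta> \<delta> X"
    "E0 s1 s3 z0 \<le> E" "s2 \<le> D" "V y0 \<le> R" "norm w0 \<le> R"
  shows "V (fst (X T)) \<le> M" "norm (fst (snd (X T))) \<le> M"
  using assms unfolding bound_after_def by blast+

lemma bound_afterI:
  assumes "\<forall>T y (w::real \<Rightarrow> 'w). T \<ge> \<tau> \<and> traj T E D y w \<and> V (y 0) \<le> R \<and> norm (w 0) \<le> R \<longrightarrow>
    V (y T) \<le> M \<and> norm (w T) \<le> M"
  shows "bound_after \<tau> M R E D"
  unfolding bound_after_def
proof (intro allI impI, elim conjE)
  fix T s1 s2 s3 d \<theta> \<delta> y0 w0 z0 X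
  assume *: "T \<ge> \<tau>" "inputs s1 s2 s3 d \<theta> \<delta>" "cl_sol T (y0, w0, z0) d \<theta> \<delta> X" "E0 s1 s3 z0 \<le> E" "s2 \<le> D" "V y0 \<le> R" "norm w0 \<le> R"
  have "traj T E D (\<lambda>t. fst (X t)) (\<lambda>t. fst (snd (X t)))" by (rule cl_traj[OF *(2-5)])
  with assms[THEN spec, of T, THEN spec, of "\<lambda>t. fst (X t)", THEN spec, of "\<lambda>t. fst (snd (X t))"] *(1,6,7) cl_init[OF *(3)]
  show "V (fst (X T)) \<le> M \<and> norm (fst (snd (X T))) \<le> M" by simp
qed

lemma cl_bounded:
  assumes "R \<ge> 0" "E \<ge> 0" "D \<ge> 0"
  shows "\<exists>M\<ge>0. bound_after 0 M R E D"
  using traj_bounded[OF assms, where 'w = 'w]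
proof (elim exE conjE)
  fix M :: real
  assume M: "0 \<le> M" "\<forall>T y (w::real \<Rightarrow> 'w). T \<ge> 0 \<and> traj T E D y w \<and> V (y 0) \<le> R \<and> norm (w 0) \<le> R \<longrightarrow>
    V (y T) \<le> M \<and> norm (w T) \<le> M"
  show ?thesis using M(1) bound_afterI[OF M(2)] by blast
qed

lemma cl_converge:
  assumes "E \<ge> 0" "D \<ge> 0"
  shows "\<exists>Z\<ge>0. \<forall>R\<ge>0. \<exists>\<tau>\<ge>0. bound_after \<tau> Z R E D"
  using traj_converge[OF assms, where 'w = 'w]
proof (elim exE conjE)
  fix Z :: real
  assume Z: "0 \<le> Z" "\<forall>R\<ge>0. \<exists>\<tau>\<ge>0. \<forall>T y (w::real \<Rightarrow> 'w). T \<ge> \<tau> \<and> traj T E D y w \<and> V (y 0) \<le> R \<and> norm (w 0) \<le> R \<longrightarrow>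
    V (y T) \<le> Z \<and> norm (w T) \<le> Z"
  have "\<exists>\<tau>\<ge>0. bound_after \<tau> Z R E D" if R: "R \<ge> 0" for R
    using mp[OF spec[OF Z(2), of R] R]
  proof (elim exE conjE)
    fix \<tau> :: real
    assume \<tau>: "0 \<le> \<tau>" "\<forall>T y (w::real \<Rightarrow> 'w). T \<ge> \<tau> \<and> traj T E D y w \<and> V (y 0) \<le> R \<and> norm (w 0) \<le> R \<longrightarrow>
      V (y T) \<le> Z \<and> norm (w T) \<le> Z"
    show ?thesis using \<tau>(1) bound_afterI[OF \<tau>(2)] by blast
  qed
  with Z(1) show ?thesis by blast
qed

lemma E0_nonneg: "E0 s1 s3 z0 \<ge> 0"
proof -
  have "b + exp z0 > 0" using par by (simp add: add_pos_pos)
  then show ?thesis using par c_nonneg unfolding E0_def by (intro add_nonneg_nonneg divide_nonneg_pos mult_nonneg_nonneg) auto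
qed

lemma zrate_le:
  assumes "z0 \<le> snd (snd x)" "V (fst x) \<le> M" "M \<ge> 0"
  shows "zrate x \<le> \<Gamma> * exp (- z0) * M"
proof -
  have "pos_part (V (fst x) - \<epsilon>) \<le> M" using assms par by (simp add: pos_part_def)
  moreover have "\<Gamma> * exp (- snd (snd x)) \<le> \<Gamma> * exp (- z0)" using assms(1) par by simp
  ultimately show ?thesis unfolding zrate_def using par pos_part_le(2) by (intro mult_mono) auto
qed

lemma cl_z_increment:
  assumes i: "inputs s1 s2 s3 d \<theta> \<delta>" and X: "cl_sol T x0 d \<theta> \<delta> X" and st: "0 \<le> s" "s \<le> t" "t \<le> T"
    and r: "\<And>\<tau>. s \<le> \<tau> \<Longrightarrow> \<tau> < t \<Longrightarrow> zrate (X \<tau>) \<le> r"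
  shows "snd (snd (X t)) \<le> snd (snd (X s)) + r * (t - s)"
proof (rule dini_bound)
  show "continuous_on {s..t} (\<lambda>t. snd (snd (X t)))"
    using st by (intro continuous_on_subset[OF cl_continuous(3)[OF X]]) auto
  fix \<tau> assume \<tau>: "s \<le> \<tau>" "\<tau> < t"
  have "dini_le (\<lambda>t. snd (snd (X t))) T \<tau> (zrate (X \<tau>))" using cl_dini_z(1)[OF i X, of \<tau>] \<tau> st by simp
  then have "dini_le (\<lambda>t. snd (snd (X t))) T \<tau> r" by (rule dini_le_mono) (rule r[OF \<tau>])
  then show "dini_le (\<lambda>t. snd (snd (X t))) t \<tau> r" by (rule dini_le_restrict) (rule st)
qed (rule st)

lemma cl_z_decrement:
  assumes i: "inputs s1 s2 s3 d \<theta> \<delta>" and X: "cl_sol T x0 d \<theta> \<delta> X" and st: "0 \<le> s" "s \<le> t" "t \<le> T"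
    and r: "\<And>\<tau>. s \<le> \<tau> \<Longrightarrow> \<tau> < t \<Longrightarrow> r \<le> zrate (X \<tau>)"
  shows "snd (snd (X s)) + r * (t - s) \<le> snd (snd (X t))"
proof -
  have "- snd (snd (X t)) \<le> - snd (snd (X s)) + (- r) * (t - s)"
  proof (rule dini_bound)
    show "continuous_on {s..t} (\<lambda>t. - snd (snd (X t)))"
      using st by (intro continuous_on_minus continuous_on_subset[OF cl_continuous(3)[OF X]]) auto
    fix \<tau> assume \<tau>: "s \<le> \<tau>" "\<tau> < t"
    have "dini_le (\<lambda>t. - snd (snd (X t))) T \<tau> (- zrate (X \<tau>))" using cl_dini_z(2)[OF i X, of \<tau>] \<tau> st by simp
    then have "dini_le (\<lambda>t. - snd (snd (X t))) T \<tau> (- r)" by (rule dini_le_mono) (simp add: r[OF \<tau>])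
    then show "dini_le (\<lambda>t. - snd (snd (X t))) t \<tau> (- r)" by (rule dini_le_restrict) (rule st)
  qed (rule st)
  then show ?thesis by simp
qed

text \<open>The small-gain bound confines y and w independently of time, and then z grows at most
  linearly, since its rate is at most \<open>\<Gamma> * exp (- z0) * M\<close>. This is the a priori
  bound on every finite horizon.\<close>

lemma cl_exists:
  assumes i: "inputs s1 s2 s3 d \<theta> \<delta>"
  shows "\<exists>X. cara_sol (\<lambda>s x. cl x (d s, \<theta> s, \<delta> s)) (y0, w0, z0) X"
proof (rule sol_exists_of_apriori[where H = cl and u = "\<lambda>s. (d s, \<theta> s, \<delta> s)"])
  show "field_ok cl" by (rule field_ok_cl)
  show "input_ok (s1 + (s3 + s2)) (\<lambda>s. (d s, \<theta> s, \<delta> s))" by (rule inputs_ok(1)[OF i])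
  fix T :: real assume T: "T \<ge> 0"
  define R where "R = max (V y0) (norm w0)"
  have R: "R \<ge> 0" "V y0 \<le> R" "norm w0 \<le> R" by (auto simp: R_def le_max_iff_disj)
  obtain M where M0: "M \<ge> 0" "bound_after 0 M R (E0 s1 s3 z0) s2"
    using cl_bounded[OF R(1) E0_nonneg[of s1 s3 z0] inputs_ok(3)[OF i]] by blast
  have M: "M \<ge> 0" "\<And>\<tau> X. \<tau> \<ge> 0 \<Longrightarrow> cl_sol \<tau> (y0, w0, z0) d \<theta> \<delta> X \<Longrightarrow> V (fst (X \<tau>)) \<le> M \<and> norm (fst (snd (X \<tau>))) \<le> M"
    using M0(1) bound_afterD[OF M0(2) _ i _ order_refl order_refl R(2,3)] by auto
  obtain \<rho> where \<rho>: "\<rho> \<ge> 0" "\<And>y. V y \<le> M \<Longrightarrow> norm y \<le> \<rho>" using V_sublevel by blast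
  define G where "G = \<Gamma> * exp (- z0) * M"
  have G: "G \<ge> 0" using M par by (simp add: G_def)
  have "norm (X \<tau>) < \<rho> + M + \<bar>z0\<bar> + G * T + 1" if \<tau>: "0 \<le> \<tau>" "\<tau> \<le> T" and X: "cl_sol \<tau> (y0, w0, z0) d \<theta> \<delta> X" for \<tau> X
  proof -
    have zr: "zrate (X s) \<le> G" if "0 \<le> s" "s < \<tau>" for s
      unfolding G_def
    proof (rule zrate_le)
      show "z0 \<le> snd (snd (X s))" using cl_z_mono[OF i X, of 0 s] that cl_init[OF X] by simp
      show "V (fst (X s)) \<le> M" using M(2)[OF that(1) cl_sol_mono[OF X]] that by simp
    qed (rule M)
    have "snd (snd (X \<tau>)) \<le> z0 + G * \<tau>"
      using cl_z_increment[OF i X _ _ _ zr, of 0 \<tau>] \<tau> cl_init[OF X] by simp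
    also have "G * \<tau> \<le> G * T" using G \<tau> by (intro mult_left_mono)
    finally have "snd (snd (X \<tau>)) \<le> z0 + G * T" by simp
    moreover have "z0 \<le> snd (snd (X \<tau>))" using cl_z_mono[OF i X, of 0 \<tau>] \<tau> cl_init[OF X] by simp
    moreover have "G * T \<ge> 0" using G T by simp
    ultimately have 3: "\<bar>snd (snd (X \<tau>))\<bar> \<le> \<bar>z0\<bar> + G * T" by linarith
    have 12: "norm (fst (X \<tau>)) \<le> \<rho>" "norm (fst (snd (X \<tau>))) \<le> M" using M(2)[OF \<tau>(1) X] \<rho>(2) by auto
    have "norm (X \<tau>) \<le> norm (fst (X \<tau>)) + (norm (fst (snd (X \<tau>))) + norm (snd (snd (X \<tau>))))"
      using norm_Pair_le[of "fst (X \<tau>)" "snd (X \<tau>)"] norm_Pair_le[of "fst (snd (X \<tau>))" "snd (snd (X \<tau>))"] by simp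
    then show ?thesis using 12 3 by simp
  qed
  then show "\<exists>R. \<forall>\<tau> X. 0 \<le> \<tau> \<and> \<tau> \<le> T \<and> sol_on \<tau> (\<lambda>s x. cl x (d s, \<theta> s, \<delta> s)) (y0, w0, z0) X \<longrightarrow> norm (X \<tau>) < R"
    unfolding cl_sol_def by blast
qed

lemma E0_le:
  assumes "0 \<le> s1" "s1 \<le> R" "0 \<le> s3" "s3 \<le> R"
  shows "E0 s1 s3 z0 \<le> c + 1 + (R^2 + R^4 + R^2 + R^4)" "(pos_part (s3 - b - exp z0)) \<le> R"
proof -
  have P: "1 \<le> b + exp z0" using par by (simp add: add_increasing2)
  let ?S = "pos_part (s3 - b - exp z0)"
  have S: "?S \<le> R" "0 \<le> ?S" using assms P by (auto simp: pos_part_def)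
  then show "?S \<le> R" by simp
  have "a / (b + exp z0) \<le> 1" using P par by (simp add: divide_le_eq)
  moreover have "s1^2 + s1^4 + ?S^2 + ?S^4 \<le> R^2 + R^4 + R^2 + R^4" using S assms by (intro add_mono power_mono) auto
  ultimately have "a / (b + exp z0) * (s1^2 + s1^4 + ?S^2 + ?S^4) \<le> 1 * (R^2 + R^4 + R^2 + R^4)"
    using P par by (intro mult_mono) auto
  then show "E0 s1 s3 z0 \<le> c + 1 + (R^2 + R^4 + R^2 + R^4)" by (simp add: E0_def)
qed

section \<open>Boundedness and convergence of the gain variable\<close>

definition z_bound :: "real \<Rightarrow> real \<Rightarrow> bool" where
  "z_bound R Z \<longleftrightarrow> (\<forall>T s1 s2 s3 d \<theta> \<delta> y0 w0 z0 X. T \<ge> 0 \<and> inputs s1 s2 s3 d \<theta> \<delta> \<and> cl_sol T (y0, w0, z0) d \<theta> \<delta> X \<and>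
    s1 \<le> R \<and> s2 \<le> R \<and> s3 \<le> R \<and> norm y0 \<le> R \<and> norm w0 \<le> R \<and> \<bar>z0\<bar> \<le> R \<longrightarrow> snd (snd (X T)) \<le> Z)"

lemma z_boundD:
  assumes "z_bound R Z" "T \<ge> 0" "inputs s1 s2 s3 d \<theta> \<delta>" "cl_sol T (y0, w0, z0) d \<theta> \<delta> X"
    "s1 \<le> R" "s2 \<le> R" "s3 \<le> R" "norm y0 \<le> R" "norm w0 \<le> R" "\<bar>z0\<bar> \<le> R"
  shows "snd (snd (X T)) \<le> Z"
  using assms unfolding z_bound_def by blast

text \<open>Once \<open>z\<close> exceeds the level \<open>Zs\<close>, the gain is so high that \<open>V\<close> decreases at a uniform rate while it is
  above \<open>\<epsilon>\<close>; after a uniform time \<open>z\<close> stops growing.\<close>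

lemma cl_z_bounded:
  assumes R: "R \<ge> 0"
  shows "\<exists>Z. z_bound R Z"
proof -
  obtain RV where RV: "RV > 0" "\<And>y. norm y \<le> R \<Longrightarrow> norm (V y) \<le> RV" using continuous_bounded_cball[OF V_cont, of R] by blast
  define E where "E = c + 1 + (R^2 + R^4 + R^2 + R^4)"
  have E: "E \<ge> 0" unfolding E_def using c_nonneg R by (intro add_nonneg_nonneg) auto
  have m: "max RV R \<ge> 0" using R by simp
  obtain M where M: "M \<ge> 0" "bound_after 0 M (max RV R) E R"
    using cl_bounded[OF m E R] by blast
  define Dm where "Dm = 1 + R^2 + R^4 + R^2 + R^4 + 3 * Kf M"
  have Dm: "Dm \<ge> 1" unfolding Dm_def using R Kf_nonneg[OF M(1)] by simp
  define dV where "dV y = - frechet_derivative V (at y) (f y + k y *\<^sub>R g y)" for y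
  have cdV: "continuous_on S dV" for S
    unfolding dV_def[abs_def] by (intro continuous_on_minus smooth_continuous smooth_Lie smooth_add smooth_scaleR sm)
  have "compact {y. V y \<le> M}" using V_rad by (simp add: rad_unbdd_def)
  then have "compact ({y. V y \<le> M} \<inter> {y. \<epsilon> \<le> V y})" by (rule compact_Int_closed) (intro closed_Collect_le continuous_on_const V_cont)
  moreover have "dV y > 0" if "\<epsilon> \<le> V y" for y
  proof -
    have "y \<noteq> 0" using that V_pos par by (auto simp: pos_def_def)
    then show ?thesis using V_neg by (simp add: dV_def)
  qed
  ultimately obtain \<alpha> where \<alpha>: "\<alpha> > 0" "\<And>y. \<epsilon> \<le> V y \<Longrightarrow> V y \<le> M \<Longrightarrow> \<alpha> \<le> dV y"
    using compact_positive_lower_bound[OF _ cdV, of "{y. V y \<le> M} \<inter> {y. \<epsilon> \<le> V y}"] by auto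
  \<comment> \<open>At this level the gain makes the disturbance term at most \<alpha> / 2, half of
    the nominal decay rate \<alpha>. The time \<open>tm\<close> is then the time in which V falls
    from M to 0 at the remaining rate \<alpha> / 2.\<close>
  define Zs where "Zs = ln (2 * Dm / \<alpha>)"
  define tm where "tm = 2 * M / \<alpha>"
  have tm: "tm \<ge> 0" using M \<alpha> by (simp add: tm_def)
  define G where "G = \<Gamma> * exp R * M"
  have G: "G \<ge> 0" using M par by (simp add: G_def)
  define Z where "Z = max Zs R + G * tm"
  have "snd (snd (X T)) \<le> Z"
    if T: "T \<ge> 0" and i: "inputs s1 s2 s3 d \<theta> \<delta>" and X: "cl_sol T (y0, w0, z0) d \<theta> \<delta> X"
      and s: "s1 \<le> R" "s2 \<le> R" "s3 \<le> R" and x0: "norm y0 \<le> R" "norm w0 \<le> R" "\<bar>z0\<bar> \<le> R"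
    for T s1 s2 s3 d \<theta> \<delta> y0 w0 z0 X
  proof -
    let ?z = "\<lambda>t. snd (snd (X t))"
    have s0: "0 \<le> s1" "0 \<le> s2" "0 \<le> s3" using inputs_ok[OF i] by auto
    have "V y0 \<le> max RV R" "norm w0 \<le> max RV R" using RV(2)[OF x0(1)] x0(2) by auto
    then have b: "V (fst (X t)) \<le> M" "norm (fst (snd (X t))) \<le> M" if "0 \<le> t" "t \<le> T" for t
      using bound_afterD[OF M(2) that(1) i cl_sol_mono[OF X that(2)]] E0_le(1)[OF s0(1) s(1) s0(3) s(3)] s(2) unfolding E_def by auto
    have z0: "?z 0 = z0" using cl_init[OF X] by simp
    have zr: "zrate (X t) \<le> G" if "0 \<le> t" "t \<le> T" for t
    proof -
      have "zrate (X t) \<le> \<Gamma> * exp (- z0) * M"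
        using cl_z_mono[OF i X order_refl that] z0 b(1)[OF that] M(1) by (intro zrate_le) auto
      also have "\<dots> \<le> G" unfolding G_def using x0(3) par M(1) by (intro mult_right_mono mult_left_mono) auto
      finally show ?thesis .
    qed
    have rt: "rate s1 s3 (X t) \<le> - (\<alpha> / 2)" if t: "0 \<le> t" "t \<le> T" and zt: "Zs \<le> ?z t" and Vt: "\<epsilon> \<le> V (fst (X t))" for t
    proof -
      let ?P = "b + exp (?z t)" and ?S = "pos_part (s3 - b - exp (?z t))"
      let ?D = "1 + ?S^2 + ?S^4 + s1^2 + s1^4 + 3 * Kf (norm (fst (snd (X t))))"
      have "2 * Dm / \<alpha> = exp Zs" unfolding Zs_def using Dm \<alpha> by simp
      also have "\<dots> \<le> exp (?z t)" using zt by simp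
      also have "\<dots> \<le> ?P" using par by simp
      finally have P1: "2 * Dm \<le> ?P * \<alpha>" using \<alpha> by (simp add: pos_divide_le_eq)
      have P: "?P > 0" using par by (simp add: add_pos_pos)
      have S: "0 \<le> ?S" "?S \<le> R" using E0_le(2)[OF s0(1) s(1) s0(3) s(3)] pos_part_le(2) by auto
      have "?D \<le> Dm"
        unfolding Dm_def using S s0 s b(2)[OF t] by (intro add_mono power_mono mult_left_mono Kf_le) auto
      moreover have "0 \<le> ?D" using Kf_nonneg by (intro add_nonneg_nonneg mult_nonneg_nonneg) auto
      ultimately have "a / ?P * ?D \<le> 1 / ?P * Dm"
        using P par by (intro mult_mono divide_right_mono) auto
      also have "\<dots> \<le> \<alpha> / 2" using P1 P by (simp add: field_simps)
      finally have "a / ?P * ?D \<le> \<alpha> / 2" .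
      moreover have "\<alpha> \<le> dV (fst (X t))" by (rule \<alpha>(2)[OF Vt b(1)[OF t]])
      ultimately show ?thesis unfolding rate_def dV_def by linarith
    qed
    show ?thesis
    proof (cases "?z T \<le> Zs")
      case True
      then show ?thesis using G tm by (simp add: Z_def add_increasing2 le_max_iff_disj)
    next
      case False
      \<comment> \<open>A time at which z is at or above the threshold but still under control: the
        initial time if z starts above it, and otherwise a crossing.\<close>
      have "\<exists>t1. 0 \<le> t1 \<and> t1 \<le> T \<and> ?z t1 \<le> max Zs R \<and> Zs \<le> ?z t1"
      proof (cases "Zs \<le> z0")
        case True
        then show ?thesis using T z0 x0(3) by (intro exI[of _ 0]) auto
      next
        case small: False
        have "\<exists>t\<ge>0. t \<le> T \<and> ?z t = Zs"
          using small False T z0 by (intro IVT' cl_continuous(3)[OF X]) auto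
        then show ?thesis by (metis max.cobounded1 order_refl)
      qed
      then obtain t1 where t1: "0 \<le> t1" "t1 \<le> T" "?z t1 \<le> max Zs R" "Zs \<le> ?z t1" by blast
      define t2 where "t2 = min T (t1 + tm)"
      have t2: "t1 \<le> t2" "t2 \<le> T" "t2 - t1 \<le> tm" using t1 tm by (auto simp: t2_def)
      have "?z t2 \<le> ?z t1 + G * (t2 - t1)"
        using t1 t2 by (intro cl_z_increment[OF i X] zr) auto
      also have "\<dots> \<le> max Zs R + G * tm" using t1 t2 G by (intro add_mono mult_left_mono) auto
      finally have z2: "?z t2 \<le> Z" by (simp add: Z_def)
      have "zrate (X \<tau>) \<le> 0" if \<tau>: "t2 \<le> \<tau>" "\<tau> < T" for \<tau>
      proof -
        have t1\<tau>: "t1 + tm \<le> \<tau>" using \<tau> by (auto simp: t2_def min_def split: if_splits)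
        have "V (fst (X \<tau>)) \<le> max \<epsilon> (V (fst (X t1)) - \<alpha> / 2 * (\<tau> - t1))"
        proof (rule dini_barrier)
          show "continuous_on {t1..\<tau>} (\<lambda>t. V (fst (X t)))"
            using t1 \<tau> by (intro continuous_on_subset[OF cl_continuous(2)[OF X]]) auto
          fix r assume r: "t1 \<le> r" "r < \<tau>" "\<epsilon> \<le> V (fst (X r))"
          have "Zs \<le> ?z r" using cl_z_mono[OF i X t1(1) r(1)] t1(4) r \<tau> by simp
          then have "rate s1 s3 (X r) \<le> - (\<alpha> / 2)" using r t1 \<tau> by (intro rt) auto
          moreover have "dini_le (\<lambda>t. V (fst (X t))) T r (rate s1 s3 (X r))" using r t1 \<tau> by (intro cl_dini_V[OF i X]) auto
          ultimately show "dini_le (\<lambda>t. V (fst (X t))) \<tau> r (- (\<alpha> / 2))"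
            using dini_le_mono dini_le_restrict \<tau>(2) less_imp_le by blast
        qed (use t1\<tau> tm \<alpha> in auto)
        moreover have "V (fst (X t1)) - \<alpha> / 2 * (\<tau> - t1) \<le> 0"
        proof -
          have "\<alpha> / 2 * tm \<le> \<alpha> / 2 * (\<tau> - t1)" using t1\<tau> \<alpha> by (intro mult_left_mono) auto
          moreover have "\<alpha> / 2 * tm = M" using \<alpha> by (simp add: tm_def)
          ultimately show ?thesis using b(1)[OF t1(1,2)] by linarith
        qed
        ultimately have "V (fst (X \<tau>)) \<le> \<epsilon>" using par by (simp add: max_def split: if_splits)
        then show ?thesis by (simp add: zrate_def pos_part_def)
      qed
      then have "?z T \<le> ?z t2 + 0 * (T - t2)"
        using t1 t2 by (intro cl_z_increment[OF i X]) auto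
      then show ?thesis using z2 by simp
    qed
  qed
  then have "z_bound R Z" unfolding z_bound_def by blast
  then show ?thesis by blast
qed

text \<open>A Barbalat-type argument. The increments of the convergent z over windows of length
  \<tau> tend to 0. Since V rises at most at rate Q, a value above \<epsilon> + 2 \<eta>' at the end
  of a window of length \<eta>' / Q keeps V above \<epsilon> + \<eta>' throughout it, which would
  make z grow by at least r \<tau>.\<close>

lemma cl_limits:
  assumes i: "inputs s1 s2 s3 d \<theta> \<delta>" and X: "\<And>T. T \<ge> 0 \<Longrightarrow> cl_sol T (y0, w0, z0) d \<theta> \<delta> X"
    and Z: "\<And>t. t \<ge> 0 \<Longrightarrow> snd (snd (X t)) \<le> Z"
  shows "\<exists>zinf. ((\<lambda>t. snd (snd (X t))) \<longlongrightarrow> zinf) at_top \<and> zinf \<le> Z \<and> (\<forall>t\<ge>0. z0 \<le> snd (snd (X t)) \<and> snd (snd (X t)) \<le> zinf)"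
    and "\<eta> > 0 \<Longrightarrow> \<forall>\<^sub>F t in at_top. V (fst (X t)) \<le> \<epsilon> + \<eta>"
proof -
  let ?z = "\<lambda>t. snd (snd (X t))"
  have mono: "?z s \<le> ?z t" if "0 \<le> s" "s \<le> t" for s t
    using cl_z_mono[OF i X[of t] that(1) that(2)] that by simp
  define zi where "zi = (SUP t\<in>{0..}. ?z t)"
  have bdd: "bdd_above (?z ` {0..})" using Z by (intro bdd_aboveI[of _ Z]) auto
  have up: "?z t \<le> zi" if "t \<ge> 0" for t unfolding zi_def using that bdd by (intro cSUP_upper) auto
  have ziZ: "zi \<le> Z" unfolding zi_def using Z by (intro cSUP_least) auto
  have lim: "(?z \<longlongrightarrow> zi) at_top"
  proof (rule tendstoI)
    fix e :: real assume e: "e > 0"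
    have "\<exists>t\<in>{0..}. zi - e < ?z t"
      using less_cSUP_iff[of "{0::real..}" ?z "zi - e"] bdd e unfolding zi_def by auto
    then obtain t0 where t0: "t0 \<ge> 0" "zi - e < ?z t0" by auto
    have "dist (?z t) zi < e" if "t \<ge> t0" for t
      using mono[OF t0(1) that] up[of t] t0 that by (simp add: dist_real_def)
    then show "\<forall>\<^sub>F t in at_top. dist (?z t) zi < e" unfolding eventually_at_top_linorder by blast
  qed
  have z0: "z0 \<le> ?z t" if "t \<ge> 0" for t using mono[OF order_refl that] cl_init[OF X[OF order_refl]] by simp
  show "\<exists>zinf. (?z \<longlongrightarrow> zinf) at_top \<and> zinf \<le> Z \<and> (\<forall>t\<ge>0. z0 \<le> ?z t \<and> ?z t \<le> zinf)"
    using lim ziZ z0 up by blast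
  assume \<eta>0: "\<eta> > 0"
  define \<eta>' where "\<eta>' = \<eta> / 2"
  have \<eta>': "\<eta>' > 0" using \<eta>0 by (simp add: \<eta>'_def)
  define R where "R = max (V y0) (norm w0)"
  have R: "R \<ge> 0" "V y0 \<le> R" "norm w0 \<le> R" by (auto simp: R_def le_max_iff_disj)
  obtain M where M0: "M \<ge> 0" "bound_after 0 M R (E0 s1 s3 z0) s2"
    using cl_bounded[OF R(1) E0_nonneg[of s1 s3 z0] inputs_ok(3)[OF i]] by blast
  have M: "M \<ge> 0" "\<And>T. T \<ge> 0 \<Longrightarrow> V (fst (X T)) \<le> M \<and> norm (fst (snd (X T))) \<le> M"
    using M0(1) bound_afterD[OF M0(2) _ i X order_refl order_refl R(2,3)] by auto
  define Q where "Q = E0 s1 s3 z0 + 3 * Kf M + 1"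
  have Q: "Q > 0" using E0_nonneg[of s1 s3 z0] Kf_nonneg[OF M(1)] by (simp add: Q_def)
  have rQ: "rate s1 s3 (X t) \<le> Q" if "t \<ge> 0" for t
  proof -
    have "rate s1 s3 (X t) \<le> E0 s1 s3 z0 + 3 * Kf (norm (fst (snd (X t)))) - V (fst (X t))"
      using rate_le[OF z0[OF that], of s1 s3] unfolding E0_def .
    moreover have "Kf (norm (fst (snd (X t)))) \<le> Kf M" using M(2)[OF that] by (intro Kf_le) auto
    ultimately show ?thesis using V_nonneg[of "fst (X t)"] unfolding Q_def by linarith
  qed
  define \<tau> where "\<tau> = \<eta>' / Q"
  have \<tau>: "\<tau> > 0" "Q * \<tau> = \<eta>'" using \<eta>' Q by (auto simp: \<tau>_def)
  define r where "r = \<Gamma> * exp (- zi) * \<eta>'"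
  have r: "r > 0" using par \<eta>' by (simp add: r_def)
  have "filterlim (\<lambda>t. t - \<tau>) at_top at_top"
    using filterlim_tendsto_add_at_top[OF tendsto_const filterlim_ident, of "- \<tau>"] by simp
  from filterlim_compose[OF lim this] have "((\<lambda>t. ?z (t - \<tau>)) \<longlongrightarrow> zi) at_top" .
  then have "((\<lambda>t. ?z t - ?z (t - \<tau>)) \<longlongrightarrow> zi - zi) at_top" by (intro tendsto_diff lim)
  then have "\<forall>\<^sub>F t in at_top. ?z t - ?z (t - \<tau>) < r * \<tau>" using r \<tau> by (intro order_tendstoD) auto
  moreover have "\<forall>\<^sub>F t in at_top. t \<ge> \<tau>" by (rule eventually_ge_at_top)
  ultimately show "\<forall>\<^sub>F t in at_top. V (fst (X t)) \<le> \<epsilon> + \<eta>"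
  proof eventually_elim
    case (elim t)
    show ?case
    proof (rule ccontr)
      assume "\<not> V (fst (X t)) \<le> \<epsilon> + \<eta>"
      then have big: "V (fst (X t)) > \<epsilon> + 2 * \<eta>'" by (simp add: \<eta>'_def)
      have "r \<le> zrate (X s)" if s: "t - \<tau> \<le> s" "s < t" for s
      proof -
        have s0: "s \<ge> 0" using s elim by simp
        have "V (fst (X t)) \<le> V (fst (X s)) + Q * (t - s)"
        proof (rule dini_bound)
          show "continuous_on {s..t} (\<lambda>t. V (fst (X t)))"
            using s s0 by (intro continuous_on_subset[OF cl_continuous(2)[OF X[of t]]]) auto
          fix \<xi> assume \<xi>: "s \<le> \<xi>" "\<xi> < t"
          have "dini_le (\<lambda>t. V (fst (X t))) t \<xi> (rate s1 s3 (X \<xi>))" using \<xi> s0 by (intro cl_dini_V[OF i X]) auto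
          then show "dini_le (\<lambda>t. V (fst (X t))) t \<xi> Q" by (rule dini_le_mono) (use rQ \<xi> s0 in auto)
        qed (use s in auto)
        moreover have "Q * (t - s) \<le> Q * \<tau>" using s Q by (intro mult_left_mono) auto
        ultimately have "\<eta>' \<le> pos_part (V (fst (X s)) - \<epsilon>)" using big \<tau>(2) by (simp add: pos_part_def)
        moreover have "\<Gamma> * exp (- zi) \<le> \<Gamma> * exp (- ?z s)" using up[OF s0] par by simp
        ultimately show ?thesis unfolding r_def zrate_def using par \<eta>' by (intro mult_mono) auto
      qed
      then have "?z (t - \<tau>) + r * (t - (t - \<tau>)) \<le> ?z t"
        using elim \<tau>(1) by (intro cl_z_decrement[OF i X[of t]]) auto
      then show False using elim by simp
    qed
  qed
qed

end

section \<open>Essentially bounded inputs\<close>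

lemma Linf_norm_attained:
  fixes u :: "real \<Rightarrow> 'a::euclidean_space"
  assumes "Linf u"
  shows "Linf_norm u \<ge> 0" "AE s in lebesgue_on {0..}. norm (u s) \<le> Linf_norm u"
proof -
  let ?S = "{M. M \<ge> 0 \<and> (AE s in lebesgue_on {0..}. norm (u s) \<le> M)}"
  obtain M where M: "AE s in lebesgue_on {0..}. norm (u s) \<le> M" using assms by (auto simp: Linf_def)
  have "AE s in lebesgue_on {0..}. norm (u s) \<le> max M 0" using M by eventually_elim auto
  then have ne: "?S \<noteq> {}" by (auto intro!: exI[of _ "max M 0"])
  show "Linf_norm u \<ge> 0" unfolding Linf_norm_def using ne by (intro cInf_greatest) auto
  have bdd: "bdd_below ?S" by (intro bdd_belowI[of _ 0]) auto
  \<comment> \<open>The infimum is approached along countably many levels, whose exceptional sets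
    unite to a null set.\<close>
  have "AE s in lebesgue_on {0..}. norm (u s) \<le> Linf_norm u + 1 / real (Suc n)" for n
  proof -
    have "Inf ?S < Linf_norm u + 1 / real (Suc n)" by (simp add: Linf_norm_def)
    then obtain M where M: "M \<in> ?S" "M < Linf_norm u + 1 / real (Suc n)" using cInf_less_iff[OF ne bdd] by blast
    then have "AE s in lebesgue_on {0..}. norm (u s) \<le> M" by simp
    then show ?thesis by eventually_elim (use M in auto)
  qed
  then have "AE s in lebesgue_on {0..}. \<forall>n. norm (u s) \<le> Linf_norm u + 1 / real (Suc n)"
    by (simp add: AE_all_countable)
  then show "AE s in lebesgue_on {0..}. norm (u s) \<le> Linf_norm u"
  proof eventually_elim
    case (elim s)
    have "(\<lambda>n. Linf_norm u + 1 / real (Suc n)) \<longlonglongrightarrow> Linf_norm u + 0"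
      by (intro tendsto_add tendsto_const LIMSEQ_Suc[OF lim_const_over_n])
    then show ?case using elim by (intro LIMSEQ_le_const[of "\<lambda>n. Linf_norm u + 1 / real (Suc n)"]) auto
  qed
qed

text \<open>An essentially bounded input is replaced by an everywhere bounded one, which changes no solution.\<close>

lemma Linf_modify:
  fixes u :: "real \<Rightarrow> 'a::euclidean_space"
  assumes "Linf u"
  shows "\<exists>u' N. input_ok (Linf_norm u) u' \<and> negligible N \<and> (\<forall>s. s \<ge> 0 \<and> s \<notin> N \<longrightarrow> u' s = u s) \<and> (\<forall>s. norm (u' s) \<le> norm (u s))"
proof -
  define v where "v s = (if s \<in> {0..} then u s else 0)" for s
  \<comment> \<open>The default 0 where the bound fails never increases the norm, so a pointwise
    limsup of |\<delta>| still dominates that of the modified input.\<close>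
  define u' where "u' s = (if norm (v s) \<le> Linf_norm u then v s else 0)" for s
  have v: "v \<in> borel_measurable lebesgue"
    unfolding v_def[abs_def] using assms by (intro borel_measurable_if_I) (auto simp: Linf_def)
  have "(\<lambda>s. norm (v s)) \<in> borel_measurable lebesgue" using v by measurable
  then have "{s \<in> space lebesgue. norm (v s) \<le> Linf_norm u} \<in> sets lebesgue"
    by (rule borel_measurable_le) simp
  then have "u' \<in> borel_measurable lebesgue"
    unfolding u'_def[abs_def] using v by (intro measurable_If) auto
  moreover have "norm (u' s) \<le> Linf_norm u" for s using Linf_norm_attained(1)[OF assms] by (simp add: u'_def)
  ultimately have ok: "input_ok (Linf_norm u) u'" by (simp add: input_ok_def)
  obtain N where N: "N \<in> null_sets (lebesgue_on {0..})" "{s \<in> space (lebesgue_on {0..}). \<not> norm (u s) \<le> Linf_norm u} \<subseteq> N"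
    using Linf_norm_attained(2)[OF assms] unfolding eventually_ae_filter by blast
  have "N \<in> null_sets lebesgue" using N(1) by (simp add: null_sets_restrict_space)
  then have "negligible N" by (simp add: negligible_iff_null_sets)
  moreover have "u' s = u s" if "s \<ge> 0" "s \<notin> N" for s using N(2) that by (auto simp: u'_def v_def)
  moreover have "norm (u' s) \<le> norm (u s)" for s by (simp add: u'_def v_def)
  ultimately show ?thesis using ok by blast
qed

text \<open>On integer balls a continuous function is bounded, and a dominating q of the larger of
  |y|, |w| is at most q(|y|) + q(|w|), hence at most the product.\<close>

lemma separated_bound:
  fixes P :: "'y::euclidean_space \<times> 'w::euclidean_space \<Rightarrow> real"
  assumes "continuous_on UNIV P"
  shows "\<exists>q. smooth q \<and> mono q \<and> (\<forall>s\<ge>0. 0 \<le> q s) \<and> (\<forall>y w. P (y, w) \<le> (1 + q (norm y)) * (1 + q (norm w)))"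
proof -
  have "\<forall>k::nat. \<exists>B>0. \<forall>p. norm p \<le> 2 * (real k + 1) \<longrightarrow> norm (P p) \<le> B"
    using continuous_bounded_cball[OF assms] by blast
  from choice[OF this] obtain B where B: "\<And>k. B k > 0" "\<And>k p. norm p \<le> 2 * (real k + 1) \<Longrightarrow> norm (P p) \<le> B k" by blast
  obtain q q' :: "real \<Rightarrow> real" where q: "smooth q" "\<And>x. (q has_real_derivative q' x) (at x)"
    "\<And>x. q' x \<ge> 1" "\<And>k x. real k \<le> x \<Longrightarrow> B k \<le> q x"
    by (rule smooth_dominating_exists[of B]) blast
  have mono: "q x \<le> q y" if "x \<le> y" for x y
    by (rule DERIV_nonneg_imp_nondecreasing[OF that]) (meson q(2,3) order_trans zero_le_one)
  have nn: "0 \<le> q s" if "s \<ge> 0" for s using q(4)[of 0 s] B(1)[of 0] that by simp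
  have "P (y, w) \<le> (1 + q (norm y)) * (1 + q (norm w))" for y w
  proof -
    define s where "s = max (norm y) (norm w)"
    define k where "k = nat \<lfloor>s\<rfloor>"
    have s: "s \<ge> 0" by (simp add: s_def le_max_iff_disj)
    then have k: "real k \<le> s" "s \<le> real k + 1" unfolding k_def by linarith+
    have "norm (y, w) \<le> 2 * (real k + 1)" using norm_Pair_le[of y w] k(2) by (simp add: s_def)
    from B(2)[OF this] have "P (y, w) \<le> q s" using q(4)[OF k(1)] by simp
    also have "q s \<le> q (norm y) + q (norm w)"
      using nn[of "norm y"] nn[of "norm w"] by (simp add: s_def max_def)
    also have "\<dots> \<le> (1 + q (norm y)) * (1 + q (norm w))"
      using nn[of "norm y"] nn[of "norm w"] by (simp add: algebra_simps)
    finally show ?thesis .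
  qed
  with q(1) mono nn show ?thesis by (auto simp: mono_def)
qed

section \<open>Comparison functions built from a dominating function\<close>

lemma class_Kinf_weighted:
  fixes q :: "real \<Rightarrow> real"
  assumes "continuous_on UNIV q" "mono q" "\<And>s. s \<ge> 0 \<Longrightarrow> q s \<ge> 0"
  shows "class_Kinf (\<lambda>s. s * (1 + q s))"
  unfolding class_Kinf_def class_K_def
proof (intro conjI)
  show "continuous_on {0..} (\<lambda>s. s * (1 + q s))"
    by (intro continuous_intros continuous_on_subset[OF assms(1)]) auto
  show "strict_mono_on {0..} (\<lambda>s. s * (1 + q s))"
  proof (rule strict_mono_onI)
    fix r s :: real assume "r \<in> {0..}" "s \<in> {0..}" "r < s"
    then show "r * (1 + q r) < s * (1 + q s)"
      using assms(3)[of r] monoD[OF assms(2), of r s] by (intro mult_less_le_imp_less) auto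
  qed
  show "filterlim (\<lambda>s. s * (1 + q s)) at_top at_top"
  proof (rule filterlim_at_top_mono[OF filterlim_ident])
    show "\<forall>\<^sub>F s in at_top. s \<le> s * (1 + q s)"
      using eventually_ge_at_top[of 0]
    proof eventually_elim
      case (elim s)
      then show ?case using assms(3)[of s] by (simp add: algebra_simps)
    qed
  qed
qed simp

text \<open>The value s (1 + q s) is held up to time q s and decays exponentially afterwards. The
  plateau covers the waiting time until an ultimate bound takes over; monotonicity in s holds
  because the plateau grows in both height and length.\<close>

lemma class_KL_weighted:
  fixes q :: "real \<Rightarrow> real"
  assumes q: "continuous_on UNIV q" "mono q" "\<And>s. s \<ge> 0 \<Longrightarrow> q s \<ge> 0"
  shows "class_KL (\<lambda>s t. s * (1 + q s) * exp (- max 0 (t - q s)))"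
  unfolding class_KL_def
proof (intro conjI allI impI)
  have "continuous_on ({0..} \<times> {0..}) (\<lambda>p. fst p * (1 + q (fst p)) * exp (- max 0 (snd p - q (fst p))))"
    by (intro continuous_intros continuous_on_compose2[OF q(1)]) auto
  then show "continuous_on ({0..} \<times> {0..}) (\<lambda>(s, t). s * (1 + q s) * exp (- max 0 (t - q s)))"
    by (simp add: case_prod_beta)
  show "class_K (\<lambda>s. s * (1 + q s) * exp (- max 0 (t - q s)))" if "t \<ge> 0" for t
    unfolding class_K_def
  proof (intro conjI)
    show "continuous_on {0..} (\<lambda>s. s * (1 + q s) * exp (- max 0 (t - q s)))"
      by (intro continuous_intros continuous_on_subset[OF q(1)]) auto
    show "strict_mono_on {0..} (\<lambda>s. s * (1 + q s) * exp (- max 0 (t - q s)))"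
    proof (rule strict_mono_onI)
      fix r s :: real assume rs: "r \<in> {0..}" "s \<in> {0..}" "r < s"
      have 1: "r * (1 + q r) < s * (1 + q s)"
        using q(3)[of r] monoD[OF q(2), of r s] rs by (intro mult_less_le_imp_less) auto
      have "q r \<le> q s" using monoD[OF q(2), of r s] rs by simp
      then have 2: "exp (- max 0 (t - q r)) \<le> exp (- max 0 (t - q s))" by auto
      have "r * (1 + q r) * exp (- max 0 (t - q r)) \<le> r * (1 + q r) * exp (- max 0 (t - q s))"
        using 2 q(3)[of r] rs by (intro mult_left_mono) auto
      also have "\<dots> < s * (1 + q s) * exp (- max 0 (t - q s))" using 1 by simp
      finally show "r * (1 + q r) * exp (- max 0 (t - q r)) < s * (1 + q s) * exp (- max 0 (t - q s))" .
    qed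
  qed simp
  fix s :: real assume s: "s \<ge> 0"
  have p: "s * (1 + q s) \<ge> 0" using s q(3)[OF s] by simp
  show "antimono_on {0..} (\<lambda>t. s * (1 + q s) * exp (- max 0 (t - q s)))"
    by (intro monotone_onI mult_left_mono p) auto
  have "((\<lambda>t. s * (1 + q s) * exp (- (t - q s))) \<longlongrightarrow> s * (1 + q s) * 0) at_top"
  proof (intro tendsto_mult tendsto_const)
    have "filterlim (\<lambda>t. - (t - q s)) at_bot at_top"
      using filterlim_tendsto_add_at_top[OF tendsto_const filterlim_ident, of "- q s"]
      by (intro filterlim_uminus_at_bot[THEN iffD2]) simp
    then show "((\<lambda>t. exp (- (t - q s))) \<longlongrightarrow> 0) at_top" by (rule filterlim_compose[OF exp_at_bot])
  qed
  moreover have "\<forall>\<^sub>F t in at_top. s * (1 + q s) * exp (- (t - q s)) = s * (1 + q s) * exp (- max 0 (t - q s))"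
    using eventually_ge_at_top[of "q s"] by eventually_elim simp
  ultimately show "((\<lambda>t. s * (1 + q s) * exp (- max 0 (t - q s))) \<longlongrightarrow> 0) at_top"
    using Lim_transform_eventually by fastforce
qed

section \<open>Comparison-function estimates for U, z and w\<close>

context closed_loop
begin

definition U :: "'y \<Rightarrow> 'w \<Rightarrow> real" where "U y w = V y + 1 / 2 * (w \<bullet> w)"

text \<open>The function \<chi> of the theorem at r = \<Lambda> = 1 and
  \<open>\<gamma> s = 2 + 2 * s\<close>; the literal factors 1 / 2 and 1 make the last step of the
  development a plain unfolding.\<close>

definition chi :: "real \<Rightarrow> real \<Rightarrow> real \<Rightarrow> real \<Rightarrow> real" where
  "chi s1 s2 s3 s4 = 1 / 2 * (2 + 2 * s2) + a *
     (s1^2 + s1^4 + (pos_part (s3 - b - s4))^2 + (pos_part (s3 - b - s4))^4 + 2 * bt * 1) / (b + s4)"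

text \<open>\<open>E0\<close> and \<open>chi\<close> share the disturbance quotient; beyond it
  \<open>chi\<close> contains 1 + s2 from \<gamma> and a nonnegative term with \<open>bt\<close>.
  Thus the level of \<open>chi\<close> bounds both parameters of \<open>bound_after\<close>.\<close>

lemma chi_ge:
  assumes "s2 \<ge> 0"
  shows "E0 s1 s3 z0 \<le> c + chi s1 s2 s3 (exp z0)" "s2 \<le> chi s1 s2 s3 (exp z0)" "1 \<le> chi s1 s2 s3 (exp z0)"
proof -
  define q where "q = s1^2 + s1^4 + (pos_part (s3 - b - exp z0))^2 + (pos_part (s3 - b - exp z0))^4"
  define x where "x = a * q / (b + exp z0)"
  define y where "y = a * (q + 2 * bt * 1) / (b + exp z0)"
  have P: "b + exp z0 > 0" using par by (simp add: add_pos_pos)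
  have q: "q \<ge> 0" by (simp add: q_def)
  have xy: "x \<le> y" unfolding x_def y_def using P par by (intro divide_right_mono mult_left_mono) auto
  have x: "0 \<le> x" unfolding x_def using P par q by (intro divide_nonneg_pos mult_nonneg_nonneg) auto
  have E: "E0 s1 s3 z0 = c + 1 + x" by (simp add: E0_def x_def q_def)
  have C: "chi s1 s2 s3 (exp z0) = 1 + s2 + y" by (simp add: chi_def y_def q_def)
  show "E0 s1 s3 z0 \<le> c + chi s1 s2 s3 (exp z0)" unfolding E C using assms xy by linarith
  show "s2 \<le> chi s1 s2 s3 (exp z0)" unfolding C using xy x by linarith
  show "1 \<le> chi s1 s2 s3 (exp z0)" unfolding C using assms xy x by linarith
qed

text \<open>Let k and l be the integer levels of x = \<open>chi\<close> and u = initial U. If l <=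
  k, the uniform bound depends on x alone and goes into \<zeta>, which works because x >= 1. If l >
  k, then u >= 1, and the uniform bound goes into the plateau of \<omega> until the ultimate bound,
  which depends on x alone, takes over and goes into \<zeta>.\<close>

lemma U_bound:
  "\<exists>\<omega> \<zeta>. class_KL \<omega> \<and> class_Kinf \<zeta> \<and> (\<forall>s1 s2 s3 d \<theta> \<delta> y0 w0 z0 X t. inputs s1 s2 s3 d \<theta> \<delta> \<and>
     cl_sol t (y0, w0, z0) d \<theta> \<delta> X \<and> t \<ge> 0 \<longrightarrow>
     U (fst (X t)) (fst (snd (X t))) \<le> \<omega> (U y0 w0) t + \<zeta> (chi s1 s2 s3 (exp z0)))"
proof -
  have E: "c + real j \<ge> 0" for j using c_nonneg by simp
  \<comment> \<open>If U is at most N, then V <= N and |w|^2 <= 2 N, so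
    \<open>2 * real N + 1\<close> bounds both V and |w|.\<close>
  have "\<forall>j. \<exists>Z. Z \<ge> 0 \<and> (\<forall>N::nat. \<exists>\<tau>\<ge>0. bound_after \<tau> Z (2 * real N + 1) (c + real j) (real j))"
  proof
    fix j :: nat
    obtain Z where Z: "Z \<ge> 0" "\<forall>R\<ge>0. \<exists>\<tau>\<ge>0. bound_after \<tau> Z R (c + real j) (real j)"
      using cl_converge[OF E[of j] of_nat_0_le_iff] by blast
    have "\<exists>\<tau>\<ge>0. bound_after \<tau> Z (2 * real N + 1) (c + real j) (real j)" for N :: nat
      using Z(2)[rule_format, of "2 * real N + 1"] by simp
    with Z(1) show "\<exists>Z. Z \<ge> 0 \<and> (\<forall>N::nat. \<exists>\<tau>\<ge>0. bound_after \<tau> Z (2 * real N + 1) (c + real j) (real j))" by blast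
  qed
  from choice[OF this] obtain Zf where Zf: "\<forall>j. Zf j \<ge> 0 \<and> (\<forall>N::nat. \<exists>\<tau>\<ge>0. bound_after \<tau> (Zf j) (2 * real N + 1) (c + real j) (real j))"
    by blast
  then have "\<forall>p. \<exists>\<tau>. \<tau> \<ge> 0 \<and> bound_after \<tau> (Zf (fst p)) (2 * real (snd p) + 1) (c + real (fst p)) (real (fst p))" by blast
  from choice[OF this] obtain \<tau>f where \<tau>f: "\<forall>p. \<tau>f p \<ge> 0 \<and> bound_after (\<tau>f p) (Zf (fst p)) (2 * real (snd p) + 1) (c + real (fst p)) (real (fst p))"
    by blast
  have "\<forall>p. \<exists>M. M \<ge> 0 \<and> bound_after 0 M (2 * real (snd p) + 1) (c + real (fst p)) (real (fst p))"
  proof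
    fix p :: "nat \<times> nat"
    have "2 * real (snd p) + 1 \<ge> 0" by simp
    from cl_bounded[OF this E of_nat_0_le_iff]
    show "\<exists>M. M \<ge> 0 \<and> bound_after 0 M (2 * real (snd p) + 1) (c + real (fst p)) (real (fst p))" .
  qed
  from choice[OF this] obtain Mf where Mf: "\<forall>p. Mf p \<ge> 0 \<and> bound_after 0 (Mf p) (2 * real (snd p) + 1) (c + real (fst p)) (real (fst p))"
    by blast
  define ub where "ub m = m + m\<^sup>2" for m :: real
  have ub0: "ub m \<ge> 0" if "m \<ge> 0" for m using that by (simp add: ub_def)
  have Uub: "U y w \<le> ub m" if "V y \<le> m" "norm w \<le> m" for y w m
  proof -
    have "w \<bullet> w \<le> m\<^sup>2" unfolding power2_norm_eq_inner[symmetric] using that by (intro power_mono) auto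
    then show ?thesis using that(1) inner_ge_zero[of w] unfolding U_def ub_def by linarith
  qed
  define m1 where "m1 k = max 0 (max (ub (Mf (Suc k, Suc k))) (ub (Zf (Suc k))))" for k
  \<comment> \<open>Summing over i covers every level of \<open>chi\<close> not above that of U,
    which is the case l > k; the result depends on the level of U alone.\<close>
  define m2 where "m2 k = max (\<Sum>i\<le>Suc k. ub (Mf (i, Suc k))) (\<Sum>i\<le>Suc k. \<tau>f (i, Suc k))" for k
  obtain q1 q1' :: "real \<Rightarrow> real" where q1: "smooth q1" "\<And>x. (q1 has_real_derivative q1' x) (at x)"
    "\<And>x. q1' x \<ge> 1" "\<And>k x. real k \<le> x \<Longrightarrow> m1 k \<le> q1 x"
    by (rule smooth_dominating_exists[of m1]) blast
  obtain q2 q2' :: "real \<Rightarrow> real" where q2: "smooth q2" "\<And>x. (q2 has_real_derivative q2' x) (at x)"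
    "\<And>x. q2' x \<ge> 1" "\<And>k x. real k \<le> x \<Longrightarrow> m2 k \<le> q2 x"
    by (rule smooth_dominating_exists[of m2]) blast
  have "mono q" if "\<And>x. (q has_real_derivative q' x) (at x)" "\<And>x. q' x \<ge> 1" for q q' :: "real \<Rightarrow> real"
  proof (rule monoI)
    fix x y :: real assume "x \<le> y"
    then show "q x \<le> q y"
    proof (rule DERIV_nonneg_imp_nondecreasing)
      fix u
      have "q' u \<ge> 0" using that(2)[of u] by simp
      then show "\<exists>v. (q has_real_derivative v) (at u) \<and> v \<ge> 0" using that(1) by blast
    qed
  qed
  from this[OF q1(2,3)] this[OF q2(2,3)] have mono1: "mono q1" and mono2: "mono q2" .
  have m2n: "m2 k \<ge> 0" for k
  proof -
    have "0 \<le> (\<Sum>i\<le>Suc k. ub (Mf (i, Suc k)))" using Mf ub0 by (intro sum_nonneg) auto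
    then show ?thesis by (simp add: m2_def le_max_iff_disj)
  qed
  have n1: "q1 s \<ge> 0" and n2: "q2 s \<ge> 0" if "s \<ge> 0" for s
  proof -
    have "m1 0 \<ge> 0" by (simp add: m1_def)
    then show "q1 s \<ge> 0" using q1(4)[of 0 s] that by simp
    show "q2 s \<ge> 0" using q2(4)[of 0 s] m2n[of 0] that by simp
  qed
  define \<zeta> where "\<zeta> s = s * (1 + q1 s)" for s
  define \<omega> where "\<omega> s t = s * (1 + q2 s) * exp (- max 0 (t - q2 s))" for s t
  have "class_Kinf \<zeta>" unfolding \<zeta>_def[abs_def]
    by (rule class_Kinf_weighted[OF smooth_continuous[OF q1(1)] mono1 n1])
  moreover have "class_KL \<omega>" unfolding \<omega>_def[abs_def]
    by (rule class_KL_weighted[OF smooth_continuous[OF q2(1)] mono2 n2])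
  moreover have "U (fst (X t)) (fst (snd (X t))) \<le> \<omega> (U y0 w0) t + \<zeta> (chi s1 s2 s3 (exp z0))"
    if i: "inputs s1 s2 s3 d \<theta> \<delta>" and X: "cl_sol t (y0, w0, z0) d \<theta> \<delta> X" and t: "t \<ge> 0" for s1 s2 s3 d \<theta> \<delta> y0 w0 z0 X t
  proof -
    define x where "x = chi s1 s2 s3 (exp z0)"
    define u where "u = U y0 w0"
    note ch = chi_ge[OF inputs_ok(3)[OF i], of s1 s3 z0, folded x_def]
    have u: "u \<ge> 0" using V_nonneg[of y0] inner_ge_zero[of w0] by (simp add: u_def U_def)
    \<comment> \<open>Rounding up and subtracting 1 gives k <= x <= k + 1, so the tables are read at
      the level k + 1 while the dominating functions are evaluated through index k. For u = 0 the
      truncation to naturals gives l = 0.\<close>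
    define k where "k = nat (\<lceil>x\<rceil> - 1)"
    define l where "l = nat (\<lceil>u\<rceil> - 1)"
    have k: "real k \<le> x" "x \<le> real (Suc k)" using ch(3) unfolding k_def by linarith+
    have l: "u \<le> real (Suc l)" "u > 0 \<Longrightarrow> real l \<le> u" using u unfolding l_def by linarith+
    have init: "V y0 \<le> 2 * real N + 1" "norm w0 \<le> 2 * real N + 1" if "u \<le> real N" for N
    proof -
      show "V y0 \<le> 2 * real N + 1" using that u inner_ge_zero[of w0] unfolding u_def U_def by linarith
      have "(norm w0)\<^sup>2 \<le> 2 * real N"
        using that V_nonneg[of y0] unfolding u_def U_def power2_norm_eq_inner by linarith
      also have "2 * real N \<le> (2 * real N + 1)\<^sup>2" by (simp add: power2_eq_square algebra_simps)
      finally show "norm w0 \<le> 2 * real N + 1" by (rule power2_le_imp_le) simp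
    qed
    have Ej: "E0 s1 s3 z0 \<le> c + real (Suc k)" "s2 \<le> real (Suc k)" using ch k by linarith+
    have bM: "U (fst (X t)) (fst (snd (X t))) \<le> ub (Mf (Suc k, N))" if "u \<le> real N" for N
      using bound_afterD[of 0 "Mf (Suc k, N)" "2 * real N + 1" "c + real (Suc k)" "real (Suc k)", OF _ t i X Ej init[OF that]]
        Mf[THEN spec, of "(Suc k, N)"] by (intro Uub) auto
    have bZ: "U (fst (X t)) (fst (snd (X t))) \<le> ub (Zf (Suc k))" if "u \<le> real N" "t \<ge> \<tau>f (Suc k, N)" for N
      using bound_afterD[of "\<tau>f (Suc k, N)" "Zf (Suc k)" "2 * real N + 1" "c + real (Suc k)" "real (Suc k)", OF _ that(2) i X Ej init[OF that(1)]]
        \<tau>f[THEN spec, of "(Suc k, N)"] by (intro Uub) auto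
    have om: "\<omega> u t \<ge> 0" unfolding \<omega>_def using u n2[OF u] by simp
    have ze: "q1 x \<le> \<zeta> x" "\<zeta> x \<ge> 0"
    proof -
      have "1 * (1 + q1 x) \<le> x * (1 + q1 x)" using ch(3) n1[of x] by (intro mult_right_mono) auto
      then show a: "q1 x \<le> \<zeta> x" unfolding \<zeta>_def mult_1 by (rule order_trans[rotated]) simp
      have "x \<ge> 0" using ch(3) by linarith
      then show "\<zeta> x \<ge> 0" using n1[of x] a by linarith
    qed
    have m1: "ub (Mf (Suc k, Suc k)) \<le> q1 x" "ub (Zf (Suc k)) \<le> q1 x" using q1(4)[OF k(1)] by (auto simp: m1_def)
    have "U (fst (X t)) (fst (snd (X t))) \<le> \<omega> u t + \<zeta> x"
    proof (cases "l \<le> k")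
      case True
      then have "u \<le> real (Suc k)" using l(1) by (auto intro: order_trans)
      from bM[OF this] m1(1) ze om show ?thesis by linarith
    next
      case False
      then have l1: "real l \<ge> 1" by simp
      have "u > 0"
      proof (rule ccontr)
        assume "\<not> u > 0"
        then have "u = 0" using u by simp
        then show False using l1 by (simp add: l_def)
      qed
      then have lu: "real l \<le> u" by (rule l(2))
      have kl: "Suc k \<in> {..Suc l}" using False by simp
      have "ub (Mf (Suc k, Suc l)) \<le> (\<Sum>i\<le>Suc l. ub (Mf (i, Suc l)))"
        using kl Mf ub0 by (intro member_le_sum) auto
      then have a1: "ub (Mf (Suc k, Suc l)) \<le> q2 u" using q2(4)[OF lu] by (simp add: m2_def)
      have "\<tau>f (Suc k, Suc l) \<le> (\<Sum>i\<le>Suc l. \<tau>f (i, Suc l))"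
        using kl \<tau>f by (intro member_le_sum) auto
      then have a2: "\<tau>f (Suc k, Suc l) \<le> q2 u" using q2(4)[OF lu] by (simp add: m2_def)
      show ?thesis
      proof (cases "t \<le> q2 u")
        case True
        have "1 * (1 + q2 u) \<le> u * (1 + q2 u)" using lu l1 n2[OF u] by (intro mult_right_mono) auto
        then have "q2 u \<le> \<omega> u t" using True by (simp add: \<omega>_def)
        then show ?thesis using bM[OF l(1)] a1 ze(2) by linarith
      next
        case False
        then show ?thesis using bZ[OF l(1)] a2 m1(2) ze(1) om by linarith
      qed
    qed
    then show ?thesis unfolding u_def x_def .
  qed
  ultimately show ?thesis by blast
qed

text \<open>Bounds for data in balls of integer radius are dominated by a continuous function of the
  sum of the norms of all data.\<close>

lemma z_continuous_bound:
  "\<exists>B :: 'y \<times> 'w \<times> real \<times> real \<times> real \<times> real \<Rightarrow> real. continuous_on UNIV B \<and>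
    (\<forall>s1 s2 s3 d \<theta> \<delta> y0 w0 z0 X T. inputs s1 s2 s3 d \<theta> \<delta> \<and> cl_sol T (y0, w0, z0) d \<theta> \<delta> X \<and> T \<ge> 0 \<longrightarrow>
      snd (snd (X T)) \<le> B (y0, w0, z0, s1, s2, s3))"
proof -
  have "\<forall>k::nat. \<exists>Z. z_bound (real (Suc k)) Z" using cl_z_bounded[OF of_nat_0_le_iff] by blast
  from choice[OF this] obtain Zf where Zf: "\<forall>k. z_bound (real (Suc k)) (Zf k)" by blast
  obtain q q' :: "real \<Rightarrow> real" where q: "smooth q" "\<And>k x. real k \<le> x \<Longrightarrow> Zf k \<le> q x"
    by (rule smooth_dominating_exists[of Zf]) blast
  define r where "r = (\<lambda>(y0::'y, w0::'w, z0::real, s1::real, s2::real, s3::real). norm y0 + norm w0 + \<bar>z0\<bar> + \<bar>s1\<bar> + \<bar>s2\<bar> + \<bar>s3\<bar>)"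
  have "continuous_on UNIV r" unfolding r_def case_prod_beta by (intro continuous_intros)
  then have "continuous_on UNIV (\<lambda>p. q (r p))" by (intro continuous_on_compose2[OF smooth_continuous[OF q(1), of UNIV]]) auto
  moreover have "snd (snd (X T)) \<le> q (r (y0, w0, z0, s1, s2, s3))"
    if i: "inputs s1 s2 s3 d \<theta> \<delta>" and X: "cl_sol T (y0, w0, z0) d \<theta> \<delta> X" and T: "T \<ge> 0" for s1 s2 s3 d \<theta> \<delta> y0 w0 z0 X T
  proof -
    define x where "x = r (y0, w0, z0, s1, s2, s3)"
    have n: "0 \<le> s1" "0 \<le> s2" "0 \<le> s3" using inputs_ok[OF i] by auto
    have x0: "x \<ge> 0" "norm y0 \<le> x" "norm w0 \<le> x" "\<bar>z0\<bar> \<le> x" "s1 \<le> x" "s2 \<le> x" "s3 \<le> x" using n by (auto simp: x_def r_def)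
    define k where "k = nat \<lfloor>x\<rfloor>"
    have k: "real k \<le> x" "x \<le> real (Suc k)" using x0(1) unfolding k_def by linarith+
    have "snd (snd (X T)) \<le> Zf k"
      using Zf x0 k by (intro z_boundD[OF _ T i X, of "real (Suc k)"]) auto
    then show ?thesis using q(2)[OF k(1)] by (simp add: x_def)
  qed
  ultimately show ?thesis by blast
qed

text \<open>Eventually V <= 2 \<epsilon>, hence |y| <= \<rho>, and |\<delta>| <= L + 1; restarting
  the ISS estimate from such a time leaves a vanishing transient. The radius \<rho> depends on
  \<epsilon>, which is fixed before the bound is chosen.\<close>

lemma w_limsup:
  "\<exists>\<zeta>t. nondec_C0 \<zeta>t \<and> (\<forall>s1 s2 s3 d \<theta> \<delta> y0 w0 z0 X L Z. inputs s1 s2 s3 d \<theta> \<delta> \<and> (\<forall>T\<ge>0. cl_sol T (y0, w0, z0) d \<theta> \<delta> X) \<and>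
     (\<forall>t\<ge>0. snd (snd (X t)) \<le> Z) \<and> L \<ge> 0 \<and> (\<forall>\<^sub>F t in at_top. norm (\<delta> t) \<le> L + 1) \<longrightarrow>
     (\<forall>\<^sub>F t in at_top. fst (snd (X t)) \<bullet> fst (snd (X t)) \<le> \<zeta>t (\<epsilon> + L)))"
proof -
  obtain \<rho> where \<rho>: "\<rho> \<ge> 0" "\<And>y. V y \<le> \<epsilon> + \<epsilon> \<Longrightarrow> norm y \<le> \<rho>" using V_sublevel by blast
  \<comment> \<open>The outer 1 is the decayed transient, the inner 1 the slack in |\<delta>| <= L +
    1; the square passes from |w| to \<Phi>.\<close>
  define \<zeta>t where "\<zeta>t s = (1 + \<sigma> (\<rho> + 1 + s))\<^sup>2" for s
  have cs: "continuous_on {0..} \<sigma>" using Kinf by (simp add: class_Kinf_def class_K_def)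
  have "nondec_C0 \<zeta>t"
    unfolding nondec_C0_def \<zeta>t_def
  proof (intro conjI)
    show "continuous_on {0..} (\<lambda>s. (1 + \<sigma> (\<rho> + 1 + s))\<^sup>2)"
      using \<rho>(1) by (intro continuous_intros continuous_on_compose2[OF cs]) auto
    show "mono_on {0..} (\<lambda>s. (1 + \<sigma> (\<rho> + 1 + s))\<^sup>2)"
      using \<rho>(1) by (intro mono_onI power_mono add_left_mono sigma_mono) (auto intro!: add_nonneg_nonneg sigma_nonneg)
  qed simp
  moreover have "\<forall>\<^sub>F t in at_top. fst (snd (X t)) \<bullet> fst (snd (X t)) \<le> \<zeta>t (\<epsilon> + L)"
    if i: "inputs s1 s2 s3 d \<theta> \<delta>" and X: "\<forall>T\<ge>0. cl_sol T (y0, w0, z0) d \<theta> \<delta> X" and Z: "\<forall>t\<ge>0. snd (snd (X t)) \<le> Z"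
      and L: "L \<ge> 0" and dl: "\<forall>\<^sub>F t in at_top. norm (\<delta> t) \<le> L + 1" for s1 s2 s3 d \<theta> \<delta> y0 w0 z0 X L Z
  proof -
    have Xs: "cl_sol T (y0, w0, z0) d \<theta> \<delta> X" if "T \<ge> 0" for T using X that by blast
    have Zs: "snd (snd (X t)) \<le> Z" if "t \<ge> 0" for t using Z that by blast
    have "\<forall>\<^sub>F t in at_top. V (fst (X t)) \<le> \<epsilon> + \<epsilon>" by (rule cl_limits(2)[OF i Xs Zs par(1)])
    with dl have "\<forall>\<^sub>F t in at_top. V (fst (X t)) \<le> \<epsilon> + \<epsilon> \<and> norm (\<delta> t) \<le> L + 1" by eventually_elim simp
    then obtain t1 where t1: "\<And>t. t \<ge> t1 \<Longrightarrow> V (fst (X t)) \<le> \<epsilon> + \<epsilon> \<and> norm (\<delta> t) \<le> L + 1"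
      unfolding eventually_at_top_linorder by blast
    define t0 where "t0 = max t1 0"
    define w0' where "w0' = norm (fst (snd (X t0)))"
    have M: "norm (fst (X s), \<delta> s) \<le> \<rho> + 1 + L" if "s \<ge> t0" for s
      using norm_Pair_le[of "fst (X s)" "\<delta> s"] t1[of s] \<rho>(2)[of "fst (X s)"] that by (auto simp: t0_def)
    have wb: "norm (fst (snd (X t))) \<le> \<beta> w0' (t - t0) + \<sigma> (\<rho> + 1 + L)" if "t \<ge> t0" for t
      unfolding w0'_def using that M by (intro cl_w[OF i Xs[of t]]) (auto simp: t0_def)
    have "filterlim (\<lambda>t. t - t0) at_top at_top"
      using filterlim_tendsto_add_at_top[OF tendsto_const filterlim_ident, of "- t0"] by simp
    from filterlim_compose[OF beta_tendsto this]
    have "((\<lambda>t. \<beta> w0' (t - t0)) \<longlongrightarrow> 0) at_top" by (simp add: w0'_def)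
    then have "\<forall>\<^sub>F t in at_top. \<beta> w0' (t - t0) < 1" by (rule order_tendstoD) simp
    moreover have "\<forall>\<^sub>F t in at_top. t \<ge> t0" by (rule eventually_ge_at_top)
    ultimately show ?thesis
    proof eventually_elim
      case (elim t)
      have "norm (fst (snd (X t))) \<le> 1 + \<sigma> (\<rho> + 1 + L)" using wb[of t] elim by simp
      also have "\<dots> \<le> 1 + \<sigma> (\<rho> + 1 + (\<epsilon> + L))" using par \<rho>(1) L by (intro add_left_mono sigma_mono) auto
      finally have "(norm (fst (snd (X t))))\<^sup>2 \<le> \<zeta>t (\<epsilon> + L)" unfolding \<zeta>t_def by (intro power_mono) auto
      then show ?case by (simp add: power2_norm_eq_inner)
    qed
  qed
  ultimately show ?thesis by blast
qed

end

lemma Limsup_le_of_eventually_add: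
  fixes F :: "'a filter" and f :: "'a \<Rightarrow> real"
  assumes "\<And>e. e > 0 \<Longrightarrow> \<forall>\<^sub>F t in F. f t \<le> x + e"
  shows "Limsup F (\<lambda>t. ereal (f t)) \<le> ereal x"
proof (rule ereal_le_epsilon2)
  fix e :: real assume "e > 0"
  from assms[OF this] have "\<forall>\<^sub>F t in F. ereal (f t) \<le> ereal (x + e)" by eventually_elim simp
  from Limsup_bounded[OF this] show "Limsup F (\<lambda>t. ereal (f t)) \<le> ereal x + ereal e" by simp
qed

lemma real_Limsup_norm:
  fixes \<delta> :: "real \<Rightarrow> 'a::real_normed_vector"
  assumes "Limsup at_top (\<lambda>t. ereal (norm (\<delta> t))) < \<infinity>"
  defines "L \<equiv> real_of_ereal (Limsup at_top (\<lambda>t. ereal (norm (\<delta> t))))"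
  shows "L \<ge> 0" "\<forall>\<^sub>F t in at_top. norm (\<delta> t) \<le> L + 1"
proof -
  let ?S = "Limsup at_top (\<lambda>t. ereal (norm (\<delta> t)))"
  have S0: "0 \<le> ?S" by (rule le_Limsup) auto
  then have S: "?S = ereal L" unfolding L_def using assms(1) by (cases ?S) auto
  show "L \<ge> 0" using S0 S by simp
  have "?S < ereal (L + 1)" unfolding S by simp
  from Limsup_lessD[OF this] show "\<forall>\<^sub>F t in at_top. norm (\<delta> t) \<le> L + 1" by eventually_elim simp
qed

context closed_loop
begin

text \<open>The Dini and ISS estimates need pointwise bounds on the inputs. The modification happens
  on one null set common to the three inputs and leaves the set of Caratheodory solutions
  unchanged.\<close>

lemma cl_inputs_modify:
  assumes "Linf d" "Linf \<theta>" "Linf \<delta>"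
  shows "\<exists>d' \<theta>' \<delta>'. inputs (Linf_norm d) (Linf_norm \<delta>) (Linf_norm \<theta>) d' \<theta>' \<delta>' \<and> (\<forall>t. norm (\<delta>' t) \<le> norm (\<delta> t)) \<and>
    (\<forall>x0 X. cara_sol (\<lambda>s x. cl x (d s, \<theta> s, \<delta> s)) x0 X \<longleftrightarrow> cara_sol (\<lambda>s x. cl x (d' s, \<theta>' s, \<delta>' s)) x0 X)"
proof -
  obtain d' N1 where d': "input_ok (Linf_norm d) d'" "negligible N1" "\<And>s. s \<ge> 0 \<Longrightarrow> s \<notin> N1 \<Longrightarrow> d' s = d s"
    using Linf_modify[OF assms(1)] by blast
  obtain \<theta>' N2 where \<theta>': "input_ok (Linf_norm \<theta>) \<theta>'" "negligible N2" "\<And>s. s \<ge> 0 \<Longrightarrow> s \<notin> N2 \<Longrightarrow> \<theta>' s = \<theta> s"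
    using Linf_modify[OF assms(2)] by blast
  obtain \<delta>' N3 where \<delta>': "input_ok (Linf_norm \<delta>) \<delta>'" "negligible N3" "\<And>s. s \<ge> 0 \<Longrightarrow> s \<notin> N3 \<Longrightarrow> \<delta>' s = \<delta> s"
    "\<And>s. norm (\<delta>' s) \<le> norm (\<delta> s)"
    using Linf_modify[OF assms(3)] by blast
  have N: "negligible (N1 \<union> N2 \<union> N3)" using d'(2) \<theta>'(2) \<delta>'(2) by (intro negligible_Un)
  have "cara_sol (\<lambda>s x. cl x (d s, \<theta> s, \<delta> s)) x0 X \<longleftrightarrow> cara_sol (\<lambda>s x. cl x (d' s, \<theta>' s, \<delta>' s)) x0 X" for x0 X
  proof
    assume X: "cara_sol (\<lambda>s x. cl x (d s, \<theta> s, \<delta> s)) x0 X"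
    have X0: "X 0 = x0" using X by (simp add: cara_sol_def)
    show "cara_sol (\<lambda>s x. cl x (d' s, \<theta>' s, \<delta>' s)) x0 X"
      unfolding cara_sol_iff
    proof (intro allI impI)
      fix T :: real assume "T \<ge> 0"
      then have "sol_on T (\<lambda>s x. cl x (d s, \<theta> s, \<delta> s)) x0 X" using X unfolding cara_sol_iff by simp
      then show "sol_on T (\<lambda>s x. cl x (d' s, \<theta>' s, \<delta>' s)) x0 X"
        by (rule sol_on_cong[OF _ N]) (use d'(3) \<theta>'(3) \<delta>'(3) X0 in auto)
    qed
  next
    assume X: "cara_sol (\<lambda>s x. cl x (d' s, \<theta>' s, \<delta>' s)) x0 X"
    have X0: "X 0 = x0" using X by (simp add: cara_sol_def)
    show "cara_sol (\<lambda>s x. cl x (d s, \<theta> s, \<delta> s)) x0 X"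
      unfolding cara_sol_iff
    proof (intro allI impI)
      fix T :: real assume "T \<ge> 0"
      then have "sol_on T (\<lambda>s x. cl x (d' s, \<theta>' s, \<delta>' s)) x0 X" using X unfolding cara_sol_iff by simp
      then show "sol_on T (\<lambda>s x. cl x (d s, \<theta> s, \<delta> s)) x0 X"
        by (rule sol_on_cong[OF _ N]) (use d'(3) \<theta>'(3) \<delta>'(3) X0 in auto)
    qed
  qed
  moreover have "inputs (Linf_norm d) (Linf_norm \<delta>) (Linf_norm \<theta>) d' \<theta>' \<delta>'"
    using d'(1) \<theta>'(1) \<delta>'(1) by (simp add: inputs_def)
  ultimately show ?thesis using \<delta>'(4) by blast
qed

lemma cl_estimates:
  "\<exists>\<omega> \<zeta> \<zeta>t (B :: 'y \<times> 'w \<times> real \<times> real \<times> real \<times> real \<Rightarrow> real).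
     class_KL \<omega> \<and> class_Kinf \<zeta> \<and> nondec_C0 \<zeta>t \<and> continuous_on UNIV B \<and>
     (\<forall>y0 w0 z0 d \<theta> \<delta>. Linf d \<and> Linf \<theta> \<and> Linf \<delta> \<longrightarrow>
        (\<exists>X. cara_sol (\<lambda>s x. cl x (d s, \<theta> s, \<delta> s)) (y0, w0, z0) X) \<and>
        (\<forall>X X'. cara_sol (\<lambda>s x. cl x (d s, \<theta> s, \<delta> s)) (y0, w0, z0) X \<and> cara_sol (\<lambda>s x. cl x (d s, \<theta> s, \<delta> s)) (y0, w0, z0) X' \<longrightarrow>
           (\<forall>t\<ge>0. X t = X' t)) \<and>
        (\<forall>X. cara_sol (\<lambda>s x. cl x (d s, \<theta> s, \<delta> s)) (y0, w0, z0) X \<longrightarrow>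
           Limsup at_top (\<lambda>t. ereal (V (fst (X t)))) \<le> ereal \<epsilon> \<and>
           (Limsup at_top (\<lambda>t. ereal (norm (\<delta> t))) < \<infinity> \<longrightarrow>
              Limsup at_top (\<lambda>t. ereal (fst (snd (X t)) \<bullet> fst (snd (X t))))
                \<le> ereal (\<zeta>t (\<epsilon> + real_of_ereal (Limsup at_top (\<lambda>t. ereal (norm (\<delta> t))))))) \<and>
           (\<exists>zinf. ((\<lambda>t. snd (snd (X t))) \<longlongrightarrow> zinf) at_top \<and>
              zinf \<le> B (y0, w0, z0, Linf_norm d, Linf_norm \<delta>, Linf_norm \<theta>) \<and>
              (\<forall>t\<ge>0. z0 \<le> snd (snd (X t)) \<and> snd (snd (X t)) \<le> zinf)) \<and>
           (\<forall>t\<ge>0. U (fst (X t)) (fst (snd (X t))) \<le> \<omega> (U y0 w0) t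
              + \<zeta> (chi (Linf_norm d) (Linf_norm \<delta>) (Linf_norm \<theta>) (exp z0)))))"
proof -
  obtain \<omega> \<zeta> where \<omega>: "class_KL \<omega>" "class_Kinf \<zeta>"
    and U: "\<forall>s1 s2 s3 d \<theta> \<delta> y0 w0 z0 X t. inputs s1 s2 s3 d \<theta> \<delta> \<and> cl_sol t (y0, w0, z0) d \<theta> \<delta> X \<and> t \<ge> 0 \<longrightarrow>
     U (fst (X t)) (fst (snd (X t))) \<le> \<omega> (U y0 w0) t + \<zeta> (chi s1 s2 s3 (exp z0))"
    using U_bound by (elim exE conjE)
  obtain B :: "'y \<times> 'w \<times> real \<times> real \<times> real \<times> real \<Rightarrow> real" where B: "continuous_on UNIV B"
    and zB: "\<forall>s1 s2 s3 d \<theta> \<delta> y0 w0 z0 X T. inputs s1 s2 s3 d \<theta> \<delta> \<and> cl_sol T (y0, w0, z0) d \<theta> \<delta> X \<and> T \<ge> 0 \<longrightarrow>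
      snd (snd (X T)) \<le> B (y0, w0, z0, s1, s2, s3)"
    using z_continuous_bound by (elim exE conjE)
  obtain \<zeta>t where \<zeta>t: "nondec_C0 \<zeta>t"
    and W: "\<forall>s1 s2 s3 d \<theta> \<delta> y0 w0 z0 X L Z. inputs s1 s2 s3 d \<theta> \<delta> \<and> (\<forall>T\<ge>0. cl_sol T (y0, w0, z0) d \<theta> \<delta> X) \<and>
     (\<forall>t\<ge>0. snd (snd (X t)) \<le> Z) \<and> L \<ge> 0 \<and> (\<forall>\<^sub>F t in at_top. norm (\<delta> t) \<le> L + 1) \<longrightarrow>
     (\<forall>\<^sub>F t in at_top. fst (snd (X t)) \<bullet> fst (snd (X t)) \<le> \<zeta>t (\<epsilon> + L))"
    using w_limsup by (elim exE conjE)
  show ?thesis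
  proof (rule exI[of _ \<omega>], rule exI[of _ \<zeta>], rule exI[of _ \<zeta>t], rule exI[of _ B], rule conjI[OF \<omega>(1)], rule conjI[OF \<omega>(2)],
      rule conjI[OF \<zeta>t], rule conjI[OF B], intro allI impI)
    fix y0 w0 z0 and d :: "real \<Rightarrow> 'm" and \<theta> :: "real \<Rightarrow> 'p" and \<delta> :: "real \<Rightarrow> 'q"
    assume lin: "Linf d \<and> Linf \<theta> \<and> Linf \<delta>"
    let ?F = "\<lambda>s x. cl x (d s, \<theta> s, \<delta> s)"
    let ?Z = "B (y0, w0, z0, Linf_norm d, Linf_norm \<delta>, Linf_norm \<theta>)"
    obtain d' \<theta>' \<delta>' where i: "inputs (Linf_norm d) (Linf_norm \<delta>) (Linf_norm \<theta>) d' \<theta>' \<delta>'"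
      and \<delta>': "\<And>t. norm (\<delta>' t) \<le> norm (\<delta> t)"
      and iff: "\<And>x0 X. cara_sol ?F x0 X \<longleftrightarrow> cara_sol (\<lambda>s x. cl x (d' s, \<theta>' s, \<delta>' s)) x0 X"
      using cl_inputs_modify[of d \<theta> \<delta>] lin by blast
    have sol: "cl_sol T (y0, w0, z0) d' \<theta>' \<delta>' X" if "cara_sol ?F (y0, w0, z0) X" "T \<ge> 0" for X T
      using that unfolding iff cara_sol_iff cl_sol_def by blast
    show "(\<exists>X. cara_sol ?F (y0, w0, z0) X) \<and>
        (\<forall>X X'. cara_sol ?F (y0, w0, z0) X \<and> cara_sol ?F (y0, w0, z0) X' \<longrightarrow> (\<forall>t\<ge>0. X t = X' t)) \<and>
        (\<forall>X. cara_sol ?F (y0, w0, z0) X \<longrightarrow>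
           Limsup at_top (\<lambda>t. ereal (V (fst (X t)))) \<le> ereal \<epsilon> \<and>
           (Limsup at_top (\<lambda>t. ereal (norm (\<delta> t))) < \<infinity> \<longrightarrow>
              Limsup at_top (\<lambda>t. ereal (fst (snd (X t)) \<bullet> fst (snd (X t))))
                \<le> ereal (\<zeta>t (\<epsilon> + real_of_ereal (Limsup at_top (\<lambda>t. ereal (norm (\<delta> t))))))) \<and>
           (\<exists>zinf. ((\<lambda>t. snd (snd (X t))) \<longlongrightarrow> zinf) at_top \<and> zinf \<le> ?Z \<and>
              (\<forall>t\<ge>0. z0 \<le> snd (snd (X t)) \<and> snd (snd (X t)) \<le> zinf)) \<and>
           (\<forall>t\<ge>0. U (fst (X t)) (fst (snd (X t))) \<le> \<omega> (U y0 w0) t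
              + \<zeta> (chi (Linf_norm d) (Linf_norm \<delta>) (Linf_norm \<theta>) (exp z0))))"
    proof (intro conjI allI impI)
      show "\<exists>X. cara_sol ?F (y0, w0, z0) X" unfolding iff by (rule cl_exists[OF i])
    next
      fix X X' and t :: real
      assume X: "cara_sol ?F (y0, w0, z0) X \<and> cara_sol ?F (y0, w0, z0) X'" and t: "t \<ge> 0"
      have s: "cl_sol t (y0, w0, z0) d' \<theta>' \<delta>' X" "cl_sol t (y0, w0, z0) d' \<theta>' \<delta>' X'"
        using sol[OF _ t] X by blast+
      show "X t = X' t"
        by (rule sol_on_unique[OF field_ok_cl inputs_ok(1)[OF i] s[unfolded cl_sol_def]]) (use t in simp)
    next
      fix X assume X: "cara_sol ?F (y0, w0, z0) X"
      note s = sol[OF X]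
      have Z: "snd (snd (X t)) \<le> ?Z" if "t \<ge> 0" for t by (rule zB[rule_format, OF conjI[OF i conjI[OF s[OF that] that]]])
      show "Limsup at_top (\<lambda>t. ereal (V (fst (X t)))) \<le> ereal \<epsilon>"
        by (rule Limsup_le_of_eventually_add) (rule cl_limits(2)[OF i s Z])
      show "Limsup at_top (\<lambda>t. ereal (fst (snd (X t)) \<bullet> fst (snd (X t))))
          \<le> ereal (\<zeta>t (\<epsilon> + real_of_ereal (Limsup at_top (\<lambda>t. ereal (norm (\<delta> t))))))"
        if fin: "Limsup at_top (\<lambda>t. ereal (norm (\<delta> t))) < \<infinity>"
      proof (rule Limsup_bounded)
        let ?L = "real_of_ereal (Limsup at_top (\<lambda>t. ereal (norm (\<delta> t))))"
        have "\<forall>\<^sub>F t in at_top. norm (\<delta>' t) \<le> ?L + 1"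
          using real_Limsup_norm(2)[OF fin] by eventually_elim (use \<delta>' order_trans in blast)
        then have "\<forall>\<^sub>F t in at_top. fst (snd (X t)) \<bullet> fst (snd (X t)) \<le> \<zeta>t (\<epsilon> + ?L)"
          using s Z by (intro W[rule_format, OF conjI[OF i conjI[OF _ conjI[OF _ conjI[OF real_Limsup_norm(1)[OF fin]]]]], of y0 w0 z0 X ?Z]) auto
        then show "\<forall>\<^sub>F t in at_top. ereal (fst (snd (X t)) \<bullet> fst (snd (X t))) \<le> ereal (\<zeta>t (\<epsilon> + ?L))"
          by eventually_elim simp
      qed
      show "\<exists>zinf. ((\<lambda>t. snd (snd (X t))) \<longlongrightarrow> zinf) at_top \<and> zinf \<le> ?Z \<and>
              (\<forall>t\<ge>0. z0 \<le> snd (snd (X t)) \<and> snd (snd (X t)) \<le> zinf)"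
        by (rule cl_limits(1)[OF i s Z])
      show "U (fst (X t)) (fst (snd (X t))) \<le> \<omega> (U y0 w0) t
              + \<zeta> (chi (Linf_norm d) (Linf_norm \<delta>) (Linf_norm \<theta>) (exp z0))" if "t \<ge> 0" for t
        by (rule U[rule_format, OF conjI[OF i conjI[OF s[OF that] that]]])
    qed
  qed
qed

end

theorem theorem2:
  fixes f g :: "real^'n \<Rightarrow> real^'n"
    and \<phi> :: "(real^'n) \<times> (real^'l) \<Rightarrow> real^'p"
    and A :: "(real^'n) \<times> (real^'l) \<Rightarrow> real^'m"
    and h :: "(real^'n) \<times> (real^'l) \<times> (real^'q) \<Rightarrow> real^'l"
    and k :: "real^'n \<Rightarrow> real"
  assumes "smooth f" and "smooth g" and "smooth \<phi>" and "smooth A" and "smooth h"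
    and "f 0 = 0" and "\<phi> (0, 0) = 0" and "h (0, 0, 0) = 0"
    and B1: "ISS h"
    and B2: "smooth k" "k 0 = 0" "GAS (\<lambda>y. f y + k y *\<^sub>R g y)"
  shows "\<exists>(V :: real^'n \<Rightarrow> real) (\<Phi> :: real^'l \<Rightarrow> real) (\<mu> :: real^'n \<Rightarrow> real) r \<Lambda> \<gamma>.
    smooth V \<and> (\<forall>y. V y \<ge> 0) \<and> pos_def V \<and> rad_unbdd V \<and>
    smooth \<Phi> \<and> (\<forall>w. \<Phi> w \<ge> 0) \<and> pos_def \<Phi> \<and> rad_unbdd \<Phi> \<and>
    smooth \<mu> \<and> (\<forall>y. \<mu> y > 0) \<and>
    r > 0 \<and> \<Lambda> > 0 \<and> nondec_C0 \<gamma> \<and>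
    (\<forall>\<epsilon> \<Gamma> a \<beta> b C. \<epsilon> > 0 \<and> \<Gamma> > 0 \<and> a \<in> {0<..1} \<and> \<beta> \<in> {0<..1} \<and> b \<ge> 1 \<and> C \<ge> 1
        \<and> 2 * a * \<beta> < b * r \<longrightarrow>
     (\<exists>\<omega> \<zeta> \<zeta>t (B :: (real^'n) \<times> (real^'l) \<times> real \<times> real \<times> real \<times> real \<Rightarrow> real).
        class_KL \<omega> \<and> class_Kinf \<zeta> \<and> nondec_C0 \<zeta>t \<and>
        continuous_on (UNIV \<times> UNIV \<times> UNIV \<times> {0..} \<times> {0..} \<times> {0..}) B \<and>
        (\<forall>y0 w0 z0 (d :: real \<Rightarrow> real^'m) (\<theta> :: real \<Rightarrow> real^'p) (\<delta> :: real \<Rightarrow> real^'q).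
           Linf d \<and> Linf \<theta> \<and> Linf \<delta> \<longrightarrow>
           (let LgV = (\<lambda>y. frechet_derivative V (at y) (g y));
                u = (\<lambda>y z. k y
                      - C * (\<mu> y)^2 * (b + exp z)^3 / (a^3 * \<beta>^2) * (LgV y)^3
                      - C * ((norm (A (y, 0)))^2 + (norm (\<phi> (y, 0)))^2 + \<mu> y + 1)
                          * (b + exp z)^3 / (a^3 * \<beta>^2) * LgV y);
                F = (\<lambda>t (y, w, z).
                      (f y + (u y z + \<phi> (y, w) \<bullet> \<theta> t + A (y, w) \<bullet> d t) *\<^sub>R g y,
                       h (y, w, \<delta> t),
                       \<Gamma> * exp (- z) * pos_part (V y - \<epsilon>)));
                U = (\<lambda>y w. V y + r / 2 * \<Phi> w);
                chi = (\<lambda>s1 s2 s3 s4. r / 2 * \<gamma> s2 + a *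
                       (s1^2 + s1^4 + (pos_part (s3 - b - s4))^2 + (pos_part (s3 - b - s4))^4
                         + 2 * \<beta> * \<Lambda>) / (b + s4))
            in
            (\<exists>X. cara_sol F (y0, w0, z0) X) \<and>
            (\<forall>X X'. cara_sol F (y0, w0, z0) X \<and> cara_sol F (y0, w0, z0) X' \<longrightarrow>
                (\<forall>t\<ge>0. X t = X' t)) \<and>
            (\<forall>X. cara_sol F (y0, w0, z0) X \<longrightarrow>
               (let y = (\<lambda>t. fst (X t)); w = (\<lambda>t. fst (snd (X t))); z = (\<lambda>t. snd (snd (X t)))
                in
                Limsup at_top (\<lambda>t. ereal (V (y t))) \<le> ereal \<epsilon> \<and>
                (Limsup at_top (\<lambda>t. ereal (norm (\<delta> t))) < \<infinity> \<longrightarrow>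
                   Limsup at_top (\<lambda>t. ereal (\<Phi> (w t)))
                     \<le> ereal (\<zeta>t (\<epsilon> + real_of_ereal (Limsup at_top (\<lambda>t. ereal (norm (\<delta> t))))))) \<and>
                (\<exists>zinf. (z \<longlongrightarrow> zinf) at_top \<and>
                   zinf \<le> B (y0, w0, z0, Linf_norm d, Linf_norm \<delta>, Linf_norm \<theta>) \<and>
                   (\<forall>t\<ge>0. z0 \<le> z t \<and> z t \<le> zinf)) \<and>
                (\<forall>t\<ge>0. U (y t) (w t) \<le> \<omega> (U y0 w0) t
                     + \<zeta> (chi (Linf_norm d) (Linf_norm \<delta>) (Linf_norm \<theta>) (exp z0)))))))))"
proof -
  obtain \<beta>0 \<sigma> where KL: "class_KL \<beta>0" and Kinf: "class_Kinf \<sigma>" and iss: "ISS_bound h \<beta>0 \<sigma>"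
    using B1 unfolding ISS_def ISS_bound_def by blast
  have sub: "continuous_on UNIV (\<lambda>p. G p - G (fst p, 0))" if "smooth G" for G :: "(real^'n) \<times> (real^'l) \<Rightarrow> 'z::real_normed_vector"
    by (intro continuous_intros smooth_continuous[OF that] continuous_on_compose2[OF smooth_continuous[OF that, of UNIV]]) auto
  \<comment> \<open>One continuous function measures the variation of both \<phi> and A in w, so a
    single pair \<mu>, \<open>Kf\<close> serves both.\<close>
  define P where "P p = (norm (\<phi> p - \<phi> (fst p, 0)))\<^sup>2 + (norm (A p - A (fst p, 0)))\<^sup>2" for p
  have "continuous_on UNIV P" unfolding P_def[abs_def] using assms(3,4) by (intro continuous_intros sub)
  from separated_bound[OF this] obtain q where q: "smooth q" "mono q" "\<And>s. s \<ge> 0 \<Longrightarrow> 0 \<le> q s"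
    "\<And>y w. P (y, w) \<le> (1 + q (norm y)) * (1 + q (norm w))" by blast
  define Kf where "Kf s = 1 + q s" for s
  \<comment> \<open>\<open>q (norm y)\<close> need not be smooth at 0\<close>
  define \<mu> where "\<mu> y = 1 + q (1 + y \<bullet> y)" for y :: "real^'n"
  define \<Phi> where "\<Phi> w = w \<bullet> w" for w :: "real^'l"
  define F where "F y = f y + k y *\<^sub>R g y" for y
  have sF: "smooth F" unfolding F_def[abs_def] using assms B2 by (intro smooth_add smooth_scaleR)
  have s\<mu>: "smooth \<mu>" unfolding \<mu>_def[abs_def]
    by (intro smooth_add smooth_const smooth_compose[OF q(1)] smooth_inner smooth_id)
  have s\<Phi>: "smooth \<Phi>" unfolding \<Phi>_def[abs_def] by (intro smooth_inner smooth_id)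
  have Kmono: "mono Kf" unfolding Kf_def[abs_def] using monoD[OF q(2)] by (intro monoI) simp
  have Kf0: "Kf s \<ge> 0" if "s \<ge> 0" for s using q(3)[OF that] by (simp add: Kf_def)
  have \<mu>0: "\<mu> y > 0" for y using q(3)[of "1 + y \<bullet> y"] by (simp add: \<mu>_def)
  have PK: "P (y, w) \<le> \<mu> y * Kf (norm w)" for y w
  proof -
    have "norm y \<le> 1 + (norm y)\<^sup>2"
      using sum_squares_bound[of "norm y" 1] norm_ge_zero[of y] unfolding power_one mult_1_right by linarith
    then have "q (norm y) \<le> q (1 + y \<bullet> y)" by (intro monoD[OF q(2)]) (simp add: power2_norm_eq_inner)
    then have "(1 + q (norm y)) * (1 + q (norm w)) \<le> \<mu> y * Kf (norm w)"
      unfolding \<mu>_def Kf_def using q(3)[of "norm w"] by (intro mult_right_mono) auto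
    with q(4)[of y w] show ?thesis by linarith
  qed
  have \<sigma>m: "\<sigma> s \<le> \<sigma> s'" if "0 \<le> s" "s \<le> s'" for s s'
    using Kinf that unfolding class_Kinf_def class_K_def
    by (cases "s = s'") (auto dest!: strict_mono_onD[of _ \<sigma> s s'])
  \<comment> \<open>The growth prescribed for V: it involves only \<open>Kf\<close> and the ISS gain
    \<sigma>, both fixed before V is constructed.\<close>
  have "mono_on {0..} (\<lambda>s. 6 * Kf (2 * \<sigma> (2 * s)))"
    by (intro mono_onI mult_left_mono monoD[OF Kmono]) (auto intro: \<sigma>m)
  from Lyapunov_dominating[OF sF B2(3)[folded F_def] this]
  obtain V c0 where V: "smooth V" "\<And>y. V y \<ge> 0" "pos_def V" "rad_unbdd V"
    "\<And>y. y \<noteq> 0 \<Longrightarrow> frechet_derivative V (at y) (F y) < 0"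
    "\<And>y. frechet_derivative V (at y) (F y) \<le> c0 - V y" "\<And>y. 6 * Kf (2 * \<sigma> (2 * norm y)) \<le> V y + c0" by blast
  \<comment> \<open>Enlarging the constant preserves both inequalities for V and makes it
    nonnegative, as the small-gain argument requires.\<close>
  define c where "c = max c0 0"
  have "compact {w. \<Phi> w \<le> m}" for m
  proof (cases "m \<ge> 0")
    case True
    then have "{w. \<Phi> w \<le> m} = cball 0 (sqrt m)" by (auto simp: \<Phi>_def norm_eq_sqrt_inner)
    then show ?thesis by simp
  next
    case False
    then have "\<not> \<Phi> w \<le> m" for w using inner_ge_zero[of w] unfolding \<Phi>_def by linarith
    then show ?thesis by simp
  qed
  then have r\<Phi>: "rad_unbdd \<Phi>" by (simp add: rad_unbdd_def)
  have p\<Phi>: "pos_def \<Phi>" by (auto simp: pos_def_def \<Phi>_def)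
  have n\<Phi>: "\<forall>w. \<Phi> w \<ge> 0" by (simp add: \<Phi>_def)
  have \<gamma>: "nondec_C0 (\<lambda>s. 2 + 2 * s)" unfolding nondec_C0_def
    by (intro conjI continuous_intros mono_onI) auto
  show ?thesis
  \<comment> \<open>The value 2 of \<gamma> at 0 and its slope 2 give
    \<open>r / 2 * \<gamma> s2 = 1 + s2\<close>, so \<chi> is at least 1 and at least s2.\<close>
  proof (rule exI[of _ V], rule exI[of _ \<Phi>], rule exI[of _ \<mu>], rule exI[of _ 1], rule exI[of _ 1], rule exI[of _ "\<lambda>s. 2 + 2 * s"],
      intro conjI allI impI V(1-4) s\<Phi> n\<Phi>[rule_format] p\<Phi> r\<Phi> s\<mu> \<mu>0 \<gamma> zero_less_one, goal_cases)
    case (1 \<epsilon> \<Gamma> a \<beta> b C)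
    interpret closed_loop \<beta>0 \<sigma> Kf V c f g k \<mu> \<phi> A h \<epsilon> \<Gamma> a \<beta> b C
    proof
      show "mono_on {0..} Kf" using monoD[OF Kmono] by (intro mono_onI)
      show "6 * Kf (2 * \<sigma> (2 * norm y)) \<le> V y + c" for y using V(7)[of y] unfolding c_def by linarith
      show "frechet_derivative V (at y) (f y + k y *\<^sub>R g y) < 0" if "y \<noteq> 0" for y using V(5)[OF that] by (simp add: F_def)
      show "frechet_derivative V (at y) (f y + k y *\<^sub>R g y) \<le> c - V y" for y using V(6)[of y] unfolding F_def c_def by linarith
      show "(norm (\<phi> (y, w) - \<phi> (y, 0)))\<^sup>2 \<le> \<mu> y * Kf (norm w)" for y w
        using PK[of y w] unfolding P_def fst_conv by (smt (verit) zero_le_power2)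
      show "(norm (A (y, w) - A (y, 0)))\<^sup>2 \<le> \<mu> y * Kf (norm w)" for y w
        using PK[of y w] unfolding P_def fst_conv by (smt (verit) zero_le_power2)
    qed (use KL Kinf Kf0 V assms B2 s\<mu> iss \<mu>0 1 smooth_continuous[OF V(1)] in \<open>auto simp: c_def\<close>)
    have F: "(\<lambda>s x. cl x (d s, \<theta> s, \<delta> s)) = (\<lambda>t (y, w, z).
       (f y + (k y - C * (\<mu> y)^2 * (b + exp z)^3 / (a^3 * \<beta>^2) * (frechet_derivative V (at y) (g y))^3
          - C * ((norm (A (y, 0)))^2 + (norm (\<phi> (y, 0)))^2 + \<mu> y + 1)
            * (b + exp z)^3 / (a^3 * \<beta>^2) * frechet_derivative V (at y) (g y)
          + \<phi> (y, w) \<bullet> \<theta> t + A (y, w) \<bullet> d t) *\<^sub>R g y,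
        h (y, w, \<delta> t), \<Gamma> * exp (- z) * pos_part (V y - \<epsilon>)))" for d \<theta> \<delta>
      by (simp add: fun_eq_iff cl_def fb_def LgV_def)
    from cl_estimates[unfolded F U_def chi_def, folded \<Phi>_def] show ?case
      unfolding Let_def
      by (elim ex_forward conj_forward) (assumption | rule continuous_on_subset, assumption, rule subset_UNIV)+
  qed
qed

end
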